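(* The closure in $L^2(\Omega)$ of $\mathrm{dom}(\mathsf A)$ is $L^2_+(\Omega):=\{u\in L^2(\Omega):u\ge0\text{ a.e. in }\Omega\}$.
   Context: $\Omega\subset\mathbb R^d$ is a bounded open convex set with outer unit normal $\mathbf n$. $H^2_N(\Omega):=\{u\in H^2(\Omega):\partial_{\mathbf n}u=0\text{ on }\partial\Omega\}$, with the Hilbert norm $\|u\|_{2,N}:=\|u-\Delta u\|_{L^2(\Omega)}$; $\Delta$ is the Laplacian with homogeneous Neumann conditions and $(\mathsf H_t)_{t\ge0}$ its heat semigroup. $H^{-2}_N(\Omega)$ is the dual of $H^2_N(\Omega)$; $L^2(\Omega)\subset H^{-2}_N(\Omega)$, and the duality $\langle\cdot,\cdot\rangle$ extends the $L^2$ scalar product. $\Delta^2:H^2_N(\Omega)\to H^{-2}_N(\Omega)$ is defined by $\langle\Delta^2u,v\rangle=\int_\Omega\Delta u\,\Delta v\,dx$. $\mathrm{Test}(\Omega):=\{\zeta\in H^2_N(\Omega)\cap\mathrm{Lip}(\overline\Omega):\Delta\zeta\in L^\infty(\Omega)\}$. $\mathcal M^{-2}_{N,+}(\overline\Omega)$ is the set of finite positive Borel measures $\mu$ on $\overline\Omega$ with $\sup\{\int w\,d\mu:w\in\mathrm{Test}(\Omega),\|w\|_{2,N}\le1\}<\infty$; each such $\mu$ is identified with an element of $H^{-2}_N(\Omega)$. Capacity: $\mathrm{cap}(A):=\inf\{\|u\|_{2,N}^2:u\in H^2_N(\Omega),u\ge1\text{ a.e. on a relatively open set containing }A\}$, $A\subset\overline\Omega$;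 $\tilde u$ is the quasi-continuous representative of $u\in H^2_N(\Omega)$, $\tilde u(x)=\lim_{t\downarrow0}\mathsf H_tu(x)$ for all $x\in\overline\Omega$ outside a set of zero capacity. Measures in $\mathcal M^{-2}_{N,+}(\overline\Omega)$ do not charge sets of zero capacity. $\mathsf h(a,b)=b^2/a$ if $a>0$, $\mathsf h(0,0)=0$, $\mathsf h(0,b)=+\infty$ if $b\neq0$; $\mathsf D(u):=\int_\Omega\mathsf h(u,\Delta u)\,dx$ for nonnegative $u\in H^2_N(\Omega)$. The operator $\mathfrak A:H^2_N(\Omega)\rightrightarrows H^{-2}_N(\Omega)$: a nonnegative $u\in H^2_N(\Omega)$ belongs to $\mathrm{dom}(\mathfrak A)$ iff $\mathsf D(u)<\infty$ and the measure $\frac{(\Delta u)^2}{u}\mathcal L^d\llcorner\{u>0\}$ belongs to $H^{-2}_N(\Omega)$ (i.e. to $\mathcal M^{-2}_{N,+}(\overline\Omega)$); then $\mathfrak A(u):=\{\Delta^2u-\frac{(\Delta u)^2}{u}\mathcal L^d\llcorner\{u>0\}-\nu:\ \nu\in\mathcal M^{-2}_{N,+}(\overline\Omega)\text{ concentrated on }\{\tilde u=0\}\}$. The operator $\mathsf A:L^2(\Omega)\rightrightarrows L^2(\Omega)$ has graph $\{(u,f)\in L^2(\Omega)\times L^2(\Omega):u\in H^2_N(\Omega),\ f\in\mathfrak A(u)\}$, and $\mathrm{dom}(\mathsf A)=\{u:\mathsf Au\ne\emptyset\}$. *)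

theory Defs
  imports "HOL-Analysis.Analysis"
begin

text \<open>
  Elements of \<open>L\<^sup>2(\<Omega>)\<close> are represented by functions on the whole space, of which only the
  restriction to \<open>\<Omega>\<close> up to null sets matters; all the sets of functions below, except
  \<open>Test\<close> (whose members are the continuous representatives on the closure), are invariant under
  changes on null sets of \<open>\<Omega>\<close>.
\<close>

subsection \<open>Lebesgue spaces\<close>

definition L2 :: "'a::euclidean_space set \<Rightarrow> ('a \<Rightarrow> real) set" where
  "L2 \<Omega> = {u \<in> borel_measurable (lebesgue_on \<Omega>). integrable (lebesgue_on \<Omega>) (\<lambda>x. (u x)\<^sup>2)}"

definition L2norm :: "'a::euclidean_space set \<Rightarrow> ('a \<Rightarrow> real) \<Rightarrow> real" where
  "L2norm \<Omega> u = sqrt (integral\<^sup>L (lebesgue_on \<Omega>) (\<lambda>x. (u x)\<^sup>2))"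

definition L2_nonneg :: "'a::euclidean_space set \<Rightarrow> ('a \<Rightarrow> real) set" where
  "L2_nonneg \<Omega> = {u \<in> L2 \<Omega>. AE x in lebesgue_on \<Omega>. 0 \<le> u x}"

definition L2_closure :: "'a::euclidean_space set \<Rightarrow> ('a \<Rightarrow> real) set \<Rightarrow> ('a \<Rightarrow> real) set" where
  "L2_closure \<Omega> S = {u \<in> L2 \<Omega>. \<forall>\<epsilon>>0. \<exists>v\<in>S. L2norm \<Omega> (\<lambda>x. u x - v x) < \<epsilon>}"

definition Linf :: "'a::euclidean_space set \<Rightarrow> ('a \<Rightarrow> real) set" where
  "Linf \<Omega> = {u \<in> borel_measurable (lebesgue_on \<Omega>). \<exists>C. AE x in lebesgue_on \<Omega>. \<bar>u x\<bar> \<le> C}"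

subsection \<open>Smooth functions and weak derivatives\<close>

definition partial :: "'a::euclidean_space \<Rightarrow> ('a \<Rightarrow> real) \<Rightarrow> 'a \<Rightarrow> real" where
  "partial b f = (\<lambda>x. frechet_derivative f (at x) b)"

primrec Ck :: "nat \<Rightarrow> ('a::euclidean_space \<Rightarrow> real) \<Rightarrow> bool" where
  "Ck 0 f \<longleftrightarrow> continuous_on UNIV f"
| "Ck (Suc k) f \<longleftrightarrow> f differentiable_on UNIV \<and> (\<forall>b\<in>Basis. Ck k (partial b f))"

definition smooth :: "('a::euclidean_space \<Rightarrow> real) \<Rightarrow> bool" where
  "smooth f \<longleftrightarrow> (\<forall>k. Ck k f)"

definition Cc_infinity :: "'a::euclidean_space set \<Rightarrow> ('a \<Rightarrow> real) set" where
  "Cc_infinity \<Omega> = {\<phi>. smooth \<phi> \<and> compact (closure {x. \<phi> x \<noteq> 0}) \<and> closure {x. \<phi> x \<noteq> 0} \<subseteq> \<Omega>}"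

definition is_weak_deriv ::
  "'a::euclidean_space set \<Rightarrow> 'a \<Rightarrow> ('a \<Rightarrow> real) \<Rightarrow> ('a \<Rightarrow> real) \<Rightarrow> bool" where
  "is_weak_deriv \<Omega> b u g \<longleftrightarrow>
     (\<forall>\<phi>\<in>Cc_infinity \<Omega>.
        integral\<^sup>L (lebesgue_on \<Omega>) (\<lambda>x. u x * partial b \<phi> x) =
        - integral\<^sup>L (lebesgue_on \<Omega>) (\<lambda>x. g x * \<phi> x))"

text \<open>The choice below is immaterial: weak derivatives are unique almost everywhere.\<close>

definition wderiv :: "'a::euclidean_space set \<Rightarrow> 'a \<Rightarrow> ('a \<Rightarrow> real) \<Rightarrow> 'a \<Rightarrow> real" where
  "wderiv \<Omega> b u = (SOME g. g \<in> L2 \<Omega> \<and> is_weak_deriv \<Omega> b u g)"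

definition H1 :: "'a::euclidean_space set \<Rightarrow> ('a \<Rightarrow> real) set" where
  "H1 \<Omega> = {u \<in> L2 \<Omega>. \<forall>b\<in>Basis. \<exists>g\<in>L2 \<Omega>. is_weak_deriv \<Omega> b u g}"

definition H2 :: "'a::euclidean_space set \<Rightarrow> ('a \<Rightarrow> real) set" where
  "H2 \<Omega> = {u \<in> H1 \<Omega>. \<forall>b\<in>Basis. wderiv \<Omega> b u \<in> H1 \<Omega>}"

definition lap :: "'a::euclidean_space set \<Rightarrow> ('a \<Rightarrow> real) \<Rightarrow> 'a \<Rightarrow> real" where
  "lap \<Omega> u = (\<lambda>x. \<Sum>b\<in>Basis. wderiv \<Omega> b (wderiv \<Omega> b u) x)"

subsection \<open>Surface measure, traces and the Neumann condition\<close>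

text \<open>
  The \<open>s\<close>-dimensional Hausdorff (outer) measure, normalised to agree with Lebesgue measure.
  Nonempty sets of diameter \<open>0\<close> have weight \<open>1\<close> for \<open>s = 0\<close> (counting measure), as \<open>0 ^ 0 = 1\<close>.
  The outer measure is a metric one, hence countably additive on the Borel sets.
\<close>

definition hausdorff_weight :: "nat \<Rightarrow> 'a::euclidean_space set \<Rightarrow> ennreal" where
  "hausdorff_weight s C =
     (if C = {} then 0 else ennreal (unit_ball_vol (real s) * (diameter C / 2) ^ s))"

definition hausdorff_outer :: "nat \<Rightarrow> 'a::euclidean_space set \<Rightarrow> ennreal" where
  "hausdorff_outer s A =
     (SUP \<delta>\<in>{0<..}. INF C\<in>{C :: nat \<Rightarrow> 'a set.
         A \<subseteq> (\<Union>i. C i) \<and> (\<forall>i. bounded (C i) \<and> diameter (C i) \<le> \<delta>)}. \<Sum>i. hausdorff_weight s (C i))"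

definition hausdorff :: "nat \<Rightarrow> 'a::euclidean_space measure" where
  "hausdorff s = measure_of UNIV (sets borel) (hausdorff_outer s)"

definition surface :: "'a::euclidean_space set \<Rightarrow> 'a measure" where
  "surface \<Omega> = restrict_space (hausdorff (DIM('a) - 1)) (frontier \<Omega>)"

text \<open>
  The trace operator on \<open>H\<^sup>1(\<Omega>)\<close> as the continuous extension, with values in \<open>L\<^sup>2(\<partial>\<Omega>)\<close>, of the
  restriction to \<open>\<partial>\<Omega>\<close> of functions that are smooth up to the boundary; \<open>g\<close> is the trace of \<open>w\<close>.
\<close>

definition is_trace :: "'a::euclidean_space set \<Rightarrow> ('a \<Rightarrow> real) \<Rightarrow> ('a \<Rightarrow> real) \<Rightarrow> bool" where
  "is_trace \<Omega> w g \<longleftrightarrow> g \<in> borel_measurable (surface \<Omega>) \<and>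
     (\<exists>\<psi>. (\<forall>k. smooth (\<psi> k)) \<and>
        (\<lambda>k. L2norm \<Omega> (\<lambda>x. \<psi> k x - w x)) \<longlonglongrightarrow> 0 \<and>
        (\<forall>b\<in>Basis. (\<lambda>k. L2norm \<Omega> (\<lambda>x. partial b (\<psi> k) x - wderiv \<Omega> b w x)) \<longlonglongrightarrow> 0) \<and>
        (\<lambda>k. \<integral>\<^sup>+ x. ennreal ((\<psi> k x - g x)\<^sup>2) \<partial>surface \<Omega>) \<longlonglongrightarrow> 0)"

text \<open>
  For convex \<open>\<Omega>\<close>, the outer unit normals at a boundary point are the unit vectors of the normal
  cone; there is exactly one of them at almost every boundary point.
\<close>

definition outer_unit_normal :: "'a::euclidean_space set \<Rightarrow> 'a \<Rightarrow> 'a \<Rightarrow> bool" where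
  "outer_unit_normal \<Omega> x n \<longleftrightarrow> norm n = 1 \<and> (\<forall>y\<in>\<Omega>. n \<bullet> (y - x) \<le> 0)"

definition normal_deriv_zero :: "'a::euclidean_space set \<Rightarrow> ('a \<Rightarrow> real) \<Rightarrow> bool" where
  "normal_deriv_zero \<Omega> u \<longleftrightarrow>
     (\<exists>g. (\<forall>b\<in>Basis. is_trace \<Omega> (wderiv \<Omega> b u) (g b)) \<and>
        (AE x in surface \<Omega>. \<forall>n. outer_unit_normal \<Omega> x n \<longrightarrow> (\<Sum>b\<in>Basis. g b x * (n \<bullet> b)) = 0))"

definition H2N :: "'a::euclidean_space set \<Rightarrow> ('a \<Rightarrow> real) set" where
  "H2N \<Omega> = {u \<in> H2 \<Omega>. normal_deriv_zero \<Omega> u}"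

definition norm2N :: "'a::euclidean_space set \<Rightarrow> ('a \<Rightarrow> real) \<Rightarrow> real" where
  "norm2N \<Omega> u = L2norm \<Omega> (\<lambda>x. u x - lap \<Omega> u x)"

definition Test :: "'a::euclidean_space set \<Rightarrow> ('a \<Rightarrow> real) set" where
  "Test \<Omega> = {\<zeta> \<in> H2N \<Omega>. (\<exists>C. C-lipschitz_on (closure \<Omega>) \<zeta>) \<and> lap \<Omega> \<zeta> \<in> Linf \<Omega>}"

subsection \<open>The dual space\<close>

text \<open>Functionals are extensional, so that equality of functionals means equality on \<open>H2N \<Omega>\<close>.\<close>

definition dual2N :: "'a::euclidean_space set \<Rightarrow> (('a \<Rightarrow> real) \<Rightarrow> real) set" where
  "dual2N \<Omega> = {l \<in> extensional (H2N \<Omega>).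
     (\<forall>v\<in>H2N \<Omega>. \<forall>w\<in>H2N \<Omega>. \<forall>a b. l (\<lambda>x. a * v x + b * w x) = a * l v + b * l w) \<and>
     (\<exists>C. \<forall>v\<in>H2N \<Omega>. \<bar>l v\<bar> \<le> C * norm2N \<Omega> v)}"

definition L2_functional ::
  "'a::euclidean_space set \<Rightarrow> ('a \<Rightarrow> real) \<Rightarrow> ('a \<Rightarrow> real) \<Rightarrow> real" where
  "L2_functional \<Omega> f = (\<lambda>v\<in>H2N \<Omega>. integral\<^sup>L (lebesgue_on \<Omega>) (\<lambda>x. f x * v x))"

definition bilaplacian ::
  "'a::euclidean_space set \<Rightarrow> ('a \<Rightarrow> real) \<Rightarrow> ('a \<Rightarrow> real) \<Rightarrow> real" where
  "bilaplacian \<Omega> u = (\<lambda>v\<in>H2N \<Omega>. integral\<^sup>L (lebesgue_on \<Omega>) (\<lambda>x. lap \<Omega> u x * lap \<Omega> v x))"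

definition M2N :: "'a::euclidean_space set \<Rightarrow> 'a measure set" where
  "M2N \<Omega> = {\<mu>. sets \<mu> = sets (restrict_space borel (closure \<Omega>)) \<and> finite_measure \<mu> \<and>
     bdd_above {integral\<^sup>L \<mu> w | w. w \<in> Test \<Omega> \<and> norm2N \<Omega> w \<le> 1}}"

text \<open>
  The element of the dual with which a measure in \<open>M2N \<Omega>\<close> is identified: its values on \<open>Test \<Omega>\<close>,
  which is dense in \<open>H2N \<Omega>\<close>, are given by integration.
\<close>

definition measure_functional ::
  "'a::euclidean_space set \<Rightarrow> 'a measure \<Rightarrow> (('a \<Rightarrow> real) \<Rightarrow> real) \<Rightarrow> bool" where
  "measure_functional \<Omega> \<mu> l \<longleftrightarrow> l \<in> dual2N \<Omega> \<and> (\<forall>w\<in>Test \<Omega>. l w = integral\<^sup>L \<mu> w)"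

subsection \<open>Neumann heat semigroup, capacity, quasi-continuous representatives\<close>

text \<open>
  \<open>U\<close> is the orbit \<open>t \<mapsto> H\<^sub>t u\<close> of the semigroup on \<open>L\<^sup>2(\<Omega>)\<close> generated by the Laplacian with domain
  \<open>H2N \<Omega>\<close>, i.e. the unique solution of the Cauchy problem; for \<open>t > 0\<close> the continuous
  representative on the closure of \<open>\<Omega>\<close> is taken, which has well defined boundary values.
\<close>

definition is_heat_orbit ::
  "'a::euclidean_space set \<Rightarrow> ('a \<Rightarrow> real) \<Rightarrow> (real \<Rightarrow> 'a \<Rightarrow> real) \<Rightarrow> bool" where
  "is_heat_orbit \<Omega> u U \<longleftrightarrow>
     U 0 = u \<and> ((\<lambda>t. L2norm \<Omega> (\<lambda>x. U t x - u x)) \<longlongrightarrow> 0) (at_right 0) \<and>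
     (\<forall>t>0. U t \<in> H2N \<Omega> \<and> continuous_on (closure \<Omega>) (U t) \<and>
        ((\<lambda>s. L2norm \<Omega> (\<lambda>x. (U s x - U t x) / (s - t) - lap \<Omega> (U t) x)) \<longlongrightarrow> 0) (at t))"

definition heat :: "'a::euclidean_space set \<Rightarrow> real \<Rightarrow> ('a \<Rightarrow> real) \<Rightarrow> 'a \<Rightarrow> real" where
  "heat \<Omega> t u = (SOME U. is_heat_orbit \<Omega> u U) t"

definition cap :: "'a::euclidean_space set \<Rightarrow> 'a set \<Rightarrow> real" where
  "cap \<Omega> A = Inf {(norm2N \<Omega> u)\<^sup>2 | u. u \<in> H2N \<Omega> \<and>
     (\<exists>G. openin (top_of_set (closure \<Omega>)) G \<and> A \<subseteq> G \<and>
        (AE x in lebesgue_on \<Omega>. x \<in> G \<longrightarrow> 1 \<le> u x))}"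

definition quasi_continuous :: "'a::euclidean_space set \<Rightarrow> ('a \<Rightarrow> real) \<Rightarrow> bool" where
  "quasi_continuous \<Omega> v \<longleftrightarrow>
     (\<forall>\<epsilon>>0. \<exists>G. openin (top_of_set (closure \<Omega>)) G \<and> cap \<Omega> G < \<epsilon> \<and> continuous_on (closure \<Omega> - G) v)"

definition is_qc_rep :: "'a::euclidean_space set \<Rightarrow> ('a \<Rightarrow> real) \<Rightarrow> ('a \<Rightarrow> real) \<Rightarrow> bool" where
  "is_qc_rep \<Omega> u v \<longleftrightarrow>
     quasi_continuous \<Omega> v \<and> (AE x in lebesgue_on \<Omega>. v x = u x) \<and>
     (\<exists>N\<subseteq>closure \<Omega>. cap \<Omega> N = 0 \<and>
        (\<forall>x\<in>closure \<Omega> - N. ((\<lambda>t. heat \<Omega> t u x) \<longlongrightarrow> v x) (at_right 0)))"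

text \<open>Unique up to sets of zero capacity, which are not charged by the measures in \<open>M2N \<Omega>\<close>.\<close>

definition qc_rep :: "'a::euclidean_space set \<Rightarrow> ('a \<Rightarrow> real) \<Rightarrow> 'a \<Rightarrow> real" where
  "qc_rep \<Omega> u = (SOME v. is_qc_rep \<Omega> u v)"

subsection \<open>The operators\<close>

text \<open>For \<open>a < 0\<close> the value of \<open>hfun\<close> is irrelevant, as it is used for nonnegative \<open>u\<close> only.\<close>

definition hfun :: "real \<Rightarrow> real \<Rightarrow> ennreal" where
  "hfun a b = (if 0 < a then ennreal (b\<^sup>2 / a) else if a = 0 \<and> b = 0 then 0 else \<infinity>)"

definition Dfun :: "'a::euclidean_space set \<Rightarrow> ('a \<Rightarrow> real) \<Rightarrow> ennreal" where
  "Dfun \<Omega> u = (\<integral>\<^sup>+ x. hfun (u x) (lap \<Omega> u x) \<partial>lebesgue_on \<Omega>)"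

definition mu_meas :: "'a::euclidean_space set \<Rightarrow> ('a \<Rightarrow> real) \<Rightarrow> 'a measure" where
  "mu_meas \<Omega> u =
     distr (density (lebesgue_on \<Omega>) (\<lambda>x. if 0 < u x then ennreal ((lap \<Omega> u x)\<^sup>2 / u x) else 0))
       (restrict_space borel (closure \<Omega>)) (\<lambda>x. x)"

definition dom_frakA :: "'a::euclidean_space set \<Rightarrow> ('a \<Rightarrow> real) set" where
  "dom_frakA \<Omega> = {u \<in> H2N \<Omega>. (AE x in lebesgue_on \<Omega>. 0 \<le> u x) \<and> Dfun \<Omega> u < \<infinity> \<and>
     mu_meas \<Omega> u \<in> M2N \<Omega>}"

definition frakA :: "'a::euclidean_space set \<Rightarrow> ('a \<Rightarrow> real) \<Rightarrow> (('a \<Rightarrow> real) \<Rightarrow> real) set" where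
  "frakA \<Omega> u = (if u \<in> dom_frakA \<Omega>
     then {(\<lambda>v\<in>H2N \<Omega>. bilaplacian \<Omega> u v - l v - m v) | l m \<nu>.
        measure_functional \<Omega> (mu_meas \<Omega> u) l \<and>
        \<nu> \<in> M2N \<Omega> \<and> (AE x in \<nu>. qc_rep \<Omega> u x = 0) \<and> measure_functional \<Omega> \<nu> m}
     else {})"

definition opA :: "'a::euclidean_space set \<Rightarrow> (('a \<Rightarrow> real) \<times> ('a \<Rightarrow> real)) set" where
  "opA \<Omega> = {(u, f). u \<in> L2 \<Omega> \<and> f \<in> L2 \<Omega> \<and> u \<in> H2N \<Omega> \<and> L2_functional \<Omega> f \<in> frakA \<Omega> u}"

end

(*
  Constants c > 0 plus nonnegative test functions phi are dense in the nonnegative cone. For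
  u = c + phi the measure (Delta u)^2 / u dx has a bounded density and the singular part nu may be
  taken to be 0, so that A(u) contains the L2 function Delta^2 phi - (Delta phi)^2 / (c + phi).
  The closure is nonnegative because convergence in L2 preserves signs.

  The analytic core is the coercivity |w| <= |w - Delta w| on H2N, without which L2 functions would
  not even act on H2N. It needs Green's formula with the Neumann condition in the sense of traces with
  respect to the Hausdorff measure. With the gauge q of Omega about an inner point, functions are
  cut off by min 1 ((1 - q) / eps); the boundary term becomes a flux through the layer
  {1 - eps < q < 1}. Covering the layer over a small piece of the boundary by balls bounds
  its volume by eps times the Hausdorff measure of the piece, and at almost every point the
  gradient of q is parallel to every outer normal at the radial projection. Hence the flux of the smooth
  approximations of grad w is controlled by their distance to the trace, whose normal component
  vanishes. Finally w itself is used as a test function, after mollification by averaging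
  over the balls (1 - s) x + s B, which stay inside Omega by convexity.
*)

theory Submission
  imports Defs "HOL-Computational_Algebra.Polynomial"
begin

section \<open>The space \<open>L\<^sup>2\<close>\<close>

text \<open>Membership in \<open>M2N\<close> asks for a bound by \<open>norm2N\<close>, while a
  square integrable density controls integrals only by the \<open>L2norm\<close> of w: so even a
  measure with bounded density calls for coercivity. In Green's formula the boundary data are square
  integrals against a Hausdorff measure known only through coverings. But all that is wanted is that
  a flux vanishes, so upper bounds with crude constants suffice: the image of Lebesgue measure on
  the layer under the radial projection is at most a constant times \<epsilon> times the surface
  measure, and this \<epsilon> cancels the 1/\<epsilon> in the gradient of the cutoff. Linear errors
  become squares by |t| \<le> \<tau> + t^2/\<tau>; the volume of the layer pays for \<tau>, the
  trace for the square. The smooth fields go to their limit at fixed \<tau>, and \<tau> goes to 0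
  last. The gauge stands in for the distance to the boundary because its sublevel sets are dilates
  of \<Omega> and its gradient is read off at the radial projection. The contracted mollifier yields
  C^1 functions on the whole space and commutes with weak derivatives up to a factor 1 - s.\<close>

lemma L2_measurable: "f \<in> L2 \<Omega> \<Longrightarrow> f \<in> borel_measurable (lebesgue_on \<Omega>)"
  and L2_integrable_square: "f \<in> L2 \<Omega> \<Longrightarrow> integrable (lebesgue_on \<Omega>) (\<lambda>x. (f x)\<^sup>2)"
  by (auto simp: L2_def)

declare L2_measurable [measurable_dest]

lemma L2_mult_integrable:
  assumes f: "f \<in> L2 \<Omega>" and g: "g \<in> L2 \<Omega>"
  shows "integrable (lebesgue_on \<Omega>) (\<lambda>x. f x * g x)"
proof (rule Bochner_Integration.integrable_bound)
  show "integrable (lebesgue_on \<Omega>) (\<lambda>x. (f x)\<^sup>2 + (g x)\<^sup>2)"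
    using L2_integrable_square[OF f] L2_integrable_square[OF g] by simp
  show "(\<lambda>x. f x * g x) \<in> borel_measurable (lebesgue_on \<Omega>)"
    using f g by measurable
  have "\<bar>a * b\<bar> \<le> a\<^sup>2 + b\<^sup>2" for a b :: real
    using sum_squares_bound[of "\<bar>a\<bar>" "\<bar>b\<bar>"] mult_nonneg_nonneg[of "\<bar>a\<bar>" "\<bar>b\<bar>"]
    unfolding abs_mult power2_abs by linarith
  then show "AE x in lebesgue_on \<Omega>. norm (f x * g x) \<le> norm ((f x)\<^sup>2 + (g x)\<^sup>2)"
    by auto
qed

lemma L2_lincomb:
  assumes f: "f \<in> L2 \<Omega>" and g: "g \<in> L2 \<Omega>"
  shows "(\<lambda>x. a * f x + b * g x) \<in> L2 \<Omega>"
proof -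
  have "integrable (lebesgue_on \<Omega>) (\<lambda>x. a\<^sup>2 * (f x)\<^sup>2 + (2*a*b) * (f x * g x) + b\<^sup>2 * (g x)\<^sup>2)"
    using L2_mult_integrable[OF f g] L2_integrable_square[OF f] L2_integrable_square[OF g] by simp
  moreover have "(\<lambda>x. a\<^sup>2 * (f x)\<^sup>2 + (2*a*b) * (f x * g x) + b\<^sup>2 * (g x)\<^sup>2) = (\<lambda>x. (a * f x + b * g x)\<^sup>2)"
    by (auto simp: power2_eq_square algebra_simps)
  moreover have "(\<lambda>x. a * f x + b * g x) \<in> borel_measurable (lebesgue_on \<Omega>)"
    using f g by measurable
  ultimately show ?thesis
    by (simp add: L2_def)
qed

lemma L2_add: "f \<in> L2 \<Omega> \<Longrightarrow> g \<in> L2 \<Omega> \<Longrightarrow> (\<lambda>x. f x + g x) \<in> L2 \<Omega>"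
  using L2_lincomb[of f \<Omega> g 1 1] by simp

lemma L2_diff: "f \<in> L2 \<Omega> \<Longrightarrow> g \<in> L2 \<Omega> \<Longrightarrow> (\<lambda>x. f x - g x) \<in> L2 \<Omega>"
  using L2_lincomb[of f \<Omega> g 1 "-1"] by simp

lemma L2_cmult: "f \<in> L2 \<Omega> \<Longrightarrow> (\<lambda>x. c * f x) \<in> L2 \<Omega>"
  using L2_lincomb[of f \<Omega> f c 0] by simp

lemma L2_zero: "(\<lambda>x. 0) \<in> L2 \<Omega>"
  by (simp add: L2_def)

lemma L2_sum: "(\<And>i. i \<in> I \<Longrightarrow> f i \<in> L2 \<Omega>) \<Longrightarrow> (\<lambda>x. \<Sum>i\<in>I. f i x) \<in> L2 \<Omega>"
  by (induction I rule: infinite_finite_induct) (auto simp: L2_zero intro: L2_add)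

lemma L2_bound:
  assumes g: "g \<in> L2 \<Omega>" and f: "f \<in> borel_measurable (lebesgue_on \<Omega>)"
    and le: "AE x in lebesgue_on \<Omega>. \<bar>f x\<bar> \<le> \<bar>g x\<bar>"
  shows "f \<in> L2 \<Omega>"
proof -
  have "integrable (lebesgue_on \<Omega>) (\<lambda>x. (f x)\<^sup>2)"
  proof (rule Bochner_Integration.integrable_bound)
    show "integrable (lebesgue_on \<Omega>) (\<lambda>x. (g x)\<^sup>2)"
      using g by (rule L2_integrable_square)
    show "AE x in lebesgue_on \<Omega>. norm ((f x)\<^sup>2) \<le> norm ((g x)\<^sup>2)"
      using le by eventually_elim (auto simp: abs_le_square_iff)
  qed (use f in auto)
  then show ?thesis
    using f by (simp add: L2_def)
qed

lemma L2_AE_cong: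
  assumes "f \<in> L2 \<Omega>" "g \<in> borel_measurable (lebesgue_on \<Omega>)" "AE x in lebesgue_on \<Omega>. f x = g x"
  shows "g \<in> L2 \<Omega>"
proof (rule L2_bound[OF assms(1,2)])
  show "AE x in lebesgue_on \<Omega>. \<bar>g x\<bar> \<le> \<bar>f x\<bar>"
    using assms(3) by eventually_elim simp
qed

lemma L2norm_nonneg: "0 \<le> L2norm \<Omega> f"
  by (simp add: L2norm_def)

lemma L2norm_square: "(L2norm \<Omega> f)\<^sup>2 = integral\<^sup>L (lebesgue_on \<Omega>) (\<lambda>x. (f x)\<^sup>2)"
  by (simp add: L2norm_def)

lemma L2norm_AE_cong:
  assumes "f \<in> borel_measurable (lebesgue_on \<Omega>)" "g \<in> borel_measurable (lebesgue_on \<Omega>)"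
    "AE x in lebesgue_on \<Omega>. f x = g x"
  shows "L2norm \<Omega> f = L2norm \<Omega> g"
  unfolding L2norm_def
  by (intro arg_cong[where f=sqrt] integral_cong_AE) (use assms in auto)

lemma L2norm_mono:
  assumes "f \<in> borel_measurable (lebesgue_on \<Omega>)" "g \<in> L2 \<Omega>"
    "AE x in lebesgue_on \<Omega>. \<bar>f x\<bar> \<le> \<bar>g x\<bar>"
  shows "L2norm \<Omega> f \<le> L2norm \<Omega> g"
  unfolding L2norm_def
proof (intro real_sqrt_le_mono integral_mono_AE)
  have "f \<in> L2 \<Omega>"
    using assms(2,1,3) by (rule L2_bound)
  then show "integrable (lebesgue_on \<Omega>) (\<lambda>x. (f x)\<^sup>2)"
    by (rule L2_integrable_square)
  show "integrable (lebesgue_on \<Omega>) (\<lambda>x. (g x)\<^sup>2)"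
    using assms(2) by (rule L2_integrable_square)
  show "AE x in lebesgue_on \<Omega>. (f x)\<^sup>2 \<le> (g x)\<^sup>2"
    using assms(3) by eventually_elim (auto simp: abs_le_square_iff)
qed

lemma L2norm_cmult: "L2norm \<Omega> (\<lambda>x. c * f x) = \<bar>c\<bar> * L2norm \<Omega> f"
  by (simp add: L2norm_def power_mult_distrib real_sqrt_mult)

lemma L2norm_minus_commute: "L2norm \<Omega> (\<lambda>x. f x - g x) = L2norm \<Omega> (\<lambda>x. g x - f x)"
  by (simp add: L2norm_def power2_commute)

lemma L2_Cauchy_Schwarz:
  assumes f: "f \<in> L2 \<Omega>" and g: "g \<in> L2 \<Omega>"
  shows "\<bar>integral\<^sup>L (lebesgue_on \<Omega>) (\<lambda>x. f x * g x)\<bar> \<le> L2norm \<Omega> f * L2norm \<Omega> g"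
proof -
  define A B I where "A = integral\<^sup>L (lebesgue_on \<Omega>) (\<lambda>x. (f x)\<^sup>2)"
    and "B = integral\<^sup>L (lebesgue_on \<Omega>) (\<lambda>x. (g x)\<^sup>2)"
    and "I = integral\<^sup>L (lebesgue_on \<Omega>) (\<lambda>x. f x * g x)"
  note [simp] = L2_mult_integrable[OF f g] L2_integrable_square[OF f] L2_integrable_square[OF g]
  have B0: "0 \<le> B" and A0: "0 \<le> A"
    by (auto simp: A_def B_def)
  have "I\<^sup>2 \<le> A * B"
  proof (cases "B = 0")
    case True
    have "AE x in lebesgue_on \<Omega>. (g x)\<^sup>2 = 0"
      using True unfolding B_def by (subst (asm) integral_nonneg_eq_0_iff_AE) auto
    then have "AE x in lebesgue_on \<Omega>. f x * g x = 0"
      by eventually_elim auto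
    then have "I = 0"
      unfolding I_def by (rule integral_eq_zero_AE)
    then show ?thesis using A0 B0 by simp
  next
    case False
    \<comment> \<open>This \<open>t\<close> minimises the quadratic polynomial A - 2 t I + t^2 B,
      whose nonnegativity is then the desired inequality.\<close>
    define t where "t = I / B"
    have "0 \<le> integral\<^sup>L (lebesgue_on \<Omega>) (\<lambda>x. (f x - t * g x)\<^sup>2)"
      by simp
    also have "(\<lambda>x. (f x - t * g x)\<^sup>2) = (\<lambda>x. (f x)\<^sup>2 - (2*t) * (f x * g x) + t\<^sup>2 * (g x)\<^sup>2)"
      by (auto simp: power2_eq_square algebra_simps)
    also have "integral\<^sup>L (lebesgue_on \<Omega>) \<dots> = A - 2 * t * I + t\<^sup>2 * B"
      by (simp add: A_def B_def I_def)
    also have "\<dots> = A - I\<^sup>2 / B"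
      using False by (simp add: t_def power2_eq_square field_simps)
    finally show ?thesis
      using False B0 by (simp add: field_simps)
  qed
  then have "sqrt (I\<^sup>2) \<le> sqrt (A * B)"
    by (rule real_sqrt_le_mono)
  then show ?thesis
    by (simp add: real_sqrt_mult L2norm_def A_def B_def I_def)
qed

lemma L2norm_triangle:
  assumes f: "f \<in> L2 \<Omega>" and g: "g \<in> L2 \<Omega>"
  shows "L2norm \<Omega> (\<lambda>x. f x + g x) \<le> L2norm \<Omega> f + L2norm \<Omega> g"
proof (rule power2_le_imp_le)
  note [simp] = L2_mult_integrable[OF f g] L2_integrable_square[OF f] L2_integrable_square[OF g]
  have "(L2norm \<Omega> (\<lambda>x. f x + g x))\<^sup>2 = integral\<^sup>L (lebesgue_on \<Omega>) (\<lambda>x. (f x)\<^sup>2 + 2 * (f x * g x) + (g x)\<^sup>2)"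
    unfolding L2norm_square by (simp add: power2_eq_square algebra_simps)
  also have "\<dots> = (L2norm \<Omega> f)\<^sup>2 + 2 * integral\<^sup>L (lebesgue_on \<Omega>) (\<lambda>x. f x * g x) + (L2norm \<Omega> g)\<^sup>2"
    by (simp add: L2norm_square)
  also have "\<dots> \<le> (L2norm \<Omega> f)\<^sup>2 + 2 * (L2norm \<Omega> f * L2norm \<Omega> g) + (L2norm \<Omega> g)\<^sup>2"
    using L2_Cauchy_Schwarz[OF f g] by linarith
  also have "\<dots> = (L2norm \<Omega> f + L2norm \<Omega> g)\<^sup>2"
    by (simp add: power2_eq_square algebra_simps)
  finally show "(L2norm \<Omega> (\<lambda>x. f x + g x))\<^sup>2 \<le> (L2norm \<Omega> f + L2norm \<Omega> g)\<^sup>2" .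
qed (simp add: L2norm_nonneg)

lemma L2norm_diff_triangle:
  assumes "f \<in> L2 \<Omega>" "g \<in> L2 \<Omega>" "h \<in> L2 \<Omega>"
  shows "L2norm \<Omega> (\<lambda>x. f x - h x) \<le> L2norm \<Omega> (\<lambda>x. f x - g x) + L2norm \<Omega> (\<lambda>x. g x - h x)"
  using L2norm_triangle[OF L2_diff[OF assms(1,2)] L2_diff[OF assms(2,3)]] by simp

lemma L2norm_zero_AE:
  assumes "f \<in> L2 \<Omega>" "L2norm \<Omega> f = 0"
  shows "AE x in lebesgue_on \<Omega>. f x = 0"
proof -
  have "integral\<^sup>L (lebesgue_on \<Omega>) (\<lambda>x. (f x)\<^sup>2) = 0"
    using assms(2) by (simp add: L2norm_def)
  then have "AE x in lebesgue_on \<Omega>. (f x)\<^sup>2 = 0"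
    using L2_integrable_square[OF assms(1)] by (simp add: integral_nonneg_eq_0_iff_AE)
  then show ?thesis by auto
qed

lemma L2_integral_tendsto:
  assumes f: "f \<in> L2 \<Omega>" and g: "g \<in> L2 \<Omega>" and F: "\<And>k. F k \<in> L2 \<Omega>"
    and lim: "(\<lambda>k. L2norm \<Omega> (\<lambda>x. F k x - f x)) \<longlonglongrightarrow> 0"
  shows "(\<lambda>k. integral\<^sup>L (lebesgue_on \<Omega>) (\<lambda>x. F k x * g x)) \<longlonglongrightarrow>
    integral\<^sup>L (lebesgue_on \<Omega>) (\<lambda>x. f x * g x)"
proof (rule LIM_zero_cancel, rule Lim_null_comparison)
  show "(\<lambda>k. L2norm \<Omega> (\<lambda>x. F k x - f x) * L2norm \<Omega> g) \<longlonglongrightarrow> 0"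
    using lim by (rule tendsto_mult_left_zero)
  show "\<forall>\<^sub>F k in sequentially. norm ((\<integral>x. F k x * g x \<partial>lebesgue_on \<Omega>) - (\<integral>x. f x * g x \<partial>lebesgue_on \<Omega>))
      \<le> L2norm \<Omega> (\<lambda>x. F k x - f x) * L2norm \<Omega> g"
  proof (rule always_eventually, rule allI)
    fix k
    have "(\<integral>x. F k x * g x \<partial>lebesgue_on \<Omega>) - (\<integral>x. f x * g x \<partial>lebesgue_on \<Omega>) =
        (\<integral>x. (F k x - f x) * g x \<partial>lebesgue_on \<Omega>)"
      by (simp add: left_diff_distrib L2_mult_integrable F f g)
    then show "norm ((\<integral>x. F k x * g x \<partial>lebesgue_on \<Omega>) - (\<integral>x. f x * g x \<partial>lebesgue_on \<Omega>))
      \<le> L2norm \<Omega> (\<lambda>x. F k x - f x) * L2norm \<Omega> g"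
      using L2_Cauchy_Schwarz[OF L2_diff[OF F f] g] by simp
  qed
qed

lemma L2norm_tendsto_dominated:
  assumes f: "f \<in> borel_measurable (lebesgue_on \<Omega>)"
    and F: "\<And>k. F k \<in> borel_measurable (lebesgue_on \<Omega>)" and g: "g \<in> L2 \<Omega>"
    and lim: "AE x in lebesgue_on \<Omega>. (\<lambda>k. F k x) \<longlonglongrightarrow> f x"
    and dom: "\<And>k. AE x in lebesgue_on \<Omega>. \<bar>F k x - f x\<bar> \<le> g x"
  shows "(\<lambda>k. L2norm \<Omega> (\<lambda>x. F k x - f x)) \<longlonglongrightarrow> 0"
proof -
  have "(\<lambda>k. integral\<^sup>L (lebesgue_on \<Omega>) (\<lambda>x. (F k x - f x)\<^sup>2)) \<longlonglongrightarrow> integral\<^sup>L (lebesgue_on \<Omega>) (\<lambda>x. 0)"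
  proof (rule integral_dominated_convergence)
    show "integrable (lebesgue_on \<Omega>) (\<lambda>x. (g x)\<^sup>2)"
      using g by (rule L2_integrable_square)
    show "AE x in lebesgue_on \<Omega>. (\<lambda>k. (F k x - f x)\<^sup>2) \<longlonglongrightarrow> 0"
      using lim
    proof eventually_elim
      case (elim x)
      have "(\<lambda>k. (F k x - f x)\<^sup>2) \<longlonglongrightarrow> (f x - f x)\<^sup>2"
        by (intro tendsto_intros elim)
      then show ?case by simp
    qed
    show "AE x in lebesgue_on \<Omega>. norm ((F k x - f x)\<^sup>2) \<le> (g x)\<^sup>2" for k
      using dom[of k]
    proof eventually_elim
      case (elim x)
      then have "\<bar>F k x - f x\<bar>\<^sup>2 \<le> (g x)\<^sup>2"
        by (intro power_mono) auto
      then show ?case by simp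
    qed
  qed (use f F in auto)
  then have "(\<lambda>k. sqrt (integral\<^sup>L (lebesgue_on \<Omega>) (\<lambda>x. (F k x - f x)\<^sup>2))) \<longlonglongrightarrow> sqrt 0"
    by (intro tendsto_real_sqrt) simp
  then show ?thesis by (simp add: L2norm_def)
qed

lemma bounded_imp_L2:
  assumes "bounded \<Omega>" "\<Omega> \<in> sets lebesgue"
    and f: "f \<in> borel_measurable (lebesgue_on \<Omega>)"
    and le: "AE x in lebesgue_on \<Omega>. \<bar>f x\<bar> \<le> C"
  shows "f \<in> L2 \<Omega>"
proof (rule L2_bound)
  have "\<Omega> \<in> lmeasurable"
    using assms(1,2) by (simp add: bounded_set_imp_lmeasurable)
  then interpret finite_measure "lebesgue_on \<Omega>"
    by (rule finite_measure_lebesgue_on)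
  show "(\<lambda>x. C) \<in> L2 \<Omega>"
    by (simp add: L2_def)
  show "AE x in lebesgue_on \<Omega>. \<bar>f x\<bar> \<le> \<bar>C\<bar>"
    using le by eventually_elim auto
qed fact

lemma continuous_imp_L2:
  fixes f :: "'a::euclidean_space \<Rightarrow> real"
  assumes \<Omega>: "bounded \<Omega>" "open \<Omega>" and f: "continuous_on (closure \<Omega>) f"
  shows "f \<in> L2 \<Omega>"
proof -
  have "compact (f ` closure \<Omega>)"
    using \<Omega> f by (intro compact_continuous_image) auto
  then obtain C where C: "\<And>x. x \<in> closure \<Omega> \<Longrightarrow> \<bar>f x\<bar> \<le> C"
    by (meson bounded_real compact_imp_bounded imageI)
  have sets: "\<Omega> \<in> sets lebesgue"
    using \<Omega> by auto
  have "f \<in> borel_measurable (lebesgue_on \<Omega>)"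
    by (intro continuous_imp_measurable_on_sets_lebesgue continuous_on_subset[OF f] closure_subset sets)
  moreover have "AE x in lebesgue_on \<Omega>. \<bar>f x\<bar> \<le> C"
    using C closure_subset by (intro AE_I2) (auto simp: space_restrict_space)
  ultimately show ?thesis
    using \<Omega> sets by (auto intro: bounded_imp_L2)
qed

section \<open>Smooth functions\<close>

lemma partial_eqI: "(f has_derivative f') (at x) \<Longrightarrow> partial b f x = f' b"
  by (metis frechet_derivative_at partial_def)

lemma partial_const: "partial b (\<lambda>x. c) = (\<lambda>x. 0)"
  by (rule ext, rule partial_eqI) (rule has_derivative_const)

lemma partial_add:
  assumes "f differentiable (at x)" "g differentiable (at x)"
  shows "partial b (\<lambda>x. f x + g x) x = partial b f x + partial b g x"
  unfolding partial_def
  by (rule partial_eqI[unfolded partial_def])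
    (intro has_derivative_add frechet_derivative_works[THEN iffD1] assms)

lemma partial_mult:
  assumes "f differentiable (at x)" "g differentiable (at x)"
  shows "partial b (\<lambda>x. f x * g x) x = f x * partial b g x + partial b f x * g x"
  unfolding partial_def
  by (rule partial_eqI[unfolded partial_def])
    (intro has_derivative_mult frechet_derivative_works[THEN iffD1] assms)

text \<open>\<open>partial\<close> is a value of the Frechet derivative, so \<open>b\<close> may be
  any vector of any length; this reduces estimates in several variables to the mean value theorem on
  a line.\<close>

lemma has_real_derivative_along:
  fixes f :: "'a::euclidean_space \<Rightarrow> real"
  assumes "f differentiable (at (x + t *\<^sub>R b))"
  shows "((\<lambda>t. f (x + t *\<^sub>R b)) has_real_derivative partial b f (x + t *\<^sub>R b)) (at t)"
proof -
  define f' where "f' = frechet_derivative f (at (x + t *\<^sub>R b))"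
  have f': "(f has_derivative f') (at (x + t *\<^sub>R b))"
    using assms unfolding f'_def by (rule frechet_derivative_works[THEN iffD1])
  have "((\<lambda>t. f (x + t *\<^sub>R b)) has_derivative (\<lambda>h. f' (h *\<^sub>R b))) (at t)"
    by (rule has_derivative_compose[where g = f and f = "\<lambda>t. x + t *\<^sub>R b", OF _ f'])
      (auto intro!: derivative_eq_intros)
  moreover have "f' (h *\<^sub>R b) = partial b f (x + t *\<^sub>R b) * h" for h
    using linear_scale[OF has_derivative_linear[OF f']] by (simp add: partial_def f'_def)
  ultimately show ?thesis
    by (simp add: has_field_derivative_def)
qed

lemma Ck_imp_continuous: "Ck k f \<Longrightarrow> continuous_on UNIV f"
  by (cases k) (auto intro: differentiable_imp_continuous_on)

lemma Ck_Suc_imp_differentiable: "Ck (Suc k) f \<Longrightarrow> f differentiable (at x)"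
  by (auto simp: differentiable_on_def)

text \<open>\<open>Ck (Suc k) f\<close> asks for differentiability of \<open>f\<close> and
  \<open>Ck k\<close> of its partials, not for \<open>Ck k f\<close> itself. The product rule leaves
  one factor undifferentiated and so depends on this descent.\<close>

lemma Ck_SucD: "Ck (Suc k) f \<Longrightarrow> Ck k f"
proof (induction k arbitrary: f)
  case 0
  then show ?case using Ck_imp_continuous[of "Suc 0" f] by simp
next
  case (Suc k)
  then show ?case by auto
qed

lemma Ck_const: "Ck k (\<lambda>x. c)"
  by (induction k arbitrary: c) (auto simp: partial_const)

lemma Ck_add: "Ck k f \<Longrightarrow> Ck k g \<Longrightarrow> Ck k (\<lambda>x. f x + g x)"
proof (induction k arbitrary: f g)
  case 0
  then show ?case by (auto intro: continuous_on_add)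
next
  case (Suc k)
  have "partial b (\<lambda>x. f x + g x) = (\<lambda>x. partial b f x + partial b g x)" for b
    using Suc.prems by (intro ext partial_add Ck_Suc_imp_differentiable)
  with Suc show ?case by (auto intro: differentiable_on_add)
qed

lemma Ck_mult: "Ck k f \<Longrightarrow> Ck k g \<Longrightarrow> Ck k (\<lambda>x. f x * g x)"
proof (induction k arbitrary: f g)
  case 0
  then show ?case by (auto intro: continuous_on_mult)
next
  case (Suc k)
  have "partial b (\<lambda>x. f x * g x) = (\<lambda>x. f x * partial b g x + partial b f x * g x)" for b
    using Suc.prems by (intro ext partial_mult Ck_Suc_imp_differentiable)
  with Suc Ck_SucD[OF Suc.prems(1)] Ck_SucD[OF Suc.prems(2)] show ?case
    by (auto intro!: differentiable_on_mult Ck_add)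
qed

lemma Ck_inner: "Ck k (\<lambda>x. (x - c) \<bullet> b)"
proof (cases k)
  case 0
  then show ?thesis by (auto intro!: continuous_intros)
next
  case (Suc m)
  have d: "((\<lambda>x. (x - c) \<bullet> b) has_derivative (\<lambda>h. h \<bullet> b)) (at x)" for x
    by (auto intro!: derivative_eq_intros)
  have "partial b' (\<lambda>x. (x - c) \<bullet> b) = (\<lambda>x. b' \<bullet> b)" for b'
    by (intro ext partial_eqI[OF d])
  then show ?thesis
    using d unfolding Suc by (auto simp: Ck_const differentiable_on_def differentiable_def)
qed

lemma smooth_const: "smooth (\<lambda>x. c)"
  by (simp add: smooth_def Ck_const)

lemma smooth_add: "smooth f \<Longrightarrow> smooth g \<Longrightarrow> smooth (\<lambda>x. f x + g x)"
  by (simp add: smooth_def Ck_add)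

lemma smooth_mult: "smooth f \<Longrightarrow> smooth g \<Longrightarrow> smooth (\<lambda>x. f x * g x)"
  by (simp add: smooth_def Ck_mult)

lemma smooth_cmult: "smooth f \<Longrightarrow> smooth (\<lambda>x. c * f x)"
  by (intro smooth_mult smooth_const)

lemma smooth_diff: "smooth f \<Longrightarrow> smooth g \<Longrightarrow> smooth (\<lambda>x. f x - g x)"
  using smooth_add[OF _ smooth_cmult[of g "-1"]] by simp

lemma smooth_prod: "(\<And>i. i \<in> I \<Longrightarrow> smooth (f i)) \<Longrightarrow> smooth (\<lambda>x. \<Prod>i\<in>I. f i x)"
  by (induction I rule: infinite_finite_induct) (auto intro: smooth_const smooth_mult)

lemma smooth_power: "smooth f \<Longrightarrow> smooth (\<lambda>x. f x ^ n)"
  by (induction n) (auto intro: smooth_const smooth_mult)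

lemma smooth_partial: "smooth f \<Longrightarrow> b \<in> Basis \<Longrightarrow> smooth (partial b f)"
  unfolding smooth_def by (meson Ck.simps(2))

lemma smooth_differentiable: "smooth f \<Longrightarrow> f differentiable (at x)"
  unfolding smooth_def by (meson Ck_Suc_imp_differentiable)

lemma smooth_continuous: "smooth f \<Longrightarrow> continuous_on A f"
  unfolding smooth_def by (meson Ck_imp_continuous continuous_on_subset subset_UNIV)

lemma smooth_measurable: "smooth f \<Longrightarrow> f \<in> borel_measurable borel"
  by (intro borel_measurable_continuous_onI smooth_continuous)

section \<open>Bump functions\<close>

text \<open>For p = 1 this is the usual flat function exp (- 1/t). Polynomials in 1/t are carried
  along because differentiation then stays inside the family.\<close>

definition flat_exp :: "real poly \<Rightarrow> real \<Rightarrow> real" where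
  "flat_exp p t = (if 0 < t then poly p (1 / t) * exp (- (1 / t)) else 0)"

lemma poly_div_exp_tendsto_0: "((\<lambda>x. poly p x / exp x) \<longlongrightarrow> (0::real)) at_top"
proof -
  have "((\<lambda>x. \<Sum>i\<le>degree p. coeff p i * (x ^ i / exp x)) \<longlongrightarrow> (\<Sum>i\<le>degree p. coeff p i * 0)) at_top"
    by (intro tendsto_sum tendsto_mult tendsto_const tendsto_power_div_exp_0)
  then show ?thesis
    by (simp add: poly_altdef sum_divide_distrib)
qed

text \<open>Put s = 1/t, so ds/dt = - s^2: the derivative of p(s) exp (- s) in t is s^2 (p(s) -
  p'(s)) exp (- s), and \<open>[:0, 0, 1:]\<close> is s^2. At t = 0 the right difference quotient is
  s p(s) / exp s with s tending to infinity.\<close>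

lemma flat_exp_has_derivative:
  "(flat_exp p has_real_derivative flat_exp ([:0, 0, 1:] * (p - pderiv p)) t) (at t)"
proof -
  consider "t > 0" | "t < 0" | "t = 0" by linarith
  then show ?thesis
  proof cases
    case 1
    have inv: "((\<lambda>t. 1 / t) has_real_derivative - (1 / t\<^sup>2)) (at t)"
      using 1 by (auto intro!: derivative_eq_intros simp: power2_eq_square)
    have "((\<lambda>t. poly p (1 / t)) has_real_derivative poly (pderiv p) (1 / t) * (- (1 / t\<^sup>2))) (at t)"
      by (rule DERIV_chain2[OF poly_DERIV inv])
    moreover have "((\<lambda>t. exp (- (1 / t))) has_real_derivative exp (- (1 / t)) * (- (- (1 / t\<^sup>2)))) (at t)"
      by (rule DERIV_chain2[OF DERIV_exp DERIV_minus[OF inv]])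
    ultimately have "((\<lambda>t. poly p (1 / t) * exp (- (1 / t))) has_real_derivative
       poly (pderiv p) (1 / t) * (- (1 / t\<^sup>2)) * exp (- (1 / t)) + exp (- (1 / t)) * (- (- (1 / t\<^sup>2))) * poly p (1 / t)) (at t)"
      by (rule DERIV_mult)
    moreover have "poly (pderiv p) (1 / t) * (- (1 / t\<^sup>2)) * exp (- (1 / t)) + exp (- (1 / t)) * (- (- (1 / t\<^sup>2))) * poly p (1 / t)
        = flat_exp ([:0, 0, 1:] * (p - pderiv p)) t"
      using 1 by (simp add: flat_exp_def power2_eq_square algebra_simps)
    ultimately have "((\<lambda>t. poly p (1 / t) * exp (- (1 / t))) has_real_derivative
       flat_exp ([:0, 0, 1:] * (p - pderiv p)) t) (at t)"
      by metis
    moreover have "\<forall>\<^sub>F s in nhds t. flat_exp p s = poly p (1 / s) * exp (- (1 / s))"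
      using 1 by (intro eventually_mono[OF eventually_nhds_in_open[of "{0<..}"]]) (auto simp: flat_exp_def)
    ultimately show ?thesis
      by (rule DERIV_cong_ev[OF refl _ refl, THEN iffD2, rotated])
  next
    case 2
    have "((\<lambda>t. 0) has_real_derivative flat_exp ([:0, 0, 1:] * (p - pderiv p)) t) (at t)"
      using 2 by (auto simp: flat_exp_def)
    moreover have "\<forall>\<^sub>F s in nhds t. flat_exp p s = 0"
      using 2 by (intro eventually_mono[OF eventually_nhds_in_open[of "{..<0}"]]) (auto simp: flat_exp_def)
    ultimately show ?thesis
      by (rule DERIV_cong_ev[OF refl _ refl, THEN iffD2, rotated])
  next
    case 3
    have "((\<lambda>h. flat_exp p h / h) \<longlongrightarrow> 0) (at_right 0)"
    proof -
      have "((\<lambda>x. flat_exp p (inverse x) / inverse x) \<longlongrightarrow> 0) at_top"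
      proof (rule Lim_transform_eventually)
        show "((\<lambda>x. poly ([:0, 1:] * p) x / exp x) \<longlongrightarrow> 0) at_top"
          by (rule poly_div_exp_tendsto_0)
        show "\<forall>\<^sub>F x in at_top. poly ([:0, 1:] * p) x / exp x = flat_exp p (inverse x) / inverse x"
          using eventually_gt_at_top[of 0]
          by eventually_elim (auto simp: flat_exp_def exp_minus field_simps)
      qed
      then show ?thesis
        by (simp add: at_right_to_top filterlim_filtermap)
    qed
    moreover have "((\<lambda>h. flat_exp p h / h) \<longlongrightarrow> 0) (at_left 0)"
    proof (rule Lim_transform_eventually)
      show "\<forall>\<^sub>F x in at_left 0. 0 = flat_exp p x / x"
        by (auto simp: flat_exp_def eventually_at_left_field intro!: exI[of _ "-1"])
    qed auto
    ultimately have "((\<lambda>h. flat_exp p h / h) \<longlongrightarrow> 0) (at 0)"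
      by (simp add: filterlim_split_at)
    then show ?thesis
      by (simp add: 3 has_field_derivative_iff flat_exp_def)
  qed
qed

text \<open>The squared distance keeps the function smooth at the centre. For r \<ge> 0 it is
  positive exactly on the open ball.\<close>

definition bump :: "'a::euclidean_space \<Rightarrow> real \<Rightarrow> 'a \<Rightarrow> real" where
  "bump c r x = flat_exp 1 (r\<^sup>2 - (x - c) \<bullet> (x - c))"

text \<open>The induction runs over all \<open>p\<close>: a partial derivative is the member of the
  family for another polynomial, times an affine function of x.\<close>

lemma Ck_flat_exp_comp: "Ck k (\<lambda>x. flat_exp p (r\<^sup>2 - (x - c) \<bullet> (x - c)))"
proof (induction k arbitrary: p)
  case 0
  have "continuous_on UNIV (flat_exp p)"
    using flat_exp_has_derivative DERIV_isCont continuous_at_imp_continuous_on by blast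
  then have "continuous_on UNIV (flat_exp p \<circ> (\<lambda>x. r\<^sup>2 - (x - c) \<bullet> (x - c)))"
    by (intro continuous_on_compose continuous_intros) (auto intro: continuous_on_subset)
  then show ?case by (simp add: o_def)
next
  case (Suc k)
  define q where "q = [:0, 0, 1:] * (p - pderiv p)"
  have d: "((\<lambda>x. flat_exp p (r\<^sup>2 - (x - c) \<bullet> (x - c))) has_derivative
     (\<lambda>h. flat_exp q (r\<^sup>2 - (x - c) \<bullet> (x - c)) * (- 2 * ((x - c) \<bullet> h)))) (at x)" for x
  proof -
    have "((\<lambda>x. r\<^sup>2 - (x - c) \<bullet> (x - c)) has_derivative (\<lambda>h. - 2 * ((x - c) \<bullet> h))) (at x)"
      by (auto intro!: derivative_eq_intros simp: inner_commute)
    from has_derivative_compose[OF this flat_exp_has_derivative[unfolded has_field_derivative_def]]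
    show ?thesis by (simp add: q_def)
  qed
  have "partial b (\<lambda>x. flat_exp p (r\<^sup>2 - (x - c) \<bullet> (x - c))) =
     (\<lambda>x. flat_exp q (r\<^sup>2 - (x - c) \<bullet> (x - c)) * (- 2 * ((x - c) \<bullet> b)))" for b
    by (intro ext partial_eqI[OF d])
  moreover have "Ck k (\<lambda>x. flat_exp q (r\<^sup>2 - (x - c) \<bullet> (x - c)) * (- 2 * ((x - c) \<bullet> b)))" for b
    by (intro Ck_mult Suc.IH Ck_const Ck_inner)
  ultimately show ?case
    using d by (auto simp: differentiable_on_def differentiable_def)
qed

lemma smooth_bump: "smooth (bump c r)"
  unfolding smooth_def bump_def using Ck_flat_exp_comp by auto

lemma bump_pos: "norm (x - c) < r \<Longrightarrow> 0 < bump c r x"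
  using power_strict_mono[of "norm (x - c)" r 2]
  by (simp add: bump_def flat_exp_def dot_square_norm)

lemma bump_zero: "0 \<le> r \<Longrightarrow> r \<le> norm (x - c) \<Longrightarrow> bump c r x = 0"
  using power_mono[of r "norm (x - c)" 2]
  by (simp add: bump_def flat_exp_def dot_square_norm not_less)

lemma bump_nonneg: "0 \<le> bump c r x"
  by (simp add: bump_def flat_exp_def)

lemma bump_le_1: "bump c r x \<le> 1"
  by (simp add: bump_def flat_exp_def)

section \<open>Test functions: closure properties and behaviour along lines\<close>

lemma Cc_infinityI:
  assumes "smooth \<phi>" "compact K" "K \<subseteq> \<Omega>" "\<And>x. x \<notin> K \<Longrightarrow> \<phi> x = 0"
  shows "\<phi> \<in> Cc_infinity \<Omega>"
proof -
  have "closure {x. \<phi> x \<noteq> 0} \<subseteq> K"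
    using assms by (intro closure_minimal compact_imp_closed) auto
  moreover have "compact (closure {x. \<phi> x \<noteq> 0})"
    using calculation assms(2) by (meson bounded_subset compact_eq_bounded_closed closed_closure)
  ultimately show ?thesis
    using assms by (auto simp: Cc_infinity_def)
qed

lemma Cc_infinity_support:
  assumes "\<phi> \<in> Cc_infinity \<Omega>"
  shows "\<exists>K. compact K \<and> K \<subseteq> \<Omega> \<and> (\<forall>x. x \<notin> K \<longrightarrow> \<phi> x = 0)"
proof (intro exI conjI allI impI)
  show "\<phi> x = 0" if "x \<notin> closure {x. \<phi> x \<noteq> 0}" for x
    using that closure_subset by (metis (mono_tags) mem_Collect_eq subsetD)
qed (use assms in \<open>auto simp: Cc_infinity_def\<close>)

lemma Cc_infinity_smooth: "\<phi> \<in> Cc_infinity \<Omega> \<Longrightarrow> smooth \<phi>"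
  by (simp add: Cc_infinity_def)

lemma Cc_infinity_zero: "(\<lambda>x. 0) \<in> Cc_infinity \<Omega>"
  by (rule Cc_infinityI[where K = "{}"]) (auto intro: smooth_const)

lemma Cc_infinity_add:
  assumes "\<phi> \<in> Cc_infinity \<Omega>" "\<psi> \<in> Cc_infinity \<Omega>"
  shows "(\<lambda>x. \<phi> x + \<psi> x) \<in> Cc_infinity \<Omega>"
proof -
  obtain K where "compact K" "K \<subseteq> \<Omega>" "\<And>x. x \<notin> K \<Longrightarrow> \<phi> x = 0"
    using Cc_infinity_support[OF assms(1)] by blast
  moreover obtain L where "compact L" "L \<subseteq> \<Omega>" "\<And>x. x \<notin> L \<Longrightarrow> \<psi> x = 0"
    using Cc_infinity_support[OF assms(2)] by blast
  ultimately show ?thesis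
    using smooth_add[OF assms[THEN Cc_infinity_smooth]] by (intro Cc_infinityI[where K = "K \<union> L"]) auto
qed

lemma Cc_infinity_mult:
  assumes "\<phi> \<in> Cc_infinity \<Omega>" "smooth \<psi>"
  shows "(\<lambda>x. \<psi> x * \<phi> x) \<in> Cc_infinity \<Omega>"
proof -
  obtain K where "compact K" "K \<subseteq> \<Omega>" "\<And>x. x \<notin> K \<Longrightarrow> \<phi> x = 0"
    using Cc_infinity_support[OF assms(1)] by blast
  then show ?thesis
    using smooth_mult[OF assms(2) Cc_infinity_smooth[OF assms(1)]] by (intro Cc_infinityI[where K = K]) auto
qed

lemma Cc_infinity_cmult: "\<phi> \<in> Cc_infinity \<Omega> \<Longrightarrow> (\<lambda>x. c * \<phi> x) \<in> Cc_infinity \<Omega>"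
  by (rule Cc_infinity_mult[OF _ smooth_const])

lemma Cc_infinity_sum:
  "(\<And>i. i \<in> I \<Longrightarrow> f i \<in> Cc_infinity \<Omega>) \<Longrightarrow> (\<lambda>x. \<Sum>i\<in>I. f i x) \<in> Cc_infinity \<Omega>"
  by (induction I rule: infinite_finite_induct) (auto intro: Cc_infinity_zero Cc_infinity_add)

lemma partial_zero_outside:
  assumes "closed K" "\<And>x. x \<notin> K \<Longrightarrow> \<phi> x = c" "x \<notin> K"
  shows "partial b \<phi> x = 0"
proof -
  have "(\<phi> has_derivative (\<lambda>h. 0)) (at x)"
    by (rule has_derivative_transform_within_open[OF has_derivative_const[of c], of "- K"])
      (use assms in auto)
  then show ?thesis
    by (rule partial_eqI)
qed

lemma Cc_infinity_partial:
  assumes "\<phi> \<in> Cc_infinity \<Omega>" "b \<in> Basis"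
  shows "partial b \<phi> \<in> Cc_infinity \<Omega>"
proof -
  obtain K where K: "compact K" "K \<subseteq> \<Omega>" "\<And>x. x \<notin> K \<Longrightarrow> \<phi> x = 0"
    using Cc_infinity_support[OF assms(1)] by blast
  show ?thesis
  proof (rule Cc_infinityI[where K = K])
    show "partial b \<phi> x = 0" if "x \<notin> K" for x
      using K that by (intro partial_zero_outside[where K = K and c = 0]) (auto intro: compact_imp_closed)
  qed (use K assms in \<open>auto intro: smooth_partial Cc_infinity_smooth\<close>)
qed

lemma Cc_infinity_bounded:
  fixes \<phi> :: "'a::euclidean_space \<Rightarrow> real"
  assumes "\<phi> \<in> Cc_infinity \<Omega>"
  obtains C where "0 < C" "\<And>x. \<bar>\<phi> x\<bar> \<le> C"
proof -
  obtain K where K: "compact K" "\<And>x. x \<notin> K \<Longrightarrow> \<phi> x = 0"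
    using Cc_infinity_support[OF assms] by blast
  have "compact (\<phi> ` K)"
    using K smooth_continuous[OF Cc_infinity_smooth[OF assms]] by (intro compact_continuous_image)
  then obtain C where "0 < C" "\<And>x. x \<in> K \<Longrightarrow> \<bar>\<phi> x\<bar> \<le> C"
    by (metis bounded_pos compact_imp_bounded imageI real_norm_def)
  then have "\<bar>\<phi> x\<bar> \<le> C" for x
    by (cases "x \<in> K") (use K in auto)
  then show thesis using that \<open>0 < C\<close> by blast
qed

lemma Cc_infinity_bump:
  assumes "cball c r \<subseteq> \<Omega>" "0 \<le> r"
  shows "bump c r \<in> Cc_infinity \<Omega>"
  by (rule Cc_infinityI[where K = "cball c r"])
    (use assms in \<open>auto simp: smooth_bump dist_norm norm_minus_commute intro!: bump_zero\<close>)

lemma lipschitz_along: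
  fixes f :: "'a::euclidean_space \<Rightarrow> real"
  assumes d: "\<And>x. f differentiable (at x)" and B: "\<And>x. \<bar>partial b f x\<bar> \<le> B"
  shows "\<bar>f (x + t *\<^sub>R b) - f x\<bar> \<le> B * \<bar>t\<bar>"
proof -
  have "norm (f (x + t *\<^sub>R b) - f (x + 0 *\<^sub>R b)) \<le> B * norm (t - 0)"
    by (rule field_differentiable_bound[where S = UNIV and f = "\<lambda>t. f (x + t *\<^sub>R b)"])
      (use B d in \<open>auto intro: has_real_derivative_along\<close>)
  then show ?thesis by simp
qed

lemma difference_quotient_tendsto:
  fixes f :: "'a::euclidean_space \<Rightarrow> real"
  assumes "f differentiable (at x)" and h: "filterlim h (at 0) sequentially"
  shows "(\<lambda>n. (f (x + h n *\<^sub>R b) - f x) / h n) \<longlonglongrightarrow> partial b f x"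
proof -
  have "((\<lambda>t. f (x + t *\<^sub>R b)) has_real_derivative partial b f (x + 0 *\<^sub>R b)) (at 0)"
    by (rule has_real_derivative_along) (use assms in simp)
  then have "((\<lambda>t. (f (x + t *\<^sub>R b) - f x) / t) \<longlongrightarrow> partial b f x) (at 0)"
    by (simp add: has_field_derivative_iff)
  from filterlim_compose[OF this h] show ?thesis .
qed

section \<open>Approximation of square integrable functions by test functions\<close>

lemma Cc_infinity_L2:
  fixes \<phi> :: "'a::euclidean_space \<Rightarrow> real"
  assumes "bounded \<Omega>" "open \<Omega>" "\<phi> \<in> Cc_infinity \<Omega>"
  shows "\<phi> \<in> L2 \<Omega>"
  using assms by (blast intro: continuous_imp_L2 smooth_continuous Cc_infinity_smooth)

text \<open>Nonnegativity of the approximants is built in because a positive constant is added to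
  them later and the sum has to stay positive.\<close>

definition test_approx :: "'a::euclidean_space set \<Rightarrow> ('a \<Rightarrow> real) \<Rightarrow> bool" where
  "test_approx \<Omega> f \<longleftrightarrow> (\<forall>\<epsilon>>0. \<exists>\<phi>\<in>Cc_infinity \<Omega>. (\<forall>x. 0 \<le> \<phi> x) \<and> L2norm \<Omega> (\<lambda>x. f x - \<phi> x) < \<epsilon>)"

lemma test_approx_limit:
  fixes f :: "'a::euclidean_space \<Rightarrow> real"
  assumes \<Omega>: "bounded \<Omega>" "open \<Omega>" and f: "f \<in> L2 \<Omega>"
    and lim: "\<And>\<epsilon>. 0 < \<epsilon> \<Longrightarrow> \<exists>g\<in>L2 \<Omega>. test_approx \<Omega> g \<and> L2norm \<Omega> (\<lambda>x. f x - g x) < \<epsilon>"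
  shows "test_approx \<Omega> f"
  unfolding test_approx_def
proof (intro allI impI)
  fix \<epsilon> :: real assume "0 < \<epsilon>"
  then obtain g where g: "g \<in> L2 \<Omega>" "test_approx \<Omega> g" "L2norm \<Omega> (\<lambda>x. f x - g x) < \<epsilon> / 2"
    using lim[of "\<epsilon> / 2"] by auto
  then obtain \<phi> where \<phi>: "\<phi> \<in> Cc_infinity \<Omega>" "\<forall>x. 0 \<le> \<phi> x" "L2norm \<Omega> (\<lambda>x. g x - \<phi> x) < \<epsilon> / 2"
    using \<open>0 < \<epsilon>\<close> unfolding test_approx_def by (meson half_gt_zero)
  have "L2norm \<Omega> (\<lambda>x. f x - \<phi> x) < \<epsilon>"
    using L2norm_diff_triangle[OF f g(1) Cc_infinity_L2[OF \<Omega> \<phi>(1)]] g(3) \<phi>(3) by linarith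
  with \<phi> show "\<exists>\<phi>\<in>Cc_infinity \<Omega>. (\<forall>x. 0 \<le> \<phi> x) \<and> L2norm \<Omega> (\<lambda>x. f x - \<phi> x) < \<epsilon>"
    by blast
qed

lemma test_approx_seq:
  fixes f :: "'a::euclidean_space \<Rightarrow> real"
  assumes \<Omega>: "bounded \<Omega>" "open \<Omega>" and f: "f \<in> L2 \<Omega>" and F: "\<And>k::nat. F k \<in> L2 \<Omega>" "\<And>k. test_approx \<Omega> (F k)"
    and lim: "(\<lambda>k. L2norm \<Omega> (\<lambda>x. F k x - f x)) \<longlonglongrightarrow> 0"
  shows "test_approx \<Omega> f"
proof (rule test_approx_limit[OF \<Omega> f])
  fix \<epsilon> :: real assume "0 < \<epsilon>"
  then obtain k where "norm (L2norm \<Omega> (\<lambda>x. F k x - f x) - 0) < \<epsilon>"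
    using LIMSEQ_D[OF lim] by blast
  then have "L2norm \<Omega> (\<lambda>x. f x - F k x) < \<epsilon>"
    using L2norm_minus_commute[of \<Omega> f "F k"] by simp
  with F show "\<exists>g\<in>L2 \<Omega>. test_approx \<Omega> g \<and> L2norm \<Omega> (\<lambda>x. f x - g x) < \<epsilon>"
    by blast
qed

lemma test_approx_add:
  fixes f g :: "'a::euclidean_space \<Rightarrow> real"
  assumes \<Omega>: "bounded \<Omega>" "open \<Omega>" and fg: "f \<in> L2 \<Omega>" "g \<in> L2 \<Omega>" "test_approx \<Omega> f" "test_approx \<Omega> g"
  shows "test_approx \<Omega> (\<lambda>x. f x + g x)"
  unfolding test_approx_def
proof (intro allI impI)
  fix \<epsilon> :: real assume "0 < \<epsilon>"
  then obtain \<phi> \<psi> where \<phi>: "\<phi> \<in> Cc_infinity \<Omega>" "\<forall>x. 0 \<le> \<phi> x" "L2norm \<Omega> (\<lambda>x. f x - \<phi> x) < \<epsilon> / 2"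
    and \<psi>: "\<psi> \<in> Cc_infinity \<Omega>" "\<forall>x. 0 \<le> \<psi> x" "L2norm \<Omega> (\<lambda>x. g x - \<psi> x) < \<epsilon> / 2"
    using fg(3,4) unfolding test_approx_def by (meson half_gt_zero)
  have "L2norm \<Omega> (\<lambda>x. (f x - \<phi> x) + (g x - \<psi> x)) < \<epsilon>"
    using L2norm_triangle[OF L2_diff[OF fg(1) Cc_infinity_L2[OF \<Omega> \<phi>(1)]] L2_diff[OF fg(2) Cc_infinity_L2[OF \<Omega> \<psi>(1)]]]
      \<phi>(3) \<psi>(3) by linarith
  then have "L2norm \<Omega> (\<lambda>x. (f x + g x) - (\<phi> x + \<psi> x)) < \<epsilon>"
    by (simp add: algebra_simps)
  with \<phi> \<psi> show "\<exists>\<phi>\<in>Cc_infinity \<Omega>. (\<forall>x. 0 \<le> \<phi> x) \<and> L2norm \<Omega> (\<lambda>x. (f x + g x) - \<phi> x) < \<epsilon>"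
    by (intro bexI[of _ "\<lambda>x. \<phi> x + \<psi> x"]) (auto intro: Cc_infinity_add)
qed

lemma test_approx_cmult:
  assumes "0 < c" "test_approx \<Omega> f"
  shows "test_approx \<Omega> (\<lambda>x. c * f x)"
  unfolding test_approx_def
proof (intro allI impI)
  fix \<epsilon> :: real assume "0 < \<epsilon>"
  then have "0 < \<epsilon> / c" using assms by simp
  then obtain \<phi> where \<phi>: "\<phi> \<in> Cc_infinity \<Omega>" "\<forall>x. 0 \<le> \<phi> x" "L2norm \<Omega> (\<lambda>x. f x - \<phi> x) < \<epsilon> / c"
    using assms(2) unfolding test_approx_def by meson
  have "L2norm \<Omega> (\<lambda>x. c * f x - c * \<phi> x) < \<epsilon>"
    using \<phi>(3) assms(1) L2norm_cmult[of \<Omega> c "\<lambda>x. f x - \<phi> x"] by (simp add: right_diff_distrib field_simps)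
  with \<phi> assms(1) show "\<exists>\<phi>\<in>Cc_infinity \<Omega>. (\<forall>x. 0 \<le> \<phi> x) \<and> L2norm \<Omega> (\<lambda>x. c * f x - \<phi> x) < \<epsilon>"
    by (intro bexI[of _ "\<lambda>x. c * \<phi> x"]) (auto intro: Cc_infinity_cmult)
qed

text \<open>Countably many balls with closure in \<open>U\<close> cover \<open>U\<close>. The
  product of the powers (1 - B i)^n over i < n is 1 off finitely many closed balls, hence \<phi> n
  has compact support in \<open>U\<close>. At a point of \<open>U\<close> some base is below 1 and
  the growing exponent drives the product to 0, so \<phi> n tends to the indicator.\<close>

lemma test_approx_indicator_open:
  fixes U :: "'a::euclidean_space set"
  assumes \<Omega>: "bounded \<Omega>" "open \<Omega>" and U: "open U" "U \<subseteq> \<Omega>"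
  shows "test_approx \<Omega> (indicator U)"
proof (cases "U = {}")
  case True
  then show ?thesis
    by (auto simp: test_approx_def L2norm_def intro!: bexI[of _ "\<lambda>x. 0"] Cc_infinity_zero)
next
  case False
  define \<F> where "\<F> = {ball c r | c r. 0 < r \<and> cball c r \<subseteq> U}"
  have "U \<subseteq> \<Union>\<F>"
  proof
    fix x assume "x \<in> U"
    then obtain r where "0 < r" "cball x r \<subseteq> U"
      using U(1) open_contains_cball by blast
    then show "x \<in> \<Union>\<F>"
      by (auto simp: \<F>_def intro!: exI[of _ "ball x r"])
  qed
  moreover have "\<Union>\<F> \<subseteq> U"
    by (auto simp: \<F>_def subset_iff)
  ultimately have Un: "\<Union>\<F> = U"
    by (rule antisym[rotated])
  have op: "open S" if "S \<in> \<F>" for S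
    using that by (auto simp: \<F>_def)
  obtain \<F>' where \<F>': "\<F>' \<subseteq> \<F>" "countable \<F>'" "\<Union>\<F>' = U"
    by (rule Lindelof[OF op], assumption, rule that) (simp_all add: Un)
  have ne: "\<F>' \<noteq> {}"
    using False \<F>'(3) by auto
  define e where "e = from_nat_into \<F>'"
  have e: "range e = \<F>'"
    unfolding e_def using ne \<F>'(2) by (rule range_from_nat_into)
  have "\<forall>i. \<exists>c r. e i = ball c r \<and> 0 < r \<and> cball c r \<subseteq> U"
    using e \<F>'(1) unfolding \<F>_def by blast
  then obtain c r where cr: "\<And>i. e i = ball (c i) (r i)" "\<And>i. 0 < r i" "\<And>i. cball (c i) (r i) \<subseteq> U"
    by metis
  define B where "B i = bump (c i) (r i)" for i
  define \<phi> where "\<phi> n x = 1 - (\<Prod>i<n. (1 - B i x) ^ n)" for n x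
  have B01: "0 \<le> 1 - B i x" "1 - B i x \<le> 1" for i x
    by (auto simp: B_def bump_le_1 bump_nonneg)
  then have P01: "0 \<le> (\<Prod>i<n. (1 - B i x) ^ m)" "(\<Prod>i<n. (1 - B i x) ^ m) \<le> 1" for n m x
    by (auto intro!: prod_nonneg prod_le_1 power_le_one)
  have Bz: "B i x = 0" if "x \<notin> cball (c i) (r i)" for i x
    unfolding B_def by (rule bump_zero) (use that cr(2)[of i] in \<open>auto simp: dist_norm norm_minus_commute\<close>)
  have \<phi>: "\<phi> n \<in> Cc_infinity \<Omega>" for n
  proof (rule Cc_infinityI)
    show "smooth (\<phi> n)"
      unfolding \<phi>_def B_def by (intro smooth_diff smooth_prod smooth_power smooth_const smooth_bump)
    show "compact (\<Union>i<n. cball (c i) (r i))" "(\<Union>i<n. cball (c i) (r i)) \<subseteq> \<Omega>"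
      using cr(3) U(2) by (auto intro!: compact_UN)
    show "\<phi> n x = 0" if "x \<notin> (\<Union>i<n. cball (c i) (r i))" for x
      using that by (simp add: \<phi>_def Bz)
  qed
  have lim: "(\<lambda>n. \<phi> n x) \<longlonglongrightarrow> indicator U x" for x
  proof (cases "x \<in> U")
    case True
    then obtain j where "x \<in> e j"
      using \<F>'(3) e by (metis UnionE imageE)
    then have "norm (x - c j) < r j"
      by (simp add: cr dist_norm norm_minus_commute)
    then have "0 < B j x"
      unfolding B_def by (rule bump_pos)
    then have "(\<lambda>n. (1 - B j x) ^ n) \<longlonglongrightarrow> 0"
      using B01[of j x] by (intro LIMSEQ_power_zero) auto
    moreover have "(\<Prod>i<n. (1 - B i x) ^ n) \<le> (1 - B j x) ^ n" if "n > j" for n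
    proof -
      have "(\<Prod>i<n. (1 - B i x) ^ n) = (1 - B j x) ^ n * (\<Prod>i\<in>{..<n} - {j}. (1 - B i x) ^ n)"
        using that by (intro prod.remove) auto
      also have "\<dots> \<le> (1 - B j x) ^ n * 1"
        using B01 by (intro mult_left_mono prod_le_1 zero_le_power) (auto intro: power_le_one)
      finally show ?thesis by simp
    qed
    then have "\<forall>\<^sub>F n in sequentially. norm (\<Prod>i<n. (1 - B i x) ^ n) \<le> (1 - B j x) ^ n"
      using P01 by (intro eventually_mono[OF eventually_gt_at_top[of j]]) auto
    ultimately have "(\<lambda>n. \<Prod>i<n. (1 - B i x) ^ n) \<longlonglongrightarrow> 0"
      by (rule Lim_null_comparison[rotated])
    then have "(\<lambda>n. 1 - (\<Prod>i<n. (1 - B i x) ^ n)) \<longlonglongrightarrow> 1 - 0"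
      by (intro tendsto_intros)
    then show ?thesis
      using True by (simp add: \<phi>_def)
  next
    case False
    then have "B i x = 0" for i
      using cr(3)[of i] Bz by blast
    then show ?thesis
      using False by (simp add: \<phi>_def)
  qed
  have ind: "indicator U \<in> L2 \<Omega>"
  proof (rule bounded_imp_L2)
    show "\<Omega> \<in> sets lebesgue" using \<Omega> by auto
    have "indicator U \<in> borel_measurable lebesgue"
      using U(1) by (intro borel_measurable_indicator) auto
    then show "indicator U \<in> borel_measurable (lebesgue_on \<Omega>)"
      by (rule measurable_restrict_space1)
    show "AE x in lebesgue_on \<Omega>. \<bar>indicator U x\<bar> \<le> (1::real)"
      by (simp add: indicator_def)
  qed fact
  show ?thesis
  proof (rule test_approx_seq[OF \<Omega> ind])
    show "\<phi> n \<in> L2 \<Omega>" for n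
      using \<Omega> \<phi> by (rule Cc_infinity_L2)
    show "test_approx \<Omega> (\<phi> n)" for n
      using \<phi>[of n] P01 by (auto simp: test_approx_def L2norm_def \<phi>_def intro!: bexI[of _ "\<phi> n"])
    show "(\<lambda>n. L2norm \<Omega> (\<lambda>x. \<phi> n x - indicator U x)) \<longlonglongrightarrow> 0"
    proof (rule L2norm_tendsto_dominated)
      show "(\<lambda>x. 1) \<in> L2 \<Omega>"
        using \<Omega> by (intro continuous_imp_L2) auto
      show "AE x in lebesgue_on \<Omega>. \<bar>\<phi> n x - indicator U x\<bar> \<le> 1" for n
      proof (rule AE_I2)
        fix x
        show "\<bar>\<phi> n x - indicator U x\<bar> \<le> 1"
          using P01(1)[where n = n and m = n and x = x] P01(2)[where n = n and m = n and x = x]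
          by (simp add: \<phi>_def indicator_def)
      qed
    qed (use lim \<phi> ind \<Omega> in \<open>auto intro: L2_measurable Cc_infinity_L2\<close>)
  qed
qed

lemma test_approx_indicator:
  fixes A :: "'a::euclidean_space set"
  assumes \<Omega>: "bounded \<Omega>" "open \<Omega>" and A: "A \<in> sets (lebesgue_on \<Omega>)"
  shows "test_approx \<Omega> (indicator A)" "indicator A \<in> L2 \<Omega>"
proof -
  have sets: "\<Omega> \<in> sets lebesgue" using \<Omega> by auto
  have ind: "indicator B \<in> L2 \<Omega>" if "B \<in> sets (lebesgue_on \<Omega>)" for B
    using that \<Omega> sets by (intro bounded_imp_L2[where C = 1]) (auto simp: indicator_def)
  show L2A: "indicator A \<in> L2 \<Omega>"
    using A by (rule ind)
  have A': "A \<in> sets lebesgue" "A \<subseteq> \<Omega>"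
    using A sets by (auto simp: sets_restrict_space_iff)
  show "test_approx \<Omega> (indicator A)"
  proof (rule test_approx_limit[OF \<Omega> L2A])
    fix \<epsilon> :: real assume "0 < \<epsilon>"
    \<comment> \<open>The bound is the square of \<epsilon> because the squared L2 distance of the
      indicators of nested sets is the measure of their difference.\<close>
    obtain T where T: "open T" "A \<subseteq> T" "T - A \<in> lmeasurable" "emeasure lebesgue (T - A) < ennreal (\<epsilon>\<^sup>2)"
      using sets_lebesgue_outer_open[OF A'(1), of "\<epsilon>\<^sup>2"] \<open>0 < \<epsilon>\<close> by auto
    have TO: "T \<inter> \<Omega> \<in> sets (lebesgue_on \<Omega>)"
      using T(1) sets \<Omega> by (auto simp: sets_restrict_space_iff)
    have D: "T \<inter> \<Omega> - A \<in> sets lebesgue"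
      using T(1) \<Omega> A' by auto
    have "(L2norm \<Omega> (\<lambda>x. indicator A x - indicator (T \<inter> \<Omega>) x))\<^sup>2 = measure (lebesgue_on \<Omega>) (T \<inter> \<Omega> - A)"
    proof -
      have "(indicator A x - indicator (T \<inter> \<Omega>) x)\<^sup>2 = (indicator (T \<inter> \<Omega> - A) x :: real)" for x
        using T(2) A'(2) by (auto simp: indicator_def)
      then have "(L2norm \<Omega> (\<lambda>x. indicator A x - indicator (T \<inter> \<Omega>) x))\<^sup>2 =
          integral\<^sup>L (lebesgue_on \<Omega>) (indicator (T \<inter> \<Omega> - A))"
        unfolding L2norm_square by presburger
      also have "\<dots> = measure (lebesgue_on \<Omega>) (T \<inter> \<Omega> - A)"
        by (simp add: space_restrict_space Int_absorb2 Diff_subset le_infI2 subset_eq Int_commute)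
          (rule arg_cong[where f = "measure (lebesgue_on \<Omega>)"], auto)
      finally show ?thesis .
    qed
    also have "\<dots> = measure lebesgue (T \<inter> \<Omega> - A)"
      using sets by (intro measure_restrict_space) auto
    also have "\<dots> \<le> measure lebesgue (T - A)"
      using T(3) D by (intro measure_mono_fmeasurable) auto
    also have "\<dots> < \<epsilon>\<^sup>2"
      using T(4) unfolding emeasure_eq_measure2[OF T(3)] by (simp add: ennreal_less_iff)
    finally have "L2norm \<Omega> (\<lambda>x. indicator A x - indicator (T \<inter> \<Omega>) x) < \<epsilon>"
      by (rule power2_less_imp_less) (use \<open>0 < \<epsilon>\<close> in simp)
    moreover have "test_approx \<Omega> (indicator (T \<inter> \<Omega>))"
      using \<Omega> T(1) by (intro test_approx_indicator_open) auto
    ultimately show "\<exists>g\<in>L2 \<Omega>. test_approx \<Omega> g \<and> L2norm \<Omega> (\<lambda>x. indicator A x - g x) < \<epsilon>"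
      using ind[OF TO] by blast
  qed
qed

text \<open>Square integrability is carried through the induction as a premise: every building block
  is dominated by a multiple of \<open>u\<close> and inherits it.\<close>

lemma test_approx_nonneg_everywhere:
  fixes u :: "'a::euclidean_space \<Rightarrow> real"
  assumes \<Omega>: "bounded \<Omega>" "open \<Omega>" and u: "u \<in> borel_measurable (lebesgue_on \<Omega>)" "\<And>x. 0 \<le> u x"
  shows "u \<in> L2 \<Omega> \<Longrightarrow> test_approx \<Omega> u"
  using u
proof (induction u rule: borel_measurable_induct_real)
  case (set A)
  then show ?case using \<Omega> by (intro test_approx_indicator)
next
  case (mult u c)
  show ?case
  proof (cases "c = 0")
    case True
    then show ?thesis
      by (auto simp: test_approx_def L2norm_def intro!: bexI[of _ "\<lambda>x. 0"] Cc_infinity_zero)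
  next
    case False
    have "u \<in> L2 \<Omega>"
      using L2_cmult[OF mult.prems, of "1 / c"] False by simp
    then show ?thesis
      using mult False by (intro test_approx_cmult) auto
  qed
next
  case (add u v)
  have "u \<in> L2 \<Omega>"
    using add by (intro L2_bound[OF add.prems]) (auto intro!: AE_I2)
  moreover have "v \<in> L2 \<Omega>"
    using add by (intro L2_bound[OF add.prems]) (auto intro!: AE_I2)
  ultimately show ?case
    using add \<Omega> by (intro test_approx_add) auto
next
  case (seq U)
  have le: "U i x \<le> u x" if "x \<in> space (lebesgue_on \<Omega>)" for i x
    using seq.hyps(3,4) that by (intro incseq_le[of "\<lambda>i. U i x"]) (auto simp: incseq_def le_fun_def)
  have UL2: "U i \<in> L2 \<Omega>" for i
  proof (rule L2_bound[OF seq.prems seq.hyps(1)], rule AE_I2)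
    fix x assume "x \<in> space (lebesgue_on \<Omega>)"
    with le[of x i] seq.hyps(2)[of i x] show "\<bar>U i x\<bar> \<le> \<bar>u x\<bar>"
      by simp
  qed
  show ?case
  proof (rule test_approx_seq[OF \<Omega> seq.prems])
    show "(\<lambda>k. L2norm \<Omega> (\<lambda>x. U k x - u x)) \<longlonglongrightarrow> 0"
    proof (rule L2norm_tendsto_dominated[OF L2_measurable[OF seq.prems] seq.hyps(1) seq.prems])
      show "AE x in lebesgue_on \<Omega>. \<bar>U k x - u x\<bar> \<le> u x" for k
      proof (rule AE_I2)
        fix x assume "x \<in> space (lebesgue_on \<Omega>)"
        with le[of x k] seq.hyps(2)[of k x] show "\<bar>U k x - u x\<bar> \<le> u x"
          by simp
      qed
    qed (use seq.hyps(4) in auto)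
  qed (use UL2 seq.IH in auto)
qed

lemma L2_nonneg_test_approx:
  fixes u :: "'a::euclidean_space \<Rightarrow> real"
  assumes \<Omega>: "bounded \<Omega>" "open \<Omega>" and u: "u \<in> L2_nonneg \<Omega>" and "0 < \<epsilon>"
  shows "\<exists>\<phi>\<in>Cc_infinity \<Omega>. (\<forall>x. 0 \<le> \<phi> x) \<and> L2norm \<Omega> (\<lambda>x. u x - \<phi> x) < \<epsilon>"
proof -
  \<comment> \<open>The induction above wants nonnegativity at every point, whereas
    \<open>L2_nonneg\<close> gives it almost everywhere.\<close>
  define v where "v x = max 0 (u x)" for x
  have uL: "u \<in> L2 \<Omega>" and ae: "AE x in lebesgue_on \<Omega>. u x = v x"
    using u by (auto simp: L2_nonneg_def v_def max_def)
  have vm: "v \<in> borel_measurable (lebesgue_on \<Omega>)"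
    using uL unfolding v_def by measurable
  then have "v \<in> L2 \<Omega>"
    by (rule L2_AE_cong[OF uL _ ae])
  with vm have "test_approx \<Omega> v"
    by (intro test_approx_nonneg_everywhere[OF \<Omega>]) (auto simp: v_def)
  then obtain \<phi> where \<phi>: "\<phi> \<in> Cc_infinity \<Omega>" "\<forall>x. 0 \<le> \<phi> x" "L2norm \<Omega> (\<lambda>x. v x - \<phi> x) < \<epsilon>"
    unfolding test_approx_def using \<open>0 < \<epsilon>\<close> by meson
  have "L2norm \<Omega> (\<lambda>x. u x - \<phi> x) = L2norm \<Omega> (\<lambda>x. v x - \<phi> x)"
    using ae uL vm L2_measurable[OF Cc_infinity_L2[OF \<Omega> \<phi>(1)]]
    by (intro L2norm_AE_cong) (auto intro: borel_measurable_diff L2_measurable)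
  with \<phi> show ?thesis
    by (intro bexI[of _ \<phi>] conjI) simp_all
qed

lemma L2_test_approx:
  fixes u :: "'a::euclidean_space \<Rightarrow> real"
  assumes \<Omega>: "bounded \<Omega>" "open \<Omega>" and u: "u \<in> L2 \<Omega>" and "0 < \<epsilon>"
  shows "\<exists>\<phi>\<in>Cc_infinity \<Omega>. L2norm \<Omega> (\<lambda>x. u x - \<phi> x) < \<epsilon>"
proof -
  \<comment> \<open>The signs s = 1 and s = -1 produce the positive and the negative part.\<close>
  have parts: "(\<lambda>x. max 0 (s * u x)) \<in> L2_nonneg \<Omega>" if "\<bar>s\<bar> = 1" for s
  proof -
    have "(\<lambda>x. max 0 (s * u x)) \<in> borel_measurable (lebesgue_on \<Omega>)"
      using u by measurable
    moreover have "max 0 (s * u x) \<le> \<bar>u x\<bar>" for x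
      using that abs_ge_self[of "s * u x"] by (simp add: abs_mult)
    ultimately have "(\<lambda>x. max 0 (s * u x)) \<in> L2 \<Omega>"
      by (intro L2_bound[OF u]) auto
    then show ?thesis by (simp add: L2_nonneg_def)
  qed
  obtain \<phi> where \<phi>: "\<phi> \<in> Cc_infinity \<Omega>" "L2norm \<Omega> (\<lambda>x. max 0 (1 * u x) - \<phi> x) < \<epsilon> / 2"
    using L2_nonneg_test_approx[OF \<Omega> parts[of 1], of "\<epsilon> / 2"] \<open>0 < \<epsilon>\<close> by auto
  obtain \<psi> where \<psi>: "\<psi> \<in> Cc_infinity \<Omega>" "L2norm \<Omega> (\<lambda>x. max 0 (-1 * u x) - \<psi> x) < \<epsilon> / 2"
    using L2_nonneg_test_approx[OF \<Omega> parts[of "-1"], of "\<epsilon> / 2"] \<open>0 < \<epsilon>\<close> by auto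
  have "(\<lambda>x. max 0 (s * u x)) \<in> L2 \<Omega>" if "\<bar>s\<bar> = 1" for s
    using parts[OF that] by (simp add: L2_nonneg_def)
  from L2_diff[OF this Cc_infinity_L2[OF \<Omega> \<phi>(1)], of 1] L2_diff[OF this Cc_infinity_L2[OF \<Omega> \<psi>(1)], of "-1"]
  have L: "(\<lambda>x. max 0 (1 * u x) - \<phi> x) \<in> L2 \<Omega>" "(\<lambda>x. -1 * (max 0 (-1 * u x) - \<psi> x)) \<in> L2 \<Omega>"
    by (simp, intro L2_cmult, simp)
  have "(\<lambda>x. u x - (\<phi> x + -1 * \<psi> x)) = (\<lambda>x. (max 0 (1 * u x) - \<phi> x) + -1 * (max 0 (-1 * u x) - \<psi> x))"
    by (auto simp: max_def)
  then have "L2norm \<Omega> (\<lambda>x. u x - (\<phi> x + -1 * \<psi> x)) \<le>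
      L2norm \<Omega> (\<lambda>x. max 0 (1 * u x) - \<phi> x) + L2norm \<Omega> (\<lambda>x. -1 * (max 0 (-1 * u x) - \<psi> x))"
    using L2norm_triangle[OF L] by metis
  also have "\<dots> < \<epsilon>"
    using \<phi>(2) \<psi>(2) unfolding L2norm_cmult by simp
  finally show ?thesis
    using \<phi>(1) \<psi>(1) by (intro bexI[of _ "\<lambda>x. \<phi> x + -1 * \<psi> x"] Cc_infinity_add Cc_infinity_cmult)
qed

text \<open>If the norm N of \<open>g\<close> were positive, some test function \<phi> would be
  closer to \<open>g\<close> than N, and orthogonality with Cauchy-Schwarz would give N^2 = <g, g -
  \<phi>> < N^2.\<close>

lemma L2_orthogonal_to_test_functions:
  fixes g :: "'a::euclidean_space \<Rightarrow> real"
  assumes \<Omega>: "bounded \<Omega>" "open \<Omega>" and g: "g \<in> L2 \<Omega>"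
    and zero: "\<And>\<phi>. \<phi> \<in> Cc_infinity \<Omega> \<Longrightarrow> integral\<^sup>L (lebesgue_on \<Omega>) (\<lambda>x. g x * \<phi> x) = 0"
  shows "AE x in lebesgue_on \<Omega>. g x = 0"
proof (rule L2norm_zero_AE[OF g])
  define N where "N = L2norm \<Omega> g"
  have "N \<le> 0"
  proof (rule ccontr)
    assume "\<not> N \<le> 0"
    then obtain \<phi> where \<phi>: "\<phi> \<in> Cc_infinity \<Omega>" "L2norm \<Omega> (\<lambda>x. g x - \<phi> x) < N"
      using L2_test_approx[OF \<Omega> g, of N] by auto
    have \<phi>L: "\<phi> \<in> L2 \<Omega>" using \<Omega> \<phi>(1) by (rule Cc_infinity_L2)
    have "N\<^sup>2 = integral\<^sup>L (lebesgue_on \<Omega>) (\<lambda>x. g x * (g x - \<phi> x))"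
      using zero[OF \<phi>(1)] L2_mult_integrable[OF g \<phi>L] L2_mult_integrable[OF g g]
      unfolding N_def L2norm_square by (simp add: right_diff_distrib power2_eq_square)
    also have "\<dots> \<le> N * L2norm \<Omega> (\<lambda>x. g x - \<phi> x)"
      using L2_Cauchy_Schwarz[OF g L2_diff[OF g \<phi>L]] by (simp add: N_def)
    also have "\<dots> < N * N"
      using \<phi>(2) \<open>\<not> N \<le> 0\<close> by simp
    finally show False by (simp add: power2_eq_square)
  qed
  then show "L2norm \<Omega> g = 0"
    using L2norm_nonneg[of \<Omega> g] by (simp add: N_def)
qed

section \<open>Integration by parts\<close>

lemma integral_lebesgue_on_eq_lborel:
  fixes f :: "'a::euclidean_space \<Rightarrow> real"
  assumes "\<Omega> \<in> sets borel" "f \<in> borel_measurable borel" "\<And>x. x \<notin> \<Omega> \<Longrightarrow> f x = 0"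
  shows "integral\<^sup>L (lebesgue_on \<Omega>) f = integral\<^sup>L lborel f"
proof -
  have "integral\<^sup>L (lebesgue_on \<Omega>) f = integral\<^sup>L lebesgue (\<lambda>x. indicator \<Omega> x *\<^sub>R f x)"
    using assms(1) by (intro integral_restrict_space) auto
  also have "(\<lambda>x. indicator \<Omega> x *\<^sub>R f x) = f"
    using assms(3) by (intro ext) (auto simp: indicator_def)
  also have "integral\<^sup>L lebesgue f = integral\<^sup>L lborel f"
    using assms(2) by (intro integral_completion) simp
  finally show ?thesis .
qed

lemma integral_lborel_translate:
  fixes f :: "'a::euclidean_space \<Rightarrow> real"
  assumes [measurable]: "f \<in> borel_measurable borel"
  shows "integral\<^sup>L lborel (\<lambda>x. f (a + x)) = integral\<^sup>L lborel f"
proof -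
  have "integral\<^sup>L lborel f = integral\<^sup>L (distr lborel borel ((+) a)) f"
    by (simp add: lborel_distr_plus)
  also have "\<dots> = integral\<^sup>L lborel (\<lambda>x. f (a + x))"
    by (rule integral_distr) auto
  finally show ?thesis by simp
qed

lemma integrable_lborel_bounded_support:
  fixes f :: "'a::euclidean_space \<Rightarrow> real"
  assumes "f \<in> borel_measurable borel" "\<And>x. \<bar>f x\<bar> \<le> C" "\<And>x. x \<notin> cball 0 R \<Longrightarrow> f x = 0"
  shows "integrable lborel f"
proof (rule Bochner_Integration.integrable_bound)
  show "integrable lborel (\<lambda>x. C * indicator (cball 0 R) x :: real)"
    by (intro integrable_mult_right integrable_real_indicator)
      (use emeasure_lborel_cball_finite in \<open>auto simp: less_top[symmetric]\<close>)
  show "AE x in lborel. norm (f x) \<le> norm (C * indicator (cball 0 R) x :: real)"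
    using assms(2,3) by (intro AE_I2) (auto simp: indicator_def intro: order_trans[OF _ abs_ge_self])
qed (use assms(1) in simp)

lemma integrable_continuous_mult_compact:
  fixes g \<eta> :: "'a::euclidean_space \<Rightarrow> real"
  assumes g: "continuous_on UNIV g"
    and \<eta>: "\<eta> \<in> borel_measurable borel" "\<And>x. x \<notin> cball 0 R \<Longrightarrow> \<eta> x = 0" "\<And>x. \<bar>\<eta> x\<bar> \<le> C"
  shows "integrable lborel (\<lambda>x. g x * \<eta> x)"
proof -
  have "compact (g ` cball 0 R)"
    using g by (intro compact_continuous_image) (auto intro: continuous_on_subset)
  then obtain B where "0 < B" and B: "\<And>x. x \<in> cball 0 R \<Longrightarrow> \<bar>g x\<bar> \<le> B"
    by (metis bounded_pos compact_imp_bounded imageI real_norm_def)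
  have gm: "g \<in> borel_measurable borel"
    using g by (rule borel_measurable_continuous_onI)
  have C0: "0 \<le> C" using \<eta>(3)[of 0] by linarith
  show ?thesis
  proof (rule integrable_lborel_bounded_support)
    show "\<bar>g x * \<eta> x\<bar> \<le> B * C" for x
    proof (cases "x \<in> cball 0 R")
      case True
      with B \<eta>(3) C0 \<open>0 < B\<close> show ?thesis
        unfolding abs_mult by (intro mult_mono) auto
    next
      case False
      then show ?thesis using \<eta>(2) C0 \<open>0 < B\<close> by simp
    qed
    show "g x * \<eta> x = 0" if "x \<notin> cball 0 R" for x
      using \<eta>(2) that by simp
  qed (use gm \<eta>(1) in measurable)
qed

text \<open>
  The second factor \<open>\<eta>\<close> is only Lipschitz and almost everywhere differentiable in direction \<open>b\<close>;
  moving the difference quotients from one factor to the other avoids any mollification.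
\<close>

lemma integral_by_parts_direction:
  fixes V \<eta> E :: "'a::euclidean_space \<Rightarrow> real"
  assumes b: "norm b = 1"
    and V: "\<And>x. V differentiable (at x)" "continuous_on UNIV (partial b V)"
    and \<eta>: "\<eta> \<in> borel_measurable borel" "\<And>x. x \<notin> cball 0 R \<Longrightarrow> \<eta> x = 0" "\<And>x. \<bar>\<eta> x\<bar> \<le> C"
    and lip: "\<And>x t. \<bar>\<eta> (x + t *\<^sub>R b) - \<eta> x\<bar> \<le> L * \<bar>t\<bar>"
    and E: "E \<in> borel_measurable borel"
    and h: "\<And>n. 0 < h n" "\<And>n. h n \<le> 1" "h \<longlonglongrightarrow> 0"
    and lim: "AE x in lborel. (\<lambda>n. (\<eta> (x - h n *\<^sub>R b) - \<eta> x) / h n) \<longlonglongrightarrow> - E x"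
  shows "integral\<^sup>L lborel (\<lambda>x. partial b V x * \<eta> x) = - integral\<^sup>L lborel (\<lambda>x. V x * E x)"
proof -
  have Vc: "continuous_on UNIV V"
    using V(1) by (intro differentiable_imp_continuous_on) (simp add: differentiable_on_def)
  have bdd: "\<exists>B\<ge>0. \<forall>x\<in>cball 0 (R + 1). \<bar>f x\<bar> \<le> B" if "continuous_on UNIV f" for f :: "'a \<Rightarrow> real"
  proof -
    have "compact (f ` cball 0 (R + 1))"
      using that by (intro compact_continuous_image) (auto intro: continuous_on_subset)
    then show ?thesis
      by (metis bounded_pos compact_imp_bounded imageI less_imp_le real_norm_def)
  qed
  obtain BV where BV: "0 \<le> BV" "\<And>x. x \<in> cball 0 (R + 1) \<Longrightarrow> \<bar>V x\<bar> \<le> BV"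
    using bdd[OF Vc] by blast
  obtain BP where BP: "0 \<le> BP" "\<And>x. x \<in> cball 0 (R + 1) \<Longrightarrow> \<bar>partial b V x\<bar> \<le> BP"
    using bdd[OF V(2)] by blast
  have [measurable]: "V \<in> borel_measurable borel" "partial b V \<in> borel_measurable borel"
    using Vc V(2) by (auto intro: borel_measurable_continuous_onI)
  note [measurable] = \<eta>(1) E
  have C0: "0 \<le> C" using \<eta>(3)[of 0] by linarith
  have L0: "0 \<le> L" using lip[of 0 1] by auto
  \<comment> \<open>Steps of length at most 1 stay in the ball of radius R + 1, on which
    \<open>V\<close> and its derivative are bounded; hence the assumption that \<open>h n\<close> is
    at most 1.\<close>
  have shift: "x + t *\<^sub>R b \<in> cball 0 (R + 1)" if "x \<in> cball 0 R" "\<bar>t\<bar> \<le> 1" for x t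
    using that b norm_triangle_ineq[of x "t *\<^sub>R b"] by simp
  have \<eta>0: "\<eta> (x - h n *\<^sub>R b) = 0" if "x \<notin> cball 0 (R + 1)" for x n
    using shift[of "x - h n *\<^sub>R b" "h n"] h(1,2)[of n] that by (intro \<eta>(2)) auto
  have hlim: "filterlim h (at 0) sequentially"
    using h(1,3) by (auto simp: filterlim_at intro!: always_eventually less_imp_neq[symmetric])
  \<comment> \<open>A translation turns forward quotients of \<open>V\<close> into backward
    quotients of \<eta>, whence the shape of the hypothesis \<open>lim\<close>.\<close>
  define P Q where "P n x = (V (x + h n *\<^sub>R b) - V x) / h n * \<eta> x"
    and "Q n x = V x * ((\<eta> (x - h n *\<^sub>R b) - \<eta> x) / h n)" for n x
  have PQ: "integral\<^sup>L lborel (P n) = integral\<^sup>L lborel (Q n)" for n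
  proof -
    have i1: "integrable lborel (\<lambda>x. V (x + h n *\<^sub>R b) * \<eta> x)"
      by (rule integrable_continuous_mult_compact[OF _ \<eta>])
        (intro continuous_on_compose2[OF Vc] continuous_intros subset_UNIV)
    have i2: "integrable lborel (\<lambda>x. V x * \<eta> x)"
      by (rule integrable_continuous_mult_compact[OF Vc \<eta>])
    have i3: "integrable lborel (\<lambda>x. V x * \<eta> (x - h n *\<^sub>R b))"
      using \<eta>0 \<eta>(3) by (intro integrable_continuous_mult_compact[OF Vc, where R = "R + 1" and C = C]) auto
    have "integral\<^sup>L lborel (\<lambda>x. V (x + h n *\<^sub>R b) * \<eta> x) = integral\<^sup>L lborel (\<lambda>x. V x * \<eta> (x - h n *\<^sub>R b))"
      using integral_lborel_translate[of "\<lambda>x. V x * \<eta> (x - h n *\<^sub>R b)" "h n *\<^sub>R b"] by (simp add: add.commute)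
    moreover have "integral\<^sup>L lborel (P n) =
        (integral\<^sup>L lborel (\<lambda>x. V (x + h n *\<^sub>R b) * \<eta> x) - integral\<^sup>L lborel (\<lambda>x. V x * \<eta> x)) / h n"
    proof -
      have "P n = (\<lambda>x. (V (x + h n *\<^sub>R b) * \<eta> x - V x * \<eta> x) / h n)"
        by (auto simp: P_def algebra_simps diff_divide_distrib)
      then show ?thesis using i1 i2 by simp
    qed
    moreover have "integral\<^sup>L lborel (Q n) =
        (integral\<^sup>L lborel (\<lambda>x. V x * \<eta> (x - h n *\<^sub>R b)) - integral\<^sup>L lborel (\<lambda>x. V x * \<eta> x)) / h n"
    proof -
      have "Q n = (\<lambda>x. (V x * \<eta> (x - h n *\<^sub>R b) - V x * \<eta> x) / h n)"
        by (auto simp: Q_def algebra_simps diff_divide_distrib)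
      then show ?thesis using i2 i3 by simp
    qed
    ultimately show ?thesis by simp
  qed
  have ind: "integrable lborel (\<lambda>x. c * indicator (cball 0 (R + 1)) x :: real)" for c
    by (intro integrable_mult_right integrable_real_indicator)
      (use emeasure_lborel_cball_finite in \<open>auto simp: less_top[symmetric]\<close>)
  have "(\<lambda>n. integral\<^sup>L lborel (P n)) \<longlonglongrightarrow> integral\<^sup>L lborel (\<lambda>x. partial b V x * \<eta> x)"
  proof (rule integral_dominated_convergence[OF _ _ ind[of "BP * C"]])
    show "AE x in lborel. (\<lambda>n. P n x) \<longlonglongrightarrow> partial b V x * \<eta> x"
      unfolding P_def using V(1)
      by (intro AE_I2 tendsto_mult tendsto_const difference_quotient_tendsto hlim)
    show "AE x in lborel. norm (P n x) \<le> BP * C * indicator (cball 0 (R + 1)) x" for n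
    proof (rule AE_I2)
      fix x :: 'a
      show "norm (P n x) \<le> BP * C * indicator (cball 0 (R + 1)) x"
      proof (cases "x \<in> cball 0 R")
        case True
        have "norm (V (x + h n *\<^sub>R b) - V (x + 0 *\<^sub>R b)) \<le> BP * norm (h n - 0)"
        proof (rule field_differentiable_bound[where S = "{0..h n}" and f = "\<lambda>t. V (x + t *\<^sub>R b)"])
          fix t assume t: "t \<in> {0..h n}"
          show "((\<lambda>t. V (x + t *\<^sub>R b)) has_field_derivative partial b V (x + t *\<^sub>R b)) (at t within {0..h n})"
            by (rule has_field_derivative_at_within[OF has_real_derivative_along[OF V(1)]])
          have "\<bar>t\<bar> \<le> 1" using t h(2)[of n] by auto
          with shift[OF True] show "norm (partial b V (x + t *\<^sub>R b)) \<le> BP"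
            using BP(2) by simp
        qed (use h(1)[of n] in auto)
        then have "\<bar>(V (x + h n *\<^sub>R b) - V x) / h n\<bar> \<le> BP"
          using h(1)[of n] by (simp add: field_simps)
        then have "norm (P n x) \<le> BP * C"
          unfolding P_def real_norm_def abs_mult using \<eta>(3) C0 BP(1) by (intro mult_mono) auto
        then show ?thesis using True by simp
      next
        case False
        then show ?thesis
          using \<eta>(2) BP(1) C0 by (simp add: P_def)
      qed
    qed
  qed (unfold P_def, measurable)
  moreover have "(\<lambda>n. integral\<^sup>L lborel (Q n)) \<longlonglongrightarrow> integral\<^sup>L lborel (\<lambda>x. V x * - E x)"
  proof (rule integral_dominated_convergence[OF _ _ ind[of "BV * L"]])
    show "AE x in lborel. (\<lambda>n. Q n x) \<longlonglongrightarrow> V x * - E x"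
      using lim unfolding Q_def by eventually_elim (intro tendsto_mult tendsto_const)
    show "AE x in lborel. norm (Q n x) \<le> BV * L * indicator (cball 0 (R + 1)) x" for n
    proof (rule AE_I2)
      fix x :: 'a
      show "norm (Q n x) \<le> BV * L * indicator (cball 0 (R + 1)) x"
      proof (cases "x \<in> cball 0 (R + 1)")
        case True
        have "\<bar>(\<eta> (x - h n *\<^sub>R b) - \<eta> x) / h n\<bar> \<le> L"
          using lip[of x "- h n"] h(1)[of n] by (simp add: field_simps)
        then have "norm (Q n x) \<le> BV * L"
          unfolding Q_def real_norm_def abs_mult using BV True by (intro mult_mono) auto
        then show ?thesis using True by simp
      next
        case False
        then have "\<eta> x = 0"
          by (intro \<eta>(2)) auto
        with False show ?thesis
          using \<eta>0 by (simp add: Q_def)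
      qed
    qed
  qed (unfold Q_def, measurable)
  ultimately have "integral\<^sup>L lborel (\<lambda>x. partial b V x * \<eta> x) = integral\<^sup>L lborel (\<lambda>x. V x * - E x)"
    unfolding PQ by (rule LIMSEQ_unique)
  then show ?thesis by simp
qed

lemma smooth_integral_by_parts:
  fixes \<phi> \<psi> :: "'a::euclidean_space \<Rightarrow> real"
  assumes \<phi>: "\<And>x. \<phi> differentiable (at x)" "continuous_on UNIV (partial b \<phi>)"
    and \<psi>: "\<psi> \<in> Cc_infinity UNIV" and b: "b \<in> Basis"
  shows "integral\<^sup>L lborel (\<lambda>x. partial b \<phi> x * \<psi> x) = - integral\<^sup>L lborel (\<lambda>x. \<phi> x * partial b \<psi> x)"
proof -
  obtain K where K: "compact K" "\<And>x. x \<notin> K \<Longrightarrow> \<psi> x = 0"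
    using Cc_infinity_support[OF \<psi>] by blast
  obtain R where R: "K \<subseteq> cball 0 R"
    using compact_imp_bounded[OF K(1)] unfolding bounded_iff by (auto simp: subset_iff)
  obtain C where C: "\<And>x. \<bar>\<psi> x\<bar> \<le> C"
    using Cc_infinity_bounded[OF \<psi>] by blast
  obtain L where L: "\<And>x. \<bar>partial b \<psi> x\<bar> \<le> L"
    using Cc_infinity_bounded[OF Cc_infinity_partial[OF \<psi> b]] by blast
  have sm: "smooth \<psi>" "smooth (partial b \<psi>)"
    using \<psi> b by (auto intro: Cc_infinity_smooth smooth_partial)
  define h where "h n = 1 / real (Suc n)" for n
  have h: "h \<longlonglongrightarrow> 0"
    unfolding h_def using LIMSEQ_inverse_real_of_nat by (simp add: inverse_eq_divide)
  have hneg: "filterlim (\<lambda>n. - h n) (at 0) sequentially"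
    using tendsto_minus[OF h] by (auto simp: filterlim_at h_def)
  show ?thesis
  proof (rule integral_by_parts_direction[where h = h and R = R and C = C and L = L])
    show "\<And>x t. \<bar>\<psi> (x + t *\<^sub>R b) - \<psi> x\<bar> \<le> L * \<bar>t\<bar>"
      by (rule lipschitz_along[OF smooth_differentiable[OF sm(1)] L])
    have "(\<lambda>n. (\<psi> (x - h n *\<^sub>R b) - \<psi> x) / h n) \<longlonglongrightarrow> - partial b \<psi> x" for x
      using tendsto_minus[OF difference_quotient_tendsto[OF smooth_differentiable[OF sm(1)] hneg, of x b]] by simp
    then show "AE x in lborel. (\<lambda>n. (\<psi> (x - h n *\<^sub>R b) - \<psi> x) / h n) \<longlonglongrightarrow> - partial b \<psi> x"
      by simp
    show "\<And>x. x \<notin> cball 0 R \<Longrightarrow> \<psi> x = 0"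
      using K(2) R by blast
  qed (use C b \<phi> h sm in \<open>auto simp: h_def intro: smooth_measurable\<close>)
qed

section \<open>Weak derivatives\<close>

context
  fixes \<Omega> :: "'a::euclidean_space set"
  assumes \<Omega>: "bounded \<Omega>" "open \<Omega>"
begin

lemma Cc_infinity_subset: "\<phi> \<in> Cc_infinity \<Omega> \<Longrightarrow> \<phi> \<in> Cc_infinity UNIV"
  by (simp add: Cc_infinity_def)

lemma smooth_L2: "smooth f \<Longrightarrow> f \<in> L2 \<Omega>"
  by (rule continuous_imp_L2[OF \<Omega> smooth_continuous])

lemma smooth_weak_deriv:
  assumes f: "smooth f" and b: "b \<in> Basis"
  shows "is_weak_deriv \<Omega> b f (partial b f)"
  unfolding is_weak_deriv_def
proof
  fix \<phi> :: "'a \<Rightarrow> real" assume \<phi>: "\<phi> \<in> Cc_infinity \<Omega>"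
  obtain K where K: "K \<subseteq> \<Omega>" "\<And>x. x \<notin> K \<Longrightarrow> \<phi> x = 0"
    using Cc_infinity_support[OF \<phi>] by blast
  obtain K' where K': "K' \<subseteq> \<Omega>" "\<And>x. x \<notin> K' \<Longrightarrow> partial b \<phi> x = 0"
    using Cc_infinity_support[OF Cc_infinity_partial[OF \<phi> b]] by blast
  note [measurable] = smooth_measurable[OF f] smooth_measurable[OF smooth_partial[OF f b]]
    smooth_measurable[OF Cc_infinity_smooth[OF \<phi>]]
    smooth_measurable[OF Cc_infinity_smooth[OF Cc_infinity_partial[OF \<phi> b]]]
  have "integral\<^sup>L (lebesgue_on \<Omega>) (\<lambda>x. f x * partial b \<phi> x) = integral\<^sup>L lborel (\<lambda>x. f x * partial b \<phi> x)"
    using K' \<Omega>(2) by (intro integral_lebesgue_on_eq_lborel) auto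
  also have "\<dots> = - integral\<^sup>L lborel (\<lambda>x. partial b f x * \<phi> x)"
    using smooth_integral_by_parts[OF smooth_differentiable[OF f] smooth_continuous[OF smooth_partial[OF f b]]
        Cc_infinity_subset[OF \<phi>] b] by simp
  also have "integral\<^sup>L lborel (\<lambda>x. partial b f x * \<phi> x) = integral\<^sup>L (lebesgue_on \<Omega>) (\<lambda>x. partial b f x * \<phi> x)"
    using K \<Omega>(2) by (intro integral_lebesgue_on_eq_lborel[symmetric]) auto
  finally show "integral\<^sup>L (lebesgue_on \<Omega>) (\<lambda>x. f x * partial b \<phi> x) =
      - integral\<^sup>L (lebesgue_on \<Omega>) (\<lambda>x. partial b f x * \<phi> x)" .
qed

lemma weak_deriv_unique:
  assumes "g \<in> L2 \<Omega>" "g' \<in> L2 \<Omega>" "is_weak_deriv \<Omega> b u g" "is_weak_deriv \<Omega> b u g'"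
  shows "AE x in lebesgue_on \<Omega>. g x = g' x"
proof -
  have "AE x in lebesgue_on \<Omega>. g x - g' x = 0"
  proof (rule L2_orthogonal_to_test_functions[OF \<Omega> L2_diff[OF assms(1,2)]])
    fix \<phi> :: "'a \<Rightarrow> real" assume \<phi>: "\<phi> \<in> Cc_infinity \<Omega>"
    then have L: "\<phi> \<in> L2 \<Omega>" by (rule Cc_infinity_L2[OF \<Omega>])
    have "integral\<^sup>L (lebesgue_on \<Omega>) (\<lambda>x. g x * \<phi> x) = integral\<^sup>L (lebesgue_on \<Omega>) (\<lambda>x. g' x * \<phi> x)"
      using assms(3,4) \<phi> unfolding is_weak_deriv_def by (metis neg_equal_iff_equal)
    then show "integral\<^sup>L (lebesgue_on \<Omega>) (\<lambda>x. (g x - g' x) * \<phi> x) = 0"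
      using L2_mult_integrable[OF assms(1) L] L2_mult_integrable[OF assms(2) L]
      by (simp add: left_diff_distrib)
  qed
  then show ?thesis by eventually_elim simp
qed

lemma weak_deriv_AE_cong:
  assumes "u \<in> L2 \<Omega>" "v \<in> L2 \<Omega>" "AE x in lebesgue_on \<Omega>. u x = v x" "b \<in> Basis" "is_weak_deriv \<Omega> b u g"
  shows "is_weak_deriv \<Omega> b v g"
  unfolding is_weak_deriv_def
proof
  fix \<phi> :: "'a \<Rightarrow> real" assume \<phi>: "\<phi> \<in> Cc_infinity \<Omega>"
  have "partial b \<phi> \<in> L2 \<Omega>"
    using Cc_infinity_partial[OF \<phi> assms(4)] by (rule Cc_infinity_L2[OF \<Omega>])
  then have "integral\<^sup>L (lebesgue_on \<Omega>) (\<lambda>x. v x * partial b \<phi> x) = integral\<^sup>L (lebesgue_on \<Omega>) (\<lambda>x. u x * partial b \<phi> x)"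
    using assms(1-3) by (intro integral_cong_AE) (auto intro!: borel_measurable_times L2_measurable)
  then show "integral\<^sup>L (lebesgue_on \<Omega>) (\<lambda>x. v x * partial b \<phi> x) = - integral\<^sup>L (lebesgue_on \<Omega>) (\<lambda>x. g x * \<phi> x)"
    using assms(5) \<phi> by (simp add: is_weak_deriv_def)
qed

lemma weak_deriv_lincomb:
  assumes L: "u \<in> L2 \<Omega>" "v \<in> L2 \<Omega>" "g \<in> L2 \<Omega>" "g' \<in> L2 \<Omega>"
    and b: "b \<in> Basis" and d: "is_weak_deriv \<Omega> b u g" "is_weak_deriv \<Omega> b v g'"
  shows "is_weak_deriv \<Omega> b (\<lambda>x. \<alpha> * u x + \<beta> * v x) (\<lambda>x. \<alpha> * g x + \<beta> * g' x)"
  unfolding is_weak_deriv_def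
proof
  fix \<phi> :: "'a \<Rightarrow> real" assume \<phi>: "\<phi> \<in> Cc_infinity \<Omega>"
  have L\<phi>: "\<phi> \<in> L2 \<Omega>" "partial b \<phi> \<in> L2 \<Omega>"
    using \<phi> Cc_infinity_partial[OF \<phi> b] by (auto intro: Cc_infinity_L2[OF \<Omega>])
  have *: "integral\<^sup>L (lebesgue_on \<Omega>) (\<lambda>x. (\<alpha> * p x + \<beta> * q x) * r x) =
      \<alpha> * integral\<^sup>L (lebesgue_on \<Omega>) (\<lambda>x. p x * r x) + \<beta> * integral\<^sup>L (lebesgue_on \<Omega>) (\<lambda>x. q x * r x)"
    if "p \<in> L2 \<Omega>" "q \<in> L2 \<Omega>" "r \<in> L2 \<Omega>" for p q r
    using L2_mult_integrable[OF that(1,3)] L2_mult_integrable[OF that(2,3)]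
    by (simp add: distrib_right mult.assoc)
  show "integral\<^sup>L (lebesgue_on \<Omega>) (\<lambda>x. (\<alpha> * u x + \<beta> * v x) * partial b \<phi> x) =
      - integral\<^sup>L (lebesgue_on \<Omega>) (\<lambda>x. (\<alpha> * g x + \<beta> * g' x) * \<phi> x)"
    using d \<phi> by (simp add: * L L\<phi> is_weak_deriv_def)
qed

lemma wderiv_L2: "u \<in> H1 \<Omega> \<Longrightarrow> b \<in> Basis \<Longrightarrow> wderiv \<Omega> b u \<in> L2 \<Omega>"
  and wderiv_weak: "u \<in> H1 \<Omega> \<Longrightarrow> b \<in> Basis \<Longrightarrow> is_weak_deriv \<Omega> b u (wderiv \<Omega> b u)"
proof -
  have "wderiv \<Omega> b u \<in> L2 \<Omega> \<and> is_weak_deriv \<Omega> b u (wderiv \<Omega> b u)" if "u \<in> H1 \<Omega>" "b \<in> Basis"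
  proof -
    have "\<exists>g. g \<in> L2 \<Omega> \<and> is_weak_deriv \<Omega> b u g"
      using that by (auto simp: H1_def)
    then show ?thesis
      unfolding wderiv_def by (rule someI_ex)
  qed
  then show "u \<in> H1 \<Omega> \<Longrightarrow> b \<in> Basis \<Longrightarrow> wderiv \<Omega> b u \<in> L2 \<Omega>"
    "u \<in> H1 \<Omega> \<Longrightarrow> b \<in> Basis \<Longrightarrow> is_weak_deriv \<Omega> b u (wderiv \<Omega> b u)" by auto
qed

lemma H1_imp_L2: "u \<in> H1 \<Omega> \<Longrightarrow> u \<in> L2 \<Omega>"
  by (simp add: H1_def)

text \<open>\<open>wderiv\<close> is an arbitrary choice and cannot be computed directly; this is
  the passage from an explicitly known weak derivative to the chosen one.\<close>

lemma wderiv_AE_eq: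
  assumes "u \<in> L2 \<Omega>" "g \<in> L2 \<Omega>" "is_weak_deriv \<Omega> b u g"
  shows "AE x in lebesgue_on \<Omega>. wderiv \<Omega> b u x = g x"
proof -
  have "wderiv \<Omega> b u \<in> L2 \<Omega> \<and> is_weak_deriv \<Omega> b u (wderiv \<Omega> b u)"
    unfolding wderiv_def by (rule someI[of _ g]) (use assms in auto)
  then show ?thesis
    using assms weak_deriv_unique by blast
qed

lemma H1_lincomb:
  assumes "u \<in> H1 \<Omega>" "v \<in> H1 \<Omega>"
  shows "(\<lambda>x. \<alpha> * u x + \<beta> * v x) \<in> H1 \<Omega>"
proof -
  note L = assms[THEN H1_imp_L2]
  have "is_weak_deriv \<Omega> b (\<lambda>x. \<alpha> * u x + \<beta> * v x) (\<lambda>x. \<alpha> * wderiv \<Omega> b u x + \<beta> * wderiv \<Omega> b v x)"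
    if b: "b \<in> Basis" for b
    using b by (intro weak_deriv_lincomb L assms[THEN wderiv_L2] assms[THEN wderiv_weak])
  then show ?thesis
    using L2_lincomb[OF L] L2_lincomb[OF assms[THEN wderiv_L2]] unfolding H1_def by blast
qed

lemma wderiv_lincomb:
  assumes "u \<in> H1 \<Omega>" "v \<in> H1 \<Omega>" "b \<in> Basis"
  shows "AE x in lebesgue_on \<Omega>. wderiv \<Omega> b (\<lambda>x. \<alpha> * u x + \<beta> * v x) x = \<alpha> * wderiv \<Omega> b u x + \<beta> * wderiv \<Omega> b v x"
  by (rule wderiv_AE_eq[OF L2_lincomb[OF assms(1,2)[THEN H1_imp_L2]] L2_lincomb[OF assms(1,2)[THEN wderiv_L2, OF assms(3)]]
        weak_deriv_lincomb[OF assms(1,2)[THEN H1_imp_L2] assms(1,2)[THEN wderiv_L2, OF assms(3)] assms(3)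
          assms(1,2)[THEN wderiv_weak, OF assms(3)]]])

text \<open>Second derivatives are derivatives of the chosen \<open>wderiv\<close>, which is known
  only up to null sets. This and \<open>wderiv_AE_cong\<close> allow it to be exchanged for a
  concrete representative before differentiating again.\<close>

lemma H1_AE_cong:
  assumes "u \<in> H1 \<Omega>" "v \<in> L2 \<Omega>" "AE x in lebesgue_on \<Omega>. u x = v x"
  shows "v \<in> H1 \<Omega>"
  using assms(2) weak_deriv_AE_cong[OF H1_imp_L2[OF assms(1)] assms(2,3)] wderiv_L2[OF assms(1)] wderiv_weak[OF assms(1)]
  unfolding H1_def by blast

lemma wderiv_AE_cong:
  assumes "u \<in> H1 \<Omega>" "v \<in> L2 \<Omega>" "AE x in lebesgue_on \<Omega>. u x = v x" "b \<in> Basis"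
  shows "AE x in lebesgue_on \<Omega>. wderiv \<Omega> b v x = wderiv \<Omega> b u x"
  by (rule wderiv_AE_eq[OF assms(2) wderiv_L2[OF assms(1,4)]
        weak_deriv_AE_cong[OF H1_imp_L2[OF assms(1)] assms(2,3,4) wderiv_weak[OF assms(1,4)]]])

lemma smooth_H1: "smooth f \<Longrightarrow> f \<in> H1 \<Omega>"
  unfolding H1_def using smooth_L2 smooth_weak_deriv smooth_partial by blast

lemma smooth_wderiv: "smooth f \<Longrightarrow> b \<in> Basis \<Longrightarrow> AE x in lebesgue_on \<Omega>. wderiv \<Omega> b f x = partial b f x"
  by (intro wderiv_AE_eq smooth_L2 smooth_weak_deriv smooth_partial)

lemma smooth_wderiv_H1: "smooth f \<Longrightarrow> b \<in> Basis \<Longrightarrow> wderiv \<Omega> b f \<in> H1 \<Omega>"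
proof -
  assume f: "smooth f" and b: "b \<in> Basis"
  have "AE x in lebesgue_on \<Omega>. partial b f x = wderiv \<Omega> b f x"
    using smooth_wderiv[OF f b] by eventually_elim simp
  then show ?thesis
    by (rule H1_AE_cong[OF smooth_H1[OF smooth_partial[OF f b]] wderiv_L2[OF smooth_H1[OF f] b]])
qed

lemma smooth_wderiv_wderiv:
  assumes f: "smooth f" and b: "b \<in> Basis" and c: "c \<in> Basis"
  shows "AE x in lebesgue_on \<Omega>. wderiv \<Omega> c (wderiv \<Omega> b f) x = partial c (partial b f) x"
proof -
  have "AE x in lebesgue_on \<Omega>. partial b f x = wderiv \<Omega> b f x"
    using smooth_wderiv[OF f b] by eventually_elim simp
  from wderiv_AE_cong[OF smooth_H1[OF smooth_partial[OF f b]] wderiv_L2[OF smooth_H1[OF f] b] this c]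
    smooth_wderiv[OF smooth_partial[OF f b] c]
  show ?thesis by eventually_elim simp
qed

lemma smooth_H2: "smooth f \<Longrightarrow> f \<in> H2 \<Omega>"
  by (simp add: H2_def smooth_H1 smooth_wderiv_H1)

lemma H2_wderiv_H1: "u \<in> H2 \<Omega> \<Longrightarrow> b \<in> Basis \<Longrightarrow> wderiv \<Omega> b u \<in> H1 \<Omega>"
  and H2_imp_H1: "u \<in> H2 \<Omega> \<Longrightarrow> u \<in> H1 \<Omega>"
  by (auto simp: H2_def)

lemma H2_lincomb:
  assumes "u \<in> H2 \<Omega>" "v \<in> H2 \<Omega>"
  shows "(\<lambda>x. \<alpha> * u x + \<beta> * v x) \<in> H2 \<Omega>"
proof -
  have "wderiv \<Omega> b (\<lambda>x. \<alpha> * u x + \<beta> * v x) \<in> H1 \<Omega>" if b: "b \<in> Basis" for b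
  proof (rule H1_AE_cong)
    show "(\<lambda>x. \<alpha> * wderiv \<Omega> b u x + \<beta> * wderiv \<Omega> b v x) \<in> H1 \<Omega>"
      using assms b by (intro H1_lincomb H2_wderiv_H1)
    show "wderiv \<Omega> b (\<lambda>x. \<alpha> * u x + \<beta> * v x) \<in> L2 \<Omega>"
      using assms b by (intro wderiv_L2 H1_lincomb H2_imp_H1)
    show "AE x in lebesgue_on \<Omega>. \<alpha> * wderiv \<Omega> b u x + \<beta> * wderiv \<Omega> b v x = wderiv \<Omega> b (\<lambda>x. \<alpha> * u x + \<beta> * v x) x"
      using wderiv_lincomb[OF assms[THEN H2_imp_H1] b, of \<alpha> \<beta>] by eventually_elim simp
  qed
  then show ?thesis
    using assms by (auto simp: H2_def intro: H1_lincomb)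
qed

lemma wderiv_wderiv_L2: "u \<in> H2 \<Omega> \<Longrightarrow> b \<in> Basis \<Longrightarrow> c \<in> Basis \<Longrightarrow> wderiv \<Omega> c (wderiv \<Omega> b u) \<in> L2 \<Omega>"
  by (intro wderiv_L2 H2_wderiv_H1)

lemma lap_L2: "u \<in> H2 \<Omega> \<Longrightarrow> lap \<Omega> u \<in> L2 \<Omega>"
  unfolding lap_def by (intro L2_sum wderiv_wderiv_L2)

lemma smooth_lap:
  assumes "smooth f"
  shows "AE x in lebesgue_on \<Omega>. lap \<Omega> f x = (\<Sum>b\<in>Basis. partial b (partial b f) x)"
proof -
  have "AE x in lebesgue_on \<Omega>. \<forall>b\<in>Basis. wderiv \<Omega> b (wderiv \<Omega> b f) x = partial b (partial b f) x"
    using smooth_wderiv_wderiv[OF assms] by (subst AE_finite_all) auto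
  then show ?thesis
    by eventually_elim (simp add: lap_def)
qed

section \<open>The Neumann condition\<close>

lemma space_surface: "space (surface \<Omega>) = frontier \<Omega>"
  and sets_surface: "sets (surface \<Omega>) = sets (restrict_space borel (frontier \<Omega>))"
proof -
  have "sets (hausdorff (DIM('a) - 1) :: 'a measure) = sets borel"
    unfolding hausdorff_def using sets.sigma_sets_eq[of "borel :: 'a measure"] by (subst sets_measure_of) auto
  then show "sets (surface \<Omega>) = sets (restrict_space borel (frontier \<Omega>))"
    unfolding surface_def by (rule sets_restrict_space_cong)
  show "space (surface \<Omega>) = frontier \<Omega>"
    unfolding surface_def hausdorff_def by (simp add: space_restrict_space space_measure_of_conv)
qed

lemma borel_measurable_surface: "f \<in> borel_measurable borel \<Longrightarrow> f \<in> borel_measurable (surface \<Omega>)"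
  unfolding measurable_cong_sets[OF sets_surface refl] by (rule measurable_restrict_space1)

text \<open>The same approximating sequence serves: the norms over \<Omega> ignore null sets, and
  the boundary values stay as they are.\<close>

lemma is_trace_AE_cong:
  assumes w: "w \<in> H1 \<Omega>" "w' \<in> L2 \<Omega>" "AE x in lebesgue_on \<Omega>. w x = w' x" and tr: "is_trace \<Omega> w g"
  shows "is_trace \<Omega> w' g"
proof -
  obtain \<psi> where \<psi>: "\<And>k. smooth (\<psi> k)" "(\<lambda>k. L2norm \<Omega> (\<lambda>x. \<psi> k x - w x)) \<longlonglongrightarrow> 0"
      "\<And>b. b \<in> Basis \<Longrightarrow> (\<lambda>k. L2norm \<Omega> (\<lambda>x. partial b (\<psi> k) x - wderiv \<Omega> b w x)) \<longlonglongrightarrow> 0"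
      "(\<lambda>k. \<integral>\<^sup>+ x. ennreal ((\<psi> k x - g x)\<^sup>2) \<partial>surface \<Omega>) \<longlonglongrightarrow> 0" and g: "g \<in> borel_measurable (surface \<Omega>)"
    using tr unfolding is_trace_def by blast
  have "L2norm \<Omega> (\<lambda>x. \<psi> k x - w x) = L2norm \<Omega> (\<lambda>x. \<psi> k x - w' x)" for k
    using w smooth_L2[OF \<psi>(1)[of k]]
    by (intro L2norm_AE_cong borel_measurable_diff L2_measurable[OF H1_imp_L2] L2_measurable) auto
  moreover have "L2norm \<Omega> (\<lambda>x. partial b (\<psi> k) x - wderiv \<Omega> b w x) = L2norm \<Omega> (\<lambda>x. partial b (\<psi> k) x - wderiv \<Omega> b w' x)"
    if b: "b \<in> Basis" for k b
    using w wderiv_AE_cong[OF w b] smooth_L2[OF smooth_partial[OF \<psi>(1)[of k] b]] wderiv_L2[OF w(1) b]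
      wderiv_L2[OF H1_AE_cong[OF w] b]
    by (intro L2norm_AE_cong borel_measurable_diff L2_measurable) auto
  ultimately show ?thesis
    unfolding is_trace_def using \<psi> g by (intro conjI exI[of _ \<psi>] ballI allI) simp_all
qed

lemma tendsto_L2norm_lincomb:
  assumes "\<And>k. F k \<in> L2 \<Omega>" "\<And>k. G k \<in> L2 \<Omega>" "f \<in> L2 \<Omega>" "g \<in> L2 \<Omega>"
    "(\<lambda>k. L2norm \<Omega> (\<lambda>x. F k x - f x)) \<longlonglongrightarrow> 0" "(\<lambda>k. L2norm \<Omega> (\<lambda>x. G k x - g x)) \<longlonglongrightarrow> 0"
  shows "(\<lambda>k. L2norm \<Omega> (\<lambda>x. (\<alpha> * F k x + \<beta> * G k x) - (\<alpha> * f x + \<beta> * g x))) \<longlonglongrightarrow> 0"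
proof (rule Lim_null_comparison)
  show "(\<lambda>k. \<bar>\<alpha>\<bar> * L2norm \<Omega> (\<lambda>x. F k x - f x) + \<bar>\<beta>\<bar> * L2norm \<Omega> (\<lambda>x. G k x - g x)) \<longlonglongrightarrow> 0"
    using assms(5,6) by (intro tendsto_add_zero tendsto_mult_right_zero)
  show "\<forall>\<^sub>F k in sequentially. norm (L2norm \<Omega> (\<lambda>x. (\<alpha> * F k x + \<beta> * G k x) - (\<alpha> * f x + \<beta> * g x)))
      \<le> \<bar>\<alpha>\<bar> * L2norm \<Omega> (\<lambda>x. F k x - f x) + \<bar>\<beta>\<bar> * L2norm \<Omega> (\<lambda>x. G k x - g x)"
  proof (rule always_eventually, rule allI)
    fix k
    have "(\<lambda>x. (\<alpha> * F k x + \<beta> * G k x) - (\<alpha> * f x + \<beta> * g x)) = (\<lambda>x. \<alpha> * (F k x - f x) + \<beta> * (G k x - g x))"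
      by (auto simp: algebra_simps)
    then show "norm (L2norm \<Omega> (\<lambda>x. (\<alpha> * F k x + \<beta> * G k x) - (\<alpha> * f x + \<beta> * g x)))
      \<le> \<bar>\<alpha>\<bar> * L2norm \<Omega> (\<lambda>x. F k x - f x) + \<bar>\<beta>\<bar> * L2norm \<Omega> (\<lambda>x. G k x - g x)"
      using L2norm_triangle[OF L2_cmult[OF L2_diff[OF assms(1,3)]] L2_cmult[OF L2_diff[OF assms(2,4)]], of \<alpha> k \<beta> k]
      by (simp add: L2norm_cmult L2norm_nonneg)
  qed
qed

lemma is_trace_lincomb:
  assumes w: "w \<in> H1 \<Omega>" "is_trace \<Omega> w g" and w': "w' \<in> H1 \<Omega>" "is_trace \<Omega> w' g'"
  shows "is_trace \<Omega> (\<lambda>x. \<alpha> * w x + \<beta> * w' x) (\<lambda>x. \<alpha> * g x + \<beta> * g' x)"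
proof -
  obtain \<psi> where \<psi>: "\<And>k. smooth (\<psi> k)" "(\<lambda>k. L2norm \<Omega> (\<lambda>x. \<psi> k x - w x)) \<longlonglongrightarrow> 0"
      "\<And>b. b \<in> Basis \<Longrightarrow> (\<lambda>k. L2norm \<Omega> (\<lambda>x. partial b (\<psi> k) x - wderiv \<Omega> b w x)) \<longlonglongrightarrow> 0"
      "(\<lambda>k. \<integral>\<^sup>+ x. ennreal ((\<psi> k x - g x)\<^sup>2) \<partial>surface \<Omega>) \<longlonglongrightarrow> 0" and g: "g \<in> borel_measurable (surface \<Omega>)"
    using w(2) unfolding is_trace_def by blast
  obtain \<psi>' where \<psi>': "\<And>k. smooth (\<psi>' k)" "(\<lambda>k. L2norm \<Omega> (\<lambda>x. \<psi>' k x - w' x)) \<longlonglongrightarrow> 0"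
      "\<And>b. b \<in> Basis \<Longrightarrow> (\<lambda>k. L2norm \<Omega> (\<lambda>x. partial b (\<psi>' k) x - wderiv \<Omega> b w' x)) \<longlonglongrightarrow> 0"
      "(\<lambda>k. \<integral>\<^sup>+ x. ennreal ((\<psi>' k x - g' x)\<^sup>2) \<partial>surface \<Omega>) \<longlonglongrightarrow> 0" and g': "g' \<in> borel_measurable (surface \<Omega>)"
    using w'(2) unfolding is_trace_def by blast
  define \<theta> where "\<theta> k x = \<alpha> * \<psi> k x + \<beta> * \<psi>' k x" for k x
  have sm: "smooth (\<theta> k)" for k
    unfolding \<theta>_def by (intro smooth_add smooth_cmult \<psi> \<psi>')
  have p\<theta>: "partial b (\<theta> k) = (\<lambda>x. \<alpha> * partial b (\<psi> k) x + \<beta> * partial b (\<psi>' k) x)" for b k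
  proof
    fix x
    have "((\<lambda>x. \<alpha> * \<psi> k x + \<beta> * \<psi>' k x) has_derivative
        (\<lambda>h. \<alpha> * frechet_derivative (\<psi> k) (at x) h + \<beta> * frechet_derivative (\<psi>' k) (at x) h)) (at x)"
      using frechet_derivative_works[THEN iffD1, OF smooth_differentiable[OF \<psi>(1)]]
        frechet_derivative_works[THEN iffD1, OF smooth_differentiable[OF \<psi>'(1)]]
      by (intro has_derivative_add has_derivative_mult_right)
    then show "partial b (\<theta> k) x = \<alpha> * partial b (\<psi> k) x + \<beta> * partial b (\<psi>' k) x"
      unfolding \<theta>_def[abs_def] by (subst partial_eqI) (auto simp: partial_def)
  qed
  have "(\<lambda>k. L2norm \<Omega> (\<lambda>x. \<theta> k x - (\<alpha> * w x + \<beta> * w' x))) \<longlonglongrightarrow> 0"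
    unfolding \<theta>_def using w w' \<psi> \<psi>' by (intro tendsto_L2norm_lincomb smooth_L2 H1_imp_L2)
  moreover have "(\<lambda>k. L2norm \<Omega> (\<lambda>x. partial b (\<theta> k) x - wderiv \<Omega> b (\<lambda>x. \<alpha> * w x + \<beta> * w' x) x)) \<longlonglongrightarrow> 0"
    if b: "b \<in> Basis" for b
  proof -
    have "L2norm \<Omega> (\<lambda>x. partial b (\<theta> k) x - wderiv \<Omega> b (\<lambda>x. \<alpha> * w x + \<beta> * w' x) x) =
        L2norm \<Omega> (\<lambda>x. (\<alpha> * partial b (\<psi> k) x + \<beta> * partial b (\<psi>' k) x) - (\<alpha> * wderiv \<Omega> b w x + \<beta> * wderiv \<Omega> b w' x))" for k
    proof (rule L2norm_AE_cong)
      show "AE x in lebesgue_on \<Omega>. partial b (\<theta> k) x - wderiv \<Omega> b (\<lambda>x. \<alpha> * w x + \<beta> * w' x) x =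
          (\<alpha> * partial b (\<psi> k) x + \<beta> * partial b (\<psi>' k) x) - (\<alpha> * wderiv \<Omega> b w x + \<beta> * wderiv \<Omega> b w' x)"
        using wderiv_lincomb[OF w(1) w'(1) b, of \<alpha> \<beta>] by eventually_elim (simp add: p\<theta>)
      show "(\<lambda>x. partial b (\<theta> k) x - wderiv \<Omega> b (\<lambda>x. \<alpha> * w x + \<beta> * w' x) x) \<in> borel_measurable (lebesgue_on \<Omega>)"
        using w w' b by (intro L2_measurable[OF L2_diff] smooth_L2 smooth_partial sm wderiv_L2 H1_lincomb)
      show "(\<lambda>x. (\<alpha> * partial b (\<psi> k) x + \<beta> * partial b (\<psi>' k) x) - (\<alpha> * wderiv \<Omega> b w x + \<beta> * wderiv \<Omega> b w' x))
          \<in> borel_measurable (lebesgue_on \<Omega>)"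
        using w w' b \<psi> \<psi>' by (intro L2_measurable[OF L2_diff] L2_lincomb smooth_L2 smooth_partial wderiv_L2)
    qed
    then show ?thesis
      using w w' b \<psi> \<psi>' by (simp only:) (intro tendsto_L2norm_lincomb smooth_L2 smooth_partial wderiv_L2)
  qed
  moreover have "(\<lambda>k. \<integral>\<^sup>+ x. ennreal ((\<theta> k x - (\<alpha> * g x + \<beta> * g' x))\<^sup>2) \<partial>surface \<Omega>) \<longlonglongrightarrow> 0"
  proof (rule tendsto_sandwich[OF _ _ tendsto_const])
    define U where "U k = (\<integral>\<^sup>+ x. ennreal ((\<psi> k x - g x)\<^sup>2) \<partial>surface \<Omega>)" for k
    define U' where "U' k = (\<integral>\<^sup>+ x. ennreal ((\<psi>' k x - g' x)\<^sup>2) \<partial>surface \<Omega>)" for k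
    have "(\<lambda>k. ennreal (2 * \<alpha>\<^sup>2) * U k + ennreal (2 * \<beta>\<^sup>2) * U' k) \<longlonglongrightarrow> ennreal (2 * \<alpha>\<^sup>2) * 0 + ennreal (2 * \<beta>\<^sup>2) * 0"
      using \<psi>(4) \<psi>'(4) unfolding U_def U'_def by (intro tendsto_add ennreal_tendsto_cmult) auto
    then show "(\<lambda>k. ennreal (2 * \<alpha>\<^sup>2) * U k + ennreal (2 * \<beta>\<^sup>2) * U' k) \<longlonglongrightarrow> 0"
      by simp
    have le: "(\<integral>\<^sup>+ x. ennreal ((\<theta> k x - (\<alpha> * g x + \<beta> * g' x))\<^sup>2) \<partial>surface \<Omega>) \<le> ennreal (2 * \<alpha>\<^sup>2) * U k + ennreal (2 * \<beta>\<^sup>2) * U' k" for k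
    proof -
      have [measurable]: "\<psi> k \<in> borel_measurable (surface \<Omega>)" "\<psi>' k \<in> borel_measurable (surface \<Omega>)"
        using \<psi>(1) \<psi>'(1) by (auto intro!: borel_measurable_surface smooth_measurable)
      note [measurable] = g g'
      \<comment> \<open>The boundary terms are extended nonnegative integrals. Their squares are
        combined pointwise, at the price of a factor 2 that is harmless for a limit equal to
        0.\<close>
      have sq: "(p + q)\<^sup>2 \<le> 2 * p\<^sup>2 + 2 * q\<^sup>2" for p q :: real
        using sum_squares_bound[of p q] by (simp add: power2_sum)
      have "(\<integral>\<^sup>+ x. ennreal ((\<theta> k x - (\<alpha> * g x + \<beta> * g' x))\<^sup>2) \<partial>surface \<Omega>) \<le>
        (\<integral>\<^sup>+ x. ennreal (2 * \<alpha>\<^sup>2) * ennreal ((\<psi> k x - g x)\<^sup>2) + ennreal (2 * \<beta>\<^sup>2) * ennreal ((\<psi>' k x - g' x)\<^sup>2) \<partial>surface \<Omega>)"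
      proof (intro nn_integral_mono)
        fix x
        have "(\<theta> k x - (\<alpha> * g x + \<beta> * g' x))\<^sup>2 = (\<alpha> * (\<psi> k x - g x) + \<beta> * (\<psi>' k x - g' x))\<^sup>2"
          by (simp add: \<theta>_def algebra_simps)
        also have "\<dots> \<le> 2 * \<alpha>\<^sup>2 * (\<psi> k x - g x)\<^sup>2 + 2 * \<beta>\<^sup>2 * (\<psi>' k x - g' x)\<^sup>2"
          using sq[of "\<alpha> * (\<psi> k x - g x)" "\<beta> * (\<psi>' k x - g' x)"] by (simp add: power_mult_distrib)
        finally show "ennreal ((\<theta> k x - (\<alpha> * g x + \<beta> * g' x))\<^sup>2) \<le>
            ennreal (2 * \<alpha>\<^sup>2) * ennreal ((\<psi> k x - g x)\<^sup>2) + ennreal (2 * \<beta>\<^sup>2) * ennreal ((\<psi>' k x - g' x)\<^sup>2)"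
          by (simp add: ennreal_mult[symmetric] ennreal_plus[symmetric] del: ennreal_plus)
      qed
      also have "\<dots> = ennreal (2 * \<alpha>\<^sup>2) * U k + ennreal (2 * \<beta>\<^sup>2) * U' k"
        unfolding U_def U'_def by (simp add: nn_integral_add nn_integral_cmult)
      finally show ?thesis .
    qed
    then show "\<forall>\<^sub>F k in sequentially. (\<integral>\<^sup>+ x. ennreal ((\<theta> k x - (\<alpha> * g x + \<beta> * g' x))\<^sup>2) \<partial>surface \<Omega>) \<le>
        ennreal (2 * \<alpha>\<^sup>2) * U k + ennreal (2 * \<beta>\<^sup>2) * U' k"
      by (intro always_eventually allI)
  qed auto
  ultimately show ?thesis
    unfolding is_trace_def using sm g g' by (intro conjI exI[of _ \<theta>] ballI allI) (auto intro: borel_measurable_add borel_measurable_times)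
qed

lemma H2N_lincomb:
  assumes u: "u \<in> H2N \<Omega>" and v: "v \<in> H2N \<Omega>"
  shows "(\<lambda>x. \<alpha> * u x + \<beta> * v x) \<in> H2N \<Omega>"
proof -
  have H: "u \<in> H2 \<Omega>" "v \<in> H2 \<Omega>"
    using u v by (auto simp: H2N_def)
  obtain g where g: "\<And>b. b \<in> Basis \<Longrightarrow> is_trace \<Omega> (wderiv \<Omega> b u) (g b)"
    "AE x in surface \<Omega>. \<forall>n. outer_unit_normal \<Omega> x n \<longrightarrow> (\<Sum>b\<in>Basis. g b x * (n \<bullet> b)) = 0"
    using u unfolding H2N_def normal_deriv_zero_def by blast
  obtain g' where g': "\<And>b. b \<in> Basis \<Longrightarrow> is_trace \<Omega> (wderiv \<Omega> b v) (g' b)"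
    "AE x in surface \<Omega>. \<forall>n. outer_unit_normal \<Omega> x n \<longrightarrow> (\<Sum>b\<in>Basis. g' b x * (n \<bullet> b)) = 0"
    using v unfolding H2N_def normal_deriv_zero_def by blast
  have "is_trace \<Omega> (wderiv \<Omega> b (\<lambda>x. \<alpha> * u x + \<beta> * v x)) (\<lambda>x. \<alpha> * g b x + \<beta> * g' b x)" if b: "b \<in> Basis" for b
  proof (rule is_trace_AE_cong)
    show "is_trace \<Omega> (\<lambda>x. \<alpha> * wderiv \<Omega> b u x + \<beta> * wderiv \<Omega> b v x) (\<lambda>x. \<alpha> * g b x + \<beta> * g' b x)"
      using H g(1) g'(1) b by (intro is_trace_lincomb H2_wderiv_H1)
    show "(\<lambda>x. \<alpha> * wderiv \<Omega> b u x + \<beta> * wderiv \<Omega> b v x) \<in> H1 \<Omega>"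
      using H b by (intro H1_lincomb H2_wderiv_H1)
    show "wderiv \<Omega> b (\<lambda>x. \<alpha> * u x + \<beta> * v x) \<in> L2 \<Omega>"
      using H b by (intro wderiv_L2 H1_lincomb H2_imp_H1)
    show "AE x in lebesgue_on \<Omega>. \<alpha> * wderiv \<Omega> b u x + \<beta> * wderiv \<Omega> b v x = wderiv \<Omega> b (\<lambda>x. \<alpha> * u x + \<beta> * v x) x"
      using wderiv_lincomb[OF H[THEN H2_imp_H1] b, of \<alpha> \<beta>] by eventually_elim simp
  qed
  moreover have "AE x in surface \<Omega>. \<forall>n. outer_unit_normal \<Omega> x n \<longrightarrow>
      (\<Sum>b\<in>Basis. (\<alpha> * g b x + \<beta> * g' b x) * (n \<bullet> b)) = 0"
    using g(2) g'(2)
  proof eventually_elim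
    case (elim x)
    show ?case
    proof (intro allI impI)
      fix n assume n: "outer_unit_normal \<Omega> x n"
      have "(\<Sum>b\<in>Basis. (\<alpha> * g b x + \<beta> * g' b x) * (n \<bullet> b)) =
          \<alpha> * (\<Sum>b\<in>Basis. g b x * (n \<bullet> b)) + \<beta> * (\<Sum>b\<in>Basis. g' b x * (n \<bullet> b))"
        by (simp add: sum_distrib_left sum.distrib[symmetric] algebra_simps)
      with elim n show "(\<Sum>b\<in>Basis. (\<alpha> * g b x + \<beta> * g' b x) * (n \<bullet> b)) = 0"
        by simp
    qed
  qed
  ultimately show ?thesis
    unfolding H2N_def normal_deriv_zero_def using H2_lincomb[OF H]
    by (intro CollectI conjI exI[of _ "\<lambda>b x. \<alpha> * g b x + \<beta> * g' b x"] ballI) simp_all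
qed

text \<open>A constant sequence approximates each partial derivative and has boundary values 0, so
  the traces are 0 and the condition holds for all normals at once. Asking the whole gradient to
  vanish on the boundary suits functions that are constant near it.\<close>

lemma smooth_H2N:
  assumes f: "smooth f" and grad: "\<And>b x. b \<in> Basis \<Longrightarrow> x \<in> frontier \<Omega> \<Longrightarrow> partial b f x = 0"
  shows "f \<in> H2N \<Omega>"
proof -
  have tr: "is_trace \<Omega> (wderiv \<Omega> b f) (\<lambda>x. 0)" if b: "b \<in> Basis" for b
  proof -
    have zero: "L2norm \<Omega> (\<lambda>x. F x - G x) = 0"
      if "F \<in> L2 \<Omega>" "G \<in> L2 \<Omega>" "AE x in lebesgue_on \<Omega>. G x = F x" for F G
    proof -
      have "L2norm \<Omega> (\<lambda>x. F x - G x) = L2norm \<Omega> (\<lambda>x. 0)"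
        using that by (intro L2norm_AE_cong) (auto intro: borel_measurable_diff L2_measurable)
      then show ?thesis by (simp add: L2norm_def)
    qed
    have "L2norm \<Omega> (\<lambda>x. partial b f x - wderiv \<Omega> b f x) = 0"
      using f b by (intro zero smooth_L2 smooth_partial wderiv_L2 smooth_H1 smooth_wderiv)
    moreover have "L2norm \<Omega> (\<lambda>x. partial c (partial b f) x - wderiv \<Omega> c (wderiv \<Omega> b f) x) = 0" if c: "c \<in> Basis" for c
      using f b c by (intro zero smooth_L2 smooth_partial wderiv_L2 smooth_wderiv_H1 smooth_wderiv_wderiv)
    moreover have "(\<integral>\<^sup>+ x. ennreal ((partial b f x - 0)\<^sup>2) \<partial>surface \<Omega>) = (\<integral>\<^sup>+ x. 0 \<partial>surface \<Omega>)"
      using grad[OF b] by (intro nn_integral_cong) (simp add: space_surface)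
    ultimately show ?thesis
      unfolding is_trace_def using smooth_partial[OF f b] by (intro conjI exI[of _ "\<lambda>k. partial b f"]) auto
  qed
  show ?thesis
    unfolding H2N_def normal_deriv_zero_def using smooth_H2[OF f] tr
    by (auto intro!: exI[of _ "\<lambda>b x. 0"])
qed

end

section \<open>Metric outer measures and the Hausdorff measure\<close>

lemma ennreal_suminf_tail_tendsto_0:
  fixes f :: "nat \<Rightarrow> ennreal"
  assumes "(\<Sum>k. f k) < \<infinity>"
  shows "(\<lambda>n. \<Sum>k. f (k + n)) \<longlonglongrightarrow> 0"
proof -
  have fin: "f k \<noteq> \<infinity>" for k
    using assms by (metis ennreal_suminf_lessD infinity_ennreal_def less_irrefl less_top)
  define g where "g k = enn2real (f k)" for k
  have f: "f k = ennreal (g k)" for k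
    using fin[of k] by (simp add: g_def ennreal_enn2real_if)
  have g0: "0 \<le> g k" for k
    by (simp add: g_def)
  have sm: "summable g"
    using assms g0 by (intro summable_suminf_not_top) (auto simp: f)
  have "(\<Sum>k. f (k + n)) = ennreal (\<Sum>k. g (k + n))" for n
    unfolding f using g0 sm by (intro suminf_ennreal2) (auto simp: summable_iff_shift)
  moreover have "(\<lambda>n. ennreal (\<Sum>k. g (k + n))) \<longlonglongrightarrow> ennreal 0"
    using suminf_exist_split2[OF sm] by (intro tendsto_ennrealI)
  ultimately show ?thesis by simp
qed

text \<open>
  Caratheodory's criterion. Every second one of the rings \<open>R n\<close> around \<open>F\<close> is separated from the previous
  ones, so their measures are summable and the sets \<open>D n\<close> exhaust \<open>T - F\<close> in measure.
\<close>

lemma metric_outer_measure_closed: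
  fixes m :: "'a::metric_space set \<Rightarrow> ennreal"
  assumes mono: "\<And>A B. A \<subseteq> B \<Longrightarrow> m A \<le> m B"
    and empty: "m {} = 0"
    and sub: "\<And>A :: nat \<Rightarrow> 'a set. m (\<Union>i. A i) \<le> (\<Sum>i. m (A i))"
    and sep: "\<And>A B r. 0 < r \<Longrightarrow> (\<And>x y. x \<in> A \<Longrightarrow> y \<in> B \<Longrightarrow> r \<le> dist x y) \<Longrightarrow> m A + m B \<le> m (A \<union> B)"
    and F: "closed F"
  shows "m (T \<inter> F) + m (T - F) \<le> m T"
proof (cases "m T = \<infinity>")
  case False
  define D where "D n = {x \<in> T. \<forall>y\<in>F. 1 / real (Suc n) \<le> dist x y}" for n
  define R where "R n = D (Suc n) - D n" for n
  have Dmono: "D i \<subseteq> D j" if "i \<le> j" for i j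
  proof
    fix x assume "x \<in> D i"
    moreover have "1 / real (Suc j) \<le> 1 / real (Suc i)"
      using that by (simp add: frac_le)
    ultimately show "x \<in> D j"
      unfolding D_def by (auto intro: order_trans)
  qed
  have near: "\<exists>y\<in>F. dist z y < 1 / real (Suc n)" if "z \<in> R n" for z n
    using that by (auto simp: R_def D_def not_le)
  \<comment> \<open>A point of \<open>R (Suc p)\<close> is nearer to \<open>F\<close> than 1 / (p +
    2), a point of \<open>D p\<close> is at distance at least 1 / (p + 1) from \<open>F\<close>; the
    difference of the two separates them.\<close>
  have Rsep: "m A + m (R (Suc p)) \<le> m (A \<union> R (Suc p))" if "A \<subseteq> D p" for A p
  proof (rule sep)
    show "0 < 1 / real (Suc p) - 1 / real (Suc (Suc p))"
      by (simp add: frac_less2)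
    fix x z assume x: "x \<in> A" and z: "z \<in> R (Suc p)"
    obtain y where y: "y \<in> F" "dist z y < 1 / real (Suc (Suc p))"
      using near[OF z] by blast
    have "1 / real (Suc p) \<le> dist x y"
      using x that y(1) by (auto simp: D_def)
    also have "\<dots> \<le> dist x z + dist z y"
      by (rule dist_triangle)
    finally show "1 / real (Suc p) - 1 / real (Suc (Suc p)) \<le> dist x z"
      using y(2) by linarith
  qed
  have RT: "R n \<subseteq> T" for n
    by (auto simp: R_def D_def)
  \<comment> \<open>\<open>q\<close> is the parity: 0 for the even rings, 1 for the odd
    ones.\<close>
  have part: "(\<Sum>k<n. m (R (2 * k + q))) \<le> m (\<Union>k<n. R (2 * k + q))" if "q \<le> 1" for n q
  proof (induction n)
    case (Suc n)
    show ?case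
    proof (cases "n = 0 \<and> q = 0")
      case True
      then show ?thesis by (simp add: lessThan_Suc)
    next
      case False
      then obtain p where p: "2 * n + q = Suc p"
        by (cases "2 * n + q") auto
      have "(\<Union>k<n. R (2 * k + q)) \<subseteq> D p"
      proof (rule UN_least)
        fix k assume "k \<in> {..<n}"
        then have "Suc (2 * k + q) \<le> p"
          using p by auto
        then show "R (2 * k + q) \<subseteq> D p"
          using Dmono by (auto simp: R_def)
      qed
      from Rsep[OF this] have "m (\<Union>k<n. R (2 * k + q)) + m (R (2 * n + q)) \<le> m ((\<Union>k<n. R (2 * k + q)) \<union> R (2 * n + q))"
        by (simp add: p)
      with Suc.IH have "(\<Sum>k<n. m (R (2 * k + q))) + m (R (2 * n + q)) \<le> m ((\<Union>k<n. R (2 * k + q)) \<union> R (2 * n + q))"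
        by (meson add_right_mono order_trans)
      then show ?thesis
        by (simp add: lessThan_Suc Un_commute add.commute)
    qed
  qed (simp add: empty)
  have "(\<Sum>k<n. m (R k)) \<le> m T + m T" for n
  proof -
    have "(\<Sum>k<n. m (R k)) \<le> (\<Sum>k<2 * n. m (R k))"
      by (intro sum_mono2) auto
    also have "\<dots> = (\<Sum>k<n. m (R (2 * k))) + (\<Sum>k<n. m (R (2 * k + 1)))"
      by (induction n) (auto simp: algebra_simps)
    also have "\<dots> \<le> m T + m T"
    proof (rule add_mono)
      show "(\<Sum>k<n. m (R (2 * k))) \<le> m T"
        using part[of 0 n] mono[of "\<Union>k<n. R (2 * k)" T] RT by (simp add: UN_least order_trans)
      show "(\<Sum>k<n. m (R (2 * k + 1))) \<le> m T"
        using part[of 1 n] mono[of "\<Union>k<n. R (2 * k + 1)" T] RT by (simp add: UN_least order_trans)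
    qed
    finally show ?thesis .
  qed
  then have "(\<Sum>k. m (R k)) \<le> m T + m T"
    by (intro suminf_le_const) auto
  also have "\<dots> < \<infinity>"
    using False by (simp add: less_top)
  finally have tail: "(\<lambda>n. \<Sum>k. m (R (k + n))) \<longlonglongrightarrow> 0"
    by (rule ennreal_suminf_tail_tendsto_0)
  have le: "m (T \<inter> F) + m (T - F) \<le> m T + (\<Sum>k. m (R (k + n)))" for n
  proof -
    define A where "A k = (case k of 0 \<Rightarrow> D n | Suc k \<Rightarrow> R (k + n))" for k
    have "T - F \<subseteq> (\<Union>k. A k)"
    proof
      fix x assume x: "x \<in> T - F"
      \<comment> \<open>Closedness of \<open>F\<close> enters here: a point off \<open>F\<close> has
        positive distance from it and therefore lies in some \<open>D N\<close>.\<close>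
      then obtain e where e: "0 < e" "\<And>y. y \<in> F \<Longrightarrow> e \<le> dist x y"
        using F open_contains_ball[of "- F"] by (force simp: open_Compl subset_iff not_less)
      obtain N where "inverse (real (Suc N)) < e"
        using reals_Archimedean[OF e(1)] by blast
      then have "x \<in> D N"
        using x e(2) by (force simp: D_def inverse_eq_divide)
      define M where "M = (LEAST M. x \<in> D M)"
      have M: "x \<in> D M"
        unfolding M_def using \<open>x \<in> D N\<close> by (rule LeastI)
      show "x \<in> (\<Union>k. A k)"
      proof (cases "M \<le> n")
        case True
        then have "x \<in> A 0"
          using M Dmono by (auto simp: A_def)
        then show ?thesis by blast
      next
        case False
        then obtain k where k: "M = Suc (k + n)"
          by (metis add.commute less_iff_Suc_add not_le)
        have "x \<notin> D (k + n)"
          using not_less_Least[of "k + n" "\<lambda>M. x \<in> D M"] k unfolding M_def by simp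
        then have "x \<in> A (Suc k)"
          using M k by (simp add: A_def R_def)
        then show ?thesis by blast
      qed
    qed
    then have "m (T - F) \<le> (\<Sum>k. m (A k))"
      using mono sub order_trans by blast
    also have "\<dots> = m (D n) + (\<Sum>k. m (R (k + n)))"
      using suminf_offset[of "\<lambda>k. m (A k)" 1] by (simp add: A_def)
    finally have "m (T \<inter> F) + m (T - F) \<le> m (T \<inter> F) + m (D n) + (\<Sum>k. m (R (k + n)))"
      by (simp add: add.assoc add_left_mono)
    also have "m (T \<inter> F) + m (D n) \<le> m ((T \<inter> F) \<union> D n)"
      by (rule sep[of "1 / real (Suc n)"]) (auto simp: D_def dist_commute)
    also have "\<dots> \<le> m T"
      by (rule mono) (auto simp: D_def)
    finally show ?thesis
      by (simp add: add_right_mono)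
  qed
  have "(\<lambda>n. m T + (\<Sum>k. m (R (k + n)))) \<longlonglongrightarrow> m T + 0"
    using tail by (intro tendsto_add tendsto_const)
  then have "m (T \<inter> F) + m (T - F) \<le> m T + 0"
    by (rule LIMSEQ_le_const) (use le in auto)
  then show ?thesis by simp
qed simp

text \<open>The content at a fixed scale \<delta>. It is subadditive at every scale and additive on
  separated sets at scales below their distance; the layer estimate later compares with it at the
  scale \<epsilon> of the layer.\<close>

definition hausdorff_pre :: "nat \<Rightarrow> real \<Rightarrow> 'a::euclidean_space set \<Rightarrow> ennreal" where
  "hausdorff_pre s \<delta> A = (INF C\<in>{C :: nat \<Rightarrow> 'a set.
     A \<subseteq> (\<Union>i. C i) \<and> (\<forall>i. bounded (C i) \<and> diameter (C i) \<le> \<delta>)}. \<Sum>i. hausdorff_weight s (C i))"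

lemma hausdorff_outer_eq: "hausdorff_outer s A = (SUP \<delta>\<in>{0<..}. hausdorff_pre s \<delta> A)"
  by (simp add: hausdorff_outer_def hausdorff_pre_def)

lemma hausdorff_pre_mono: "A \<subseteq> B \<Longrightarrow> hausdorff_pre s \<delta> A \<le> hausdorff_pre s \<delta> B"
  unfolding hausdorff_pre_def by (intro INF_superset_mono) auto

lemma hausdorff_pre_antimono: "\<delta> \<le> \<delta>' \<Longrightarrow> hausdorff_pre s \<delta>' A \<le> hausdorff_pre s \<delta> A"
  unfolding hausdorff_pre_def by (intro INF_superset_mono) (auto intro: order_trans)

lemma hausdorff_pre_empty: "0 < \<delta> \<Longrightarrow> hausdorff_pre s \<delta> ({} :: 'a::euclidean_space set) = 0"
proof -
  assume "0 < \<delta>"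
  then have "hausdorff_pre s \<delta> ({} :: 'a set) \<le> (\<Sum>i. hausdorff_weight s ({} :: 'a set))"
    unfolding hausdorff_pre_def by (intro INF_lower2[of "\<lambda>_. {}"]) (auto simp: diameter_def)
  then show ?thesis by (simp add: hausdorff_weight_def)
qed

lemma hausdorff_pre_le_outer: "0 < \<delta> \<Longrightarrow> hausdorff_pre s \<delta> A \<le> hausdorff_outer s A"
  unfolding hausdorff_outer_eq by (intro SUP_upper) auto

lemma hausdorff_pre_subadditive:
  fixes A :: "nat \<Rightarrow> 'a::euclidean_space set"
  shows "hausdorff_pre s \<delta> (\<Union>i. A i) \<le> (\<Sum>i. hausdorff_pre s \<delta> (A i))"
proof (cases "\<forall>i. hausdorff_pre s \<delta> (A i) \<noteq> \<infinity>")
  case False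
  then have "(\<Sum>i. hausdorff_pre s \<delta> (A i)) = \<infinity>"
    by (metis ennreal_suminf_lessD infinity_ennreal_def less_irrefl less_top)
  then show ?thesis by simp
next
  case True
  show ?thesis
  proof (rule ennreal_le_epsilon)
    fix e :: real assume "0 < e"
    have "\<exists>C. (A i \<subseteq> (\<Union>j. C j) \<and> (\<forall>j. bounded (C j) \<and> diameter (C j) \<le> \<delta>)) \<and>
       (\<Sum>j. hausdorff_weight s (C j)) \<le> hausdorff_pre s \<delta> (A i) + ennreal (e * (1 / 2) ^ Suc i)" for i
    proof -
      have "0 < e * (1 / 2) ^ Suc i"
        using \<open>0 < e\<close> by simp
      from INF_approx_ennreal[OF this hausdorff_pre_def[of s \<delta> "A i"]] True
      obtain C where "C \<in> {C. A i \<subseteq> (\<Union>i. C i) \<and> (\<forall>i. bounded (C i) \<and> diameter (C i) \<le> \<delta>)}"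
        "(\<Sum>j. hausdorff_weight s (C j)) < hausdorff_pre s \<delta> (A i) + ennreal (e * (1 / 2) ^ Suc i)"
        by blast
      then show ?thesis
        using less_imp_le by (intro exI[of _ C]) blast
    qed
    then obtain C where C: "\<And>i. A i \<subseteq> (\<Union>j. C i j)" "\<And>i j. bounded (C i j)" "\<And>i j. diameter (C i j) \<le> \<delta>"
      "\<And>i. (\<Sum>j. hausdorff_weight s (C i j)) \<le> hausdorff_pre s \<delta> (A i) + ennreal (e * (1 / 2) ^ Suc i)"
      by metis
    define B where "B n = (case prod_decode n of (i, j) \<Rightarrow> C i j)" for n
    have cov: "(\<Union>i. A i) \<subseteq> (\<Union>n. B n)"
    proof
      fix x assume "x \<in> (\<Union>i. A i)"
      then obtain i j where "x \<in> C i j"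
        using C(1) by blast
      then have "x \<in> B (prod_encode (i, j))"
        by (simp add: B_def)
      then show "x \<in> (\<Union>n. B n)" by blast
    qed
    have "hausdorff_pre s \<delta> (\<Union>i. A i) \<le> (\<Sum>n. hausdorff_weight s (B n))"
      unfolding hausdorff_pre_def
    proof (rule INF_lower)
      show "B \<in> {C. (\<Union>i. A i) \<subseteq> (\<Union>i. C i) \<and> (\<forall>i. bounded (C i) \<and> diameter (C i) \<le> \<delta>)}"
        using cov C(2,3) by (auto simp: B_def split: prod.split)
    qed
    also have "(\<Sum>n. hausdorff_weight s (B n)) = (\<Sum>i. \<Sum>j. hausdorff_weight s (C i j))"
      using suminf_ennreal_2dimen[of "\<lambda>i. \<Sum>j. hausdorff_weight s (C i j)" "\<lambda>(i, j). hausdorff_weight s (C i j)"]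
      by (simp add: B_def case_prod_beta)
    also have "\<dots> \<le> (\<Sum>i. hausdorff_pre s \<delta> (A i) + ennreal (e * (1 / 2) ^ Suc i))"
      using C(4) by (intro suminf_le) auto
    also have "\<dots> = (\<Sum>i. hausdorff_pre s \<delta> (A i)) + (\<Sum>i. ennreal (e * (1 / 2) ^ Suc i))"
      by (intro suminf_add[symmetric]) auto
    also have "(\<Sum>i. ennreal (e * (1 / 2) ^ Suc i)) = ennreal e"
      using \<open>0 < e\<close> sums_mult[OF power_half_series, of e] by (intro suminf_ennreal_eq) auto
    finally show "hausdorff_pre s \<delta> (\<Union>i. A i) \<le> (\<Sum>i. hausdorff_pre s \<delta> (A i)) + ennreal e" .
  qed
qed

text \<open>A covering set of diameter at most \<delta> < r cannot meet both \<open>A\<close> and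
  \<open>B\<close>, so a cover of the union splits into a cover of \<open>A\<close> and one of
  \<open>B\<close> that share no set.\<close>

lemma hausdorff_pre_separated:
  fixes A B :: "'a::euclidean_space set"
  assumes "\<delta> < r" and sep: "\<And>x y. x \<in> A \<Longrightarrow> y \<in> B \<Longrightarrow> r \<le> dist x y"
  shows "hausdorff_pre s \<delta> A + hausdorff_pre s \<delta> B \<le> hausdorff_pre s \<delta> (A \<union> B)"
  unfolding hausdorff_pre_def[of s \<delta> "A \<union> B"]
proof (rule INF_greatest)
  fix C :: "nat \<Rightarrow> 'a set" assume "C \<in> {C. A \<union> B \<subseteq> (\<Union>i. C i) \<and> (\<forall>i. bounded (C i) \<and> diameter (C i) \<le> \<delta>)}"
  then have C: "A \<union> B \<subseteq> (\<Union>i. C i)" "\<And>i. bounded (C i)" "\<And>i. diameter (C i) \<le> \<delta>"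
    by auto
  \<comment> \<open>Discarded sets are replaced by the empty set, whose weight is 0 also for s =
    0.\<close>
  define D where "D E i = (if C i \<inter> E = {} then {} else C i)" for E and i :: nat
  have pre: "hausdorff_pre s \<delta> E \<le> (\<Sum>i. hausdorff_weight s (D E i))" if "E \<subseteq> A \<union> B" for E
    unfolding hausdorff_pre_def
  proof (rule INF_lower)
    have "0 \<le> \<delta>"
      using C(3)[of 0] diameter_ge_0[OF C(2)[of 0]] by linarith
    moreover have "E \<subseteq> (\<Union>i. D E i)"
      using C(1) that by (fastforce simp: D_def)
    ultimately show "D E \<in> {C. E \<subseteq> (\<Union>i. C i) \<and> (\<forall>i. bounded (C i) \<and> diameter (C i) \<le> \<delta>)}"
      using C(2,3) diameter_empty by (auto simp: D_def simp del: Union_iff)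
  qed
  have "hausdorff_pre s \<delta> A + hausdorff_pre s \<delta> B \<le> (\<Sum>i. hausdorff_weight s (D A i)) + (\<Sum>i. hausdorff_weight s (D B i))"
    by (intro add_mono pre) auto
  also have "\<dots> = (\<Sum>i. hausdorff_weight s (D A i) + hausdorff_weight s (D B i))"
    by (intro suminf_add) auto
  also have "\<dots> \<le> (\<Sum>i. hausdorff_weight s (C i))"
  proof (intro suminf_le)
    fix i
    have "C i \<inter> A = {} \<or> C i \<inter> B = {}"
    proof (rule ccontr)
      assume "\<not> ?thesis"
      then obtain x y where xy: "x \<in> C i" "x \<in> A" "y \<in> C i" "y \<in> B" by blast
      have "dist x y \<le> \<delta>"
        using diameter_bounded_bound[OF C(2) xy(1,3)] C(3)[of i] by linarith
      with sep[OF xy(2,4)] assms(1) show False by linarith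
    qed
    then show "hausdorff_weight s (D A i) + hausdorff_weight s (D B i) \<le> hausdorff_weight s (C i)"
      by (auto simp: D_def hausdorff_weight_def)
  qed auto
  finally show "hausdorff_pre s \<delta> A + hausdorff_pre s \<delta> B \<le> (\<Sum>i. hausdorff_weight s (C i))" .
qed

lemma hausdorff_outer_mono: "A \<subseteq> B \<Longrightarrow> hausdorff_outer s A \<le> hausdorff_outer s B"
  unfolding hausdorff_outer_eq by (intro SUP_mono') (rule hausdorff_pre_mono)

lemma hausdorff_outer_empty: "hausdorff_outer s {} = 0"
  unfolding hausdorff_outer_eq
  by (intro antisym SUP_least) (auto simp: hausdorff_pre_empty)

lemma hausdorff_outer_subadditive:
  fixes A :: "nat \<Rightarrow> 'a::euclidean_space set"
  shows "hausdorff_outer s (\<Union>i. A i) \<le> (\<Sum>i. hausdorff_outer s (A i))"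
  unfolding hausdorff_outer_eq[of s "\<Union>i. A i"]
proof (rule SUP_least)
  fix \<delta> :: real assume "\<delta> \<in> {0<..}"
  then have "(\<Sum>i. hausdorff_pre s \<delta> (A i)) \<le> (\<Sum>i. hausdorff_outer s (A i))"
    by (intro suminf_le hausdorff_pre_le_outer) auto
  with hausdorff_pre_subadditive[of s \<delta> A] show "hausdorff_pre s \<delta> (\<Union>i. A i) \<le> (\<Sum>i. hausdorff_outer s (A i))"
    by (rule order_trans)
qed

lemma hausdorff_outer_separated:
  assumes "0 < r" and sep: "\<And>x y. x \<in> A \<Longrightarrow> y \<in> B \<Longrightarrow> r \<le> dist x y"
  shows "hausdorff_outer s A + hausdorff_outer s B \<le> hausdorff_outer s (A \<union> B)"
proof -
  have "hausdorff_outer s A + hausdorff_outer s B = (SUP \<delta>\<in>{0<..}. hausdorff_pre s \<delta> A + hausdorff_pre s \<delta> B)"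
    unfolding hausdorff_outer_eq
  proof (rule SUP_add_directed_ennreal[symmetric])
    fix i j :: real assume "i \<in> {0<..}" "j \<in> {0<..}"
    then show "\<exists>k\<in>{0<..}. hausdorff_pre s i A + hausdorff_pre s j B \<le> hausdorff_pre s k A + hausdorff_pre s k B"
      by (intro bexI[of _ "min i j"] add_mono hausdorff_pre_antimono) auto
  qed
  also have "\<dots> \<le> hausdorff_outer s (A \<union> B)"
  proof (rule SUP_least)
    fix \<delta> :: real assume "\<delta> \<in> {0<..}"
    \<comment> \<open>The separation argument works at scales below r, and contents only grow when
      the scale shrinks.\<close>
    then have d: "0 < min \<delta> (r / 2)" "min \<delta> (r / 2) < r"
      using \<open>0 < r\<close> by (auto simp: min_def)
    have "hausdorff_pre s \<delta> A + hausdorff_pre s \<delta> B \<le> hausdorff_pre s (min \<delta> (r / 2)) A + hausdorff_pre s (min \<delta> (r / 2)) B"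
      by (intro add_mono hausdorff_pre_antimono) auto
    also have "\<dots> \<le> hausdorff_pre s (min \<delta> (r / 2)) (A \<union> B)"
      by (rule hausdorff_pre_separated[OF d(2) sep])
    also have "\<dots> \<le> hausdorff_outer s (A \<union> B)"
      by (rule hausdorff_pre_le_outer[OF d(1)])
    finally show "hausdorff_pre s \<delta> A + hausdorff_pre s \<delta> B \<le> hausdorff_outer s (A \<union> B)" .
  qed
  finally show ?thesis .
qed

text \<open>\<open>measure_of\<close> returns the prescribed function only if that is a measure. By
  Caratheodory it is one on the sets that split every set additively; these form a sigma-algebra,
  which contains the closed sets by the metric criterion and hence all Borel sets.\<close>

lemma emeasure_hausdorff:
  fixes A :: "'a::euclidean_space set"
  assumes "A \<in> sets borel"
  shows "emeasure (hausdorff s) A = hausdorff_outer s A"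
proof -
  define m where "m = (hausdorff_outer s :: 'a set \<Rightarrow> ennreal)"
  interpret P: sigma_algebra "UNIV :: 'a set" "Pow UNIV"
    by (rule sigma_algebra_Pow)
  have "outer_measure_space (Pow UNIV) m"
    unfolding outer_measure_space_def positive_def increasing_def countably_subadditive_def m_def
    using hausdorff_outer_empty hausdorff_outer_mono hausdorff_outer_subadditive by auto
  then have ms: "measure_space UNIV (lambda_system UNIV (Pow UNIV) m) m"
    by (rule P.caratheodory_lemma)
  then have sa: "sigma_algebra UNIV (lambda_system UNIV (Pow UNIV) m)"
    by (simp add: measure_space_def)
  have closed: "F \<in> lambda_system UNIV (Pow UNIV) m" if "closed F" for F
    unfolding lambda_system_def
  proof (intro CollectI conjI ballI)
    fix T :: "'a set"
    have "m (T \<inter> F) + m (T - F) \<le> m T"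
      unfolding m_def
      by (rule metric_outer_measure_closed[OF hausdorff_outer_mono hausdorff_outer_empty
            hausdorff_outer_subadditive hausdorff_outer_separated that])
    moreover have "m T \<le> m (T \<inter> F) + m (T - F)"
    proof -
      define B where "B i = (if i = 0 then T \<inter> F else if i = Suc 0 then T - F else {})" for i :: nat
      have "m T \<le> m (\<Union>i. B i)"
        unfolding m_def by (rule hausdorff_outer_mono) (auto simp: B_def split: if_splits intro: exI[of _ 0] exI[of _ "Suc 0"])
      also have "\<dots> \<le> (\<Sum>i. m (B i))"
        unfolding m_def by (rule hausdorff_outer_subadditive)
      also have "\<dots> = (\<Sum>i<2. m (B i))"
        by (rule suminf_finite) (auto simp: B_def m_def hausdorff_outer_empty)
      also have "\<dots> = m (T \<inter> F) + m (T - F)"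
        by (simp add: B_def numeral_2_eq_2)
      finally show ?thesis .
    qed
    ultimately show "m (F \<inter> T) + m ((UNIV - F) \<inter> T) = m T"
      by (simp add: Int_commute Diff_eq antisym)
  qed simp
  have sub: "sets borel \<subseteq> lambda_system UNIV (Pow UNIV) m"
  proof -
    have "sigma_sets UNIV (Collect closed) \<subseteq> lambda_system UNIV (Pow UNIV) m"
      by (rule sigma_algebra.sigma_sets_subset[OF sa]) (use closed in blast)
    moreover have "sets borel = sigma_sets UNIV (Collect closed :: 'a set set)"
      unfolding borel_eq_closed by (rule sets_measure_of) simp
    ultimately show ?thesis by simp
  qed
  have sb: "sigma_algebra UNIV (sets (borel :: 'a measure))"
    using sets.sigma_algebra_axioms[of "borel :: 'a measure"] by simp
  have "measure_space UNIV (sets borel) m"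
    by (rule measure_down[OF ms sb sub])
  then have "emeasure (measure_of UNIV (sets borel) m) A = m A"
    unfolding measure_space_def using assms by (intro emeasure_measure_of_sigma[OF sb]) simp_all
  then show ?thesis
    by (simp add: hausdorff_def m_def)
qed

section \<open>The gauge of a convex body\<close>

text \<open>Two radii about \<open>a\<close> measure the shape: 1 / \<rho> becomes the Lipschitz
  constant of the gauge, and \<open>R\<close> bounds the length of the rays from \<open>a\<close> to
  the boundary.\<close>

locale convex_body =
  fixes \<Omega> :: "'a::euclidean_space set" and a :: 'a and \<rho> R :: real
  assumes convex: "convex \<Omega>" and op: "open \<Omega>"
    and \<rho>: "0 < \<rho>" "cball a \<rho> \<subseteq> \<Omega>" and R: "\<And>x. x \<in> \<Omega> \<Longrightarrow> norm (x - a) \<le> R"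
begin

text \<open>The Minkowski functional of \<Omega> - a; a point x enters as
  \<open>q (x - a)\<close>.\<close>

definition q :: "'a \<Rightarrow> real" where
  "q v = Inf {t. 0 < t \<and> a + (1 / t) *\<^sub>R v \<in> \<Omega>}"

lemma bounded: "bounded \<Omega>"
proof -
  have "norm x \<le> R + norm a" if "x \<in> \<Omega>" for x
    using R[OF that] norm_triangle_ineq[of "x - a" a] by simp
  then show ?thesis by (auto simp: bounded_iff)
qed

lemma R_pos: "0 < R"
proof -
  obtain b :: 'a where b: "b \<in> Basis" using nonempty_Basis by blast
  have "a + \<rho> *\<^sub>R b \<in> cball a \<rho>"
    using b \<rho> by (simp add: dist_norm)
  then have "a + \<rho> *\<^sub>R b \<in> \<Omega>" using \<rho> by blast
  from R[OF this] b \<rho>(1) show ?thesis by simp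
qed

lemma a_in: "a \<in> \<Omega>"
  using \<rho> by auto

lemma scale_mem_mono:
  assumes "0 < t" "t \<le> t'" "a + (1 / t) *\<^sub>R v \<in> \<Omega>"
  shows "a + (1 / t') *\<^sub>R v \<in> \<Omega>"
proof -
  have "(1 - t / t') *\<^sub>R a + (t / t') *\<^sub>R (a + (1 / t) *\<^sub>R v) \<in> \<Omega>"
    using assms by (intro convexD_alt[OF convex a_in]) auto
  also have "(1 - t / t') *\<^sub>R a + (t / t') *\<^sub>R (a + (1 / t) *\<^sub>R v) = a + (1 / t') *\<^sub>R v"
    using assms by (simp add: algebra_simps)
  finally show ?thesis .
qed

lemma scale_mem_large:
  assumes "0 < t" "norm v \<le> \<rho> * t"
  shows "a + (1 / t) *\<^sub>R v \<in> \<Omega>"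
proof -
  have "a + (1 / t) *\<^sub>R v \<in> cball a \<rho>"
    using assms by (simp add: dist_norm field_simps)
  then show ?thesis using \<rho> by blast
qed

lemma scale_set_nonempty: "{t. 0 < t \<and> a + (1 / t) *\<^sub>R v \<in> \<Omega>} \<noteq> {}"
proof -
  define t where "t = norm v / \<rho> + 1"
  have "0 < t" "norm v \<le> \<rho> * t"
    using \<rho>(1) by (auto simp: t_def field_simps add_pos_nonneg)
  with scale_mem_large[of t v] show ?thesis by blast
qed

text \<open>Since \<Omega> is open, t can be lowered a little without losing membership, so the
  infimum is never attained and strict inequality is equivalent to membership. Most properties of
  \<open>q\<close> are drawn from this equivalence rather than from \<open>Inf\<close>.\<close>

lemma q_less_iff:
  assumes t: "0 < t"
  shows "q v < t \<longleftrightarrow> a + (1 / t) *\<^sub>R v \<in> \<Omega>"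
proof
  assume "q v < t"
  then obtain s where "0 < s" "s < t" "a + (1 / s) *\<^sub>R v \<in> \<Omega>"
    unfolding q_def using cInf_lessD[OF scale_set_nonempty] by blast
  then show "a + (1 / t) *\<^sub>R v \<in> \<Omega>"
    using scale_mem_mono[of s t v] by simp
next
  assume mem: "a + (1 / t) *\<^sub>R v \<in> \<Omega>"
  have "((\<lambda>s. a + (1 / s) *\<^sub>R v) \<longlongrightarrow> a + (1 / t) *\<^sub>R v) (at_left t)"
    using t by (intro tendsto_intros) auto
  then have "\<forall>\<^sub>F s in at_left t. a + (1 / s) *\<^sub>R v \<in> \<Omega>"
    using op mem by (rule topological_tendstoD)
  moreover have "\<forall>\<^sub>F s in at_left t. 0 < s \<and> s < t"
    using eventually_at_left_real[OF t] by eventually_elim auto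
  ultimately have "\<forall>\<^sub>F s in at_left t. 0 < s \<and> s < t \<and> a + (1 / s) *\<^sub>R v \<in> \<Omega>"
    by eventually_elim auto
  from eventually_happens'[OF trivial_limit_at_left_real this]
  obtain s where s: "0 < s" "s < t" "a + (1 / s) *\<^sub>R v \<in> \<Omega>"
    by blast
  have "q v \<le> s"
    unfolding q_def using s by (intro cInf_lower) (auto intro!: bdd_belowI[of _ 0])
  with s show "q v < t" by simp
qed

lemma q_nonneg: "0 \<le> q v"
proof (rule ccontr)
  assume "\<not> 0 \<le> q v"
  have "0 \<le> q v"
    unfolding q_def by (rule cInf_greatest[OF scale_set_nonempty]) auto
  with \<open>\<not> 0 \<le> q v\<close> show False ..
qed

lemma q_le_norm: "q v \<le> norm v / \<rho>"
proof (rule dense_ge)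
  fix t assume t: "norm v / \<rho> < t"
  then have "0 < t" using \<rho>(1) by (meson divide_nonneg_pos le_less_trans norm_ge_zero)
  moreover have "norm v \<le> \<rho> * t"
    using t \<rho>(1) by (simp add: field_simps)
  ultimately show "q v \<le> t"
    using q_less_iff[of t v] scale_mem_large by fastforce
qed

lemma norm_le_q: "norm v \<le> R * q v"
proof -
  have "norm v / R \<le> q v"
  proof (rule dense_ge)
    fix t assume t: "q v < t"
    then have t0: "0 < t" using q_nonneg[of v] by linarith
    then have "norm ((1 / t) *\<^sub>R v) \<le> R"
      using t q_less_iff[of t v] R[of "a + (1 / t) *\<^sub>R v"] by simp
    then show "norm v / R \<le> t"
      using t0 R_pos by (simp add: field_simps)
  qed
  then show ?thesis using R_pos by (simp add: field_simps)
qed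

lemma q_zero: "q 0 = 0"
  using q_le_norm[of 0] q_nonneg[of 0] by simp

lemma q_pos: "v \<noteq> 0 \<Longrightarrow> 0 < q v"
  using norm_le_q[of v] R_pos q_nonneg[of v] by (cases "q v = 0") auto

lemma q_eqI:
  assumes "0 \<le> c" "\<And>t. 0 < t \<Longrightarrow> q v < t \<longleftrightarrow> c < t"
  shows "q v = c"
proof (rule ccontr)
  assume "q v \<noteq> c"
  then consider "q v < c" | "c < q v" by linarith
  then show False
  proof cases
    case 1
    with assms(2)[of c] q_nonneg[of v] show False by simp
  next
    case 2
    with assms(2)[of "q v"] assms(1) show False by simp
  qed
qed

lemma q_scale: "0 < s \<Longrightarrow> q (s *\<^sub>R v) = s * q v"
proof (rule q_eqI)
  fix t :: real assume s: "0 < s" and t: "0 < t"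
  have "q (s *\<^sub>R v) < t \<longleftrightarrow> q v < t / s"
    using s t q_less_iff[of t "s *\<^sub>R v"] q_less_iff[of "t / s" v] by simp
  then show "q (s *\<^sub>R v) < t \<longleftrightarrow> s * q v < t"
    using s by (simp add: field_simps)
qed (simp add: q_nonneg)

lemma q_add: "q (u + v) \<le> q u + q v"
proof -
  have "q (u + v) \<le> q u + q v + e" if "0 < e" for e
  proof -
    define t s where "t = q u + e / 2" and "s = q v + e / 2"
    have pos: "0 < t" "0 < s"
      using that q_nonneg[of u] q_nonneg[of v] by (auto simp: t_def s_def)
    have "q u < t" "q v < s"
      using that by (auto simp: t_def s_def)
    then have mem: "a + (1 / t) *\<^sub>R u \<in> \<Omega>" "a + (1 / s) *\<^sub>R v \<in> \<Omega>"
      using q_less_iff pos by blast+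
    have "(1 - s / (t + s)) *\<^sub>R (a + (1 / t) *\<^sub>R u) + (s / (t + s)) *\<^sub>R (a + (1 / s) *\<^sub>R v) \<in> \<Omega>"
      using pos by (intro convexD_alt[OF convex mem]) auto
    moreover have "1 - s / (t + s) = t / (t + s)"
      using pos by (simp add: field_simps)
    moreover have "(t / (t + s)) *\<^sub>R (a + (1 / t) *\<^sub>R u) + (s / (t + s)) *\<^sub>R (a + (1 / s) *\<^sub>R v) =
        ((t / (t + s)) + (s / (t + s))) *\<^sub>R a + (1 / (t + s)) *\<^sub>R (u + v)"
      using pos by (simp add: algebra_simps)
    moreover have "(t / (t + s)) + (s / (t + s)) = 1"
      using pos by (simp add: add_divide_distrib[symmetric])
    ultimately have "a + (1 / (t + s)) *\<^sub>R (u + v) \<in> \<Omega>"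
      by simp
    then have "q (u + v) < t + s"
      using q_less_iff[of "t + s"] pos by simp
    then show ?thesis by (simp add: t_def s_def)
  qed
  then show ?thesis
    by (rule field_le_epsilon)
qed

lemma q_lipschitz: "\<bar>q u - q v\<bar> \<le> norm (u - v) / \<rho>"
  using q_add[of "u - v" v] q_add[of "v - u" u] q_le_norm[of "u - v"] q_le_norm[of "v - u"]
  by (simp add: norm_minus_commute abs_le_iff)

lemma q_lipschitz_on: "(1 / \<rho>)-lipschitz_on UNIV q"
  using q_lipschitz \<rho>(1) by (intro lipschitz_onI) (auto simp: dist_norm)

lemma q_continuous: "continuous_on A q"
  using lipschitz_on_continuous_on[OF q_lipschitz_on] by (rule continuous_on_subset) simp

lemma q_measurable [measurable]: "q \<in> borel_measurable borel"
  using q_continuous by (rule borel_measurable_continuous_onI)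

lemma mem_iff_q: "x \<in> \<Omega> \<longleftrightarrow> q (x - a) < 1"
  using q_less_iff[of 1 "x - a"] by simp

text \<open>The radial projection from \<open>a\<close> to the boundary. At x = a division by zero
  makes it \<open>a\<close> itself, which is why that point is excluded below.\<close>

definition \<pi> :: "'a \<Rightarrow> 'a" where
  "\<pi> x = a + (1 / q (x - a)) *\<^sub>R (x - a)"

lemma \<pi>_frontier: "x \<noteq> a \<Longrightarrow> \<pi> x \<in> frontier \<Omega>"
proof -
  assume "x \<noteq> a"
  then have q0: "0 < q (x - a)" by (intro q_pos) simp
  define v where "v = (1 / q (x - a)) *\<^sub>R (x - a)"
  have qv: "q v = 1"
    using q0 q_scale[of "1 / q (x - a)" "x - a"] by (simp add: v_def)
  then have "\<pi> x \<notin> \<Omega>"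
    unfolding mem_iff_q by (simp add: \<pi>_def v_def)
  moreover have "\<pi> x \<in> closure \<Omega>"
  proof (rule closure_sequential[THEN iffD2], intro exI conjI allI)
    fix n
    show "a + (1 - 1 / real (Suc (Suc n))) *\<^sub>R v \<in> \<Omega>"
    proof -
      define t where "t = 1 / real (Suc (Suc n))"
      have "0 < t" "t < 1" by (auto simp: t_def)
      then have "q ((1 - t) *\<^sub>R v) < 1"
        using q_scale[of "1 - t" v] qv by simp
      then show ?thesis unfolding mem_iff_q t_def by simp
    qed
    have "(\<lambda>n. 1 / real (Suc (Suc n))) \<longlonglongrightarrow> 0"
      using LIMSEQ_Suc[OF LIMSEQ_inverse_real_of_nat] by (simp add: inverse_eq_divide)
    then have "(\<lambda>n. a + (1 - 1 / real (Suc (Suc n))) *\<^sub>R v) \<longlonglongrightarrow> a + (1 - 0) *\<^sub>R v"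
      by (intro tendsto_intros)
    then show "(\<lambda>n. a + (1 - 1 / real (Suc (Suc n))) *\<^sub>R v) \<longlonglongrightarrow> \<pi> x"
      by (simp add: \<pi>_def v_def)
  qed
  ultimately show ?thesis
    using op by (simp add: frontier_def interior_open)
qed

section \<open>Outer normals as subgradients of the gauge\<close>

lemma outer_unit_normal_exists:
  assumes y: "y \<in> frontier \<Omega>"
  shows "\<exists>n. outer_unit_normal \<Omega> y n"
proof -
  have "y \<notin> \<Omega>"
    using y op by (simp add: frontier_def interior_open)
  then obtain n c where n: "n \<noteq> 0" "\<forall>x\<in>\<Omega>. n \<bullet> x \<le> c" "\<forall>x\<in>{y}. n \<bullet> x \<ge> c"
    using separating_hyperplane_sets[of \<Omega> "{y}"] convex a_in by auto
  have "outer_unit_normal \<Omega> y ((1 / norm n) *\<^sub>R n)"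
    unfolding outer_unit_normal_def
  proof (intro conjI ballI)
    fix z assume "z \<in> \<Omega>"
    then have "n \<bullet> (z - y) \<le> 0"
      using n by (force simp: inner_diff_right)
    then show "(1 / norm n) *\<^sub>R n \<bullet> (z - y) \<le> 0"
      by (simp add: divide_le_0_iff)
  qed (use n in simp)
  then show ?thesis ..
qed

lemma normal_inner_ge:
  assumes "outer_unit_normal \<Omega> y n"
  shows "\<rho> \<le> n \<bullet> (y - a)"
proof -
  have n: "norm n = 1" "\<And>z. z \<in> \<Omega> \<Longrightarrow> n \<bullet> (z - y) \<le> 0"
    using assms by (auto simp: outer_unit_normal_def)
  \<comment> \<open>The point of the inner ball that is farthest in direction \<open>n\<close> lies
    in \<Omega>, hence behind the supporting hyperplane at \<open>y\<close>.\<close>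
  have "a + \<rho> *\<^sub>R n \<in> \<Omega>"
    using \<rho> n(1) by (auto simp: subset_iff dist_norm)
  from n(2)[OF this] have "\<rho> * (n \<bullet> n) \<le> n \<bullet> (y - a)"
    by (simp add: algebra_simps inner_diff_right inner_add_right)
  moreover have "n \<bullet> n = 1"
    using n(1) by (simp add: dot_square_norm)
  ultimately show ?thesis by simp
qed

text \<open>Divided by n . (y - a), the normal becomes the linear form that is 1 on the supporting
  hyperplane at \<open>y\<close> as seen from \<open>a\<close>. As \<Omega> lies behind this
  hyperplane, the form stays below the gauge.\<close>

lemma normal_subgradient:
  assumes "outer_unit_normal \<Omega> y n"
  shows "n \<bullet> w / (n \<bullet> (y - a)) \<le> q w"
proof (rule dense_ge)
  fix t assume t: "q w < t"
  then have t0: "0 < t" using q_nonneg[of w] by linarith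
  have c0: "0 < n \<bullet> (y - a)"
    using normal_inner_ge[OF assms] \<rho>(1) by linarith
  have "a + (1 / t) *\<^sub>R w \<in> \<Omega>"
    using t t0 q_less_iff by blast
  then have "n \<bullet> ((a + (1 / t) *\<^sub>R w) - y) \<le> 0"
    using assms by (simp add: outer_unit_normal_def)
  then have "(n \<bullet> w) / t \<le> n \<bullet> (y - a)"
    by (simp add: inner_diff_right inner_add_right)
  then show "n \<bullet> w / (n \<bullet> (y - a)) \<le> t"
    using t0 c0 by (simp add: field_simps)
qed

lemma normal_at_\<pi>:
  assumes n: "outer_unit_normal \<Omega> (\<pi> x) n" and x: "x \<noteq> a"
  shows "n \<bullet> (x - a) / (n \<bullet> (\<pi> x - a)) = q (x - a)"
proof -
  have q0: "0 < q (x - a)" using x by (intro q_pos) simp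
  have c0: "0 < n \<bullet> (\<pi> x - a)"
    using normal_inner_ge[OF n] \<rho>(1) by linarith
  have "n \<bullet> (\<pi> x - a) = (n \<bullet> (x - a)) / q (x - a)"
    by (simp add: \<pi>_def)
  then have "n \<bullet> (x - a) = q (x - a) * (n \<bullet> (\<pi> x - a))"
    using q0 by simp
  then show ?thesis using c0 by simp
qed

text \<open>The form of \<open>normal_subgradient\<close> touches the gauge along the ray through
  the boundary point, so it is a subgradient at \<open>x - a\<close>.\<close>

lemma normal_supports:
  assumes n: "outer_unit_normal \<Omega> (\<pi> x) n" and x: "x \<noteq> a"
  shows "q (x - a) + h * (n \<bullet> b / (n \<bullet> (\<pi> x - a))) \<le> q (x - a + h *\<^sub>R b)"
proof -
  have "q (x - a) + h * (n \<bullet> b / (n \<bullet> (\<pi> x - a))) = n \<bullet> (x - a + h *\<^sub>R b) / (n \<bullet> (\<pi> x - a))"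
    unfolding normal_at_\<pi>[OF n x, symmetric] by (simp add: inner_add_right add_divide_distrib)
  also have "\<dots> \<le> q (x - a + h *\<^sub>R b)"
    by (rule normal_subgradient[OF n])
  finally show ?thesis .
qed

lemma q_convex: "0 \<le> s \<Longrightarrow> s \<le> 1 \<Longrightarrow> q ((1 - s) *\<^sub>R u + s *\<^sub>R v) \<le> (1 - s) * q u + s * q v"
proof -
  assume s: "0 \<le> s" "s \<le> 1"
  have *: "q (r *\<^sub>R w) = r * q w" if "0 \<le> r" for r w
    using that q_scale[of r w] q_zero by (cases "r = 0") auto
  show ?thesis
    using q_add[of "(1 - s) *\<^sub>R u" "s *\<^sub>R v"] s by (simp add: *)
qed

lemma q_secant_mono:
  assumes "0 < h" "h \<le> h'"
  shows "(q (v + h *\<^sub>R b) - q v) / h \<le> (q (v + h' *\<^sub>R b) - q v) / h'"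
proof -
  have "q ((1 - h / h') *\<^sub>R v + (h / h') *\<^sub>R (v + h' *\<^sub>R b)) \<le> (1 - h / h') * q v + (h / h') * q (v + h' *\<^sub>R b)"
    using assms by (intro q_convex) auto
  also have "(1 - h / h') *\<^sub>R v + (h / h') *\<^sub>R (v + h' *\<^sub>R b) = v + h *\<^sub>R b"
    using assms by (simp add: algebra_simps)
  finally have "q (v + h *\<^sub>R b) - q v \<le> (h / h') * (q (v + h' *\<^sub>R b) - q v)"
    by (simp add: algebra_simps)
  then have "(q (v + h *\<^sub>R b) - q v) / h \<le> (h / h') * (q (v + h' *\<^sub>R b) - q v) / h"
    using assms by (intro divide_right_mono) auto
  then show ?thesis using assms by simp
qed

subsection \<open>Almost everywhere differentiability of the gauge\<close>

text \<open>One sequence serves both as step of the difference quotients and as width of the layers.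
  Its first term is 1, so \<open>h n < 1\<close> holds only from n = 1 on.\<close>

definition h :: "nat \<Rightarrow> real" where "h n = 1 / real (Suc n)"

lemma h_pos: "0 < h n" and h_le_1: "h n \<le> 1" and h_mono: "m \<le> n \<Longrightarrow> h n \<le> h m"
  by (auto simp: h_def frac_le)

lemma h_lim: "h \<longlonglongrightarrow> 0"
  unfolding h_def using LIMSEQ_inverse_real_of_nat by (simp add: inverse_eq_divide)

text \<open>Forward minus backward difference quotient, that is, the second difference divided by
  \<open>h n\<close> and not by its square: the limit is the jump of the directional
  derivative.\<close>

definition gap :: "'a \<Rightarrow> nat \<Rightarrow> 'a \<Rightarrow> real" where
  "gap b n v = (q (v + h n *\<^sub>R b) + q (v - h n *\<^sub>R b) - 2 * q v) / h n"

lemma gap_eq: "gap b n v = (q (v + h n *\<^sub>R b) - q v) / h n - (q v - q (v - h n *\<^sub>R b)) / h n"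
  by (simp add: gap_def diff_divide_distrib add_divide_distrib)

lemma gap_nonneg: "0 \<le> gap b n v"
proof -
  have "q ((1 - 1/2) *\<^sub>R (v + h n *\<^sub>R b) + (1/2) *\<^sub>R (v - h n *\<^sub>R b)) \<le> (1 - 1/2) * q (v + h n *\<^sub>R b) + (1/2) * q (v - h n *\<^sub>R b)"
    by (intro q_convex) auto
  also have "(1 - 1/2) *\<^sub>R (v + h n *\<^sub>R b) + (1/2) *\<^sub>R (v - h n *\<^sub>R b) = v"
    by (simp add: algebra_simps scaleR_add_left[symmetric])
  finally show ?thesis
    using h_pos[of n] by (simp add: gap_def)
qed

text \<open>By convexity the forward quotient decreases with the step, and the backward quotient is,
  up to sign, the forward quotient in direction - b.\<close>

lemma gap_antimono: "m \<le> n \<Longrightarrow> gap b n v \<le> gap b m v"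
  using q_secant_mono[OF h_pos h_mono, of m n v b] q_secant_mono[OF h_pos h_mono, of m n v "- b"]
  by (simp add: gap_eq diff_divide_distrib)

lemma gap_bound: "norm b = 1 \<Longrightarrow> gap b n v \<le> 2 / \<rho>"
proof -
  assume b: "norm b = 1"
  have "\<bar>q (v + h n *\<^sub>R b) - q v\<bar> \<le> h n / \<rho>" "\<bar>q (v - h n *\<^sub>R b) - q v\<bar> \<le> h n / \<rho>"
    using q_lipschitz[of "v + h n *\<^sub>R b" v] q_lipschitz[of "v - h n *\<^sub>R b" v] b h_pos[of n] by auto
  then have "q (v + h n *\<^sub>R b) + q (v - h n *\<^sub>R b) - 2 * q v \<le> 2 * (h n / \<rho>)"
    by linarith
  then show ?thesis
    using h_pos[of n] \<rho>(1) by (simp add: gap_def field_simps)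
qed

text \<open>
  Integrating the second difference quotient against a bump function and moving it to the bump
  function shows that the one-sided derivatives of the convex function \<open>q\<close> agree almost everywhere.
\<close>

lemma gap_integral_tendsto_0:
  assumes b: "b \<in> Basis" and r: "0 < r"
  shows "(\<lambda>n. \<integral>v. gap b n v * bump 0 r v \<partial>lborel) \<longlonglongrightarrow> 0"
proof -
  define \<theta> where "\<theta> = bump (0::'a) r"
  have \<theta>: "\<theta> \<in> Cc_infinity UNIV"
    unfolding \<theta>_def using r by (intro Cc_infinity_bump) auto
  have sm: "smooth \<theta>" by (simp add: \<theta>_def smooth_bump)
  have [measurable]: "\<theta> \<in> borel_measurable borel"
    using sm by (rule smooth_measurable)
  have nb: "norm b = 1" using b by simp
  obtain L where L: "0 < L" "\<And>x. \<bar>partial b \<theta> x\<bar> \<le> L"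
    using Cc_infinity_bounded[OF Cc_infinity_partial[OF \<theta> b]] by blast
  have \<theta>0: "\<theta> x = 0" if "x \<notin> cball 0 r" for x
    unfolding \<theta>_def by (rule bump_zero) (use that r in auto)
  have \<theta>1: "\<bar>\<theta> x\<bar> \<le> 1" for x
    by (simp add: \<theta>_def bump_nonneg bump_le_1)
  have shift0: "\<theta> (x + t *\<^sub>R b) = 0" if "x \<notin> cball 0 (r + 1)" "\<bar>t\<bar> \<le> 1" for x t
  proof (rule \<theta>0)
    have "norm x \<le> norm (x + t *\<^sub>R b) + norm (t *\<^sub>R b)"
      by (metis add_diff_cancel norm_triangle_ineq4)
    with that nb show "x + t *\<^sub>R b \<notin> cball 0 r" by simp
  qed
  have hb: "\<bar>h n\<bar> \<le> 1" "\<bar>- h n\<bar> \<le> 1" for n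
    using h_pos[of n] h_le_1[of n] by auto
  define G where "G n v = q v * ((\<theta> (v - h n *\<^sub>R b) - \<theta> v) / h n + (\<theta> (v + h n *\<^sub>R b) - \<theta> v) / h n)" for n v
  have eq: "(\<integral>v. gap b n v * \<theta> v \<partial>lborel) = integral\<^sup>L lborel (G n)" for n
  proof -
    have int: "integrable lborel (\<lambda>v. q (v + s *\<^sub>R b) * \<theta> (v + t *\<^sub>R b))" if "\<bar>t\<bar> \<le> 1" for s t
      using that shift0[of _ t] \<theta>1
      by (intro integrable_continuous_mult_compact[where R = "r + 1" and C = 1]
          continuous_on_compose2[OF q_continuous[of UNIV]] continuous_intros) auto
    have tr: "(\<integral>v. q (v + s *\<^sub>R b) * \<theta> v \<partial>lborel) = (\<integral>v. q v * \<theta> (v - s *\<^sub>R b) \<partial>lborel)" for s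
      using integral_lborel_translate[of "\<lambda>v. q v * \<theta> (v - s *\<^sub>R b)" "s *\<^sub>R b"] by (simp add: add.commute)
    have i: "integrable lborel (\<lambda>v. q (v + h n *\<^sub>R b) * \<theta> v)" "integrable lborel (\<lambda>v. q (v - h n *\<^sub>R b) * \<theta> v)"
      "integrable lborel (\<lambda>v. q v * \<theta> v)" "integrable lborel (\<lambda>v. q v * \<theta> (v - h n *\<^sub>R b))"
      "integrable lborel (\<lambda>v. q v * \<theta> (v + h n *\<^sub>R b))"
      using int[of 0 "h n"] int[of 0 "- h n"] int[of 0 0] int[OF hb(2), of 0 n] int[OF hb(1), of 0 n] by simp_all
    have "(\<integral>v. gap b n v * \<theta> v \<partial>lborel) =
        (\<integral>v. (q (v + h n *\<^sub>R b) * \<theta> v + q (v - h n *\<^sub>R b) * \<theta> v - 2 * (q v * \<theta> v)) / h n \<partial>lborel)"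
      by (intro Bochner_Integration.integral_cong) (auto simp: gap_def algebra_simps)
    also have "\<dots> = ((\<integral>v. q v * \<theta> (v - h n *\<^sub>R b) \<partial>lborel) + (\<integral>v. q v * \<theta> (v + h n *\<^sub>R b) \<partial>lborel)
         - 2 * (\<integral>v. q v * \<theta> v \<partial>lborel)) / h n"
      using i tr[of "h n"] tr[of "- h n"] by simp
    also have "\<dots> = (\<integral>v. (q v * \<theta> (v - h n *\<^sub>R b) + q v * \<theta> (v + h n *\<^sub>R b) - 2 * (q v * \<theta> v)) / h n \<partial>lborel)"
      using i by simp
    also have "\<dots> = integral\<^sup>L lborel (G n)"
      using h_pos[of n] by (intro Bochner_Integration.integral_cong) (auto simp: G_def field_simps)
    finally show ?thesis .
  qed
  have "(\<lambda>n. integral\<^sup>L lborel (G n)) \<longlonglongrightarrow> integral\<^sup>L lborel (\<lambda>v :: 'a. 0 :: real)"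
  proof (rule integral_dominated_convergence)
    show "integrable lborel (\<lambda>v. (r + 1) / \<rho> * (2 * L) * indicator (cball 0 (r + 1)) v :: real)"
      by (intro integrable_mult_right integrable_real_indicator)
        (use emeasure_lborel_cball_finite in \<open>auto simp: less_top[symmetric]\<close>)
    show "AE v in lborel. (\<lambda>n. G n v) \<longlonglongrightarrow> 0"
    proof (rule AE_I2)
      fix v
      have d: "\<theta> differentiable at v" using sm by (rule smooth_differentiable)
      have h1: "filterlim h (at 0) sequentially"
        using h_lim h_pos by (auto simp: filterlim_at intro!: always_eventually less_imp_neq[symmetric])
      have h2: "filterlim (\<lambda>n. - h n) (at 0) sequentially"
        using tendsto_minus[OF h_lim] h_pos by (auto simp: filterlim_at intro!: always_eventually less_imp_neq[symmetric])
      \<comment> \<open>Written with the step - h, the backward quotient converges to the same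
        partial derivative as the forward one, and the two cancel.\<close>
      have "(\<lambda>n. - ((\<theta> (v + (- h n) *\<^sub>R b) - \<theta> v) / (- h n)) + (\<theta> (v + h n *\<^sub>R b) - \<theta> v) / h n) \<longlonglongrightarrow>
          - partial b \<theta> v + partial b \<theta> v"
        by (intro tendsto_add tendsto_minus difference_quotient_tendsto d h1 h2)
      then have "(\<lambda>n. q v * ((\<theta> (v - h n *\<^sub>R b) - \<theta> v) / h n + (\<theta> (v + h n *\<^sub>R b) - \<theta> v) / h n)) \<longlonglongrightarrow> q v * 0"
        by (intro tendsto_mult tendsto_const) simp
      then show "(\<lambda>n. G n v) \<longlonglongrightarrow> 0"
        by (simp add: G_def)
    qed
    show "AE v in lborel. norm (G n v) \<le> (r + 1) / \<rho> * (2 * L) * indicator (cball 0 (r + 1)) v" for n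
    proof (rule AE_I2)
      fix v :: 'a
      show "norm (G n v) \<le> (r + 1) / \<rho> * (2 * L) * indicator (cball 0 (r + 1)) v"
      proof (cases "v \<in> cball 0 (r + 1)")
        case True
        have lip: "\<bar>\<theta> (v + t *\<^sub>R b) - \<theta> v\<bar> \<le> L * \<bar>t\<bar>" for t
          by (rule lipschitz_along[OF smooth_differentiable[OF sm] L(2)])
        have "\<bar>(\<theta> (v - h n *\<^sub>R b) - \<theta> v) / h n\<bar> \<le> L" "\<bar>(\<theta> (v + h n *\<^sub>R b) - \<theta> v) / h n\<bar> \<le> L"
          using lip[of "- h n"] lip[of "h n"] h_pos[of n] by (auto simp: field_simps)
        then have "\<bar>(\<theta> (v - h n *\<^sub>R b) - \<theta> v) / h n + (\<theta> (v + h n *\<^sub>R b) - \<theta> v) / h n\<bar> \<le> 2 * L"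
          by linarith
        moreover have "q v \<le> (r + 1) / \<rho>"
          using True \<rho>(1) by (intro order_trans[OF q_le_norm] divide_right_mono) auto
        ultimately have "norm (G n v) \<le> (r + 1) / \<rho> * (2 * L)"
          unfolding G_def real_norm_def abs_mult using q_nonneg[of v] r \<rho>(1) by (intro mult_mono) auto
        then show ?thesis using True by simp
      next
        case False
        then have "\<theta> v = 0" "\<theta> (v - h n *\<^sub>R b) = 0" "\<theta> (v + h n *\<^sub>R b) = 0"
          using shift0[OF False, of 0] shift0[OF False hb(2)] shift0[OF False hb(1)] by simp_all
        then show ?thesis using False by (simp add: G_def)
      qed
    qed
  qed (unfold G_def, measurable)
  then show ?thesis
    unfolding \<theta>_def[symmetric] eq by simp
qed

text \<open>The gaps decrease to a limit e \<ge> 0 that lies below each of them, so the integral of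
  e against a bump is at most the limit 0 of the integrals of the gaps. Bumps of growing radius
  exhaust the space.\<close>

lemma gap_AE_tendsto_0:
  assumes b: "b \<in> Basis"
  shows "AE v in lborel. (\<lambda>n. gap b n v) \<longlonglongrightarrow> 0"
proof -
  have [measurable]: "gap b n \<in> borel_measurable borel" for n
    unfolding gap_def by measurable
  define e where "e v = lim (\<lambda>n. gap b n v)" for v
  have [measurable]: "e \<in> borel_measurable borel"
    unfolding e_def by measurable
  have conv: "(\<lambda>n. gap b n v) \<longlonglongrightarrow> e v" for v
  proof -
    have "convergent (\<lambda>n. gap b n v)"
    proof -
      have "decseq (\<lambda>n. gap b n v)"
        by (simp add: decseq_def gap_antimono)
      then show ?thesis
        unfolding convergent_def using decseq_convergent[of "\<lambda>n. gap b n v" 0] gap_nonneg by metis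
    qed
    then show ?thesis by (simp add: e_def convergent_LIMSEQ_iff)
  qed
  have e0: "0 \<le> e v" for v
    by (rule LIMSEQ_le_const[OF conv]) (use gap_nonneg in auto)
  have e_le: "e v \<le> gap b n v" for v n
    by (rule LIMSEQ_le_const2[OF conv], rule exI[of _ n]) (simp add: gap_antimono)
  have "AE v in lborel. v \<in> ball 0 (real (Suc k)) \<longrightarrow> e v = 0" for k
  proof -
    define \<theta> where "\<theta> = bump (0::'a) (real (Suc k))"
    have [measurable]: "\<theta> \<in> borel_measurable borel"
      unfolding \<theta>_def by (intro smooth_measurable smooth_bump)
    have \<theta>: "0 \<le> \<theta> v" "\<bar>\<theta> v\<bar> \<le> 1" for v
      by (auto simp: \<theta>_def bump_nonneg bump_le_1)
    have \<theta>0: "\<theta> v = 0" if "v \<notin> cball 0 (real (Suc k))" for v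
      unfolding \<theta>_def by (rule bump_zero) (use that in auto)
    have i: "integrable lborel (\<lambda>v. f v * \<theta> v)"
      if [measurable]: "f \<in> borel_measurable borel" and f: "\<And>v. 0 \<le> f v" "\<And>v. f v \<le> 2 / \<rho>" for f :: "'a \<Rightarrow> real"
    proof (rule integrable_lborel_bounded_support)
      show "\<bar>f v * \<theta> v\<bar> \<le> 2 / \<rho> * 1" for v
        unfolding abs_mult using f[of v] \<theta>[of v] \<rho>(1) by (intro mult_mono) auto
    qed (use \<theta>0 in auto)
    have ib: "integrable lborel (\<lambda>v. gap b n v * \<theta> v)" for n
      using b by (intro i) (auto simp: gap_nonneg gap_bound)
    have ie: "integrable lborel (\<lambda>v. e v * \<theta> v)"
      using e0 order_trans[OF e_le gap_bound] b by (intro i) auto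
    have "integral\<^sup>L lborel (\<lambda>v. e v * \<theta> v) \<le> (\<integral>v. gap b n v * \<theta> v \<partial>lborel)" for n
      using e_le \<theta>(1) by (intro integral_mono[OF ie ib] mult_right_mono)
    then have "integral\<^sup>L lborel (\<lambda>v. e v * \<theta> v) \<le> 0"
      using gap_integral_tendsto_0[OF b, of "real (Suc k)"] unfolding \<theta>_def[symmetric]
      by (intro LIMSEQ_le_const) auto
    moreover have "0 \<le> integral\<^sup>L lborel (\<lambda>v. e v * \<theta> v)"
      using e0 \<theta>(1) by (intro integral_nonneg_AE) auto
    ultimately have "AE v in lborel. e v * \<theta> v = 0"
      using ie e0 \<theta>(1) by (subst integral_nonneg_eq_0_iff_AE[symmetric]) auto
    then show ?thesis
    proof eventually_elim
      case (elim v)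
      have "0 < \<theta> v" if "v \<in> ball 0 (real (Suc k))"
        unfolding \<theta>_def by (rule bump_pos) (use that in simp)
      with elim show ?case by auto
    qed
  qed
  then have "AE v in lborel. \<forall>k. v \<in> ball 0 (real (Suc k)) \<longrightarrow> e v = 0"
    unfolding AE_all_countable by blast
  then show ?thesis
  proof eventually_elim
    case (elim v)
    obtain k where "norm v < real k" using reals_Archimedean2 by blast
    then have "v \<in> ball 0 (real (Suc k))" by simp
    then have "e v = 0" using elim by blast
    with conv[of v] show ?case by simp
  qed
qed

text \<open>The derivative from the left, which convexity provides at every point, so that the
  gradient of the gauge is represented by total Borel functions. It agrees with the derivative from
  the right where the gap tends to 0.\<close>

definition D :: "'a \<Rightarrow> 'a \<Rightarrow> real" where
  "D b v = lim (\<lambda>n. (q v - q (v - h n *\<^sub>R b)) / h n)"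

lemma D_measurable [measurable]: "D b \<in> borel_measurable borel"
  unfolding D_def by measurable

lemma D_tendsto:
  assumes "norm b = 1"
  shows "(\<lambda>n. (q v - q (v - h n *\<^sub>R b)) / h n) \<longlonglongrightarrow> D b v"
proof -
  define f where "f n = (q v - q (v - h n *\<^sub>R b)) / h n" for n
  have f_le: "\<bar>f n\<bar> \<le> 1 / \<rho>" for n
    using q_lipschitz[of v "v - h n *\<^sub>R b"] assms h_pos[of n] \<rho>(1) by (simp add: f_def field_simps)
  have "incseq f"
  proof (rule incseq_SucI)
    fix n
    have "(q (v + h (Suc n) *\<^sub>R (- b)) - q v) / h (Suc n) \<le> (q (v + h n *\<^sub>R (- b)) - q v) / h n"
      by (intro q_secant_mono h_pos h_mono) simp
    then show "f n \<le> f (Suc n)"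
      by (simp add: f_def diff_divide_distrib)
  qed
  moreover have "f n \<le> 1 / \<rho>" for n
    using f_le[of n] by linarith
  ultimately have "convergent f"
    unfolding convergent_def using incseq_convergent[of f "1 / \<rho>"] by metis
  then show ?thesis
    by (simp add: D_def f_def[abs_def] convergent_LIMSEQ_iff)
qed

lemma D_bound:
  assumes "norm b = 1"
  shows "\<bar>D b v\<bar> \<le> 1 / \<rho>"
proof (rule LIMSEQ_le_const2[OF tendsto_rabs[OF D_tendsto[OF assms]]], intro exI allI impI)
  fix n
  show "\<bar>(q v - q (v - h n *\<^sub>R b)) / h n\<bar> \<le> 1 / \<rho>"
    using q_lipschitz[of v "v - h n *\<^sub>R b"] assms h_pos[of n] \<rho>(1) by (simp add: field_simps)
qed

text \<open>Each outer normal at the projected point gives a slope between the left and the right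
  derivative of the gauge; where these agree, the slope is determined.\<close>

lemma D_eq_normal:
  assumes b: "norm b = 1" and gap: "(\<lambda>n. gap b n (x - a)) \<longlonglongrightarrow> 0" and x: "x \<noteq> a"
    and n: "outer_unit_normal \<Omega> (\<pi> x) n"
  shows "D b (x - a) = n \<bullet> b / (n \<bullet> (\<pi> x - a))"
proof (rule antisym)
  let ?g = "n \<bullet> b / (n \<bullet> (\<pi> x - a))"
  have lo: "(q (x - a) - q (x - a - h k *\<^sub>R b)) / h k \<le> ?g" for k
    using normal_supports[OF n x, of "- h k" b] h_pos[of k] by (simp add: field_simps)
  have hi: "?g \<le> (q (x - a + h k *\<^sub>R b) - q (x - a)) / h k" for k
    using normal_supports[OF n x, of "h k" b] h_pos[of k] by (simp add: field_simps)
  show "D b (x - a) \<le> ?g"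
    by (rule LIMSEQ_le_const2[OF D_tendsto[OF b]]) (use lo in auto)
  have "(\<lambda>k. gap b k (x - a) + (q (x - a) - q (x - a - h k *\<^sub>R b)) / h k) \<longlonglongrightarrow> 0 + D b (x - a)"
    by (intro tendsto_add gap D_tendsto[OF b])
  then have "?g \<le> 0 + D b (x - a)"
    by (rule LIMSEQ_le_const) (use hi in \<open>auto simp: gap_eq\<close>)
  then show "?g \<le> D b (x - a)" by simp
qed

lemma AE_lborel_translate:
  assumes "AE v in lborel. P v"
  shows "AE x in lborel. P (x - a)"
proof -
  have "AE x in lborel. P ((+) (- a) x)"
    by (rule AE_distrD[where f = "(+) (- a)" and P = P and M' = borel]) (simp, subst lborel_distr_plus, rule assms)
  then show ?thesis by simp
qed

lemma AE_D_eq_normal: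
  "AE x in lborel. x \<noteq> a \<longrightarrow> (\<forall>n. outer_unit_normal \<Omega> (\<pi> x) n \<longrightarrow>
     (\<forall>b\<in>Basis. D b (x - a) = n \<bullet> b / (n \<bullet> (\<pi> x - a))))"
proof -
  have "AE v in lborel. \<forall>b\<in>Basis. (\<lambda>n. gap b n v) \<longlonglongrightarrow> 0"
    using gap_AE_tendsto_0 by (subst AE_finite_all) auto
  from AE_lborel_translate[OF this] show ?thesis
    by eventually_elim (auto intro!: D_eq_normal)
qed

section \<open>The divergence theorem as an estimate in terms of the Hausdorff measure\<close>

definition layer :: "real \<Rightarrow> 'a set" where
  "layer \<epsilon> = {x. 1 - \<epsilon> < q (x - a) \<and> q (x - a) < 1}"

lemma layer_sets [measurable]: "layer \<epsilon> \<in> sets borel"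
  unfolding layer_def by measurable

lemma \<pi>_measurable [measurable]: "\<pi> \<in> borel_measurable borel"
  unfolding \<pi>_def by measurable

lemma layer_ne: "x \<in> layer \<epsilon> \<Longrightarrow> \<epsilon> \<le> 1 \<Longrightarrow> x \<noteq> a"
  using q_zero by (auto simp: layer_def)

lemma layer_\<pi>: "x \<in> layer \<epsilon> \<Longrightarrow> \<epsilon> \<le> 1 \<Longrightarrow> x - a = q (x - a) *\<^sub>R (\<pi> x - a)"
  using layer_ne[of x \<epsilon>] q_pos[of "x - a"] by (simp add: \<pi>_def)

lemma norm_frontier_le: "y \<in> closure \<Omega> \<Longrightarrow> norm (y - a) \<le> R"
proof -
  have "\<Omega> \<subseteq> cball a R"
    using R by (auto simp: dist_norm norm_minus_commute)
  then have "closure \<Omega> \<subseteq> cball a R"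
    by (intro closure_minimal) auto
  then show "y \<in> closure \<Omega> \<Longrightarrow> norm (y - a) \<le> R"
    by (auto simp: dist_norm norm_minus_commute)
qed

lemma \<Omega>_lmeasurable: "\<Omega> \<in> lmeasurable"
  using bounded op by (simp add: lmeasurable_open)

section \<open>Volume of the layer and of its part over a boundary set\<close>

definition K1 :: real where "K1 = real DIM('a) * measure lebesgue \<Omega>"

lemma K1_nonneg: "0 \<le> K1"
  by (simp add: K1_def)

text \<open>Below the gauge level 1 - \<epsilon> lies a copy of \<Omega> contracted by 1 -
  \<epsilon>, of measure (1 - \<epsilon>)^d |\<Omega>|. Bernoulli's inequality bounds the rest by d
  \<epsilon> |\<Omega>|, whence \<open>K1\<close>.\<close>

lemma emeasure_layer:
  assumes \<epsilon>: "0 < \<epsilon>" "\<epsilon> < 1"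
  shows "emeasure lborel (layer \<epsilon>) \<le> ennreal (K1 * \<epsilon>)"
proof -
  define S where "S = (\<lambda>x. (1 - \<epsilon>) *\<^sub>R x + \<epsilon> *\<^sub>R a) ` \<Omega>"
  have S: "S = {x. q (x - a) < 1 - \<epsilon>}"
  proof (intro set_eqI iffI)
    fix x assume "x \<in> S"
    then obtain y where y: "y \<in> \<Omega>" "x = (1 - \<epsilon>) *\<^sub>R y + \<epsilon> *\<^sub>R a"
      by (auto simp: S_def)
    have "x - a = (1 - \<epsilon>) *\<^sub>R (y - a)"
      by (simp add: y(2) algebra_simps)
    then have "q (x - a) = (1 - \<epsilon>) * q (y - a)"
      using \<epsilon> q_scale by simp
    also have "\<dots> < (1 - \<epsilon>) * 1"
      using y(1) \<epsilon> unfolding mem_iff_q by (intro mult_strict_left_mono) auto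
    finally show "x \<in> {x. q (x - a) < 1 - \<epsilon>}" by simp
  next
    fix x assume "x \<in> {x. q (x - a) < 1 - \<epsilon>}"
    then have "a + (1 / (1 - \<epsilon>)) *\<^sub>R (x - a) \<in> \<Omega>"
      using q_less_iff[of "1 - \<epsilon>" "x - a"] \<epsilon> by simp
    moreover have "x = (1 - \<epsilon>) *\<^sub>R (a + (1 / (1 - \<epsilon>)) *\<^sub>R (x - a)) + \<epsilon> *\<^sub>R a"
      using \<epsilon> by (simp add: algebra_simps)
    ultimately show "x \<in> S"
      unfolding S_def by blast
  qed
  have Sm: "S \<in> sets borel"
    unfolding S by measurable
  have SO: "S \<subseteq> \<Omega>"
  proof
    fix x assume "x \<in> S"
    with \<epsilon> show "x \<in> \<Omega>"
      unfolding S mem_iff_q[of x] by simp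
  qed
  have d: "measure lebesgue S = (1 - \<epsilon>) ^ DIM('a) * measure lebesgue \<Omega>"
    unfolding S_def using \<epsilon> measure_lebesgue_affine[of "1 - \<epsilon>" "\<epsilon> *\<^sub>R a" \<Omega>] by simp
  have "emeasure lborel (layer \<epsilon>) = emeasure lebesgue (layer \<epsilon>)"
    by simp
  also have "\<dots> \<le> emeasure lebesgue (\<Omega> - S)"
  proof (rule emeasure_mono)
    show "layer \<epsilon> \<subseteq> \<Omega> - S"
    proof
      fix x assume "x \<in> layer \<epsilon>"
      then show "x \<in> \<Omega> - S"
        using mem_iff_q[of x] by (simp add: layer_def S)
    qed
    show "\<Omega> - S \<in> sets lebesgue"
      using Sm op by auto
  qed
  also have "\<dots> = ennreal (measure lebesgue (\<Omega> - S))"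
    using \<Omega>_lmeasurable Sm by (intro emeasure_eq_measure2 fmeasurable_Diff) auto
  also have "measure lebesgue (\<Omega> - S) = measure lebesgue \<Omega> - measure lebesgue S"
    using \<Omega>_lmeasurable Sm SO by (intro measurable_measure_Diff) auto
  also have "\<dots> = (1 - (1 - \<epsilon>) ^ DIM('a)) * measure lebesgue \<Omega>"
    by (simp add: d algebra_simps)
  also have "\<dots> \<le> (real DIM('a) * \<epsilon>) * measure lebesgue \<Omega>"
    using Bernoulli_inequality[of "- \<epsilon>" "DIM('a)"] \<epsilon> by (intro mult_right_mono) auto
  also have "\<dots> = K1 * \<epsilon>"
    by (simp add: K1_def)
  finally show ?thesis
    by (simp add: ennreal_leI)
qed

text \<open>At most \<epsilon> (R + 2) / r balls of radius 2 r, each of volume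
  \<open>unit_ball_vol\<close> times (2 r)^d, have total volume at most K2 \<epsilon>
  r^(d-1).\<close>

definition K2 :: real where
  "K2 = (R + 2) * unit_ball_vol (real DIM('a)) * 2 ^ DIM('a)"

lemma K2_pos: "0 < K2"
  using R_pos by (simp add: K2_def)

text \<open>
  The part of the layer lying over a boundary piece of diameter \<open>r\<close> is covered by a tube of radius
  \<open>r\<close> around a segment of length at most \<open>\<epsilon> R\<close>, hence by about \<open>\<epsilon> R / r\<close> balls of radius \<open>2 r\<close>.
\<close>

lemma layer_over_piece:
  assumes \<epsilon>: "0 < \<epsilon>" "\<epsilon> \<le> 1" and y0: "y0 \<in> closure \<Omega>" and r: "0 < r" "r \<le> 2 * \<epsilon>"
    and P: "\<And>y. y \<in> P \<Longrightarrow> dist y y0 \<le> r"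
  shows "\<exists>T\<in>sets borel. {x \<in> layer \<epsilon>. \<pi> x \<in> P} \<subseteq> T \<and> emeasure lborel T \<le> ennreal (K2 * \<epsilon> * r ^ (DIM('a) - 1))"
proof (intro bexI conjI)
  define N where "N = nat \<lfloor>\<epsilon> * R / r\<rfloor>"
  \<comment> \<open>Centres on the segment from y0 towards \<open>a\<close>, spaced by r / R in the
    ray parameter and so by at most r in space, since the ray has length at most
    \<open>R\<close>.\<close>
  define c where "c j = a + (1 - real j * (r / R)) *\<^sub>R (y0 - a)" for j
  define T where "T = (\<Union>j\<le>N. cball (c j) (2 * r))"
  have y0R: "norm (y0 - a) \<le> R"
    using y0 by (rule norm_frontier_le)
  show "T \<in> sets borel"
    unfolding T_def by (intro sets.finite_UN) auto
  show "{x \<in> layer \<epsilon>. \<pi> x \<in> P} \<subseteq> T"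
  proof
    fix x assume "x \<in> {x \<in> layer \<epsilon>. \<pi> x \<in> P}"
    then have x: "x \<in> layer \<epsilon>" "\<pi> x \<in> P" by auto
    define s where "s = q (x - a)"
    have s: "1 - \<epsilon> < s" "s < 1" "0 \<le> s"
      using x(1) q_nonneg[of "x - a"] by (auto simp: layer_def s_def)
    define j where "j = nat \<lfloor>(1 - s) * R / r\<rfloor>"
    have arg0: "0 \<le> (1 - s) * R / r"
      using s R_pos r by simp
    have "(1 - s) * R / r \<le> \<epsilon> * R / r"
      using s R_pos r by (intro divide_right_mono mult_right_mono) auto
    then have jN: "j \<le> N"
      unfolding j_def N_def by (intro nat_mono floor_mono)
    have j: "real j \<le> (1 - s) * R / r" "(1 - s) * R / r < real j + 1"
      using arg0 unfolding j_def by linarith+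
    have "real j * (r / R) \<le> 1 - s"
      using j(1) r R_pos by (simp add: field_simps)
    moreover have "1 - s < (real j + 1) * (r / R)"
      using j(2) r R_pos by (simp add: field_simps)
    moreover have "(real j + 1) * (r / R) = real j * (r / R) + r / R"
      by (simp only: distrib_right mult_1)
    ultimately have sj: "\<bar>s - (1 - real j * (r / R))\<bar> \<le> r / R"
      unfolding abs_le_iff by linarith
    \<comment> \<open>The offset from the centre splits into a sideways part, at most r because
      \<pi> x is near y0, and a part along the ray, at most (r / R) R = r.\<close>
    have "x - c j = s *\<^sub>R (\<pi> x - y0) + (s - (1 - real j * (r / R))) *\<^sub>R (y0 - a)"
    proof -
      have "x - c j = s *\<^sub>R (\<pi> x - a) - (1 - real j * (r / R)) *\<^sub>R (y0 - a)"
        using layer_\<pi>[OF x(1) \<epsilon>(2)] by (simp add: c_def s_def algebra_simps)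
      then show ?thesis by (simp add: algebra_simps)
    qed
    then have "norm (x - c j) \<le> norm (s *\<^sub>R (\<pi> x - y0)) + norm ((s - (1 - real j * (r / R))) *\<^sub>R (y0 - a))"
      by (metis norm_triangle_ineq)
    also have "norm (s *\<^sub>R (\<pi> x - y0)) \<le> 1 * r"
      using s P[OF x(2)] by (simp only: norm_scaleR, intro mult_mono) (auto simp: dist_norm)
    also have "norm ((s - (1 - real j * (r / R))) *\<^sub>R (y0 - a)) \<le> (r / R) * R"
      using sj y0R R_pos r by (simp only: norm_scaleR, intro mult_mono) auto
    finally have "x \<in> cball (c j) (2 * r)"
      using R_pos by (simp add: dist_norm norm_minus_commute)
    then show "x \<in> T"
      using jN by (auto simp: T_def)
  qed
  have d: "r ^ DIM('a) = r * r ^ (DIM('a) - 1)"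
    using power_minus_mult[of "DIM('a)" r] by (simp add: mult.commute)
  have "emeasure lborel T \<le> (\<Sum>j\<le>N. emeasure lborel (cball (c j) (2 * r)))"
    unfolding T_def by (intro emeasure_subadditive_finite) auto
  also have "\<dots> = (\<Sum>j\<le>N. ennreal (unit_ball_vol (real DIM('a)) * (2 * r) ^ DIM('a)))"
    using r by (intro sum.cong) (auto simp: emeasure_cball)
  also have "\<dots> = ennreal (real (N + 1) * (unit_ball_vol (real DIM('a)) * (2 * r) ^ DIM('a)))"
    using r by (simp add: ennreal_mult ennreal_of_nat_eq_real_of_nat)
  also have "\<dots> \<le> ennreal (K2 * \<epsilon> * r ^ (DIM('a) - 1))"
  proof (rule ennreal_leI)
    have "real N \<le> \<epsilon> * R / r"
      using \<epsilon> R_pos r unfolding N_def by simp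
    \<comment> \<open>The condition r \<le> 2 \<epsilon> absorbs the additional ball counted by N +
      1; this is the origin of the summand 2 in \<open>K2\<close>.\<close>
    moreover have "1 \<le> 2 * \<epsilon> / r"
      using r by simp
    ultimately have "real (N + 1) \<le> \<epsilon> * (R + 2) / r"
      by (simp add: field_simps add_divide_distrib)
    then have "real (N + 1) * (unit_ball_vol (real DIM('a)) * (2 * r) ^ DIM('a)) \<le>
        (\<epsilon> * (R + 2) / r) * (unit_ball_vol (real DIM('a)) * (2 * r) ^ DIM('a))"
      using r by (intro mult_right_mono) auto
    also have "\<dots> = K2 * \<epsilon> * r ^ (DIM('a) - 1)"
      using r by (simp add: K2_def power_mult_distrib d)
    finally show "real (N + 1) * (unit_ball_vol (real DIM('a)) * (2 * r) ^ DIM('a)) \<le> K2 * \<epsilon> * r ^ (DIM('a) - 1)" .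
  qed
  finally show "emeasure lborel T \<le> ennreal (K2 * \<epsilon> * r ^ (DIM('a) - 1))" .
qed

text \<open>Converts the power d - 1 of a diameter into the Hausdorff weight, which contains half
  the diameter and the volume of the unit ball of dimension d - 1.\<close>

definition K3 :: real where
  "K3 = K2 * 2 ^ (DIM('a) - 1) / unit_ball_vol (real (DIM('a) - 1))"

lemma K3_pos: "0 < K3"
  using K2_pos by (simp add: K3_def)

text \<open>The diameter of \<open>C\<close> may be 0, while balls need a positive radius. The
  radius is therefore taken slightly above the diameter, so close that the excess costs at most
  \<open>e\<close> and so that it stays below 2 \<epsilon>.\<close>

lemma layer_over_set_weight:
  assumes \<epsilon>: "0 < \<epsilon>" "\<epsilon> \<le> 1" and E: "E \<subseteq> frontier \<Omega>" and C: "bounded C" "diameter C \<le> \<epsilon>" and e: "0 < e"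
  shows "\<exists>T\<in>sets borel. {x \<in> layer \<epsilon>. \<pi> x \<in> C \<inter> E} \<subseteq> T \<and>
    emeasure lborel T \<le> ennreal (K3 * \<epsilon>) * hausdorff_weight (DIM('a) - 1) C + ennreal e"
proof (cases "C \<inter> E = {}")
  case True
  then show ?thesis by (intro bexI[of _ "{}"]) auto
next
  case False
  then obtain y0 where y0: "y0 \<in> C" "y0 \<in> E" by blast
  define \<delta> where "\<delta> = diameter C"
  have \<delta>: "0 \<le> \<delta>" "\<delta> \<le> \<epsilon>"
    using C diameter_ge_0 by (auto simp: \<delta>_def)
  have "((\<lambda>r. K2 * \<epsilon> * r ^ (DIM('a) - 1)) \<longlongrightarrow> K2 * \<epsilon> * \<delta> ^ (DIM('a) - 1)) (at_right \<delta>)"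
    by (intro tendsto_intros)
  then have "\<forall>\<^sub>F r in at_right \<delta>. K2 * \<epsilon> * r ^ (DIM('a) - 1) < K2 * \<epsilon> * \<delta> ^ (DIM('a) - 1) + e"
    using e by (intro order_tendstoD(2)) auto
  moreover have "\<forall>\<^sub>F r in at_right \<delta>. \<delta> < r \<and> r < 2 * \<epsilon>"
    using eventually_at_right_real[of \<delta> "2 * \<epsilon>"] \<delta> \<epsilon> by simp
  ultimately have "\<forall>\<^sub>F r in at_right \<delta>. K2 * \<epsilon> * r ^ (DIM('a) - 1) < K2 * \<epsilon> * \<delta> ^ (DIM('a) - 1) + e \<and> \<delta> < r \<and> r < 2 * \<epsilon>"
    by eventually_elim auto
  from eventually_happens'[OF trivial_limit_at_right_real this]
  obtain r where r: "K2 * \<epsilon> * r ^ (DIM('a) - 1) < K2 * \<epsilon> * \<delta> ^ (DIM('a) - 1) + e" "\<delta> < r" "r < 2 * \<epsilon>"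
    by blast
  have "dist y y0 \<le> r" if "y \<in> C \<inter> E" for y
    using diameter_bounded_bound[OF C(1), of y y0] that y0 r(2) by (auto simp: \<delta>_def)
  moreover have "y0 \<in> closure \<Omega>"
    using y0 E by (auto simp: frontier_def)
  ultimately obtain T where T: "T \<in> sets borel" "{x \<in> layer \<epsilon>. \<pi> x \<in> C \<inter> E} \<subseteq> T"
      "emeasure lborel T \<le> ennreal (K2 * \<epsilon> * r ^ (DIM('a) - 1))"
    using layer_over_piece[OF \<epsilon>, of y0 r "C \<inter> E"] r \<delta> by auto
  have "hausdorff_weight (DIM('a) - 1) C = ennreal (unit_ball_vol (real (DIM('a) - 1)) * (\<delta> / 2) ^ (DIM('a) - 1))"
    using y0 by (auto simp: hausdorff_weight_def \<delta>_def)
  then have "ennreal (K3 * \<epsilon>) * hausdorff_weight (DIM('a) - 1) C =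
      ennreal (K3 * \<epsilon> * (unit_ball_vol (real (DIM('a) - 1)) * (\<delta> / 2) ^ (DIM('a) - 1)))"
    using \<delta> \<epsilon> K3_pos by (simp only:) (intro ennreal_mult[symmetric], auto)
  also have "K3 * \<epsilon> * (unit_ball_vol (real (DIM('a) - 1)) * (\<delta> / 2) ^ (DIM('a) - 1)) = K2 * \<epsilon> * \<delta> ^ (DIM('a) - 1)"
  proof -
    define \<omega> where "\<omega> = unit_ball_vol (real (DIM('a) - 1))"
    have "\<omega> \<noteq> 0" unfolding \<omega>_def using unit_ball_vol_pos[of "real (DIM('a) - 1)"] by linarith
    then show ?thesis
      unfolding K3_def \<omega>_def[symmetric] by (simp add: power_divide)
  qed
  finally have "ennreal (K3 * \<epsilon>) * hausdorff_weight (DIM('a) - 1) C = ennreal (K2 * \<epsilon> * \<delta> ^ (DIM('a) - 1))" .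
  then have "ennreal (K3 * \<epsilon>) * hausdorff_weight (DIM('a) - 1) C + ennreal e = ennreal (K2 * \<epsilon> * \<delta> ^ (DIM('a) - 1) + e)"
    using e \<delta> \<epsilon> K2_pos by (simp add: ennreal_plus)
  also have "\<dots> \<ge> emeasure lborel T"
    using order_trans[OF T(3) ennreal_leI[OF less_imp_le[OF r(1)]]] .
  finally show ?thesis using T by blast
qed

text \<open>The pieces of a cover are summed with tolerances e / 2^(i+1). Only covers by sets of
  diameter at most \<epsilon> enter, so the bound is by the content at that scale, which the outer
  measure dominates.\<close>

lemma layer_over_set:
  assumes \<epsilon>: "0 < \<epsilon>" "\<epsilon> \<le> 1" and E: "E \<subseteq> frontier \<Omega>"
  shows "emeasure lborel {x \<in> layer \<epsilon>. \<pi> x \<in> E} \<le> ennreal (K3 * \<epsilon>) * hausdorff_outer (DIM('a) - 1) E"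
proof -
  define s where "s = DIM('a) - 1"
  have cover: "emeasure lborel {x \<in> layer \<epsilon>. \<pi> x \<in> E} \<le> ennreal (K3 * \<epsilon>) * (\<Sum>i. hausdorff_weight s (C i))"
    if C: "E \<subseteq> (\<Union>i. C i)" "\<And>i. bounded (C i)" "\<And>i. diameter (C i) \<le> \<epsilon>" for C :: "nat \<Rightarrow> 'a set"
  proof (rule ennreal_le_epsilon)
    fix e :: real assume "0 < e"
    define Q where "Q i T \<longleftrightarrow> T \<in> sets borel \<and> {x \<in> layer \<epsilon>. \<pi> x \<in> C i \<inter> E} \<subseteq> T \<and>
        emeasure lborel T \<le> ennreal (K3 * \<epsilon>) * hausdorff_weight s (C i) + ennreal (e * (1 / 2) ^ Suc i)" for i T
    have "\<exists>T. Q i T" for i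
    proof -
      have "0 < e * (1 / 2) ^ Suc i" using \<open>0 < e\<close> by simp
      from layer_over_set_weight[OF \<epsilon> E C(2,3) this, of i] show ?thesis
        by (auto simp: Q_def s_def)
    qed
    then obtain T where "\<And>i. Q i (T i)"
      using choice[of Q] by blast
    then have T: "\<And>i. T i \<in> sets borel" "\<And>i. {x \<in> layer \<epsilon>. \<pi> x \<in> C i \<inter> E} \<subseteq> T i"
        "\<And>i. emeasure lborel (T i) \<le> ennreal (K3 * \<epsilon>) * hausdorff_weight s (C i) + ennreal (e * (1 / 2) ^ Suc i)"
      unfolding Q_def by blast+
    have "emeasure lborel {x \<in> layer \<epsilon>. \<pi> x \<in> E} \<le> emeasure lborel (\<Union>i. T i)"
    proof (rule emeasure_mono)
      show "{x \<in> layer \<epsilon>. \<pi> x \<in> E} \<subseteq> (\<Union>i. T i)"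
        using C(1) T(2) by blast
      show "(\<Union>i. T i) \<in> sets lborel"
        using T(1) by auto
    qed
    also have "\<dots> \<le> (\<Sum>i. emeasure lborel (T i))"
      using T(1) by (intro emeasure_subadditive_countably) auto
    also have "\<dots> \<le> (\<Sum>i. ennreal (K3 * \<epsilon>) * hausdorff_weight s (C i) + ennreal (e * (1 / 2) ^ Suc i))"
      using T(3) by (intro suminf_le) auto
    also have "\<dots> = (\<Sum>i. ennreal (K3 * \<epsilon>) * hausdorff_weight s (C i)) + (\<Sum>i. ennreal (e * (1 / 2) ^ Suc i))"
      by (intro suminf_add[symmetric]) auto
    also have "(\<Sum>i. ennreal (e * (1 / 2) ^ Suc i)) = ennreal e"
      using \<open>0 < e\<close> sums_mult[OF power_half_series, of e] by (intro suminf_ennreal_eq) auto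
    finally show "emeasure lborel {x \<in> layer \<epsilon>. \<pi> x \<in> E} \<le> ennreal (K3 * \<epsilon>) * (\<Sum>i. hausdorff_weight s (C i)) + ennreal e"
      by simp
  qed
  have K: "0 < ennreal (K3 * \<epsilon>)" "ennreal (K3 * \<epsilon>) \<noteq> \<infinity>"
    using K3_pos \<epsilon> by auto
  \<comment> \<open>Dividing by the finite positive constant allows the infimum over covers to be
    taken on the right.\<close>
  have "emeasure lborel {x \<in> layer \<epsilon>. \<pi> x \<in> E} / ennreal (K3 * \<epsilon>) \<le> hausdorff_pre s \<epsilon> E"
    unfolding hausdorff_pre_def
    by (intro INF_greatest divide_le_posI_ennreal[OF K(1)] cover) auto
  then have "ennreal (K3 * \<epsilon>) * (emeasure lborel {x \<in> layer \<epsilon>. \<pi> x \<in> E} / ennreal (K3 * \<epsilon>)) \<le>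
      ennreal (K3 * \<epsilon>) * hausdorff_pre s \<epsilon> E"
    by (intro mult_left_mono) auto
  also have "ennreal (K3 * \<epsilon>) * (emeasure lborel {x \<in> layer \<epsilon>. \<pi> x \<in> E} / ennreal (K3 * \<epsilon>)) = emeasure lborel {x \<in> layer \<epsilon>. \<pi> x \<in> E}"
    using K by (subst ennreal_times_divide, subst mult.commute) (intro ennreal_mult_divide_eq, auto)
  also have "ennreal (K3 * \<epsilon>) * hausdorff_pre s \<epsilon> E \<le> ennreal (K3 * \<epsilon>) * hausdorff_outer s E"
    using \<epsilon> by (intro mult_left_mono hausdorff_pre_le_outer) auto
  finally show ?thesis by (simp add: s_def)
qed

section \<open>Comparison of the layer with the surface measure along the radial projection\<close>

lemma emeasure_surface:
  assumes "A \<in> sets (surface \<Omega>)"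
  shows "emeasure (surface \<Omega>) A = hausdorff_outer (DIM('a) - 1) A" "A \<subseteq> frontier \<Omega>" "A \<in> sets borel"
proof -
  have fr: "frontier \<Omega> \<in> sets (borel :: 'a measure)" by simp
  have A: "A \<in> sets (restrict_space borel (frontier \<Omega>))"
    using assms sets_surface[of \<Omega>] bounded op by simp
  then show 1: "A \<subseteq> frontier \<Omega>" "A \<in> sets borel"
    by (auto simp: sets_restrict_space_iff)
  have sh: "sets (hausdorff (DIM('a) - 1) :: 'a measure) = sets borel"
    unfolding hausdorff_def using sets.sigma_sets_eq[of "borel :: 'a measure"] by (subst sets_measure_of) auto
  have "emeasure (surface \<Omega>) A = emeasure (hausdorff (DIM('a) - 1)) A"
    unfolding surface_def using 1 sh by (intro emeasure_restrict_space) (auto simp: hausdorff_def)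
  then show "emeasure (surface \<Omega>) A = hausdorff_outer (DIM('a) - 1) A"
    using emeasure_hausdorff[OF 1(2)] by simp
qed

text \<open>By the volume bound, a null set of the boundary has a null preimage in the layer, so
  almost everywhere statements can be pulled back along \<pi>.\<close>

lemma AE_layer_\<pi>:
  assumes P: "AE y in surface \<Omega>. P y" and \<epsilon>: "0 < \<epsilon>" "\<epsilon> \<le> 1"
  shows "AE x in lborel. x \<in> layer \<epsilon> \<longrightarrow> P (\<pi> x)"
proof -
  obtain N where N: "N \<in> null_sets (surface \<Omega>)" "{y \<in> space (surface \<Omega>). \<not> P y} \<subseteq> N"
    using P unfolding eventually_ae_filter by blast
  have NS: "N \<in> sets (surface \<Omega>)" "emeasure (surface \<Omega>) N = 0"
    using N(1) by auto
  note NB = emeasure_surface[OF NS(1)]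
  have "emeasure lborel {x \<in> layer \<epsilon>. \<pi> x \<in> N} = 0"
    using layer_over_set[OF \<epsilon> NB(2)] NS(2) NB(1) by simp
  moreover have "{x \<in> layer \<epsilon>. \<pi> x \<in> N} \<in> sets lborel"
    using NB(3) by measurable
  ultimately have "{x \<in> layer \<epsilon>. \<pi> x \<in> N} \<in> null_sets lborel"
    by auto
  then show ?thesis
  proof (rule AE_I')
    show "{x \<in> space lborel. \<not> (x \<in> layer \<epsilon> \<longrightarrow> P (\<pi> x))} \<subseteq> {x \<in> layer \<epsilon>. \<pi> x \<in> N}"
    proof
      fix x assume "x \<in> {x \<in> space lborel. \<not> (x \<in> layer \<epsilon> \<longrightarrow> P (\<pi> x))}"
      then have x: "x \<in> layer \<epsilon>" "\<not> P (\<pi> x)"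
        by auto
      then have "\<pi> x \<in> frontier \<Omega>"
        using layer_ne[OF _ \<epsilon>(2)] \<pi>_frontier by blast
      with x N(2) space_surface[of \<Omega>] bounded op show "x \<in> {x \<in> layer \<epsilon>. \<pi> x \<in> N}" by auto
    qed
  qed
qed

lemma \<pi>_measurable_surface:
  assumes "\<epsilon> \<le> 1"
  shows "\<pi> \<in> measurable (restrict_space lborel (layer \<epsilon>)) (surface \<Omega>)"
proof -
  have "\<pi> \<in> measurable (restrict_space lborel (layer \<epsilon>)) (restrict_space borel (frontier \<Omega>))"
  proof (rule measurable_restrict_space2)
    show "\<pi> \<in> space (restrict_space lborel (layer \<epsilon>)) \<rightarrow> frontier \<Omega>"
      using layer_ne[OF _ assms] \<pi>_frontier by (auto simp: space_restrict_space)
    show "\<pi> \<in> measurable (restrict_space lborel (layer \<epsilon>)) borel"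
      by (rule measurable_restrict_space1) simp
  qed
  then show ?thesis
    using measurable_cong_sets[OF refl sets_surface[of \<Omega>]] bounded op by blast
qed

text \<open>On sets this is \<open>layer_over_set\<close>: the image of Lebesgue measure on the
  layer under \<pi> is at most K3 \<epsilon> times the surface measure. The inequality of measures
  passes to integrals.\<close>

lemma nn_integral_layer_\<pi>:
  fixes f :: "'a \<Rightarrow> ennreal"
  assumes \<epsilon>: "0 < \<epsilon>" "\<epsilon> \<le> 1" and f: "f \<in> borel_measurable (surface \<Omega>)"
  shows "(\<integral>\<^sup>+x\<in>layer \<epsilon>. f (\<pi> x) \<partial>lborel) \<le> ennreal (K3 * \<epsilon>) * (\<integral>\<^sup>+y. f y \<partial>surface \<Omega>)"
proof -
  let ?L = "restrict_space lborel (layer \<epsilon>)"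
  define M where "M = distr ?L (surface \<Omega>) \<pi>"
  define N where "N = scale_measure (ennreal (K3 * \<epsilon>)) (surface \<Omega>)"
  have m: "\<pi> \<in> measurable ?L (surface \<Omega>)"
    using \<epsilon>(2) by (rule \<pi>_measurable_surface)
  have sets: "sets M = sets N"
    by (simp add: M_def N_def)
  have "\<forall>A\<in>sets M. emeasure M A \<le> emeasure N A"
  proof
    fix A assume "A \<in> sets M"
    then have A: "A \<in> sets (surface \<Omega>)" by (simp add: M_def)
    note AB = emeasure_surface[OF A]
    have "emeasure M A = emeasure ?L (\<pi> -` A \<inter> space ?L)"
      unfolding M_def using m A by (rule emeasure_distr)
    also have "\<pi> -` A \<inter> space ?L = {x \<in> layer \<epsilon>. \<pi> x \<in> A}"
      by (auto simp: space_restrict_space)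
    also have "emeasure ?L {x \<in> layer \<epsilon>. \<pi> x \<in> A} = emeasure lborel {x \<in> layer \<epsilon>. \<pi> x \<in> A}"
      by (rule emeasure_restrict_space) auto
    also have "\<dots> \<le> ennreal (K3 * \<epsilon>) * hausdorff_outer (DIM('a) - 1) A"
      by (rule layer_over_set[OF \<epsilon> AB(2)])
    finally show "emeasure M A \<le> emeasure N A"
      by (simp add: N_def AB(1))
  qed
  then have "M \<le> N"
    using le_measure[OF sets] by blast
  then have "nn_integral M f \<le> nn_integral N f"
    by (intro nn_integral_mono_measure) (simp_all add: M_def N_def)
  moreover have "nn_integral M f = (\<integral>\<^sup>+x\<in>layer \<epsilon>. f (\<pi> x) \<partial>lborel)"
    unfolding M_def using m f by (subst nn_integral_distr) (auto simp: nn_integral_restrict_space)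
  moreover have "nn_integral N f = ennreal (K3 * \<epsilon>) * (\<integral>\<^sup>+y. f y \<partial>surface \<Omega>)"
    unfolding N_def using f by (rule nn_integral_scale_measure)
  ultimately show ?thesis by simp
qed

subsection \<open>Cutting off near the boundary\<close>

text \<open>The outer \<open>max 0\<close> continues the function by 0 off \<Omega> and keeps it
  Lipschitz on the whole space, where the integration by parts takes place.\<close>

definition cutoff :: "real \<Rightarrow> 'a \<Rightarrow> real" where
  "cutoff \<epsilon> x = max 0 (min 1 ((1 - q (x - a)) / \<epsilon>))"

lemma cutoff_measurable [measurable]: "cutoff \<epsilon> \<in> borel_measurable borel"
  unfolding cutoff_def by measurable

lemma cutoff_bounds: "0 \<le> cutoff \<epsilon> x" "cutoff \<epsilon> x \<le> 1"
  by (auto simp: cutoff_def)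

lemma cutoff_outside: "x \<notin> \<Omega> \<Longrightarrow> 0 < \<epsilon> \<Longrightarrow> cutoff \<epsilon> x = 0"
  using divide_nonpos_pos[of "1 - q (x - a)" \<epsilon>] by (simp add: cutoff_def mem_iff_q)

lemma ball_contains: "\<Omega> \<subseteq> cball 0 (R + norm a)"
proof
  fix x assume "x \<in> \<Omega>"
  then have "norm (x - a) \<le> R" by (rule R)
  then show "x \<in> cball 0 (R + norm a)"
    using norm_triangle_ineq[of "x - a" a] by simp
qed

lemma clamp_lipschitz: "\<bar>max 0 (min 1 s) - max 0 (min 1 t)\<bar> \<le> \<bar>s - t\<bar>" for s t :: real
  by linarith

lemma cutoff_lipschitz:
  assumes "0 < \<epsilon>" "norm b = 1"
  shows "\<bar>cutoff \<epsilon> (x + t *\<^sub>R b) - cutoff \<epsilon> x\<bar> \<le> 1 / (\<rho> * \<epsilon>) * \<bar>t\<bar>"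
proof -
  have "\<bar>cutoff \<epsilon> (x + t *\<^sub>R b) - cutoff \<epsilon> x\<bar> \<le> \<bar>(1 - q (x + t *\<^sub>R b - a)) / \<epsilon> - (1 - q (x - a)) / \<epsilon>\<bar>"
    unfolding cutoff_def by (rule clamp_lipschitz)
  also have "\<dots> = \<bar>q (x + t *\<^sub>R b - a) - q (x - a)\<bar> / \<epsilon>"
    using assms by (simp add: diff_divide_distrib[symmetric] abs_minus_commute)
  also have "\<dots> \<le> (\<bar>t\<bar> / \<rho>) / \<epsilon>"
    using q_lipschitz[of "x + t *\<^sub>R b - a" "x - a"] assms by (intro divide_right_mono) auto
  finally show ?thesis by simp
qed

text \<open>A point of the level set is a limit of contracted points, so the level set lies in the
  boundary of a convex sublevel set, and such boundaries are null.\<close>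

lemma AE_q_neq:
  assumes c: "0 < c"
  shows "AE x in lborel. q (x - a) \<noteq> c"
proof -
  define S where "S = {x. q (x - a) < c}"
  have "convex S"
    unfolding convex_alt
  proof (intro ballI allI impI)
    fix x y u assume xy: "x \<in> S" "y \<in> S" and u: "0 \<le> u \<and> u \<le> (1::real)"
    have "q ((1 - u) *\<^sub>R (x - a) + u *\<^sub>R (y - a)) \<le> (1 - u) * q (x - a) + u * q (y - a)"
      using u by (intro q_convex) auto
    also have "\<dots> < c"
      using xy u by (intro convex_bound_lt) (auto simp: S_def)
    also have "(1 - u) *\<^sub>R (x - a) + u *\<^sub>R (y - a) = (1 - u) *\<^sub>R x + u *\<^sub>R y - a"
      by (simp add: algebra_simps)
    finally show "(1 - u) *\<^sub>R x + u *\<^sub>R y \<in> S" by (simp add: S_def)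
  qed
  then have "negligible (frontier S)"
    by (rule negligible_convex_frontier)
  moreover have "{x. q (x - a) = c} \<subseteq> frontier S"
  proof
    fix x assume "x \<in> {x. q (x - a) = c}"
    then have x: "q (x - a) = c" by simp
    have "x \<in> closure S"
    proof (rule closure_sequential[THEN iffD2], intro exI conjI allI)
      fix n
      define t where "t = 1 / real (Suc (Suc n))"
      have t: "0 < t" "t < 1" by (auto simp: t_def)
      then have "q ((1 - t) *\<^sub>R (x - a)) < c"
        using q_scale[of "1 - t" "x - a"] x c by simp
      then show "a + (1 - 1 / real (Suc (Suc n))) *\<^sub>R (x - a) \<in> S"
        by (simp add: S_def t_def)
      have "(\<lambda>n. 1 / real (Suc (Suc n))) \<longlonglongrightarrow> 0"
        using LIMSEQ_Suc[OF LIMSEQ_inverse_real_of_nat] by (simp add: inverse_eq_divide)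
      then have "(\<lambda>n. a + (1 - 1 / real (Suc (Suc n))) *\<^sub>R (x - a)) \<longlonglongrightarrow> a + (1 - 0) *\<^sub>R (x - a)"
        by (intro tendsto_intros)
      then show "(\<lambda>n. a + (1 - 1 / real (Suc (Suc n))) *\<^sub>R (x - a)) \<longlonglongrightarrow> x"
        by simp
    qed
    moreover have "x \<notin> interior S"
      using x interior_subset[of S] by (auto simp: S_def)
    ultimately show "x \<in> frontier S"
      by (simp add: frontier_def)
  qed
  ultimately have "negligible {x. q (x - a) = c}"
    by (rule negligible_subset)
  then have "{x. q (x - a) = c} \<in> null_sets lborel"
    by (simp add: negligible_iff_null_sets null_sets_completion_iff)
  then show ?thesis
    by (rule AE_I') auto
qed

definition cutoff_deriv :: "real \<Rightarrow> 'a \<Rightarrow> 'a \<Rightarrow> real" where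
  "cutoff_deriv \<epsilon> b x = (if x \<in> layer \<epsilon> then - D b (x - a) / \<epsilon> else 0)"

lemma cutoff_deriv_measurable [measurable]: "cutoff_deriv \<epsilon> b \<in> borel_measurable borel"
  unfolding cutoff_deriv_def by measurable

text \<open>The two level sets where the cutoff has kinks are null; elsewhere it is locally 0, 1 or
  affine in the gauge. Backward quotients appear because \<open>D\<close> is the derivative from the
  left.\<close>

lemma cutoff_has_deriv:
  assumes \<epsilon>: "0 < \<epsilon>" "\<epsilon> < 1" and b: "norm b = 1"
  shows "AE x in lborel. (\<lambda>n. (cutoff \<epsilon> (x - h n *\<^sub>R b) - cutoff \<epsilon> x) / h n) \<longlonglongrightarrow> - cutoff_deriv \<epsilon> b x"
proof -
  have "AE x in lborel. q (x - a) \<noteq> 1"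
    by (rule AE_q_neq) simp
  moreover have "AE x in lborel. q (x - a) \<noteq> 1 - \<epsilon>"
    using \<epsilon> by (intro AE_q_neq) simp
  ultimately show ?thesis
  proof eventually_elim
    case (elim x)
    have xn: "(\<lambda>n. q (x - h n *\<^sub>R b - a)) \<longlonglongrightarrow> q (x - 0 *\<^sub>R b - a)"
      by (rule continuous_on_tendsto_compose[OF q_continuous[of UNIV]])
        (intro tendsto_intros h_lim, auto)
    consider "q (x - a) > 1" | "q (x - a) < 1 - \<epsilon>" | "x \<in> layer \<epsilon>"
      using elim by (fastforce simp: layer_def)
    then show ?case
    proof cases
      case 1
      have "\<forall>\<^sub>F n in sequentially. 1 < q (x - h n *\<^sub>R b - a)"
        using xn 1 by (intro order_tendstoD(1)) auto
      then have "\<forall>\<^sub>F n in sequentially. 0 = (cutoff \<epsilon> (x - h n *\<^sub>R b) - cutoff \<epsilon> x) / h n"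
        by eventually_elim (use 1 \<epsilon> in \<open>simp add: cutoff_outside mem_iff_q\<close>)
      then show ?thesis
        using 1 by (intro Lim_transform_eventually[OF tendsto_const]) (auto simp: cutoff_deriv_def layer_def)
    next
      case 2
      have one: "cutoff \<epsilon> z = 1" if "q (z - a) < 1 - \<epsilon>" for z
      proof -
        have "1 \<le> (1 - q (z - a)) / \<epsilon>"
          using that \<epsilon> by (simp add: field_simps)
        then show ?thesis by (simp add: cutoff_def)
      qed
      have "\<forall>\<^sub>F n in sequentially. q (x - h n *\<^sub>R b - a) < 1 - \<epsilon>"
        using xn 2 by (intro order_tendstoD(2)) auto
      then have "\<forall>\<^sub>F n in sequentially. 0 = (cutoff \<epsilon> (x - h n *\<^sub>R b) - cutoff \<epsilon> x) / h n"
        by eventually_elim (use 2 in \<open>simp add: one\<close>)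
      then show ?thesis
        using 2 by (intro Lim_transform_eventually[OF tendsto_const]) (auto simp: cutoff_deriv_def layer_def)
    next
      case 3
      have lin: "cutoff \<epsilon> z = (1 - q (z - a)) / \<epsilon>" if "1 - \<epsilon> < q (z - a)" "q (z - a) < 1" for z
      proof -
        have "0 \<le> (1 - q (z - a)) / \<epsilon>" "(1 - q (z - a)) / \<epsilon> \<le> 1"
          using that \<epsilon> by (auto simp: field_simps)
        then show ?thesis by (simp add: cutoff_def)
      qed
      have x: "1 - \<epsilon> < q (x - a)" "q (x - a) < 1"
        using 3 by (auto simp: layer_def)
      have "\<forall>\<^sub>F n in sequentially. q (x - h n *\<^sub>R b - a) < 1"
        using xn x by (intro order_tendstoD(2)) auto
      moreover have "\<forall>\<^sub>F n in sequentially. 1 - \<epsilon> < q (x - h n *\<^sub>R b - a)"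
        using xn x by (intro order_tendstoD(1)) auto
      ultimately have "\<forall>\<^sub>F n in sequentially. (q (x - a) - q (x - a - h n *\<^sub>R b)) / h n / \<epsilon> =
          (cutoff \<epsilon> (x - h n *\<^sub>R b) - cutoff \<epsilon> x) / h n"
      proof eventually_elim
        case (elim n)
        have comm: "x - h n *\<^sub>R b - a = x - a - h n *\<^sub>R b" by simp
        have "cutoff \<epsilon> (x - h n *\<^sub>R b) = (1 - q (x - a - h n *\<^sub>R b)) / \<epsilon>"
          using lin[OF elim(2,1)] unfolding comm .
        then show ?case
          unfolding lin[OF x] using \<epsilon> h_pos[of n] by (simp add: divide_simps)
      qed
      moreover have "(\<lambda>n. (q (x - a) - q (x - a - h n *\<^sub>R b)) / h n / \<epsilon>) \<longlonglongrightarrow> D b (x - a) / \<epsilon>"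
        using \<epsilon> by (intro tendsto_divide D_tendsto[OF b] tendsto_const) auto
      ultimately have "(\<lambda>n. (cutoff \<epsilon> (x - h n *\<^sub>R b) - cutoff \<epsilon> x) / h n) \<longlonglongrightarrow> D b (x - a) / \<epsilon>"
        by (rule Lim_transform_eventually[rotated])
      then show ?thesis
        using 3 by (simp add: cutoff_deriv_def)
    qed
  qed
qed

lemma integral_partial_cutoff:
  assumes \<epsilon>: "0 < \<epsilon>" "\<epsilon> < 1" and b: "b \<in> Basis"
    and V: "\<And>x. V differentiable (at x)" "continuous_on UNIV (partial b V)"
  shows "integral\<^sup>L lborel (\<lambda>x. partial b V x * cutoff \<epsilon> x) = - integral\<^sup>L lborel (\<lambda>x. V x * cutoff_deriv \<epsilon> b x)"
proof (rule integral_by_parts_direction[where h = h and R = "R + norm a" and C = 1 and L = "1 / (\<rho> * \<epsilon>)"])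
  show "norm b = 1" using b by simp
  then show "\<And>x t. \<bar>cutoff \<epsilon> (x + t *\<^sub>R b) - cutoff \<epsilon> x\<bar> \<le> 1 / (\<rho> * \<epsilon>) * \<bar>t\<bar>"
    using \<epsilon>(1) by (intro cutoff_lipschitz)
  show "AE x in lborel. (\<lambda>n. (cutoff \<epsilon> (x - h n *\<^sub>R b) - cutoff \<epsilon> x) / h n) \<longlonglongrightarrow> - cutoff_deriv \<epsilon> b x"
    using \<epsilon> \<open>norm b = 1\<close> by (rule cutoff_has_deriv)
  show "cutoff \<epsilon> x = 0" if "x \<notin> cball 0 (R + norm a)" for x
    using that ball_contains \<epsilon> by (intro cutoff_outside) auto
  show "\<bar>cutoff \<epsilon> x\<bar> \<le> 1" for x
    using cutoff_bounds[of \<epsilon> x] by simp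
qed (use V h_pos h_le_1 h_lim in auto)

text \<open>A sum, so as to dominate both constants of the flux estimate at once.\<close>

definition K4 :: real where
  "K4 = 2 * real DIM('a) * K1 / \<rho> + K3 / \<rho>"

lemma K4_ge: "0 \<le> K4" "2 * real DIM('a) * K1 / \<rho> \<le> K4" "K3 / \<rho> \<le> K4"
  using K1_nonneg K3_pos \<rho>(1) by (auto simp: K4_def)

text \<open>Either |t| is at most \<tau> or it is at most t^2 / \<tau>. This trades a linear
  boundary error for a small constant and a square, and squares are what the definition of the trace
  controls.\<close>

lemma abs_le_square_div: "0 < \<tau> \<Longrightarrow> \<bar>t\<bar> \<le> \<tau> + t\<^sup>2 / \<tau>" for t \<tau> :: real
proof (cases "\<bar>t\<bar> \<le> \<tau>")
  case True
  moreover assume "0 < \<tau>"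
  then have "0 \<le> t\<^sup>2 / \<tau>" by simp
  ultimately show ?thesis by linarith
next
  case False
  moreover assume \<tau>: "0 < \<tau>"
  ultimately have "\<bar>t\<bar> * \<tau> \<le> \<bar>t\<bar> * \<bar>t\<bar>"
    by (intro mult_left_mono) auto
  then have "\<bar>t\<bar> \<le> t\<^sup>2 / \<tau>"
    using \<tau> by (simp add: field_simps power2_eq_square)
  then show ?thesis using \<tau> by linarith
qed

text \<open>V(x) is split into V(x) - V(\<pi> x), V(\<pi> x) - g(\<pi> x) and g(\<pi> x). The first
  is at most \<tau>; the second is treated by \<open>abs_le_square_div\<close>, which contributes
  another \<tau>; the third is annihilated by the gradient of the gauge. The factor 1 / \<rho>
  bounds \<open>D\<close>.\<close>

lemma flux_pointwise:
  assumes x: "x \<in> layer \<epsilon>" and \<epsilon>: "0 < \<epsilon>" and \<tau>: "0 < \<tau>"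
    and near: "\<And>b. b \<in> Basis \<Longrightarrow> \<bar>V b x - V b (\<pi> x)\<bar> \<le> \<tau>"
    and normal: "(\<Sum>b\<in>Basis. g b (\<pi> x) * D b (x - a)) = 0"
  shows "\<bar>\<Sum>b\<in>Basis. V b x * cutoff_deriv \<epsilon> b x\<bar> \<le>
     2 * real DIM('a) * \<tau> / (\<rho> * \<epsilon>) + (\<Sum>b\<in>Basis. (V b (\<pi> x) - g b (\<pi> x))\<^sup>2 / (\<rho> * \<tau> * \<epsilon>))"
proof -
  have "(\<Sum>b\<in>Basis. V b x * cutoff_deriv \<epsilon> b x) = - (\<Sum>b\<in>Basis. V b x * D b (x - a)) / \<epsilon>"
    using x by (simp add: cutoff_deriv_def sum_negf sum_divide_distrib)
  also have "(\<Sum>b\<in>Basis. V b x * D b (x - a)) =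
      (\<Sum>b\<in>Basis. ((V b x - V b (\<pi> x)) + (V b (\<pi> x) - g b (\<pi> x))) * D b (x - a)) + (\<Sum>b\<in>Basis. g b (\<pi> x) * D b (x - a))"
    unfolding sum.distrib[symmetric] by (intro sum.cong refl) (simp add: algebra_simps)
  finally have eq: "\<bar>\<Sum>b\<in>Basis. V b x * cutoff_deriv \<epsilon> b x\<bar> =
      \<bar>\<Sum>b\<in>Basis. ((V b x - V b (\<pi> x)) + (V b (\<pi> x) - g b (\<pi> x))) * D b (x - a)\<bar> / \<epsilon>"
    using \<epsilon> normal by simp
  have "\<bar>\<Sum>b\<in>Basis. ((V b x - V b (\<pi> x)) + (V b (\<pi> x) - g b (\<pi> x))) * D b (x - a)\<bar> \<le>
      (\<Sum>b\<in>Basis. (2 * \<tau> + (V b (\<pi> x) - g b (\<pi> x))\<^sup>2 / \<tau>) * (1 / \<rho>))"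
  proof (rule sum_abs[THEN order_trans], rule sum_mono)
    fix b :: 'a assume b: "b \<in> Basis"
    have "\<bar>(V b x - V b (\<pi> x)) + (V b (\<pi> x) - g b (\<pi> x))\<bar> \<le> 2 * \<tau> + (V b (\<pi> x) - g b (\<pi> x))\<^sup>2 / \<tau>"
      using near[OF b] abs_le_square_div[OF \<tau>, of "V b (\<pi> x) - g b (\<pi> x)"] by linarith
    then show "\<bar>((V b x - V b (\<pi> x)) + (V b (\<pi> x) - g b (\<pi> x))) * D b (x - a)\<bar> \<le>
        (2 * \<tau> + (V b (\<pi> x) - g b (\<pi> x))\<^sup>2 / \<tau>) * (1 / \<rho>)"
      unfolding abs_mult using D_bound[of b "x - a"] b \<tau> by (intro mult_mono) auto
  qed
  also have "\<dots> = 2 * real DIM('a) * \<tau> / \<rho> + (\<Sum>b\<in>Basis. (V b (\<pi> x) - g b (\<pi> x))\<^sup>2 / (\<rho> * \<tau>))"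
    by (simp add: distrib_right sum.distrib add_divide_distrib mult.commute)
  finally have "\<bar>\<Sum>b\<in>Basis. ((V b x - V b (\<pi> x)) + (V b (\<pi> x) - g b (\<pi> x))) * D b (x - a)\<bar> / \<epsilon> \<le>
      (2 * real DIM('a) * \<tau> / \<rho> + (\<Sum>b\<in>Basis. (V b (\<pi> x) - g b (\<pi> x))\<^sup>2 / (\<rho> * \<tau>))) / \<epsilon>"
    using \<epsilon> by (intro divide_right_mono) auto
  also have "\<dots> = 2 * real DIM('a) * \<tau> / (\<rho> * \<epsilon>) + (\<Sum>b\<in>Basis. (V b (\<pi> x) - g b (\<pi> x))\<^sup>2 / (\<rho> * \<tau> * \<epsilon>))"
    by (simp add: add_divide_distrib sum_divide_distrib)
  finally show ?thesis
    unfolding eq .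
qed

text \<open>Integrate \<open>flux_pointwise\<close>: the constant has order \<tau> / \<epsilon> on a
  layer of volume at most K1 \<epsilon>, and the squares have a factor of order 1 / (\<tau>
  \<epsilon>) while projecting them costs K3 \<epsilon>. In both terms \<epsilon> cancels, so the
  bound is uniform in the width of the layer.\<close>

lemma flux_through_layer:
  fixes V g :: "'a \<Rightarrow> 'a \<Rightarrow> real"
  assumes \<epsilon>: "0 < \<epsilon>" "\<epsilon> < 1" and \<tau>: "0 < \<tau>"
    and V: "\<And>b x. b \<in> Basis \<Longrightarrow> V b differentiable (at x)" "\<And>b. b \<in> Basis \<Longrightarrow> continuous_on UNIV (partial b (V b))"
    and g: "\<And>b. b \<in> Basis \<Longrightarrow> g b \<in> borel_measurable (surface \<Omega>)"
    and normal: "AE y in surface \<Omega>. \<forall>n. outer_unit_normal \<Omega> y n \<longrightarrow> (\<Sum>b\<in>Basis. g b y * (n \<bullet> b)) = 0"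
    and near: "\<And>b x. b \<in> Basis \<Longrightarrow> x \<in> layer \<epsilon> \<Longrightarrow> \<bar>V b x - V b (\<pi> x)\<bar> \<le> \<tau>"
  shows "ennreal \<bar>\<integral>x. (\<Sum>b\<in>Basis. partial b (V b) x) * cutoff \<epsilon> x \<partial>lborel\<bar> \<le>
     ennreal (K4 * \<tau>) + ennreal (K4 / \<tau>) * (\<Sum>b\<in>Basis. \<integral>\<^sup>+y. ennreal ((V b y - g b y)\<^sup>2) \<partial>surface \<Omega>)"
proof -
  let ?L = "restrict_space lborel (layer \<epsilon>)"
  let ?R = "R + norm a"
  have \<epsilon>1: "\<epsilon> \<le> 1" using \<epsilon> by simp
  have Vc: "continuous_on UNIV (V b)" if "b \<in> Basis" for b
    using V(1)[OF that] by (intro differentiable_imp_continuous_on) (simp add: differentiable_on_def)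
  have i1: "integrable lborel (\<lambda>x. partial b (V b) x * cutoff \<epsilon> x)" if "b \<in> Basis" for b
  proof (rule integrable_continuous_mult_compact[OF V(2)[OF that], where R = ?R and C = 1])
    show "cutoff \<epsilon> x = 0" if "x \<notin> cball 0 ?R" for x
      using that ball_contains \<epsilon> by (intro cutoff_outside) auto
    show "\<bar>cutoff \<epsilon> x\<bar> \<le> 1" for x
      using cutoff_bounds[of \<epsilon> x] by simp
  qed simp
  have i2: "integrable lborel (\<lambda>x. V b x * cutoff_deriv \<epsilon> b x)" if b: "b \<in> Basis" for b
  proof (rule integrable_continuous_mult_compact[OF Vc[OF b], where R = ?R and C = "1 / \<rho> / \<epsilon>"])
    show "cutoff_deriv \<epsilon> b x = 0" if "x \<notin> cball 0 ?R" for x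
      using that ball_contains by (auto simp: cutoff_deriv_def layer_def mem_iff_q[symmetric])
    show "\<bar>cutoff_deriv \<epsilon> b x\<bar> \<le> 1 / \<rho> / \<epsilon>" for x
    proof (cases "x \<in> layer \<epsilon>")
      case True
      have "\<bar>D b (x - a)\<bar> / \<epsilon> \<le> 1 / \<rho> / \<epsilon>"
        using D_bound[of b "x - a"] b \<epsilon> by (intro divide_right_mono) auto
      then show ?thesis using True \<epsilon> by (simp add: cutoff_deriv_def)
    next
      case False
      then show ?thesis using \<epsilon> \<rho>(1) by (simp add: cutoff_deriv_def)
    qed
  qed simp
  have "(\<integral>x. (\<Sum>b\<in>Basis. partial b (V b) x) * cutoff \<epsilon> x \<partial>lborel) = (\<Sum>b\<in>Basis. \<integral>x. partial b (V b) x * cutoff \<epsilon> x \<partial>lborel)"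
    unfolding sum_distrib_right using i1 by (rule Bochner_Integration.integral_sum)
  also have "\<dots> = (\<Sum>b\<in>Basis. - (\<integral>x. V b x * cutoff_deriv \<epsilon> b x \<partial>lborel))"
    using integral_partial_cutoff[OF \<epsilon> _ V] by (intro sum.cong) auto
  also have "\<dots> = - (\<integral>x. (\<Sum>b\<in>Basis. V b x * cutoff_deriv \<epsilon> b x) \<partial>lborel)"
    unfolding sum_negf by (subst Bochner_Integration.integral_sum) (auto intro: i2)
  finally have "ennreal \<bar>\<integral>x. (\<Sum>b\<in>Basis. partial b (V b) x) * cutoff \<epsilon> x \<partial>lborel\<bar> =
      ennreal (norm (\<integral>x. (\<Sum>b\<in>Basis. V b x * cutoff_deriv \<epsilon> b x) \<partial>lborel))"
    by simp
  also have "\<dots> \<le> (\<integral>\<^sup>+x. ennreal (norm (\<Sum>b\<in>Basis. V b x * cutoff_deriv \<epsilon> b x)) \<partial>lborel)"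
    using i2 by (intro integral_norm_bound_ennreal Bochner_Integration.integrable_sum)
  also have "\<dots> = (\<integral>\<^sup>+x. ennreal \<bar>\<Sum>b\<in>Basis. V b x * cutoff_deriv \<epsilon> b x\<bar> * indicator (layer \<epsilon>) x \<partial>lborel)"
    by (intro nn_integral_cong) (auto simp: cutoff_deriv_def indicator_def)
  also have "\<dots> = (\<integral>\<^sup>+x. ennreal \<bar>\<Sum>b\<in>Basis. V b x * cutoff_deriv \<epsilon> b x\<bar> \<partial>?L)"
    by (rule nn_integral_restrict_space[symmetric]) simp
  also have "\<dots> \<le> (\<integral>\<^sup>+x. ennreal (2 * real DIM('a) * \<tau> / (\<rho> * \<epsilon>)) +
      (\<Sum>b\<in>Basis. ennreal (1 / (\<rho> * \<tau> * \<epsilon>)) * ennreal ((V b (\<pi> x) - g b (\<pi> x))\<^sup>2)) \<partial>?L)"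
  proof (rule nn_integral_mono_AE, subst AE_restrict_space_iff)
    have "AE x in lborel. x \<in> layer \<epsilon> \<longrightarrow> (\<forall>n. outer_unit_normal \<Omega> (\<pi> x) n \<longrightarrow> (\<Sum>b\<in>Basis. g b (\<pi> x) * (n \<bullet> b)) = 0)"
      using AE_layer_\<pi>[OF normal \<epsilon>(1) \<epsilon>1] .
    with AE_D_eq_normal
    show "AE x in lborel. x \<in> layer \<epsilon> \<longrightarrow> ennreal \<bar>\<Sum>b\<in>Basis. V b x * cutoff_deriv \<epsilon> b x\<bar> \<le>
        ennreal (2 * real DIM('a) * \<tau> / (\<rho> * \<epsilon>)) +
        (\<Sum>b\<in>Basis. ennreal (1 / (\<rho> * \<tau> * \<epsilon>)) * ennreal ((V b (\<pi> x) - g b (\<pi> x))\<^sup>2))"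
    proof eventually_elim
      case (elim x)
      show ?case
      proof
        assume x: "x \<in> layer \<epsilon>"
        have xa: "x \<noteq> a" using layer_ne[OF x \<epsilon>1] .
        \<comment> \<open>Any single normal at the projected point does, since the vector of the
          \<open>D b\<close> is proportional to it.\<close>
        obtain n where n: "outer_unit_normal \<Omega> (\<pi> x) n"
          using outer_unit_normal_exists[OF \<pi>_frontier[OF xa]] by blast
        have Dn: "D b (x - a) = n \<bullet> b / (n \<bullet> (\<pi> x - a))" if "b \<in> Basis" for b
          using elim(1) xa n that by blast
        have "(\<Sum>b\<in>Basis. g b (\<pi> x) * D b (x - a)) = (\<Sum>b\<in>Basis. g b (\<pi> x) * (n \<bullet> b)) / (n \<bullet> (\<pi> x - a))"
          using Dn by (simp add: sum_divide_distrib)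
        also have "\<dots> = 0"
          using elim(2) x n by simp
        finally have N0: "(\<Sum>b\<in>Basis. g b (\<pi> x) * D b (x - a)) = 0" .
        have "\<bar>\<Sum>b\<in>Basis. V b x * cutoff_deriv \<epsilon> b x\<bar> \<le>
            2 * real DIM('a) * \<tau> / (\<rho> * \<epsilon>) + (\<Sum>b\<in>Basis. (V b (\<pi> x) - g b (\<pi> x))\<^sup>2 / (\<rho> * \<tau> * \<epsilon>))"
          by (rule flux_pointwise[where V = V and g = g, OF x \<epsilon>(1) \<tau> near[OF _ x] N0])
        then have "ennreal \<bar>\<Sum>b\<in>Basis. V b x * cutoff_deriv \<epsilon> b x\<bar> \<le>
            ennreal (2 * real DIM('a) * \<tau> / (\<rho> * \<epsilon>) + (\<Sum>b\<in>Basis. (V b (\<pi> x) - g b (\<pi> x))\<^sup>2 / (\<rho> * \<tau> * \<epsilon>)))"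
          by (rule ennreal_leI)
        also have "\<dots> = ennreal (2 * real DIM('a) * \<tau> / (\<rho> * \<epsilon>)) +
            (\<Sum>b\<in>Basis. ennreal ((V b (\<pi> x) - g b (\<pi> x))\<^sup>2 / (\<rho> * \<tau> * \<epsilon>)))"
          using \<epsilon> \<tau> \<rho>(1) by (subst ennreal_plus) (auto intro!: sum_nonneg simp: sum_ennreal)
        also have "\<dots> = ennreal (2 * real DIM('a) * \<tau> / (\<rho> * \<epsilon>)) +
            (\<Sum>b\<in>Basis. ennreal (1 / (\<rho> * \<tau> * \<epsilon>)) * ennreal ((V b (\<pi> x) - g b (\<pi> x))\<^sup>2))"
          using \<epsilon> \<tau> \<rho>(1) by (simp add: ennreal_mult[symmetric])
        finally show "ennreal \<bar>\<Sum>b\<in>Basis. V b x * cutoff_deriv \<epsilon> b x\<bar> \<le>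
            ennreal (2 * real DIM('a) * \<tau> / (\<rho> * \<epsilon>)) +
            (\<Sum>b\<in>Basis. ennreal (1 / (\<rho> * \<tau> * \<epsilon>)) * ennreal ((V b (\<pi> x) - g b (\<pi> x))\<^sup>2))" .
      qed
    qed
  qed simp
  also have "\<dots> = ennreal (2 * real DIM('a) * \<tau> / (\<rho> * \<epsilon>)) * emeasure lborel (layer \<epsilon>) +
      (\<Sum>b\<in>Basis. ennreal (1 / (\<rho> * \<tau> * \<epsilon>)) * (\<integral>\<^sup>+x. ennreal ((V b (\<pi> x) - g b (\<pi> x))\<^sup>2) \<partial>?L))"
  proof -
    have m: "(\<lambda>x. ennreal ((V b (\<pi> x) - g b (\<pi> x))\<^sup>2)) \<in> borel_measurable ?L" if b: "b \<in> Basis" for b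
    proof -
      have [measurable]: "V b \<in> borel_measurable (surface \<Omega>)"
        using Vc[OF b] bounded op by (intro borel_measurable_surface borel_measurable_continuous_onI)
      note [measurable] = g[OF b]
      have "(\<lambda>y. ennreal ((V b y - g b y)\<^sup>2)) \<in> borel_measurable (surface \<Omega>)"
        by measurable
      then show ?thesis
        by (rule measurable_compose[OF \<pi>_measurable_surface[OF \<epsilon>1]])
    qed
    then show ?thesis
      by (subst nn_integral_add)
        (auto intro!: borel_measurable_sum borel_measurable_times_ennreal
          simp: nn_integral_sum nn_integral_cmult emeasure_restrict_space space_restrict_space)
  qed
  also have "\<dots> \<le> ennreal (2 * real DIM('a) * \<tau> / (\<rho> * \<epsilon>)) * ennreal (K1 * \<epsilon>) +
      (\<Sum>b\<in>Basis. ennreal (1 / (\<rho> * \<tau> * \<epsilon>)) * (ennreal (K3 * \<epsilon>) * (\<integral>\<^sup>+y. ennreal ((V b y - g b y)\<^sup>2) \<partial>surface \<Omega>)))"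
  proof (intro add_mono mult_left_mono sum_mono emeasure_layer \<epsilon>)
    fix b :: 'a assume b: "b \<in> Basis"
    have [measurable]: "V b \<in> borel_measurable (surface \<Omega>)"
      using Vc[OF b] bounded op by (intro borel_measurable_surface borel_measurable_continuous_onI)
    note [measurable] = g[OF b]
    have "(\<integral>\<^sup>+x. ennreal ((V b (\<pi> x) - g b (\<pi> x))\<^sup>2) \<partial>?L) = (\<integral>\<^sup>+x\<in>layer \<epsilon>. ennreal ((V b (\<pi> x) - g b (\<pi> x))\<^sup>2) \<partial>lborel)"
      by (rule nn_integral_restrict_space) simp
    also have "\<dots> \<le> ennreal (K3 * \<epsilon>) * (\<integral>\<^sup>+y. ennreal ((V b y - g b y)\<^sup>2) \<partial>surface \<Omega>)"
      by (rule nn_integral_layer_\<pi>[OF \<epsilon>(1) \<epsilon>1]) measurable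
    finally show "(\<integral>\<^sup>+x. ennreal ((V b (\<pi> x) - g b (\<pi> x))\<^sup>2) \<partial>?L) \<le>
        ennreal (K3 * \<epsilon>) * (\<integral>\<^sup>+y. ennreal ((V b y - g b y)\<^sup>2) \<partial>surface \<Omega>)" .
  qed auto
  also have "\<dots> = ennreal (2 * real DIM('a) * K1 / \<rho> * \<tau>) + ennreal (K3 / \<rho> / \<tau>) *
      (\<Sum>b\<in>Basis. \<integral>\<^sup>+y. ennreal ((V b y - g b y)\<^sup>2) \<partial>surface \<Omega>)"
  proof -
    have 1: "ennreal (2 * real DIM('a) * \<tau> / (\<rho> * \<epsilon>)) * ennreal (K1 * \<epsilon>) = ennreal (2 * real DIM('a) * K1 / \<rho> * \<tau>)"
      using \<epsilon> \<tau> \<rho>(1) K1_nonneg by (subst ennreal_mult[symmetric]) (auto simp: field_simps)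
    have 2: "ennreal (1 / (\<rho> * \<tau> * \<epsilon>)) * ennreal (K3 * \<epsilon>) = ennreal (K3 / \<rho> / \<tau>)"
      using \<epsilon> \<tau> \<rho>(1) K3_pos by (subst ennreal_mult[symmetric]) (auto simp: field_simps)
    show ?thesis
      unfolding 1 mult.assoc[symmetric] 2 sum_distrib_left ..
  qed
  also have "\<dots> \<le> ennreal (K4 * \<tau>) + ennreal (K4 / \<tau>) * (\<Sum>b\<in>Basis. \<integral>\<^sup>+y. ennreal ((V b y - g b y)\<^sup>2) \<partial>surface \<Omega>)"
    using K4_ge \<tau> by (intro add_mono mult_right_mono ennreal_leI divide_right_mono) auto
  finally show ?thesis .
qed

section \<open>Shrinking the layer: divergence estimate and Green's formula\<close>

lemma eventually_near_layer:
  assumes V: "continuous_on (closure \<Omega>) V" and \<tau>: "0 < (\<tau>::real)"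
  shows "\<forall>\<^sub>F n in sequentially. \<forall>x\<in>layer (h n). \<bar>V x - V (\<pi> x)\<bar> \<le> \<tau>"
proof -
  have "uniformly_continuous_on (closure \<Omega>) V"
    using V bounded by (intro compact_uniformly_continuous) auto
  then obtain \<delta> where \<delta>: "0 < \<delta>" "\<And>x y. x \<in> closure \<Omega> \<Longrightarrow> y \<in> closure \<Omega> \<Longrightarrow> dist y x < \<delta> \<Longrightarrow> dist (V y) (V x) < \<tau>"
    using \<tau> unfolding uniformly_continuous_on_def by meson
  \<comment> \<open>A point of the layer of width h n is at most h n R away from its projection,
    because the ray has length at most \<open>R\<close>.\<close>
  have "\<forall>\<^sub>F n in sequentially. h n < \<delta> / R"
    using h_lim \<delta>(1) R_pos by (intro order_tendstoD(2)) auto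
  then show ?thesis
  proof eventually_elim
    case (elim n)
    show ?case
    proof
      fix x assume x: "x \<in> layer (h n)"
      have xa: "x \<noteq> a" using layer_ne[OF x h_le_1] .
      have fr: "\<pi> x \<in> closure \<Omega>"
        using \<pi>_frontier[OF xa] by (auto simp: frontier_def)
      have "x \<in> closure \<Omega>"
        using x closure_subset[of \<Omega>] mem_iff_q[of x] by (auto simp: layer_def)
      have "\<pi> x - x = (1 - q (x - a)) *\<^sub>R (\<pi> x - a)"
        using layer_\<pi>[OF x h_le_1] by (simp add: algebra_simps)
      then have "dist (\<pi> x) x = \<bar>1 - q (x - a)\<bar> * norm (\<pi> x - a)"
        by (simp add: dist_norm)
      also have "\<dots> \<le> h n * R"
        using x norm_frontier_le[OF fr] by (intro mult_mono) (auto simp: layer_def)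
      also have "\<dots> < \<delta>"
        using elim R_pos by (simp add: field_simps)
      finally have "dist (V (\<pi> x)) (V x) < \<tau>"
        using \<delta>(2)[OF \<open>x \<in> closure \<Omega>\<close> fr] by simp
      then show "\<bar>V x - V (\<pi> x)\<bar> \<le> \<tau>"
        by (simp add: dist_real_def abs_minus_commute)
    qed
  qed
qed

lemma cutoff_tendsto: "(\<lambda>n. cutoff (h n) x) \<longlonglongrightarrow> indicator \<Omega> x"
proof (cases "x \<in> \<Omega>")
  case True
  then have q1: "0 < 1 - q (x - a)"
    using mem_iff_q by auto
  have "\<forall>\<^sub>F n in sequentially. h n < 1 - q (x - a)"
    using h_lim q1 by (intro order_tendstoD(2)) auto
  then have "\<forall>\<^sub>F n in sequentially. 1 = cutoff (h n) x"
  proof eventually_elim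
    case (elim n)
    then have "1 \<le> (1 - q (x - a)) / h n"
      using h_pos[of n] by (simp add: field_simps)
    then show ?case by (simp add: cutoff_def)
  qed
  then show ?thesis
    using True by (intro Lim_transform_eventually[OF tendsto_const]) auto
next
  case False
  then show ?thesis
    using cutoff_outside[OF False h_pos] by simp
qed

lemma integral_continuous_cutoff_tendsto:
  assumes G: "continuous_on UNIV G"
  shows "(\<lambda>n. \<integral>x. G x * cutoff (h n) x \<partial>lborel) \<longlonglongrightarrow> integral\<^sup>L (lebesgue_on \<Omega>) G"
proof -
  let ?R = "R + norm a"
  have Gm [measurable]: "G \<in> borel_measurable borel"
    using G by (rule borel_measurable_continuous_onI)
  have \<Omega>b [measurable]: "\<Omega> \<in> sets borel"
    using op by simp
  have "(\<lambda>n. \<integral>x. G x * cutoff (h n) x \<partial>lborel) \<longlonglongrightarrow> (\<integral>x. G x * indicator \<Omega> x \<partial>lborel)"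
  proof (rule integral_dominated_convergence)
    show "integrable lborel (\<lambda>x. \<bar>G x * indicator (cball 0 ?R) x\<bar>)"
      by (intro integrable_abs integrable_continuous_mult_compact[OF G, where R = ?R and C = 1]
          borel_measurable_indicator) auto
    show "AE x in lborel. (\<lambda>n. G x * cutoff (h n) x) \<longlonglongrightarrow> G x * indicator \<Omega> x"
      by (intro AE_I2 tendsto_mult tendsto_const cutoff_tendsto)
    show "AE x in lborel. norm (G x * cutoff (h n) x) \<le> \<bar>G x * indicator (cball 0 ?R) x\<bar>" for n
    proof (rule AE_I2)
      fix x
      show "norm (G x * cutoff (h n) x) \<le> \<bar>G x * indicator (cball 0 ?R) x\<bar>"
      proof (cases "x \<in> \<Omega>")
        case True
        then have "x \<in> cball 0 ?R" using ball_contains by blast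
        then show ?thesis
          using cutoff_bounds[of "h n" x] by (simp add: abs_mult mult_left_le)
      next
        case False
        then show ?thesis using cutoff_outside[OF False h_pos] by simp
      qed
    qed
  qed auto
  also have "(\<integral>x. G x * indicator \<Omega> x \<partial>lborel) = integral\<^sup>L (lebesgue_on \<Omega>) (\<lambda>x. G x * indicator \<Omega> x)"
    by (rule integral_lebesgue_on_eq_lborel[symmetric]) auto
  also have "\<dots> = integral\<^sup>L (lebesgue_on \<Omega>) G"
    by (intro Bochner_Integration.integral_cong) (auto simp: space_restrict_space)
  finally show ?thesis .
qed

text \<open>The right side of \<open>flux_through_layer\<close> is free of \<epsilon>, so the layer
  may shrink: the cutoffs tend to the indicator of \<Omega>, and by uniform continuity the fields
  vary by at most \<tau> along the rays in the layer.\<close>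

lemma divergence_bound:
  fixes V g :: "'a \<Rightarrow> 'a \<Rightarrow> real"
  assumes \<tau>: "0 < \<tau>"
    and V: "\<And>b x. b \<in> Basis \<Longrightarrow> V b differentiable (at x)" "\<And>b. b \<in> Basis \<Longrightarrow> continuous_on UNIV (partial b (V b))"
    and g: "\<And>b. b \<in> Basis \<Longrightarrow> g b \<in> borel_measurable (surface \<Omega>)"
    and normal: "AE y in surface \<Omega>. \<forall>n. outer_unit_normal \<Omega> y n \<longrightarrow> (\<Sum>b\<in>Basis. g b y * (n \<bullet> b)) = 0"
  shows "ennreal \<bar>\<integral>x. (\<Sum>b\<in>Basis. partial b (V b) x) \<partial>lebesgue_on \<Omega>\<bar> \<le>
     ennreal (K4 * \<tau>) + ennreal (K4 / \<tau>) * (\<Sum>b\<in>Basis. \<integral>\<^sup>+y. ennreal ((V b y - g b y)\<^sup>2) \<partial>surface \<Omega>)"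
proof (rule tendsto_upperbound)
  show "(\<lambda>n. ennreal \<bar>\<integral>x. (\<Sum>b\<in>Basis. partial b (V b) x) * cutoff (h n) x \<partial>lborel\<bar>) \<longlonglongrightarrow>
      ennreal \<bar>\<integral>x. (\<Sum>b\<in>Basis. partial b (V b) x) \<partial>lebesgue_on \<Omega>\<bar>"
    using V(2) by (intro tendsto_ennrealI tendsto_rabs integral_continuous_cutoff_tendsto continuous_on_sum)
  have "continuous_on (closure \<Omega>) (V b)" if "b \<in> Basis" for b
    using V(1)[OF that] by (intro differentiable_imp_continuous_on)
      (auto simp: differentiable_on_def intro: differentiable_at_withinI)
  then have "\<forall>\<^sub>F n in sequentially. \<forall>b\<in>Basis. \<forall>x\<in>layer (h n). \<bar>V b x - V b (\<pi> x)\<bar> \<le> \<tau>"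
    using \<tau> by (intro eventually_ball_finite) (auto intro: eventually_near_layer)
  moreover have "\<forall>\<^sub>F n in sequentially. h n < 1"
    using h_lim by (intro order_tendstoD(2)) auto
  ultimately show "\<forall>\<^sub>F n in sequentially. ennreal \<bar>\<integral>x. (\<Sum>b\<in>Basis. partial b (V b) x) * cutoff (h n) x \<partial>lborel\<bar> \<le>
     ennreal (K4 * \<tau>) + ennreal (K4 / \<tau>) * (\<Sum>b\<in>Basis. \<integral>\<^sup>+y. ennreal ((V b y - g b y)\<^sup>2) \<partial>surface \<Omega>)"
  proof eventually_elim
    case (elim n)
    show ?case
      by (rule flux_through_layer[OF h_pos elim(2) \<tau> V g normal]) (use elim(1) in auto)
  qed
qed simp

text \<open>The estimate is applied to the smooth approximants of the gradient multiplied by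
  \<zeta>, with \<zeta> g in the role of the trace, whose normal component still vanishes. At fixed
  \<tau> the approximation removes the boundary squares; then \<tau> tends to 0.\<close>

lemma Neumann_Green:
  assumes u: "u \<in> H2N \<Omega>"
    and \<zeta>: "\<And>x. \<zeta> differentiable (at x)" "\<And>b. b \<in> Basis \<Longrightarrow> continuous_on UNIV (partial b \<zeta>)"
  shows "integral\<^sup>L (lebesgue_on \<Omega>) (\<lambda>x. lap \<Omega> u x * \<zeta> x) =
     - (\<Sum>b\<in>Basis. integral\<^sup>L (lebesgue_on \<Omega>) (\<lambda>x. wderiv \<Omega> b u x * partial b \<zeta> x))"
proof -
  note \<Omega> = bounded op
  have H: "u \<in> H2 \<Omega>" using u by (simp add: H2N_def)
  obtain g where tr: "\<And>b. b \<in> Basis \<Longrightarrow> is_trace \<Omega> (wderiv \<Omega> b u) (g b)"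
    and normal: "AE x in surface \<Omega>. \<forall>n. outer_unit_normal \<Omega> x n \<longrightarrow> (\<Sum>b\<in>Basis. g b x * (n \<bullet> b)) = 0"
    using u unfolding H2N_def normal_deriv_zero_def by blast
  define Q where "Q b \<psi> \<longleftrightarrow> (\<forall>k. smooth (\<psi> k)) \<and> (\<lambda>k. L2norm \<Omega> (\<lambda>x. \<psi> k x - wderiv \<Omega> b u x)) \<longlonglongrightarrow> 0 \<and>
      (\<lambda>k. L2norm \<Omega> (\<lambda>x. partial b (\<psi> k) x - wderiv \<Omega> b (wderiv \<Omega> b u) x)) \<longlonglongrightarrow> 0 \<and>
      (\<lambda>k. \<integral>\<^sup>+ x. ennreal ((\<psi> k x - g b x)\<^sup>2) \<partial>surface \<Omega>) \<longlonglongrightarrow> 0" for b and \<psi> :: "nat \<Rightarrow> 'a \<Rightarrow> real"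
  have "\<forall>b\<in>Basis. \<exists>\<psi>. Q b \<psi>"
    using tr unfolding is_trace_def Q_def by blast
  then obtain \<psi> where "\<forall>b\<in>Basis. Q b (\<psi> b)"
    using bchoice[of Basis Q] by blast
  then have \<psi>: "\<And>b k. b \<in> Basis \<Longrightarrow> smooth (\<psi> b k)"
      "\<And>b. b \<in> Basis \<Longrightarrow> (\<lambda>k. L2norm \<Omega> (\<lambda>x. \<psi> b k x - wderiv \<Omega> b u x)) \<longlonglongrightarrow> 0"
      "\<And>b. b \<in> Basis \<Longrightarrow> (\<lambda>k. L2norm \<Omega> (\<lambda>x. partial b (\<psi> b k) x - wderiv \<Omega> b (wderiv \<Omega> b u) x)) \<longlonglongrightarrow> 0"
      "\<And>b. b \<in> Basis \<Longrightarrow> (\<lambda>k. \<integral>\<^sup>+ x. ennreal ((\<psi> b k x - g b x)\<^sup>2) \<partial>surface \<Omega>) \<longlonglongrightarrow> 0"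
    unfolding Q_def by blast+
  have gm: "g b \<in> borel_measurable (surface \<Omega>)" if "b \<in> Basis" for b
    using tr[OF that] by (simp add: is_trace_def)
  have \<zeta>c: "continuous_on A \<zeta>" for A
    using \<zeta>(1) by (intro differentiable_imp_continuous_on)
      (auto simp: differentiable_on_def intro: differentiable_at_withinI)
  have \<zeta>L: "\<zeta> \<in> L2 \<Omega>" "\<And>b. b \<in> Basis \<Longrightarrow> partial b \<zeta> \<in> L2 \<Omega>"
    using \<zeta>c \<zeta>(2) by (auto intro!: continuous_imp_L2[OF \<Omega>] intro: continuous_on_subset)
  have "compact (\<zeta> ` closure \<Omega>)"
    using \<Omega> by (intro compact_continuous_image \<zeta>c) auto
  then obtain Z where Z: "0 < Z" "\<And>x. x \<in> closure \<Omega> \<Longrightarrow> \<bar>\<zeta> x\<bar> \<le> Z"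
    by (metis bounded_pos compact_imp_bounded imageI real_norm_def)
  define V where "V k b x = \<zeta> x * \<psi> b k x" for k b x
  have pV: "partial b (V k b) = (\<lambda>x. \<zeta> x * partial b (\<psi> b k) x + partial b \<zeta> x * \<psi> b k x)" if "b \<in> Basis" for k b
    unfolding V_def by (intro ext partial_mult \<zeta>(1) smooth_differentiable[OF \<psi>(1)[OF that]])
  \<comment> \<open>The defect in Green's formula, reached as the limit of the integrals of the
    divergence.\<close>
  define J where "J = (\<Sum>b\<in>Basis. integral\<^sup>L (lebesgue_on \<Omega>) (\<lambda>x. wderiv \<Omega> b (wderiv \<Omega> b u) x * \<zeta> x) +
       integral\<^sup>L (lebesgue_on \<Omega>) (\<lambda>x. wderiv \<Omega> b u x * partial b \<zeta> x))"
  have wL: "wderiv \<Omega> b u \<in> L2 \<Omega>" "wderiv \<Omega> b (wderiv \<Omega> b u) \<in> L2 \<Omega>" if "b \<in> Basis" for b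
    using wderiv_L2[OF \<Omega> H2_imp_H1[OF \<Omega> H] that] wderiv_wderiv_L2[OF \<Omega> H that that] by auto
  have \<psi>L: "\<psi> b k \<in> L2 \<Omega>" "partial b (\<psi> b k) \<in> L2 \<Omega>" if "b \<in> Basis" for b k
    using smooth_L2[OF \<Omega> \<psi>(1)[OF that]] smooth_L2[OF \<Omega> smooth_partial[OF \<psi>(1)[OF that] that]] by auto
  have limJ: "(\<lambda>k. \<integral>x. (\<Sum>b\<in>Basis. partial b (V k b) x) \<partial>lebesgue_on \<Omega>) \<longlonglongrightarrow> J"
  proof -
    have "(\<integral>x. (\<Sum>b\<in>Basis. partial b (V k b) x) \<partial>lebesgue_on \<Omega>) =
       (\<Sum>b\<in>Basis. integral\<^sup>L (lebesgue_on \<Omega>) (\<lambda>x. partial b (\<psi> b k) x * \<zeta> x) +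
         integral\<^sup>L (lebesgue_on \<Omega>) (\<lambda>x. \<psi> b k x * partial b \<zeta> x))" for k
    proof -
      have "(\<integral>x. (\<Sum>b\<in>Basis. partial b (V k b) x) \<partial>lebesgue_on \<Omega>) =
        (\<integral>x. (\<Sum>b\<in>Basis. partial b (\<psi> b k) x * \<zeta> x + \<psi> b k x * partial b \<zeta> x) \<partial>lebesgue_on \<Omega>)"
        by (intro Bochner_Integration.integral_cong sum.cong) (auto simp: pV mult.commute)
      also have "\<dots> = (\<Sum>b\<in>Basis. \<integral>x. (partial b (\<psi> b k) x * \<zeta> x + \<psi> b k x * partial b \<zeta> x) \<partial>lebesgue_on \<Omega>)"
        by (intro Bochner_Integration.integral_sum Bochner_Integration.integrable_add L2_mult_integrable \<psi>L \<zeta>L)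
      also have "\<dots> = (\<Sum>b\<in>Basis. integral\<^sup>L (lebesgue_on \<Omega>) (\<lambda>x. partial b (\<psi> b k) x * \<zeta> x) +
         integral\<^sup>L (lebesgue_on \<Omega>) (\<lambda>x. \<psi> b k x * partial b \<zeta> x))"
        by (intro sum.cong refl Bochner_Integration.integral_add L2_mult_integrable \<psi>L \<zeta>L)
      finally show ?thesis .
    qed
    then show ?thesis
      unfolding J_def
      by (simp only:) (intro tendsto_sum tendsto_add L2_integral_tendsto wL \<psi>L \<zeta>L \<psi>)
  qed
  have s_lim: "(\<lambda>k. \<Sum>b\<in>Basis. \<integral>\<^sup>+y. ennreal ((V k b y - \<zeta> y * g b y)\<^sup>2) \<partial>surface \<Omega>) \<longlonglongrightarrow> 0"
  proof -
    have "(\<lambda>k. \<integral>\<^sup>+y. ennreal ((V k b y - \<zeta> y * g b y)\<^sup>2) \<partial>surface \<Omega>) \<longlonglongrightarrow> 0" if b: "b \<in> Basis" for b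
    proof (rule tendsto_sandwich[OF _ _ tendsto_const])
      have "(\<lambda>k. ennreal (Z\<^sup>2) * (\<integral>\<^sup>+y. ennreal ((\<psi> b k y - g b y)\<^sup>2) \<partial>surface \<Omega>)) \<longlonglongrightarrow> ennreal (Z\<^sup>2) * 0"
        using \<psi>(4)[OF b] by (intro ennreal_tendsto_cmult) auto
      then show "(\<lambda>k. ennreal (Z\<^sup>2) * (\<integral>\<^sup>+y. ennreal ((\<psi> b k y - g b y)\<^sup>2) \<partial>surface \<Omega>)) \<longlonglongrightarrow> 0"
        by simp
      have "(\<integral>\<^sup>+y. ennreal ((V k b y - \<zeta> y * g b y)\<^sup>2) \<partial>surface \<Omega>) \<le>
          ennreal (Z\<^sup>2) * (\<integral>\<^sup>+y. ennreal ((\<psi> b k y - g b y)\<^sup>2) \<partial>surface \<Omega>)" for k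
      proof -
        have [measurable]: "\<psi> b k \<in> borel_measurable (surface \<Omega>)"
          by (intro borel_measurable_surface[OF \<Omega>] smooth_measurable \<psi>(1)[OF b])
        note [measurable] = gm[OF b]
        have "(\<integral>\<^sup>+y. ennreal ((V k b y - \<zeta> y * g b y)\<^sup>2) \<partial>surface \<Omega>) \<le>
            (\<integral>\<^sup>+y. ennreal (Z\<^sup>2) * ennreal ((\<psi> b k y - g b y)\<^sup>2) \<partial>surface \<Omega>)"
        proof (rule nn_integral_mono)
          fix y assume "y \<in> space (surface \<Omega>)"
          then have "y \<in> closure \<Omega>"
            unfolding space_surface[OF \<Omega>] by (auto simp: frontier_def)
          then have "(\<zeta> y)\<^sup>2 \<le> Z\<^sup>2"
            using Z(2)[of y] Z(1) by (simp add: abs_le_square_iff[symmetric])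
          then have "(V k b y - \<zeta> y * g b y)\<^sup>2 \<le> Z\<^sup>2 * (\<psi> b k y - g b y)\<^sup>2"
            by (simp add: V_def right_diff_distrib[symmetric] power_mult_distrib mult_right_mono)
          then show "ennreal ((V k b y - \<zeta> y * g b y)\<^sup>2) \<le> ennreal (Z\<^sup>2) * ennreal ((\<psi> b k y - g b y)\<^sup>2)"
            by (simp add: ennreal_mult[symmetric] ennreal_leI)
        qed
        then show ?thesis
          by (subst (asm) nn_integral_cmult) auto
      qed
      then show "\<forall>\<^sub>F k in sequentially. (\<integral>\<^sup>+y. ennreal ((V k b y - \<zeta> y * g b y)\<^sup>2) \<partial>surface \<Omega>) \<le>
          ennreal (Z\<^sup>2) * (\<integral>\<^sup>+y. ennreal ((\<psi> b k y - g b y)\<^sup>2) \<partial>surface \<Omega>)"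
        by (intro always_eventually allI)
    qed auto
    from tendsto_sum[OF this] show ?thesis by simp
  qed
  have J_le: "\<bar>J\<bar> \<le> K4 * \<tau>" if \<tau>: "0 < \<tau>" for \<tau>
  proof -
    have le: "ennreal \<bar>\<integral>x. (\<Sum>b\<in>Basis. partial b (V k b) x) \<partial>lebesgue_on \<Omega>\<bar> \<le>
        ennreal (K4 * \<tau>) + ennreal (K4 / \<tau>) * (\<Sum>b\<in>Basis. \<integral>\<^sup>+y. ennreal ((V k b y - \<zeta> y * g b y)\<^sup>2) \<partial>surface \<Omega>)" for k
    proof (rule divergence_bound[OF \<tau>])
      fix b :: 'a assume b: "b \<in> Basis"
      show "V k b differentiable (at x)" for x
        unfolding V_def using \<zeta>(1) smooth_differentiable[OF \<psi>(1)[OF b]] by (rule differentiable_mult)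
      show "continuous_on UNIV (partial b (V k b))"
        unfolding pV[OF b] using \<zeta>(2)[OF b] smooth_continuous[OF \<psi>(1)[OF b]] smooth_continuous[OF smooth_partial[OF \<psi>(1)[OF b] b]]
        by (intro continuous_intros \<zeta>c)
      have "\<zeta> \<in> borel_measurable (surface \<Omega>)"
        by (intro borel_measurable_surface[OF \<Omega>] borel_measurable_continuous_onI \<zeta>c)
      then show "(\<lambda>y. \<zeta> y * g b y) \<in> borel_measurable (surface \<Omega>)"
        using gm[OF b] by measurable
    next
      show "AE y in surface \<Omega>. \<forall>n. outer_unit_normal \<Omega> y n \<longrightarrow> (\<Sum>b\<in>Basis. \<zeta> y * g b y * (n \<bullet> b)) = 0"
        using normal
      proof eventually_elim
        case (elim y)
        have "(\<Sum>b\<in>Basis. \<zeta> y * g b y * (n \<bullet> b)) = \<zeta> y * (\<Sum>b\<in>Basis. g b y * (n \<bullet> b))" for n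
          by (simp add: sum_distrib_left mult.assoc)
        with elim show ?case by simp
      qed
    qed
    have rhs: "(\<lambda>k. ennreal (K4 * \<tau>) + ennreal (K4 / \<tau>) *
        (\<Sum>b\<in>Basis. \<integral>\<^sup>+y. ennreal ((V k b y - \<zeta> y * g b y)\<^sup>2) \<partial>surface \<Omega>)) \<longlonglongrightarrow> ennreal (K4 * \<tau>) + ennreal (K4 / \<tau>) * 0"
      by (intro tendsto_add tendsto_const ennreal_tendsto_cmult s_lim) auto
    have lhs: "(\<lambda>k. ennreal \<bar>\<integral>x. (\<Sum>b\<in>Basis. partial b (V k b) x) \<partial>lebesgue_on \<Omega>\<bar>) \<longlonglongrightarrow> ennreal \<bar>J\<bar>"
      by (intro tendsto_ennrealI tendsto_rabs limJ)
    have "ennreal \<bar>J\<bar> \<le> ennreal (K4 * \<tau>) + ennreal (K4 / \<tau>) * 0"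
      using le by (intro LIMSEQ_le[OF lhs rhs]) blast
    then show ?thesis
      using K4_ge(1) \<tau> by (simp add: ennreal_le_iff)
  qed
  have "J = 0"
  proof (rule ccontr)
    assume "J \<noteq> 0"
    \<comment> \<open>With this value of \<tau> the bound on |J| becomes at most half of
      |J|.\<close>
    then have "0 < \<bar>J\<bar> / (2 * (K4 + 1))"
      using K4_ge(1) by simp
    from J_le[OF this] have "\<bar>J\<bar> \<le> K4 * (\<bar>J\<bar> / (2 * (K4 + 1)))" .
    also have "\<dots> = (K4 / (K4 + 1)) * (\<bar>J\<bar> / 2)"
      by simp
    also have "\<dots> \<le> 1 * (\<bar>J\<bar> / 2)"
      using K4_ge(1) by (intro mult_right_mono) auto
    finally show False using \<open>J \<noteq> 0\<close> by simp
  qed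
  moreover have "integral\<^sup>L (lebesgue_on \<Omega>) (\<lambda>x. lap \<Omega> u x * \<zeta> x) =
      (\<Sum>b\<in>Basis. integral\<^sup>L (lebesgue_on \<Omega>) (\<lambda>x. wderiv \<Omega> b (wderiv \<Omega> b u) x * \<zeta> x))"
    unfolding lap_def sum_distrib_right by (intro Bochner_Integration.integral_sum L2_mult_integrable wL \<zeta>L)
  ultimately show ?thesis
    by (simp add: J_def sum.distrib)
qed

end

section \<open>Mollification on a convex body\<close>

lemma frechet_derivative_partial:
  fixes f :: "'a::euclidean_space \<Rightarrow> real"
  assumes "f differentiable (at x)"
  shows "frechet_derivative f (at x) k = (\<Sum>b\<in>Basis. (k \<bullet> b) * partial b f x)"
proof -
  have lin: "linear (frechet_derivative f (at x))"
    using assms by (rule linear_frechet_derivative)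
  have "frechet_derivative f (at x) k = frechet_derivative f (at x) (\<Sum>b\<in>Basis. (k \<bullet> b) *\<^sub>R b)"
    by (simp add: euclidean_representation)
  also have "\<dots> = (\<Sum>b\<in>Basis. (k \<bullet> b) * partial b f x)"
    by (simp add: linear_sum[OF lin] linear_scale[OF lin] partial_def)
  finally show ?thesis .
qed

lemma has_real_derivative_along_sum:
  fixes f :: "'a::euclidean_space \<Rightarrow> real"
  assumes "\<And>x. f differentiable (at x)"
  shows "((\<lambda>t. f (x + t *\<^sub>R k)) has_real_derivative (\<Sum>b\<in>Basis. (k \<bullet> b) * partial b f (x + t *\<^sub>R k))) (at t)"
proof -
  have "partial k f (x + t *\<^sub>R k) = (\<Sum>b\<in>Basis. (k \<bullet> b) * partial b f (x + t *\<^sub>R k))"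
    by (subst partial_def) (rule frechet_derivative_partial[OF assms])
  with has_real_derivative_along[where x = x and t = t and b = k, OF assms] show ?thesis by simp
qed

lemma Cc_infinity_lipschitz:
  fixes f :: "'a::euclidean_space \<Rightarrow> real"
  assumes f: "f \<in> Cc_infinity UNIV"
  shows "\<exists>L\<ge>0. \<forall>x k. \<bar>f (x + k) - f x\<bar> \<le> L * norm k"
proof -
  have d: "f differentiable (at x)" for x
    using Cc_infinity_smooth[OF f] by (rule smooth_differentiable)
  have "\<forall>b\<in>Basis. \<exists>C. \<forall>x. \<bar>partial b f x\<bar> \<le> C"
    using Cc_infinity_bounded[OF Cc_infinity_partial[OF f]] by metis
  then obtain C where C: "\<And>b x. b \<in> Basis \<Longrightarrow> \<bar>partial b f x\<bar> \<le> C b"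
    by metis
  have C0: "0 \<le> (\<Sum>b\<in>Basis. C b)"
    using C by (intro sum_nonneg) (meson abs_ge_zero order_trans)
  have "\<bar>f (x + k) - f x\<bar> \<le> (\<Sum>b\<in>Basis. C b) * norm k" for x k
  proof -
    have "norm (f (x + 1 *\<^sub>R k) - f (x + 0 *\<^sub>R k)) \<le> ((\<Sum>b\<in>Basis. C b) * norm k) * norm (1 - 0 :: real)"
    proof (rule field_differentiable_bound[where S = UNIV and f = "\<lambda>t. f (x + t *\<^sub>R k)"])
      fix t :: real
      show "((\<lambda>t. f (x + t *\<^sub>R k)) has_real_derivative (\<Sum>b\<in>Basis. (k \<bullet> b) * partial b f (x + t *\<^sub>R k))) (at t within UNIV)"
        using has_real_derivative_along_sum[OF d] by simp
      have "norm (\<Sum>b\<in>Basis. (k \<bullet> b) * partial b f (x + t *\<^sub>R k)) \<le> (\<Sum>b\<in>Basis. norm k * C b)"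
      proof (rule norm_sum[THEN order_trans], rule sum_mono)
        fix b :: 'a assume b: "b \<in> Basis"
        show "norm ((k \<bullet> b) * partial b f (x + t *\<^sub>R k)) \<le> norm k * C b"
          unfolding real_norm_def abs_mult using C[OF b] Basis_le_norm[OF b, of k] by (intro mult_mono) auto
      qed
      then show "norm (\<Sum>b\<in>Basis. (k \<bullet> b) * partial b f (x + t *\<^sub>R k)) \<le> (\<Sum>b\<in>Basis. C b) * norm k"
        by (simp add: sum_distrib_left mult.commute)
    qed auto
    then show ?thesis by simp
  qed
  with C0 show ?thesis by blast
qed

text \<open>Along the segment the derivative of the remainder is a combination of differences of
  partials, controlled by their Lipschitz constants. The bound is uniform in x, so it can be
  integrated when differentiating under the integral sign.\<close>

lemma Cc_infinity_second_order:
  fixes f :: "'a::euclidean_space \<Rightarrow> real"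
  assumes f: "f \<in> Cc_infinity UNIV"
  shows "\<exists>M\<ge>0. \<forall>x k. \<bar>f (x + k) - f x - (\<Sum>b\<in>Basis. (k \<bullet> b) * partial b f x)\<bar> \<le> M * (norm k)\<^sup>2"
proof -
  have d: "f differentiable (at x)" for x
    using Cc_infinity_smooth[OF f] by (rule smooth_differentiable)
  have "\<forall>b\<in>Basis. \<exists>L\<ge>0. \<forall>x k. \<bar>partial b f (x + k) - partial b f x\<bar> \<le> L * norm k"
    using Cc_infinity_lipschitz[OF Cc_infinity_partial[OF f]] by blast
  then obtain L where L: "\<And>b. b \<in> Basis \<Longrightarrow> 0 \<le> L b"
      "\<And>b x k. b \<in> Basis \<Longrightarrow> \<bar>partial b f (x + k) - partial b f x\<bar> \<le> L b * norm k"
    by metis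
  define M where "M = (\<Sum>b\<in>Basis. L b)"
  have M0: "0 \<le> M"
    unfolding M_def using L(1) by (intro sum_nonneg)
  have "\<bar>f (x + k) - f x - (\<Sum>b\<in>Basis. (k \<bullet> b) * partial b f x)\<bar> \<le> M * (norm k)\<^sup>2" for x k
  proof -
    define G where "G t = f (x + t *\<^sub>R k) - t * (\<Sum>b\<in>Basis. (k \<bullet> b) * partial b f x)" for t
    have "norm (G 1 - G 0) \<le> (M * (norm k)\<^sup>2) * norm (1 - 0 :: real)"
    proof (rule field_differentiable_bound[where S = "{0..1}"])
      fix t :: real assume t: "t \<in> {0..1}"
      have "(G has_real_derivative (\<Sum>b\<in>Basis. (k \<bullet> b) * partial b f (x + t *\<^sub>R k)) - (\<Sum>b\<in>Basis. (k \<bullet> b) * partial b f x)) (at t)"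
        unfolding G_def
        by (intro DERIV_diff has_real_derivative_along_sum[OF d] DERIV_cmult_right[OF DERIV_ident, THEN DERIV_cong]) simp
      then show "(G has_real_derivative (\<Sum>b\<in>Basis. (k \<bullet> b) * partial b f (x + t *\<^sub>R k)) - (\<Sum>b\<in>Basis. (k \<bullet> b) * partial b f x)) (at t within {0..1})"
        by (rule has_field_derivative_at_within)
      have "(\<Sum>b\<in>Basis. (k \<bullet> b) * partial b f (x + t *\<^sub>R k)) - (\<Sum>b\<in>Basis. (k \<bullet> b) * partial b f x) =
          (\<Sum>b\<in>Basis. (k \<bullet> b) * (partial b f (x + t *\<^sub>R k) - partial b f x))"
        by (simp add: right_diff_distrib sum_subtractf)
      also have "norm \<dots> \<le> (\<Sum>b\<in>Basis. norm k * (L b * norm k))"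
      proof (rule norm_sum[THEN order_trans], rule sum_mono)
        fix b :: 'a assume b: "b \<in> Basis"
        have "norm (t *\<^sub>R k) \<le> norm k"
          using t mult_right_mono[of t 1 "norm k"] by simp
        then have "L b * norm (t *\<^sub>R k) \<le> L b * norm k"
          using L(1)[OF b] by (intro mult_left_mono)
        with L(2)[OF b, of x "t *\<^sub>R k"] have "\<bar>partial b f (x + t *\<^sub>R k) - partial b f x\<bar> \<le> L b * norm k"
          by linarith
        then show "norm ((k \<bullet> b) * (partial b f (x + t *\<^sub>R k) - partial b f x)) \<le> norm k * (L b * norm k)"
          unfolding real_norm_def abs_mult using Basis_le_norm[OF b, of k] by (intro mult_mono) auto
      qed
      also have "\<dots> = M * (norm k)\<^sup>2"
        by (simp add: M_def sum_distrib_left power2_eq_square mult_ac)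
      finally show "norm ((\<Sum>b\<in>Basis. (k \<bullet> b) * partial b f (x + t *\<^sub>R k)) - (\<Sum>b\<in>Basis. (k \<bullet> b) * partial b f x)) \<le> M * (norm k)\<^sup>2" .
    qed auto
    then show ?thesis by (simp add: G_def algebra_simps)
  qed
  with M0 show ?thesis by blast
qed

lemma nn_integral_lborel_affine:
  fixes f :: "'a::euclidean_space \<Rightarrow> ennreal"
  assumes [measurable]: "f \<in> borel_measurable borel" and c: "c \<noteq> 0"
  shows "ennreal (\<bar>c\<bar> ^ DIM('a)) * (\<integral>\<^sup>+x. f (t + c *\<^sub>R x) \<partial>lborel) = (\<integral>\<^sup>+x. f x \<partial>lborel)"
proof -
  have "(\<integral>\<^sup>+x. f x \<partial>lborel) = (\<integral>\<^sup>+x. f x \<partial>density (distr lborel borel (\<lambda>x. t + c *\<^sub>R x)) (\<lambda>_. \<bar>c\<bar> ^ DIM('a)))"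
    using lborel_affine[OF c, of t] by simp
  also have "\<dots> = ennreal (\<bar>c\<bar> ^ DIM('a)) * (\<integral>\<^sup>+x. f (t + c *\<^sub>R x) \<partial>lborel)"
    by (simp add: nn_integral_density nn_integral_distr nn_integral_cmult)
  finally show ?thesis by simp
qed

lemma nn_integral_lebesgue_on_le:
  fixes f :: "'a::euclidean_space \<Rightarrow> ennreal"
  assumes "f \<in> borel_measurable borel" "\<Omega> \<in> sets lebesgue"
  shows "(\<integral>\<^sup>+x. f x \<partial>lebesgue_on \<Omega>) \<le> (\<integral>\<^sup>+x. f x \<partial>lborel)"
proof -
  have "(\<integral>\<^sup>+x. f x \<partial>lebesgue_on \<Omega>) = (\<integral>\<^sup>+x. f x * indicator \<Omega> x \<partial>lebesgue)"
    using assms(2) by (intro nn_integral_restrict_space) auto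
  also have "\<dots> \<le> (\<integral>\<^sup>+x. f x \<partial>lebesgue)"
    by (intro nn_integral_mono) (auto simp: indicator_def)
  also have "\<dots> = (\<integral>\<^sup>+x. f x \<partial>lborel)"
    by (rule nn_integral_completion)
  finally show ?thesis .
qed

context convex_body
begin

lemma \<Omega>_sets: "\<Omega> \<in> sets lebesgue"
  using op by auto

sublocale \<Omega>: finite_measure "lebesgue_on \<Omega>"
  using \<Omega>_lmeasurable by (rule finite_measure_lebesgue_on)

lemma L2_imp_integrable: "v \<in> L2 \<Omega> \<Longrightarrow> integrable (lebesgue_on \<Omega>) v"
  using L2_mult_integrable[of v \<Omega> "\<lambda>x. 1"] by (simp add: L2_def)

lemma L2_mult_bounded:
  assumes v: "v \<in> L2 \<Omega>" and f: "f \<in> borel_measurable borel" "\<And>x. \<bar>f x\<bar> \<le> C"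
  shows "(\<lambda>y. v y * f y) \<in> L2 \<Omega>"
proof (rule L2_bound)
  show "(\<lambda>y. C * v y) \<in> L2 \<Omega>"
    using v by (rule L2_cmult)
  have "f \<in> borel_measurable (lebesgue_on \<Omega>)"
    using f(1) by (intro measurable_restrict_space1 measurable_completion) simp
  then show "(\<lambda>y. v y * f y) \<in> borel_measurable (lebesgue_on \<Omega>)"
    using v by measurable
  show "AE y in lebesgue_on \<Omega>. \<bar>v y * f y\<bar> \<le> \<bar>C * v y\<bar>"
  proof (rule AE_I2)
    fix y
    have "\<bar>f y\<bar> \<le> \<bar>C\<bar>" using f(2)[of y] by linarith
    then show "\<bar>v y * f y\<bar> \<le> \<bar>C * v y\<bar>"
      by (simp add: abs_mult mult.commute mult_right_mono)
  qed
qed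

subsection \<open>Differentiation under the integral sign\<close>

text \<open>The second order remainder of \<Theta> is integrated against |v|, which is integrable
  because \<Omega> has finite measure; the result is still of order |k|^2. The factor
  \<open>r\<close> is there for the contraction, with r = 1 - s below.\<close>

lemma mollification_has_derivative:
  assumes v: "v \<in> L2 \<Omega>" and \<Theta>: "\<Theta> \<in> Cc_infinity UNIV"
  shows "((\<lambda>x. \<integral>y. v y * \<Theta> (y - r *\<^sub>R x) \<partial>lebesgue_on \<Omega>) has_derivative
     (\<lambda>k. \<Sum>b\<in>Basis. (k \<bullet> b) * (- r * (\<integral>y. v y * partial b \<Theta> (y - r *\<^sub>R x) \<partial>lebesgue_on \<Omega>)))) (at x)"
proof -
  define F where "F x = (\<integral>y. v y * \<Theta> (y - r *\<^sub>R x) \<partial>lebesgue_on \<Omega>)" for x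
  define P where "P b = (\<integral>y. v y * partial b \<Theta> (y - r *\<^sub>R x) \<partial>lebesgue_on \<Omega>)" for b
  have int: "integrable (lebesgue_on \<Omega>) (\<lambda>y. v y * f (y - z))" if f: "f \<in> Cc_infinity UNIV" for f z
  proof -
    obtain C where C: "\<And>x. \<bar>f x\<bar> \<le> C"
      using Cc_infinity_bounded[OF f] by blast
    have [measurable]: "f \<in> borel_measurable borel"
      using f by (intro smooth_measurable) (rule Cc_infinity_smooth)
    have "(\<lambda>y. v y * f (y - z)) \<in> L2 \<Omega>"
      by (rule L2_mult_bounded[OF v _ C]) measurable
    then show ?thesis by (rule L2_imp_integrable)
  qed
  obtain M where M: "0 \<le> M" "\<And>z k. \<bar>\<Theta> (z + k) - \<Theta> z - (\<Sum>b\<in>Basis. (k \<bullet> b) * partial b \<Theta> z)\<bar> \<le> M * (norm k)\<^sup>2"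
    using Cc_infinity_second_order[OF \<Theta>] by blast
  define I where "I = (\<integral>y. \<bar>v y\<bar> \<partial>lebesgue_on \<Omega>)"
  have iv: "integrable (lebesgue_on \<Omega>) (\<lambda>y. \<bar>v y\<bar>)"
    using L2_imp_integrable[OF v] by simp
  have main: "\<bar>F (x + k) - F x - (\<Sum>b\<in>Basis. (k \<bullet> b) * (- r * P b))\<bar> \<le> (M * r\<^sup>2 * I) * (norm k)\<^sup>2" for k
  proof -
    let ?E = "\<lambda>y. \<Theta> ((y - r *\<^sub>R x) + (- r) *\<^sub>R k) - \<Theta> (y - r *\<^sub>R x) -
       (\<Sum>b\<in>Basis. (((- r) *\<^sub>R k) \<bullet> b) * partial b \<Theta> (y - r *\<^sub>R x))"
    have arg: "y - r *\<^sub>R (x + k) = (y - r *\<^sub>R x) + (- r) *\<^sub>R k" for y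
      by (simp add: algebra_simps)
    have i1: "integrable (lebesgue_on \<Omega>) (\<lambda>y. v y * \<Theta> ((y - r *\<^sub>R x) + (- r) *\<^sub>R k))"
      using int[OF \<Theta>, of "r *\<^sub>R (x + k)"] unfolding arg .
    have i3: "integrable (lebesgue_on \<Omega>) (\<lambda>y. (k \<bullet> b) * (- r * (v y * partial b \<Theta> (y - r *\<^sub>R x))))" if "b \<in> Basis" for b
      using int[OF Cc_infinity_partial[OF \<Theta> that]] by simp
    have "F (x + k) - F x - (\<Sum>b\<in>Basis. (k \<bullet> b) * (- r * P b)) =
        (\<integral>y. v y * \<Theta> ((y - r *\<^sub>R x) + (- r) *\<^sub>R k) \<partial>lebesgue_on \<Omega>) - (\<integral>y. v y * \<Theta> (y - r *\<^sub>R x) \<partial>lebesgue_on \<Omega>) -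
        (\<integral>y. (\<Sum>b\<in>Basis. (k \<bullet> b) * (- r * (v y * partial b \<Theta> (y - r *\<^sub>R x)))) \<partial>lebesgue_on \<Omega>)"
      unfolding F_def P_def arg by (subst Bochner_Integration.integral_sum, rule i3, assumption, simp)
    also have "\<dots> = (\<integral>y. (v y * \<Theta> ((y - r *\<^sub>R x) + (- r) *\<^sub>R k) - v y * \<Theta> (y - r *\<^sub>R x) -
        (\<Sum>b\<in>Basis. (k \<bullet> b) * (- r * (v y * partial b \<Theta> (y - r *\<^sub>R x))))) \<partial>lebesgue_on \<Omega>)"
      using i1 int[OF \<Theta>, of "r *\<^sub>R x"] i3
      by (simp only: Bochner_Integration.integral_diff Bochner_Integration.integrable_diff Bochner_Integration.integrable_sum)
    also have "\<dots> = (\<integral>y. v y * ?E y \<partial>lebesgue_on \<Omega>)"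
      by (intro Bochner_Integration.integral_cong refl) (simp add: right_diff_distrib sum_distrib_left mult_ac)
    finally have eq: "F (x + k) - F x - (\<Sum>b\<in>Basis. (k \<bullet> b) * (- r * P b)) = (\<integral>y. v y * ?E y \<partial>lebesgue_on \<Omega>)" .
    have "norm (\<integral>y. v y * ?E y \<partial>lebesgue_on \<Omega>) \<le> (\<integral>y. (M * r\<^sup>2 * (norm k)\<^sup>2) * \<bar>v y\<bar> \<partial>lebesgue_on \<Omega>)"
    proof (rule Bochner_Integration.integral_norm_bound_integral)
      have "integrable (lebesgue_on \<Omega>) (\<lambda>y. v y * \<Theta> ((y - r *\<^sub>R x) + (- r) *\<^sub>R k) - v y * \<Theta> (y - r *\<^sub>R x) -
        (\<Sum>b\<in>Basis. (k \<bullet> b) * (- r * (v y * partial b \<Theta> (y - r *\<^sub>R x)))))"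
        by (intro Bochner_Integration.integrable_diff Bochner_Integration.integrable_sum i1 int[OF \<Theta>] i3)
      also have "(\<lambda>y. v y * \<Theta> ((y - r *\<^sub>R x) + (- r) *\<^sub>R k) - v y * \<Theta> (y - r *\<^sub>R x) -
        (\<Sum>b\<in>Basis. (k \<bullet> b) * (- r * (v y * partial b \<Theta> (y - r *\<^sub>R x))))) = (\<lambda>y. v y * ?E y)"
        by (intro ext) (simp add: right_diff_distrib sum_distrib_left mult_ac)
      finally show "integrable (lebesgue_on \<Omega>) (\<lambda>y. v y * ?E y)" .
      show "integrable (lebesgue_on \<Omega>) (\<lambda>y. (M * r\<^sup>2 * (norm k)\<^sup>2) * \<bar>v y\<bar>)"
        using iv by (rule integrable_mult_right)
      fix y
      have "\<bar>?E y\<bar> \<le> M * (norm ((- r) *\<^sub>R k))\<^sup>2"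
        by (rule M(2))
      also have "\<dots> = M * r\<^sup>2 * (norm k)\<^sup>2"
        by (simp add: power_mult_distrib)
      finally show "norm (v y * ?E y) \<le> (M * r\<^sup>2 * (norm k)\<^sup>2) * \<bar>v y\<bar>"
        unfolding real_norm_def abs_mult by (subst mult.commute) (intro mult_right_mono, auto)
    qed
    also have "\<dots> = (M * r\<^sup>2 * I) * (norm k)\<^sup>2"
      by (simp add: I_def)
    finally show ?thesis
      unfolding eq real_norm_def .
  qed
  show ?thesis
    unfolding F_def[symmetric] P_def[symmetric] has_derivative_at
  proof
    show "bounded_linear (\<lambda>k. \<Sum>b\<in>Basis. (k \<bullet> b) * (- r * P b))"
      by (intro bounded_linear_sum bounded_linear_mult_const bounded_linear_inner_left)
    show "(\<lambda>k. norm (F (x + k) - F x - (\<Sum>b\<in>Basis. (k \<bullet> b) * (- r * P b))) / norm k) \<midarrow>0\<rightarrow> 0"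
    proof (rule Lim_null_comparison)
      show "\<forall>\<^sub>F k in at 0. norm (norm (F (x + k) - F x - (\<Sum>b\<in>Basis. (k \<bullet> b) * (- r * P b))) / norm k) \<le> (M * r\<^sup>2 * I) * norm k"
      proof (rule always_eventually, rule allI)
        fix k :: 'a
        show "norm (norm (F (x + k) - F x - (\<Sum>b\<in>Basis. (k \<bullet> b) * (- r * P b))) / norm k) \<le> (M * r\<^sup>2 * I) * norm k"
        proof (cases "k = 0")
          case False
          then show ?thesis
            using main[of k] by (simp add: divide_le_eq power2_eq_square mult.assoc)
        qed simp
      qed
      show "((\<lambda>k :: 'a. (M * r\<^sup>2 * I) * norm k) \<longlongrightarrow> 0) (at 0)"
        by (rule tendsto_mult_right_zero[OF tendsto_norm_zero[OF tendsto_ident_at]])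
    qed
  qed
qed

lemma mollification_continuous:
  assumes v: "v \<in> L2 \<Omega>" and \<Theta>: "\<Theta> \<in> Cc_infinity UNIV"
  shows "continuous_on UNIV (\<lambda>x. \<integral>y. v y * \<Theta> (y - r *\<^sub>R x) \<partial>lebesgue_on \<Omega>)"
  using has_derivative_continuous[OF mollification_has_derivative[OF assms]]
  by (simp add: continuous_on_eq_continuous_within)

lemma mollification_partial:
  assumes v: "v \<in> L2 \<Omega>" and \<Theta>: "\<Theta> \<in> Cc_infinity UNIV" and b: "b \<in> Basis"
  shows "partial b (\<lambda>x. \<integral>y. v y * \<Theta> (y - r *\<^sub>R x) \<partial>lebesgue_on \<Omega>) =
     (\<lambda>x. - r * (\<integral>y. v y * partial b \<Theta> (y - r *\<^sub>R x) \<partial>lebesgue_on \<Omega>))"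
proof
  fix x
  have "partial b (\<lambda>x. \<integral>y. v y * \<Theta> (y - r *\<^sub>R x) \<partial>lebesgue_on \<Omega>) x =
     (\<Sum>c\<in>Basis. (b \<bullet> c) * (- r * (\<integral>y. v y * partial c \<Theta> (y - r *\<^sub>R x) \<partial>lebesgue_on \<Omega>)))"
    by (rule partial_eqI[OF mollification_has_derivative[OF v \<Theta>]])
  also have "\<dots> = (\<Sum>c\<in>Basis. if c = b then - r * (\<integral>y. v y * partial c \<Theta> (y - r *\<^sub>R x) \<partial>lebesgue_on \<Omega>) else 0)"
    using b by (intro sum.cong) (auto simp: inner_Basis)
  also have "\<dots> = - r * (\<integral>y. v y * partial b \<Theta> (y - r *\<^sub>R x) \<partial>lebesgue_on \<Omega>)"
    using b by simp
  finally show "partial b (\<lambda>x. \<integral>y. v y * \<Theta> (y - r *\<^sub>R x) \<partial>lebesgue_on \<Omega>) x =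
     - r * (\<integral>y. v y * partial b \<Theta> (y - r *\<^sub>R x) \<partial>lebesgue_on \<Omega>)" .
qed

end

lemma partial_translate:
  fixes f :: "'a::euclidean_space \<Rightarrow> real"
  assumes "f differentiable (at (y - c))"
  shows "partial b (\<lambda>y. f (y - c)) y = partial b f (y - c)"
proof -
  have d: "(f has_derivative frechet_derivative f (at (y - c))) (at (y - c))"
    using assms by (rule frechet_derivative_works[THEN iffD1])
  have "((\<lambda>y. f (y - c)) has_derivative frechet_derivative f (at (y - c))) (at y)"
    by (rule has_derivative_compose[where f = "\<lambda>y. y - c" and g = f, OF _ d, simplified])
      (auto intro!: derivative_eq_intros)
  from partial_eqI[OF this] show ?thesis by (simp add: partial_def)
qed

context convex_body
begin

subsection \<open>The contracted mollifier\<close>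

text \<open>
  For \<open>x \<in> \<Omega>\<close> the kernel below averages over the ball of radius \<open>s \<rho>\<close> around
  \<open>(1 - s) x + s a\<close>, which is contained in \<open>\<Omega>\<close> by convexity; no extension of functions is needed.
\<close>

definition mass :: "real \<Rightarrow> real" where
  "mass s = integral\<^sup>L lborel (bump (s *\<^sub>R a) (s * \<rho>))"

definition kern :: "real \<Rightarrow> 'a \<Rightarrow> real" where
  "kern s z = (1 / mass s) * bump (s *\<^sub>R a) (s * \<rho>) z"

definition mollify :: "real \<Rightarrow> ('a \<Rightarrow> real) \<Rightarrow> 'a \<Rightarrow> real" where
  "mollify s v x = (\<integral>y. v y * kern s (y - (1 - s) *\<^sub>R x) \<partial>lebesgue_on \<Omega>)"

lemma kern_Cc:
  assumes "0 < s"
  shows "kern s \<in> Cc_infinity UNIV"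
  unfolding kern_def using assms \<rho>(1) by (intro Cc_infinity_cmult Cc_infinity_bump) auto

lemma kern_smooth: "0 < s \<Longrightarrow> smooth (kern s)"
  by (rule Cc_infinity_smooth[OF kern_Cc])

lemma bump_integrable:
  assumes "0 < s"
  shows "integrable lborel (bump (s *\<^sub>R a) (s * \<rho>))"
proof (rule integrable_lborel_bounded_support)
  show "bump (s *\<^sub>R a) (s * \<rho>) \<in> borel_measurable borel"
    by (intro smooth_measurable smooth_bump)
  show "\<bar>bump (s *\<^sub>R a) (s * \<rho>) x\<bar> \<le> 1" for x
    by (simp add: bump_nonneg bump_le_1)
  show "bump (s *\<^sub>R a) (s * \<rho>) x = 0" if "x \<notin> cball 0 (s * \<rho> + norm (s *\<^sub>R a))" for x
  proof (rule bump_zero)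
    show "0 \<le> s * \<rho>" using assms \<rho>(1) by simp
    show "s * \<rho> \<le> norm (x - s *\<^sub>R a)"
      using that norm_triangle_ineq[of "x - s *\<^sub>R a" "s *\<^sub>R a"] by simp
  qed
qed

lemma mass_pos:
  assumes s: "0 < s"
  shows "0 < mass s"
proof -
  let ?b = "bump (s *\<^sub>R a) (s * \<rho>)"
  have "0 \<le> mass s"
    unfolding mass_def by (intro integral_nonneg_AE) (simp add: bump_nonneg)
  moreover have "mass s \<noteq> 0"
  proof
    assume "mass s = 0"
    then have "AE x in lborel. ?b x = 0"
      unfolding mass_def using bump_integrable[OF s]
      by (subst (asm) integral_nonneg_eq_0_iff_AE) (auto simp: bump_nonneg)
    then have "AE x in lborel. x \<notin> ball (s *\<^sub>R a) (s * \<rho>)"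
    proof eventually_elim
      case (elim x)
      then show ?case
        using bump_pos[of x "s *\<^sub>R a" "s * \<rho>"] by (auto simp: dist_norm norm_minus_commute)
    qed
    then have "ball (s *\<^sub>R a) (s * \<rho>) \<in> null_sets lborel"
      by (subst (asm) AE_iff_null) (auto simp: ball_def)
    then have "negligible (ball (s *\<^sub>R a) (s * \<rho>))"
      by (simp add: negligible_iff_null_sets null_sets_completionI)
    then show False
      using open_not_negligible[of "ball (s *\<^sub>R a) (s * \<rho>)"] mult_pos_pos[OF s \<rho>(1)] by auto
  qed
  ultimately show ?thesis by simp
qed

lemma kern_nonneg: "0 < s \<Longrightarrow> 0 \<le> kern s z"
  using mass_pos[of s] by (simp add: kern_def bump_nonneg)

lemma kern_measurable: "0 < s \<Longrightarrow> kern s \<in> borel_measurable borel"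
  by (intro smooth_measurable kern_smooth)

lemma kern_bounded: "0 < s \<Longrightarrow> \<bar>kern s z\<bar> \<le> 1 / mass s"
  using mass_pos[of s] bump_le_1[of "s *\<^sub>R a" "s * \<rho>" z] bump_nonneg[of "s *\<^sub>R a" "s * \<rho>" z]
  by (simp add: kern_def divide_right_mono)

lemma kern_integral:
  assumes s: "0 < s"
  shows "integrable lborel (kern s)" "integral\<^sup>L lborel (kern s) = 1"
proof -
  show "integrable lborel (kern s)"
    unfolding kern_def using bump_integrable[OF s] by (rule integrable_mult_right)
  have "integral\<^sup>L lborel (kern s) = (1 / mass s) * integral\<^sup>L lborel (bump (s *\<^sub>R a) (s * \<rho>))"
    unfolding kern_def by simp
  then show "integral\<^sup>L lborel (kern s) = 1"
    using mass_pos[OF s] by (simp add: mass_def)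
qed

lemma kern_nn_integral:
  assumes s: "0 < s"
  shows "(\<integral>\<^sup>+z. ennreal (kern s z) \<partial>lborel) = 1"
  using kern_integral[OF s] kern_nonneg[OF s] by (subst nn_integral_eq_integral) auto

text \<open>Such a \<open>y\<close> is a convex combination of \<open>x\<close> and a point a + z of
  the inner ball, with weight s on the latter. This yields the membership and the displacement s (z
  - (x - a)).\<close>

lemma kern_support:
  assumes s: "0 < s" "s \<le> 1" and x: "x \<in> \<Omega>" and y: "kern s (y - (1 - s) *\<^sub>R x) \<noteq> 0"
  shows "y \<in> \<Omega>" "norm (y - x) \<le> s * (R + \<rho>)"
proof -
  define z where "z = (1 / s) *\<^sub>R (y - (1 - s) *\<^sub>R x - s *\<^sub>R a)"
  have "\<not> s * \<rho> \<le> norm (y - (1 - s) *\<^sub>R x - s *\<^sub>R a)"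
    using y bump_zero[of "s * \<rho>" "y - (1 - s) *\<^sub>R x" "s *\<^sub>R a"] s \<rho>(1) by (auto simp: kern_def)
  then have z: "norm z \<le> \<rho>"
    using s unfolding z_def norm_scaleR by (simp add: pos_divide_le_eq mult.commute)
  have yz: "y = (1 - s) *\<^sub>R x + s *\<^sub>R (a + z)"
    using s by (simp add: z_def algebra_simps)
  have "a + z \<in> \<Omega>"
    using z \<rho>(2) by (auto simp: subset_iff dist_norm)
  then show "y \<in> \<Omega>"
    unfolding yz using convexD_alt[OF convex x] s by auto
  have "y - x = s *\<^sub>R (z - (x - a))"
    unfolding yz by (simp add: algebra_simps)
  then have "norm (y - x) = s * norm (z - (x - a))"
    using s by simp
  also have "\<dots> \<le> s * (R + \<rho>)"
    using norm_triangle_ineq4[of z "x - a"] z R[OF x] s by (intro mult_left_mono) auto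
  finally show "norm (y - x) \<le> s * (R + \<rho>)" .
qed

text \<open>As a function of the integration variable the kernel is supported in a closed ball
  inside \<Omega>, which makes it admissible in the definition of weak derivatives.\<close>

lemma kern_test_function:
  assumes s: "0 < s" "s \<le> 1" and x: "x \<in> \<Omega>"
  shows "(\<lambda>y. kern s (y - (1 - s) *\<^sub>R x)) \<in> Cc_infinity \<Omega>"
proof -
  have "(\<lambda>y. kern s (y - (1 - s) *\<^sub>R x)) = (\<lambda>y. (1 / mass s) * bump ((1 - s) *\<^sub>R x + s *\<^sub>R a) (s * \<rho>) y)"
    by (simp add: kern_def bump_def algebra_simps)
  moreover have "cball ((1 - s) *\<^sub>R x + s *\<^sub>R a) (s * \<rho>) \<subseteq> \<Omega>"
  proof
    fix y assume y: "y \<in> cball ((1 - s) *\<^sub>R x + s *\<^sub>R a) (s * \<rho>)"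
    define z where "z = (1 / s) *\<^sub>R (y - (1 - s) *\<^sub>R x - s *\<^sub>R a)"
    have "norm (y - (1 - s) *\<^sub>R x - s *\<^sub>R a) \<le> s * \<rho>"
      using y by (simp add: dist_norm norm_minus_commute algebra_simps)
    then have "norm z \<le> \<rho>"
      using s unfolding z_def norm_scaleR by (simp add: pos_divide_le_eq mult.commute)
    then have "a + z \<in> \<Omega>"
      using \<rho>(2) by (auto simp: subset_iff dist_norm)
    moreover have "y = (1 - s) *\<^sub>R x + s *\<^sub>R (a + z)"
      using s by (simp add: z_def algebra_simps)
    ultimately show "y \<in> \<Omega>"
      using convexD_alt[OF convex x] s by auto
  qed
  ultimately show ?thesis
    using s \<rho>(1) by (simp only:) (intro Cc_infinity_cmult Cc_infinity_bump, auto)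
qed

lemma kern_integral_\<Omega>:
  assumes s: "0 < s" "s \<le> 1" and x: "x \<in> \<Omega>"
  shows "(\<integral>y. kern s (y - (1 - s) *\<^sub>R x) \<partial>lebesgue_on \<Omega>) = 1"
proof -
  have [measurable]: "kern s \<in> borel_measurable borel"
    using s(1) by (rule kern_measurable)
  have "(\<integral>y. kern s (y - (1 - s) *\<^sub>R x) \<partial>lebesgue_on \<Omega>) = (\<integral>y. kern s (y - (1 - s) *\<^sub>R x) \<partial>lborel)"
    using kern_support(1)[OF s x] op by (intro integral_lebesgue_on_eq_lborel) auto
  also have "\<dots> = integral\<^sup>L lborel (kern s)"
    using integral_lborel_translate[of "kern s" "- ((1 - s) *\<^sub>R x)"] by (simp add: add.commute)
  finally show ?thesis using kern_integral(2)[OF s(1)] by simp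
qed

text \<open>Differentiation in x falls on the kernel with factor - (1 - s), and the weak derivative
  moves it to \<open>v\<close> with a second minus sign. So the contraction alone accounts for the
  factor 1 - s.\<close>

lemma mollify_partial:
  assumes s: "0 < s" "s \<le> 1" and x: "x \<in> \<Omega>" and b: "b \<in> Basis" and v: "v \<in> L2 \<Omega>" and g: "is_weak_deriv \<Omega> b v g"
  shows "partial b (mollify s v) x = (1 - s) * mollify s g x"
proof -
  have "partial b (mollify s v) x = - (1 - s) * (\<integral>y. v y * partial b (kern s) (y - (1 - s) *\<^sub>R x) \<partial>lebesgue_on \<Omega>)"
    unfolding mollify_def[abs_def] by (simp only: mollification_partial[OF v kern_Cc[OF s(1)] b])
  also have "(\<integral>y. v y * partial b (kern s) (y - (1 - s) *\<^sub>R x) \<partial>lebesgue_on \<Omega>) =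
      (\<integral>y. v y * partial b (\<lambda>y. kern s (y - (1 - s) *\<^sub>R x)) y \<partial>lebesgue_on \<Omega>)"
    using smooth_differentiable[OF kern_smooth[OF s(1)]] by (simp add: partial_translate)
  also have "\<dots> = - mollify s g x"
    using g kern_test_function[OF s x] unfolding is_weak_deriv_def mollify_def by blast
  finally show ?thesis by (simp only: mult_minus_left mult_minus_right minus_minus)
qed

lemma mollify_differentiable: "0 < s \<Longrightarrow> v \<in> L2 \<Omega> \<Longrightarrow> mollify s v differentiable (at x)"
  unfolding mollify_def[abs_def] differentiable_def using mollification_has_derivative[OF _ kern_Cc] by blast

lemma mollify_continuous: "0 < s \<Longrightarrow> v \<in> L2 \<Omega> \<Longrightarrow> continuous_on UNIV (mollify s v)"
  unfolding mollify_def[abs_def] by (rule mollification_continuous[OF _ kern_Cc])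

lemma mollify_partial_continuous:
  assumes "0 < s" "v \<in> L2 \<Omega>" "b \<in> Basis"
  shows "continuous_on UNIV (partial b (mollify s v))"
  unfolding mollify_def[abs_def] mollification_partial[OF assms(2) kern_Cc[OF assms(1)] assms(3)]
  by (intro continuous_intros mollification_continuous[OF assms(2) Cc_infinity_partial[OF kern_Cc[OF assms(1)] assms(3)]])

lemma mollify_L2: "0 < s \<Longrightarrow> v \<in> L2 \<Omega> \<Longrightarrow> mollify s v \<in> L2 \<Omega>"
  by (rule continuous_imp_L2[OF bounded op continuous_on_subset[OF mollify_continuous subset_UNIV]])

lemma kern_shift_measurable: "0 < s \<Longrightarrow> (\<lambda>y. kern s (y - z)) \<in> borel_measurable borel"
  using kern_measurable[of s] by measurable

lemma mollify_integrable:
  assumes "0 < s" "v \<in> L2 \<Omega>"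
  shows "integrable (lebesgue_on \<Omega>) (\<lambda>y. v y * kern s (y - z))"
  by (rule L2_imp_integrable[OF L2_mult_bounded[OF assms(2) kern_shift_measurable[OF assms(1)] kern_bounded[OF assms(1)]]])

lemma mollify_diff:
  assumes "0 < s" "u \<in> L2 \<Omega>" "v \<in> L2 \<Omega>"
  shows "mollify s (\<lambda>x. u x - v x) x = mollify s u x - mollify s v x"
  unfolding mollify_def left_diff_distrib
  by (intro Bochner_Integration.integral_diff mollify_integrable assms)

lemma one_L2: "(\<lambda>x. 1) \<in> L2 \<Omega>"
  by (intro continuous_imp_L2 bounded op continuous_intros)

text \<open>Cauchy-Schwarz with the kernel split into two square roots; the mass of the kernel over
  \<Omega> is at most 1 for every x.\<close>

lemma mollify_square_le:
  assumes s: "0 < s" and v: "v \<in> L2 \<Omega>"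
  shows "ennreal ((mollify s v x)\<^sup>2) \<le> (\<integral>\<^sup>+y. ennreal ((v y)\<^sup>2) * ennreal (kern s (y - (1 - s) *\<^sub>R x)) \<partial>lebesgue_on \<Omega>)"
proof -
  define k where "k y = kern s (y - (1 - s) *\<^sub>R x)" for y
  have k0: "0 \<le> k y" for y
    by (simp add: k_def kern_nonneg[OF s])
  have [measurable]: "k \<in> borel_measurable borel"
    unfolding k_def using s by (rule kern_shift_measurable)
  have kb: "\<bar>sqrt (k y)\<bar> \<le> sqrt (1 / mass s)" for y
    using kern_bounded[OF s, of "y - (1 - s) *\<^sub>R x"] k0[of y] by (simp add: k_def)
  have L: "(\<lambda>y. v y * sqrt (k y)) \<in> L2 \<Omega>"
    by (rule L2_mult_bounded[OF v _ kb]) measurable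
  have L': "(\<lambda>y. sqrt (k y)) \<in> L2 \<Omega>"
    using L2_mult_bounded[OF one_L2 _ kb] by simp
  have "mollify s v x = (\<integral>y. (v y * sqrt (k y)) * sqrt (k y) \<partial>lebesgue_on \<Omega>)"
    using k0 by (simp add: mollify_def k_def[symmetric] mult.assoc)
  then have "\<bar>mollify s v x\<bar> \<le> L2norm \<Omega> (\<lambda>y. v y * sqrt (k y)) * L2norm \<Omega> (\<lambda>y. sqrt (k y))"
    using L2_Cauchy_Schwarz[OF L L'] by simp
  then have "(mollify s v x)\<^sup>2 \<le> (L2norm \<Omega> (\<lambda>y. v y * sqrt (k y)) * L2norm \<Omega> (\<lambda>y. sqrt (k y)))\<^sup>2"
    by (metis abs_ge_zero power2_abs power_mono)
  also have "\<dots> = (\<integral>y. (v y)\<^sup>2 * k y \<partial>lebesgue_on \<Omega>) * (\<integral>y. k y \<partial>lebesgue_on \<Omega>)"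
    using k0 by (simp add: power_mult_distrib L2norm_square)
  also have "\<dots> \<le> (\<integral>y. (v y)\<^sup>2 * k y \<partial>lebesgue_on \<Omega>) * 1"
  proof (rule mult_left_mono)
    have ik: "integrable (lebesgue_on \<Omega>) k"
      using mollify_integrable[OF s one_L2, of "(1 - s) *\<^sub>R x"] unfolding k_def[abs_def] by simp
    have "ennreal (\<integral>y. k y \<partial>lebesgue_on \<Omega>) = (\<integral>\<^sup>+y. ennreal (k y) \<partial>lebesgue_on \<Omega>)"
      using ik k0 by (intro nn_integral_eq_integral[symmetric]) auto
    also have "\<dots> \<le> (\<integral>\<^sup>+y. ennreal (k y) \<partial>lborel)"
      by (intro nn_integral_lebesgue_on_le \<Omega>_sets) measurable
    also have "\<dots> = 1"
      using nn_integral_lborel_affine[of "\<lambda>z. ennreal (kern s z)" 1 "- ((1 - s) *\<^sub>R x)"] kern_nn_integral[OF s]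
        kern_measurable[OF s] by (simp add: k_def)
    finally show "(\<integral>y. k y \<partial>lebesgue_on \<Omega>) \<le> 1"
      by simp
    show "0 \<le> (\<integral>y. (v y)\<^sup>2 * k y \<partial>lebesgue_on \<Omega>)"
      using k0 by (intro integral_nonneg_AE) auto
  qed
  finally have "ennreal ((mollify s v x)\<^sup>2) \<le> ennreal (\<integral>y. (v y)\<^sup>2 * k y \<partial>lebesgue_on \<Omega>)"
    by (simp add: ennreal_leI)
  also have "\<dots> = (\<integral>\<^sup>+y. ennreal ((v y)\<^sup>2 * k y) \<partial>lebesgue_on \<Omega>)"
  proof (rule nn_integral_eq_integral[symmetric])
    show "integrable (lebesgue_on \<Omega>) (\<lambda>y. (v y)\<^sup>2 * k y)"
      using L2_integrable_square[OF L] k0 by (simp add: power_mult_distrib)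
  qed (use k0 in auto)
  also have "\<dots> = (\<integral>\<^sup>+y. ennreal ((v y)\<^sup>2) * ennreal (k y) \<partial>lebesgue_on \<Omega>)"
    using k0 by (simp add: ennreal_mult)
  finally show ?thesis by (simp add: k_def)
qed

text \<open>After Fubini it remains to integrate the kernel in x. The contraction of x by 1 - s
  makes this integral at most (1 - s)^(-d), which is at most 2^d because s \<le> 1/2.\<close>

lemma mollify_L2norm_le:
  assumes s: "0 < s" "s \<le> 1 / 2" and v: "v \<in> L2 \<Omega>"
  shows "L2norm \<Omega> (mollify s v) \<le> sqrt (2 ^ DIM('a)) * L2norm \<Omega> v"
proof -
  interpret P: pair_sigma_finite "lebesgue_on \<Omega>" "lebesgue_on \<Omega>" ..
  have [measurable]: "kern s \<in> borel_measurable borel"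
    using s(1) by (rule kern_measurable)
  \<comment> \<open>Fubini takes place on a product of completed measures; the kernel is jointly
    measurable there because the identity is measurable into the Borel sets.\<close>
  have idm: "(\<lambda>x. x) \<in> borel_measurable (lebesgue_on \<Omega>)"
    by (intro measurable_restrict_space1 measurable_completion) simp
  have [measurable]: "fst \<in> measurable (lebesgue_on \<Omega> \<Otimes>\<^sub>M lebesgue_on \<Omega>) borel"
    "snd \<in> measurable (lebesgue_on \<Omega> \<Otimes>\<^sub>M lebesgue_on \<Omega>) borel"
    "(\<lambda>p. v (snd p)) \<in> borel_measurable (lebesgue_on \<Omega> \<Otimes>\<^sub>M lebesgue_on \<Omega>)"
    using measurable_compose[OF measurable_fst idm] measurable_compose[OF measurable_snd idm]
      measurable_compose[OF measurable_snd L2_measurable[OF v]] by auto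
  have vm [measurable]: "v \<in> borel_measurable (lebesgue_on \<Omega>)"
    using v by (rule L2_measurable)
  let ?k = "\<lambda>x y. ennreal (kern s (y - (1 - s) *\<^sub>R x))"
  have k: "(\<integral>\<^sup>+x. ?k x y \<partial>lebesgue_on \<Omega>) \<le> ennreal (2 ^ DIM('a))" for y
  proof -
    have "(\<integral>\<^sup>+x. ?k x y \<partial>lebesgue_on \<Omega>) \<le> (\<integral>\<^sup>+x. ?k x y \<partial>lborel)"
      by (intro nn_integral_lebesgue_on_le \<Omega>_sets) measurable
    also have "\<dots> \<le> ennreal (2 ^ DIM('a) * (1 - s) ^ DIM('a)) * (\<integral>\<^sup>+x. ?k x y \<partial>lborel)"
    proof -
      have "1 \<le> (2 * (1 - s)) ^ DIM('a)"
        using s by (intro one_le_power) simp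
      then have "1 \<le> 2 ^ DIM('a) * (1 - s) ^ DIM('a)"
        by (simp only: power_mult_distrib)
      then have "ennreal 1 * (\<integral>\<^sup>+x. ?k x y \<partial>lborel) \<le> ennreal (2 ^ DIM('a) * (1 - s) ^ DIM('a)) * (\<integral>\<^sup>+x. ?k x y \<partial>lborel)"
        by (intro mult_right_mono ennreal_leI) auto
      then show ?thesis by simp
    qed
    also have "\<dots> = ennreal (2 ^ DIM('a)) * (ennreal (\<bar>- (1 - s)\<bar> ^ DIM('a)) * (\<integral>\<^sup>+x. ennreal (kern s (y + (- (1 - s)) *\<^sub>R x)) \<partial>lborel))"
    proof -
      have "y - (1 - s) *\<^sub>R x = y + (- (1 - s)) *\<^sub>R x" for x
        by (simp add: algebra_simps)
      then show ?thesis
        using s by (simp only: ennreal_mult mult.assoc) (simp add: ennreal_mult mult.assoc)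
    qed
    also have "ennreal (\<bar>- (1 - s)\<bar> ^ DIM('a)) * (\<integral>\<^sup>+x. ennreal (kern s (y + (- (1 - s)) *\<^sub>R x)) \<partial>lborel) = 1"
      using nn_integral_lborel_affine[of "\<lambda>z. ennreal (kern s z)" "- (1 - s)" y] kern_nn_integral[OF s(1)] s by simp
    finally show ?thesis by simp
  qed
  have "ennreal ((L2norm \<Omega> (mollify s v))\<^sup>2) = (\<integral>\<^sup>+x. ennreal ((mollify s v x)\<^sup>2) \<partial>lebesgue_on \<Omega>)"
    unfolding L2norm_square using L2_integrable_square[OF mollify_L2[OF s(1) v]]
    by (intro nn_integral_eq_integral[symmetric]) auto
  also have "\<dots> \<le> (\<integral>\<^sup>+x. (\<integral>\<^sup>+y. ennreal ((v y)\<^sup>2) * ?k x y \<partial>lebesgue_on \<Omega>) \<partial>lebesgue_on \<Omega>)"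
    by (intro nn_integral_mono mollify_square_le s v)
  also have "\<dots> = (\<integral>\<^sup>+y. (\<integral>\<^sup>+x. ennreal ((v y)\<^sup>2) * ?k x y \<partial>lebesgue_on \<Omega>) \<partial>lebesgue_on \<Omega>)"
    by (rule P.Fubini'[symmetric]) (simp add: split_beta')
  also have "\<dots> = (\<integral>\<^sup>+y. ennreal ((v y)\<^sup>2) * (\<integral>\<^sup>+x. ?k x y \<partial>lebesgue_on \<Omega>) \<partial>lebesgue_on \<Omega>)"
  proof (intro nn_integral_cong nn_integral_cmult)
    fix y
    have "(\<lambda>x. ?k x y) \<in> borel_measurable borel" by measurable
    then show "(\<lambda>x. ?k x y) \<in> borel_measurable (lebesgue_on \<Omega>)"
      by (rule measurable_compose[OF idm])
  qed
  also have "\<dots> \<le> (\<integral>\<^sup>+y. ennreal ((v y)\<^sup>2) * ennreal (2 ^ DIM('a)) \<partial>lebesgue_on \<Omega>)"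
    by (intro nn_integral_mono mult_left_mono k) auto
  also have "\<dots> = (\<integral>\<^sup>+y. ennreal ((v y)\<^sup>2) \<partial>lebesgue_on \<Omega>) * ennreal (2 ^ DIM('a))"
    by (rule nn_integral_multc) measurable
  also have "(\<integral>\<^sup>+y. ennreal ((v y)\<^sup>2) \<partial>lebesgue_on \<Omega>) = ennreal ((L2norm \<Omega> v)\<^sup>2)"
    unfolding L2norm_square using L2_integrable_square[OF v] by (intro nn_integral_eq_integral) auto
  also have "ennreal ((L2norm \<Omega> v)\<^sup>2) * ennreal (2 ^ DIM('a)) = ennreal ((sqrt (2 ^ DIM('a)) * L2norm \<Omega> v)\<^sup>2)"
    by (simp add: ennreal_mult[symmetric] power_mult_distrib mult.commute)
  finally have "(L2norm \<Omega> (mollify s v))\<^sup>2 \<le> (sqrt (2 ^ DIM('a)) * L2norm \<Omega> v)\<^sup>2"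
    by simp
  then show ?thesis
    by (rule power2_le_imp_le) (simp add: L2norm_nonneg)
qed

text \<open>For x in \<Omega> the kernel has mass exactly 1 and sees only points within s (R +
  \<rho>) of x; the Lipschitz constant of \<open>u\<close> turns this into a rate.\<close>

lemma mollify_test_function:
  assumes u: "u \<in> Cc_infinity \<Omega>"
  shows "\<exists>C\<ge>0. \<forall>s. 0 < s \<longrightarrow> s \<le> 1 \<longrightarrow> L2norm \<Omega> (\<lambda>x. mollify s u x - u x) \<le> C * s"
proof -
  have uL: "u \<in> L2 \<Omega>"
    by (rule Cc_infinity_L2[OF bounded op u])
  obtain L where L: "0 \<le> L" "\<And>x k. \<bar>u (x + k) - u x\<bar> \<le> L * norm k"
    using Cc_infinity_lipschitz[OF Cc_infinity_subset[OF bounded op u]] by blast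
  define C where "C = L * (R + \<rho>) * L2norm \<Omega> (\<lambda>x. 1)"
  have C0: "0 \<le> C"
    using L(1) R_pos \<rho>(1) by (simp add: C_def L2norm_nonneg)
  have "L2norm \<Omega> (\<lambda>x. mollify s u x - u x) \<le> C * s" if s: "0 < s" "s \<le> 1" for s
  proof -
    have "\<bar>mollify s u x - u x\<bar> \<le> L * (s * (R + \<rho>))" if x: "x \<in> \<Omega>" for x
    proof -
      let ?k = "\<lambda>y. kern s (y - (1 - s) *\<^sub>R x)"
      have ik: "integrable (lebesgue_on \<Omega>) ?k"
        using mollify_integrable[OF s(1) one_L2] by simp
      have iu: "integrable (lebesgue_on \<Omega>) (\<lambda>y. u y * ?k y)"
        by (rule mollify_integrable[OF s(1) uL])
      have "mollify s u x - u x = (\<integral>y. u y * ?k y \<partial>lebesgue_on \<Omega>) - u x * (\<integral>y. ?k y \<partial>lebesgue_on \<Omega>)"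
        by (simp add: kern_integral_\<Omega>[OF s x] mollify_def)
      also have "\<dots> = (\<integral>y. u y * ?k y - u x * ?k y \<partial>lebesgue_on \<Omega>)"
        using ik iu by simp
      finally have "\<bar>mollify s u x - u x\<bar> = norm (\<integral>y. u y * ?k y - u x * ?k y \<partial>lebesgue_on \<Omega>)"
        by simp
      also have "\<dots> \<le> (\<integral>y. (L * (s * (R + \<rho>))) * ?k y \<partial>lebesgue_on \<Omega>)"
      proof (rule Bochner_Integration.integral_norm_bound_integral)
        show "integrable (lebesgue_on \<Omega>) (\<lambda>y. u y * ?k y - u x * ?k y)"
          using ik iu by simp
        show "integrable (lebesgue_on \<Omega>) (\<lambda>y. (L * (s * (R + \<rho>))) * ?k y)"
          using ik by simp
        fix y
        show "norm (u y * ?k y - u x * ?k y) \<le> (L * (s * (R + \<rho>))) * ?k y"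
        proof (cases "?k y = 0")
          case False
          have "\<bar>u y - u x\<bar> \<le> L * norm (y - x)"
            using L(2)[of x "y - x"] by simp
          also have "\<dots> \<le> L * (s * (R + \<rho>))"
            using kern_support(2)[OF s x False] L(1) by (rule mult_left_mono)
          finally have "\<bar>u y - u x\<bar> * ?k y \<le> (L * (s * (R + \<rho>))) * ?k y"
            using kern_nonneg[OF s(1)] by (rule mult_right_mono)
          moreover have "norm (u y * ?k y - u x * ?k y) = \<bar>u y - u x\<bar> * ?k y"
            using kern_nonneg[OF s(1)] by (simp add: left_diff_distrib[symmetric] abs_mult)
          ultimately show ?thesis by simp
        qed simp
      qed
      also have "\<dots> = L * (s * (R + \<rho>))"
        using kern_integral_\<Omega>[OF s x] by simp
      finally show ?thesis .
    qed
    then have "L2norm \<Omega> (\<lambda>x. mollify s u x - u x) \<le> L2norm \<Omega> (\<lambda>x. L * (s * (R + \<rho>)) * 1)"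
      using L2_measurable[OF L2_diff[OF mollify_L2[OF s(1) uL] uL]] L(1) R_pos \<rho>(1) s
      by (intro L2norm_mono L2_cmult one_L2) (auto intro!: AE_I2 order_trans[OF _ abs_ge_self] simp: space_restrict_space)
    also have "\<dots> = C * s"
      using L(1) R_pos \<rho>(1) s unfolding L2norm_cmult by (simp add: C_def)
    finally show ?thesis .
  qed
  with C0 show ?thesis by blast
qed

lemma mollify_tendsto:
  assumes v: "v \<in> L2 \<Omega>" and s: "\<And>n. 0 < s n" "\<And>n. s n \<le> 1 / 2" "s \<longlonglongrightarrow> 0"
  shows "(\<lambda>n. L2norm \<Omega> (\<lambda>x. mollify (s n) v x - v x)) \<longlonglongrightarrow> 0"
proof (rule LIMSEQ_I)
  fix e :: real assume "0 < e"
  \<comment> \<open>The square root bounds the mollification of the difference v - u, the summand 1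
    accounts for the difference itself.\<close>
  define A where "A = sqrt (2 ^ DIM('a)) + 1"
  have A: "0 < A" by (simp add: A_def add_nonneg_pos)
  obtain u where u: "u \<in> Cc_infinity \<Omega>" "L2norm \<Omega> (\<lambda>x. v x - u x) < e / (2 * A)"
    using L2_test_approx[OF bounded op v, of "e / (2 * A)"] \<open>0 < e\<close> A by auto
  have uL: "u \<in> L2 \<Omega>"
    by (rule Cc_infinity_L2[OF bounded op u(1)])
  obtain C where C: "0 \<le> C" "\<And>s. 0 < s \<Longrightarrow> s \<le> 1 \<Longrightarrow> L2norm \<Omega> (\<lambda>x. mollify s u x - u x) \<le> C * s"
    using mollify_test_function[OF u(1)] by blast
  have bound: "L2norm \<Omega> (\<lambda>x. mollify (s n) v x - v x) \<le> A * L2norm \<Omega> (\<lambda>x. v x - u x) + C * s n" for n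
  proof -
    note sn = s(1)[of n]
    have L: "mollify (s n) v \<in> L2 \<Omega>" "mollify (s n) u \<in> L2 \<Omega>"
      using sn v uL by (auto intro: mollify_L2)
    have "L2norm \<Omega> (\<lambda>x. mollify (s n) v x - v x) \<le>
        L2norm \<Omega> (\<lambda>x. mollify (s n) v x - mollify (s n) u x) + L2norm \<Omega> (\<lambda>x. mollify (s n) u x - v x)"
      by (rule L2norm_diff_triangle[OF L v])
    also have "L2norm \<Omega> (\<lambda>x. mollify (s n) u x - v x) \<le> L2norm \<Omega> (\<lambda>x. mollify (s n) u x - u x) + L2norm \<Omega> (\<lambda>x. u x - v x)"
      by (rule L2norm_diff_triangle[OF L(2) uL v])
    also have "L2norm \<Omega> (\<lambda>x. mollify (s n) v x - mollify (s n) u x) \<le> sqrt (2 ^ DIM('a)) * L2norm \<Omega> (\<lambda>x. v x - u x)"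
      using mollify_L2norm_le[OF sn s(2) L2_diff[OF v uL]]
      unfolding mollify_diff[OF sn v uL, abs_def] .
    also have "L2norm \<Omega> (\<lambda>x. mollify (s n) u x - u x) \<le> C * s n"
      using C(2)[OF sn] s(2)[of n] by simp
    also have "L2norm \<Omega> (\<lambda>x. u x - v x) = L2norm \<Omega> (\<lambda>x. v x - u x)"
      by (rule L2norm_minus_commute)
    finally show ?thesis
      by (simp add: A_def algebra_simps)
  qed
  have "(\<lambda>n. C * s n) \<longlonglongrightarrow> C * 0"
    by (intro tendsto_intros s(3))
  then obtain N where N: "\<And>n. n \<ge> N \<Longrightarrow> C * s n < e / 2"
    using order_tendstoD(2)[of "\<lambda>n. C * s n" 0 sequentially "e / 2"] \<open>0 < e\<close> by (auto simp: eventually_sequentially)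
  have "A * L2norm \<Omega> (\<lambda>x. v x - u x) < e / 2"
    using u(2) A by (simp add: field_simps)
  then have "norm (L2norm \<Omega> (\<lambda>x. mollify (s n) v x - v x) - 0) < e" if "n \<ge> N" for n
    using bound[of n] N[OF that] L2norm_nonneg[of \<Omega> "\<lambda>x. mollify (s n) v x - v x"] by simp
  then show "\<exists>N. \<forall>n\<ge>N. norm (L2norm \<Omega> (\<lambda>x. mollify (s n) v x - v x) - 0) < e"
    by blast
qed

section \<open>Coercivity of the Neumann operator\<close>

text \<open>In the limit Green's formula makes the integral of \<open>w\<close> times its Laplacian
  nonpositive. Hence the squared norm of \<open>w\<close> is at most the scalar product of
  \<open>w\<close> with w - \<Delta>w, and Cauchy-Schwarz cancels one factor.\<close>

lemma coercive:
  assumes w: "w \<in> H2N \<Omega>"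
  shows "L2norm \<Omega> w \<le> norm2N \<Omega> w"
proof -
  note \<Omega> = bounded op
  have H: "w \<in> H2 \<Omega>" using w by (simp add: H2N_def)
  have L: "w \<in> L2 \<Omega>" "lap \<Omega> w \<in> L2 \<Omega>" "\<And>b. b \<in> Basis \<Longrightarrow> wderiv \<Omega> b w \<in> L2 \<Omega>"
    using H1_imp_L2[OF \<Omega> H2_imp_H1[OF \<Omega> H]] lap_L2[OF \<Omega> H] wderiv_L2[OF \<Omega> H2_imp_H1[OF \<Omega> H]] by auto
  \<comment> \<open>The shift is there because \<open>h 0 = 1\<close> exceeds the bound 1/2 under
    which the mollifications are uniformly bounded.\<close>
  define s where "s n = h (Suc n)" for n
  have s: "\<And>n. 0 < s n" "\<And>n. s n \<le> 1 / 2" "s \<longlonglongrightarrow> 0"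
    using LIMSEQ_Suc[OF h_lim] unfolding s_def[abs_def] by (auto simp: h_def[abs_def])
  have s1: "s n \<le> 1" for n using s(2)[of n] by simp
  have green: "integral\<^sup>L (lebesgue_on \<Omega>) (\<lambda>x. mollify (s n) w x * lap \<Omega> w x) =
     - (\<Sum>b\<in>Basis. (1 - s n) * integral\<^sup>L (lebesgue_on \<Omega>) (\<lambda>x. mollify (s n) (wderiv \<Omega> b w) x * wderiv \<Omega> b w x))" for n
  proof -
    have "integral\<^sup>L (lebesgue_on \<Omega>) (\<lambda>x. mollify (s n) w x * lap \<Omega> w x) =
       - (\<Sum>b\<in>Basis. integral\<^sup>L (lebesgue_on \<Omega>) (\<lambda>x. wderiv \<Omega> b w x * partial b (mollify (s n) w) x))"
      using Neumann_Green[OF w mollify_differentiable[OF s(1) L(1)] mollify_partial_continuous[OF s(1) L(1)], of n]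
      by (simp add: mult.commute)
    also have "(\<Sum>b\<in>Basis. integral\<^sup>L (lebesgue_on \<Omega>) (\<lambda>x. wderiv \<Omega> b w x * partial b (mollify (s n) w) x)) =
      (\<Sum>b\<in>Basis. integral\<^sup>L (lebesgue_on \<Omega>) (\<lambda>x. (1 - s n) * (mollify (s n) (wderiv \<Omega> b w) x * wderiv \<Omega> b w x)))"
    proof (intro sum.cong refl Bochner_Integration.integral_cong)
      fix b x :: 'a assume b: "b \<in> Basis" and "x \<in> space (lebesgue_on \<Omega>)"
      then have x: "x \<in> \<Omega>" by (simp add: space_restrict_space)
      show "wderiv \<Omega> b w x * partial b (mollify (s n) w) x = (1 - s n) * (mollify (s n) (wderiv \<Omega> b w) x * wderiv \<Omega> b w x)"
        using mollify_partial[OF s(1) s1 x b L(1) wderiv_weak[OF \<Omega> H2_imp_H1[OF \<Omega> H] b]] by simp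
    qed
    finally show ?thesis by simp
  qed
  have "(\<lambda>n. integral\<^sup>L (lebesgue_on \<Omega>) (\<lambda>x. mollify (s n) w x * lap \<Omega> w x)) \<longlonglongrightarrow>
      integral\<^sup>L (lebesgue_on \<Omega>) (\<lambda>x. w x * lap \<Omega> w x)"
    by (intro L2_integral_tendsto L mollify_L2 s mollify_tendsto)
  moreover have "(\<lambda>n. - (\<Sum>b\<in>Basis. (1 - s n) * integral\<^sup>L (lebesgue_on \<Omega>) (\<lambda>x. mollify (s n) (wderiv \<Omega> b w) x * wderiv \<Omega> b w x))) \<longlonglongrightarrow>
      - (\<Sum>b\<in>Basis. (1 - 0) * integral\<^sup>L (lebesgue_on \<Omega>) (\<lambda>x. wderiv \<Omega> b w x * wderiv \<Omega> b w x))"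
    by (intro tendsto_minus tendsto_sum tendsto_mult tendsto_diff tendsto_const s(3) L2_integral_tendsto L mollify_L2 s mollify_tendsto)
  ultimately have "integral\<^sup>L (lebesgue_on \<Omega>) (\<lambda>x. w x * lap \<Omega> w x) =
      - (\<Sum>b\<in>Basis. (1 - 0) * integral\<^sup>L (lebesgue_on \<Omega>) (\<lambda>x. wderiv \<Omega> b w x * wderiv \<Omega> b w x))"
    unfolding green by (rule LIMSEQ_unique)
  also have "\<dots> \<le> 0"
    by (simp add: sum_nonneg)
  finally have neg: "integral\<^sup>L (lebesgue_on \<Omega>) (\<lambda>x. w x * lap \<Omega> w x) \<le> 0" .
  have "(L2norm \<Omega> w)\<^sup>2 = integral\<^sup>L (lebesgue_on \<Omega>) (\<lambda>x. w x * w x)"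
    unfolding L2norm_square by (simp add: power2_eq_square)
  also have "\<dots> \<le> integral\<^sup>L (lebesgue_on \<Omega>) (\<lambda>x. w x * w x) - integral\<^sup>L (lebesgue_on \<Omega>) (\<lambda>x. w x * lap \<Omega> w x)"
    using neg by simp
  also have "\<dots> = integral\<^sup>L (lebesgue_on \<Omega>) (\<lambda>x. w x * (w x - lap \<Omega> w x))"
    using L2_mult_integrable[OF L(1,1)] L2_mult_integrable[OF L(1,2)] by (simp add: right_diff_distrib)
  also have "\<dots> \<le> L2norm \<Omega> w * norm2N \<Omega> w"
    using L2_Cauchy_Schwarz[OF L(1) L2_diff[OF L(1,2)]] by (simp add: norm2N_def)
  finally have "L2norm \<Omega> w * L2norm \<Omega> w \<le> L2norm \<Omega> w * norm2N \<Omega> w"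
    by (simp add: power2_eq_square)
  then show ?thesis
    using L2norm_nonneg[of \<Omega> w] by (cases "L2norm \<Omega> w = 0") (auto simp: norm2N_def L2norm_nonneg)
qed

end

lemma L2norm_le_norm2N:
  fixes \<Omega> :: "'a::euclidean_space set"
  assumes \<Omega>: "bounded \<Omega>" "open \<Omega>" "convex \<Omega>" and w: "w \<in> H2N \<Omega>"
  shows "L2norm \<Omega> w \<le> norm2N \<Omega> w"
proof (cases "\<Omega> = {}")
  case True
  have "integral\<^sup>L (lebesgue_on \<Omega>) (\<lambda>x. (w x)\<^sup>2) = integral\<^sup>L (lebesgue_on \<Omega>) (\<lambda>x. 0)"
    by (intro Bochner_Integration.integral_cong) (auto simp: True space_restrict_space)
  then show ?thesis
    by (simp add: L2norm_def norm2N_def)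
next
  case False
  then obtain a where "a \<in> \<Omega>" by blast
  then obtain \<rho> where \<rho>: "0 < \<rho>" "cball a \<rho> \<subseteq> \<Omega>"
    using \<Omega>(2) open_contains_cball by blast
  obtain B where B: "\<And>x. x \<in> \<Omega> \<Longrightarrow> norm x \<le> B"
    using \<Omega>(1) by (auto simp: bounded_iff)
  interpret convex_body \<Omega> a \<rho> "B + norm a"
  proof
    show "norm (x - a) \<le> B + norm a" if "x \<in> \<Omega>" for x
      using norm_triangle_ineq4[of x a] B[OF that] by linarith
  qed (use \<Omega> \<rho> in auto)
  show ?thesis
    using w by (rule coercive)
qed

section \<open>The domain of the operator\<close>

lemma L2_functional_dual:
  fixes \<Omega> :: "'a::euclidean_space set"
  assumes \<Omega>: "bounded \<Omega>" "open \<Omega>" "convex \<Omega>" and f: "f \<in> L2 \<Omega>"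
  shows "L2_functional \<Omega> f \<in> dual2N \<Omega>"
proof -
  have L: "w \<in> L2 \<Omega>" if "w \<in> H2N \<Omega>" for w
    using that H1_imp_L2[OF \<Omega>(1,2) H2_imp_H1[OF \<Omega>(1,2)]] by (auto simp: H2N_def)
  have "L2_functional \<Omega> f (\<lambda>x. \<alpha> * v x + \<beta> * w x) = \<alpha> * L2_functional \<Omega> f v + \<beta> * L2_functional \<Omega> f w"
    if v: "v \<in> H2N \<Omega>" and w: "w \<in> H2N \<Omega>" for v w \<alpha> \<beta>
  proof -
    have "(\<integral>x. f x * (\<alpha> * v x + \<beta> * w x) \<partial>lebesgue_on \<Omega>) = (\<integral>x. \<alpha> * (f x * v x) + \<beta> * (f x * w x) \<partial>lebesgue_on \<Omega>)"
      by (simp add: algebra_simps)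
    also have "\<dots> = \<alpha> * (\<integral>x. f x * v x \<partial>lebesgue_on \<Omega>) + \<beta> * (\<integral>x. f x * w x \<partial>lebesgue_on \<Omega>)"
      using L2_mult_integrable[OF f L[OF v]] L2_mult_integrable[OF f L[OF w]] by simp
    finally show ?thesis
      using v w H2N_lincomb[OF \<Omega>(1,2) v w] by (simp add: L2_functional_def)
  qed
  moreover have "\<bar>L2_functional \<Omega> f w\<bar> \<le> L2norm \<Omega> f * norm2N \<Omega> w" if w: "w \<in> H2N \<Omega>" for w
  proof -
    have "\<bar>L2_functional \<Omega> f w\<bar> \<le> L2norm \<Omega> f * L2norm \<Omega> w"
      using L2_Cauchy_Schwarz[OF f L[OF w]] w by (simp add: L2_functional_def)
    also have "\<dots> \<le> L2norm \<Omega> f * norm2N \<Omega> w"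
      by (intro mult_left_mono L2norm_le_norm2N[OF \<Omega> w] L2norm_nonneg)
    finally show ?thesis .
  qed
  ultimately show ?thesis
    unfolding dual2N_def by (intro CollectI conjI ballI allI exI[of _ "L2norm \<Omega> f"]) (auto simp: L2_functional_def)
qed

lemma positive_smooth_in_domain:
  fixes \<Omega> :: "'a::euclidean_space set"
  assumes \<Omega>: "bounded \<Omega>" "open \<Omega>" "convex \<Omega>"
    and \<phi>: "\<phi> \<in> Cc_infinity \<Omega>" "\<And>x. 0 \<le> \<phi> x" and c: "0 < c"
  shows "(\<lambda>x. c + \<phi> x) \<in> Domain (opA \<Omega>)"
proof -
  note \<Omega>2 = \<Omega>(1,2)
  let ?M = "lebesgue_on \<Omega>"
  define v where "v x = c + \<phi> x" for x
  \<comment> \<open>The classical Laplacian of \<phi>, hence also of \<open>v\<close>; unlike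
    \<open>v\<close> it has compact support.\<close>
  define p where "p x = (\<Sum>b\<in>Basis. partial b (partial b \<phi>) x)" for x
  define f where "f x = (p x)\<^sup>2 / v x" for x
  \<comment> \<open>As \<open>v\<close> has Laplacian \<open>p\<close>, this is the bilaplacian of
    \<open>v\<close> minus the density \<open>f\<close>.\<close>
  define F where "F x = (\<Sum>b\<in>Basis. partial b (partial b p) x) - f x" for x
  have smooth_\<phi>: "smooth \<phi>" using \<phi>(1) by (rule Cc_infinity_smooth)
  have p: "p \<in> Cc_infinity \<Omega>"
    unfolding p_def[abs_def] using \<phi>(1) by (intro Cc_infinity_sum Cc_infinity_partial)
  have smooth_p: "smooth p" using p by (rule Cc_infinity_smooth)
  have smooth_v: "smooth v"
    unfolding v_def[abs_def] by (intro smooth_add smooth_const smooth_\<phi>)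
  have v_pos: "c \<le> v x" "0 < v x" for x
    using \<phi>(2)[of x] c by (auto simp: v_def)
  have pv: "partial b v = partial b \<phi>" for b
  proof
    fix x
    show "partial b v x = partial b \<phi> x"
      unfolding v_def[abs_def] using smooth_differentiable[OF smooth_\<phi>, of x]
      by (subst partial_add) (auto simp: partial_const)
  qed
  have fc: "continuous_on A f" for A
    unfolding f_def[abs_def] using v_pos(2) smooth_continuous[OF smooth_p] smooth_continuous[OF smooth_v]
    by (intro continuous_intros) (auto simp: less_imp_neq[symmetric])
  have fL: "f \<in> L2 \<Omega>"
    by (rule continuous_imp_L2[OF \<Omega>2 fc])
  have ppL: "partial b (partial b p) \<in> L2 \<Omega>" if "b \<in> Basis" for b
    using that smooth_p by (intro smooth_L2[OF \<Omega>2] smooth_partial)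
  have FL: "F \<in> L2 \<Omega>"
    unfolding F_def[abs_def] by (intro L2_diff L2_sum fL ppL)
  have pL: "p \<in> L2 \<Omega>"
    using smooth_p by (rule smooth_L2[OF \<Omega>2])
  have vN: "v \<in> H2N \<Omega>"
  proof (rule smooth_H2N[OF \<Omega>2 smooth_v])
    fix b x :: 'a assume "b \<in> Basis" and x: "x \<in> frontier \<Omega>"
    obtain K where K: "compact K" "K \<subseteq> \<Omega>" "\<And>x. x \<notin> K \<Longrightarrow> \<phi> x = 0"
      using Cc_infinity_support[OF \<phi>(1)] by blast
    have "x \<notin> \<Omega>"
      using x \<Omega>(2) by (simp add: frontier_def interior_open)
    then have "x \<notin> K" using K(2) by blast
    then show "partial b v x = 0"
      unfolding pv using K by (intro partial_zero_outside[where K = K and c = 0] compact_imp_closed)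
  qed
  have vH: "v \<in> H2 \<Omega>" using vN by (simp add: H2N_def)
  have lap: "AE x in ?M. lap \<Omega> v x = p x"
    using smooth_lap[OF \<Omega>2 smooth_v] by (simp add: pv p_def)
  have NL: "w \<in> L2 \<Omega>" if "w \<in> H2N \<Omega>" for w
    using that H1_imp_L2[OF \<Omega>2 H2_imp_H1[OF \<Omega>2]] by (auto simp: H2N_def)
  \<comment> \<open>The density as the definitions state it, with the chosen weak Laplacian. It
    equals the continuous function \<open>f\<close> only almost everywhere, and its integrability is
    transferred from \<open>f\<close>.\<close>
  define g where "g x = (lap \<Omega> v x)\<^sup>2 / v x" for x
  have g0: "0 \<le> g x" for x
    using v_pos(2)[of x] by (simp add: g_def)
  have gf: "AE x in ?M. g x = f x"
    using lap by eventually_elim (simp add: g_def f_def)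
  have vm [measurable]: "v \<in> borel_measurable ?M"
    using smooth_L2[OF \<Omega>2 smooth_v] by (rule L2_measurable)
  have [measurable]: "lap \<Omega> v \<in> borel_measurable ?M"
    using lap_L2[OF \<Omega>2 vH] by (rule L2_measurable)
  have gm [measurable]: "g \<in> borel_measurable ?M"
    unfolding g_def[abs_def] by measurable
  have gL: "g \<in> L2 \<Omega>"
    by (rule L2_AE_cong[OF fL gm]) (use gf in \<open>eventually_elim, simp\<close>)
  interpret finite_measure ?M
    using \<Omega>2 by (intro finite_measure_lebesgue_on bounded_set_imp_lmeasurable) auto
  have g_int: "integrable ?M g"
    using L2_mult_integrable[OF gL continuous_imp_L2[OF \<Omega>2 continuous_on_const, of 1]] by simp
  have id: "(\<lambda>x. x) \<in> measurable (density ?M (\<lambda>x. ennreal (g x))) (restrict_space borel (closure \<Omega>))"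
  proof -
    have "(\<lambda>x. x) \<in> measurable ?M (restrict_space borel (closure \<Omega>))"
    proof (rule measurable_restrict_space2)
      show "(\<lambda>x. x) \<in> space ?M \<rightarrow> closure \<Omega>"
        using closure_subset by (auto simp: space_restrict_space)
      show "(\<lambda>x. x) \<in> borel_measurable ?M"
        by (intro measurable_restrict_space1 measurable_completion) simp
    qed
    then show ?thesis by simp
  qed
  have mu: "mu_meas \<Omega> v = distr (density ?M (\<lambda>x. ennreal (g x))) (restrict_space borel (closure \<Omega>)) (\<lambda>x. x)"
    using v_pos(2) by (simp add: mu_meas_def g_def)
  have mu_int: "integral\<^sup>L (mu_meas \<Omega> v) w = integral\<^sup>L ?M (\<lambda>x. f x * w x)"
    if w: "w \<in> L2 \<Omega>" "continuous_on (closure \<Omega>) w" for w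
  proof -
    have [measurable]: "w \<in> borel_measurable ?M"
      using w(1) by (rule L2_measurable)
    have "integral\<^sup>L (mu_meas \<Omega> v) w = integral\<^sup>L (density ?M (\<lambda>x. ennreal (g x))) w"
      unfolding mu by (rule integral_distr[OF id borel_measurable_continuous_on_restrict[OF w(2)]])
    also have "\<dots> = integral\<^sup>L ?M (\<lambda>x. g x * w x)"
      using g0 by (subst integral_density) auto
    also have "\<dots> = integral\<^sup>L ?M (\<lambda>x. f x * w x)"
      using gf L2_measurable[OF fL] by (intro integral_cong_AE) auto
    finally show ?thesis .
  qed
  have TestD: "w \<in> H2N \<Omega>" "continuous_on (closure \<Omega>) w" if "w \<in> Test \<Omega>" for w
    using that lipschitz_on_continuous_on by (auto simp: Test_def)
  have mu_M2N: "mu_meas \<Omega> v \<in> M2N \<Omega>"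
    unfolding M2N_def
  proof (intro CollectI conjI)
    show "sets (mu_meas \<Omega> v) = sets (restrict_space borel (closure \<Omega>))"
      by (simp add: mu)
    show "finite_measure (mu_meas \<Omega> v)"
      unfolding mu
    proof (rule finite_measure.finite_measure_distr[OF _ id], rule finite_measureI)
      have "emeasure (density ?M (\<lambda>x. ennreal (g x))) (space (density ?M (\<lambda>x. ennreal (g x)))) = (\<integral>\<^sup>+x. ennreal (g x) \<partial>?M)"
        by (subst emeasure_density) (auto intro!: nn_integral_cong)
      also have "\<dots> = ennreal (integral\<^sup>L ?M g)"
        using g_int g0 by (intro nn_integral_eq_integral) auto
      finally show "emeasure (density ?M (\<lambda>x. ennreal (g x))) (space (density ?M (\<lambda>x. ennreal (g x)))) \<noteq> \<infinity>"
        by simp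
    qed
    show "bdd_above {integral\<^sup>L (mu_meas \<Omega> v) w | w. w \<in> Test \<Omega> \<and> norm2N \<Omega> w \<le> 1}"
    proof (rule bdd_aboveI, clarify)
      fix w assume w: "w \<in> Test \<Omega>" "norm2N \<Omega> w \<le> 1"
      have wL: "w \<in> L2 \<Omega>" using TestD(1)[OF w(1)] by (rule NL)
      have "integral\<^sup>L (mu_meas \<Omega> v) w \<le> L2norm \<Omega> f * L2norm \<Omega> w"
        using mu_int[OF wL TestD(2)[OF w(1)]] L2_Cauchy_Schwarz[OF fL wL] by simp
      also have "\<dots> \<le> L2norm \<Omega> f * 1"
        using L2norm_le_norm2N[OF \<Omega> TestD(1)[OF w(1)]] w(2) by (intro mult_left_mono L2norm_nonneg) simp
      finally show "integral\<^sup>L (mu_meas \<Omega> v) w \<le> L2norm \<Omega> f * 1" .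
    qed
  qed
  have Dfin: "Dfun \<Omega> v < \<infinity>"
  proof -
    have "Dfun \<Omega> v = (\<integral>\<^sup>+x. ennreal (g x) \<partial>?M)"
      unfolding Dfun_def using v_pos(2) by (simp add: hfun_def g_def)
    also have "\<dots> = ennreal (integral\<^sup>L ?M g)"
      using g_int g0 by (intro nn_integral_eq_integral) auto
    finally show ?thesis by simp
  qed
  have dom: "v \<in> dom_frakA \<Omega>"
    unfolding dom_frakA_def using vN Dfin mu_M2N v_pos(2) by (auto intro!: AE_I2 less_imp_le)
  define \<nu> :: "'a measure" where "\<nu> = null_measure (restrict_space borel (closure \<Omega>))"
  \<comment> \<open>Under the null measure every property holds almost everywhere, in particular the
    concentration on the zero set.\<close>
  have \<nu>AE: "AE x in \<nu>. P x" for P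
  proof (rule AE_I'[of "space \<nu>"])
    show "space \<nu> \<in> null_sets \<nu>"
      by (rule null_setsI[OF _ sets.top]) (simp add: \<nu>_def)
  qed blast
  have \<nu>int: "integral\<^sup>L \<nu> w = 0" for w :: "'a \<Rightarrow> real"
    by (rule integral_eq_zero_AE) (rule \<nu>AE)
  have \<nu>M2N: "\<nu> \<in> M2N \<Omega>"
    unfolding M2N_def by (auto simp: \<nu>int intro!: finite_measureI) (auto simp: \<nu>_def)
  have mf: "measure_functional \<Omega> (mu_meas \<Omega> v) (L2_functional \<Omega> f)"
    unfolding measure_functional_def
    using L2_functional_dual[OF \<Omega> fL] TestD mu_int NL by (simp add: L2_functional_def)
  have mz: "measure_functional \<Omega> \<nu> (L2_functional \<Omega> (\<lambda>x. 0))"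
    unfolding measure_functional_def
    using L2_functional_dual[OF \<Omega> L2_zero] TestD by (simp add: L2_functional_def \<nu>int)
  \<comment> \<open>\<open>p\<close> is a test function, so both derivatives move from
    \<open>w\<close> to \<open>p\<close> by the definition of weak derivatives, without boundary
    terms.\<close>
  have ibp: "integral\<^sup>L ?M (\<lambda>x. lap \<Omega> v x * lap \<Omega> w x) = integral\<^sup>L ?M (\<lambda>x. (\<Sum>b\<in>Basis. partial b (partial b p) x) * w x)"
    if w: "w \<in> H2N \<Omega>" for w
  proof -
    have H: "w \<in> H2 \<Omega>" using w by (simp add: H2N_def)
    have one: "integral\<^sup>L ?M (\<lambda>x. p x * wderiv \<Omega> b (wderiv \<Omega> b w) x) = integral\<^sup>L ?M (\<lambda>x. partial b (partial b p) x * w x)"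
      if b: "b \<in> Basis" for b
    proof -
      have "integral\<^sup>L ?M (\<lambda>x. wderiv \<Omega> b w x * partial b p x) = - integral\<^sup>L ?M (\<lambda>x. wderiv \<Omega> b (wderiv \<Omega> b w) x * p x)"
        using wderiv_weak[OF \<Omega>2 H2_wderiv_H1[OF \<Omega>2 H b] b] p by (simp add: is_weak_deriv_def)
      moreover have "integral\<^sup>L ?M (\<lambda>x. w x * partial b (partial b p) x) = - integral\<^sup>L ?M (\<lambda>x. wderiv \<Omega> b w x * partial b p x)"
        using wderiv_weak[OF \<Omega>2 H2_imp_H1[OF \<Omega>2 H] b] Cc_infinity_partial[OF p b] by (simp add: is_weak_deriv_def)
      ultimately show ?thesis by (simp add: mult.commute)
    qed
    have wm: "lap \<Omega> w \<in> borel_measurable ?M"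
      using lap_L2[OF \<Omega>2 H] by (rule L2_measurable)
    have "integral\<^sup>L ?M (\<lambda>x. lap \<Omega> v x * lap \<Omega> w x) = integral\<^sup>L ?M (\<lambda>x. p x * lap \<Omega> w x)"
      using lap L2_measurable[OF pL] wm by (intro integral_cong_AE) auto
    also have "\<dots> = (\<Sum>b\<in>Basis. integral\<^sup>L ?M (\<lambda>x. p x * wderiv \<Omega> b (wderiv \<Omega> b w) x))"
      unfolding lap_def sum_distrib_left
      by (intro Bochner_Integration.integral_sum L2_mult_integrable pL wderiv_wderiv_L2[OF \<Omega>2 H])
    also have "\<dots> = (\<Sum>b\<in>Basis. integral\<^sup>L ?M (\<lambda>x. partial b (partial b p) x * w x))"
      using one by (intro sum.cong) auto
    also have "\<dots> = integral\<^sup>L ?M (\<lambda>x. (\<Sum>b\<in>Basis. partial b (partial b p) x) * w x)"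
      unfolding sum_distrib_right
      by (intro Bochner_Integration.integral_sum[symmetric] L2_mult_integrable ppL NL[OF w])
    finally show ?thesis .
  qed
  have "L2_functional \<Omega> F = (\<lambda>w\<in>H2N \<Omega>. bilaplacian \<Omega> v w - L2_functional \<Omega> f w - L2_functional \<Omega> (\<lambda>x. 0) w)"
  proof
    fix w
    show "L2_functional \<Omega> F w = (\<lambda>w\<in>H2N \<Omega>. bilaplacian \<Omega> v w - L2_functional \<Omega> f w - L2_functional \<Omega> (\<lambda>x. 0) w) w"
    proof (cases "w \<in> H2N \<Omega>")
      case True
      have sL: "(\<lambda>x. \<Sum>b\<in>Basis. partial b (partial b p) x) \<in> L2 \<Omega>"
        by (intro L2_sum ppL)
      have "integral\<^sup>L ?M (\<lambda>x. F x * w x) =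
          integral\<^sup>L ?M (\<lambda>x. (\<Sum>b\<in>Basis. partial b (partial b p) x) * w x) - integral\<^sup>L ?M (\<lambda>x. f x * w x)"
        unfolding F_def left_diff_distrib
        by (intro Bochner_Integration.integral_diff L2_mult_integrable sL fL NL[OF True])
      then show ?thesis
        using True ibp[OF True] by (simp add: L2_functional_def bilaplacian_def)
    qed (simp add: L2_functional_def)
  qed
  then have "L2_functional \<Omega> F \<in> frakA \<Omega> v"
    unfolding frakA_def using dom mf mz \<nu>M2N \<nu>AE by auto
  then have "(v, F) \<in> opA \<Omega>"
    unfolding opA_def using smooth_L2[OF \<Omega>2 smooth_v] FL vN by simp
  then show ?thesis
    unfolding v_def[abs_def] by blast
qed

text \<open>For v \<ge> 0 the negative part of \<open>u\<close> is pointwise at most |u - v|, so its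
  norm lies below every \<epsilon>.\<close>

lemma L2_closure_nonneg:
  assumes S: "S \<subseteq> L2_nonneg \<Omega>"
  shows "L2_closure \<Omega> S \<subseteq> L2_nonneg \<Omega>"
proof
  fix u assume "u \<in> L2_closure \<Omega> S"
  then have u: "u \<in> L2 \<Omega>" and lim: "\<And>\<epsilon>. 0 < \<epsilon> \<Longrightarrow> \<exists>v\<in>S. L2norm \<Omega> (\<lambda>x. u x - v x) < \<epsilon>"
    by (auto simp: L2_closure_def)
  define n where "n x = min 0 (u x)" for x
  have "n \<in> borel_measurable (lebesgue_on \<Omega>)"
    unfolding n_def[abs_def] using u by measurable
  then have nL: "n \<in> L2 \<Omega>"
    by (rule L2_bound[OF u]) (auto simp: n_def)
  have "L2norm \<Omega> n \<le> 0"
  proof (rule field_le_epsilon)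
    fix \<epsilon> :: real assume "0 < \<epsilon>"
    then obtain v where v: "v \<in> S" "L2norm \<Omega> (\<lambda>x. u x - v x) < \<epsilon>"
      using lim by blast
    have vL: "v \<in> L2 \<Omega>" and v0: "AE x in lebesgue_on \<Omega>. 0 \<le> v x"
      using v(1) S by (auto simp: L2_nonneg_def)
    have "L2norm \<Omega> n \<le> L2norm \<Omega> (\<lambda>x. u x - v x)"
    proof (rule L2norm_mono[OF L2_measurable[OF nL] L2_diff[OF u vL]])
      show "AE x in lebesgue_on \<Omega>. \<bar>n x\<bar> \<le> \<bar>u x - v x\<bar>"
        using v0 by eventually_elim (auto simp: n_def)
    qed
    with v(2) show "L2norm \<Omega> n \<le> 0 + \<epsilon>" by simp
  qed
  then have "L2norm \<Omega> n = 0"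
    using L2norm_nonneg[of \<Omega> n] by simp
  from L2norm_zero_AE[OF nL this] have "AE x in lebesgue_on \<Omega>. 0 \<le> u x"
    by eventually_elim (simp add: n_def)
  with u show "u \<in> L2_nonneg \<Omega>"
    by (simp add: L2_nonneg_def)
qed

theorem lemma4p4:
  fixes \<Omega> :: "'a::euclidean_space set"
  assumes "bounded \<Omega>" "open \<Omega>" "convex \<Omega>"
  shows "L2_closure \<Omega> (Domain (opA \<Omega>)) = L2_nonneg \<Omega>"
proof
  \<comment> \<open>\<open>frakA\<close> is empty outside \<open>dom_frakA\<close>, where
    nonnegativity is demanded.\<close>
  have "Domain (opA \<Omega>) \<subseteq> L2_nonneg \<Omega>"
    by (auto simp: opA_def frakA_def dom_frakA_def L2_nonneg_def split: if_splits)
  then show "L2_closure \<Omega> (Domain (opA \<Omega>)) \<subseteq> L2_nonneg \<Omega>"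
    by (rule L2_closure_nonneg)
  show "L2_nonneg \<Omega> \<subseteq> L2_closure \<Omega> (Domain (opA \<Omega>))"
  proof
    fix u assume u: "u \<in> L2_nonneg \<Omega>"
    then have uL: "u \<in> L2 \<Omega>" by (simp add: L2_nonneg_def)
    have one: "(\<lambda>x. 1) \<in> L2 \<Omega>"
      by (rule continuous_imp_L2[OF assms(1,2)]) (intro continuous_intros)
    have "\<exists>v\<in>Domain (opA \<Omega>). L2norm \<Omega> (\<lambda>x. u x - v x) < \<epsilon>" if \<epsilon>: "0 < \<epsilon>" for \<epsilon>
    proof -
      obtain \<phi> where \<phi>: "\<phi> \<in> Cc_infinity \<Omega>" "\<forall>x. 0 \<le> \<phi> x" "L2norm \<Omega> (\<lambda>x. u x - \<phi> x) < \<epsilon> / 2"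
        using L2_nonneg_test_approx[OF assms(1,2) u, of "\<epsilon> / 2"] \<epsilon> by auto
      define N where "N = L2norm \<Omega> (\<lambda>x. 1)"
      have N0: "0 \<le> N" by (simp add: N_def L2norm_nonneg)
      \<comment> \<open>This makes the norm of the constant function c at most \<epsilon> / 2; the
        summand 1 keeps the quotient meaningful when N = 0, that is, for empty \<Omega>.\<close>
      define c where "c = \<epsilon> / (2 * (N + 1))"
      have c: "0 < c" using \<epsilon> N0 by (simp add: c_def)
      have cN: "c * N \<le> \<epsilon> / 2"
        using \<epsilon> N0 by (simp add: c_def field_simps)
      have \<phi>L: "\<phi> \<in> L2 \<Omega>"
        by (rule Cc_infinity_L2[OF assms(1,2) \<phi>(1)])
      have "L2norm \<Omega> (\<lambda>x. u x - (c + \<phi> x)) = L2norm \<Omega> (\<lambda>x. (u x - \<phi> x) + (- c) * 1)"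
        by (simp add: algebra_simps)
      also have "\<dots> \<le> L2norm \<Omega> (\<lambda>x. u x - \<phi> x) + L2norm \<Omega> (\<lambda>x. (- c) * 1)"
        by (intro L2norm_triangle L2_diff L2_cmult uL \<phi>L one)
      also have "L2norm \<Omega> (\<lambda>x. (- c) * 1) = c * N"
        unfolding L2norm_cmult using c by (simp add: N_def)
      finally have "L2norm \<Omega> (\<lambda>x. u x - (c + \<phi> x)) < \<epsilon>"
        using \<phi>(3) cN by linarith
      moreover have "(\<lambda>x. c + \<phi> x) \<in> Domain (opA \<Omega>)"
        using \<phi>(2) c by (intro positive_smooth_in_domain assms \<phi>(1)) auto
      ultimately show ?thesis
        by (intro bexI[of _ "\<lambda>x. c + \<phi> x"])
    qed
    with uL show "u \<in> L2_closure \<Omega> (Domain (opA \<Omega>))"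
      by (simp add: L2_closure_def)
  qed
qed

end
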